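(* For all $n\in\mathbb N$ and $\delta\in\{0,1\}$, $$\zeta^{\mathrm k}_{F_{n,\delta}(\mathcal O)}(s)=\frac{\zeta_K\bigl(s-\binom{2n+\delta}{2}-1\bigr)\,\zeta_K\bigl(s-\binom{2n+\delta}{2}\bigr)}{\zeta_K\bigl(s-\binom{2n+\delta-1}{2}\bigr)},$$ where $\zeta_K(s)$ is the Dedekind zeta function of the number field $K$. Furthermore, for $n\ge2$, $$\zeta^{\mathrm k}_{G_n(\mathcal O)}(s)=\prod_{\mathfrak p}\frac{(1-q_{\mathfrak p}^{2\binom n2-s})(1-q_{\mathfrak p}^{2\binom n2+1-s})+q_{\mathfrak p}^{n^2-s}(1-q_{\mathfrak p}^{-n})(1-q_{\mathfrak p}^{-n+1})}{(1-q_{\mathfrak p}^{n^2-s})^2(1-q_{\mathfrak p}^{n^2+1-s})},$$ $$\zeta^{\mathrm k}_{H_n(\mathcal O)}(s)=\prod_{\mathfrak p}\frac{(1-q_{\mathfrak p}^{\binom n2-s})(1-q_{\mathfrak p}^{\binom n2+2-s})+q_{\mathfrak p}^{\binom{n+1}2-s}(1-q_{\mathfrak p}^{-n+1})^2}{(1-q_{\mathfrak p}^{\binom{n+1}2-s})(1-q_{\mathfrak p}^{\binom{n+1}2+1-s})^2},$$ where the products run over all nonzero prime ideals $\mathfrak p$ of $\mathcal O$ and $q_{\mathfrak p}=|\mathcal O:\mathfrak p|$.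
   Context: $K$ is a number field with ring of integers $\mathcal O$. Lie lattices. For $n\in\mathbb N=\{1,2,\dots\}$ and $\delta\in\{0,1\}$ let $\mathcal F_{n,\delta},\mathcal G_n,\mathcal H_n$ be the free $\mathbb Z$-modules, with class-$2$ nilpotent Lie bracket, with the following bases and relations (all brackets of basis elements not determined by the given ones through antisymmetry are zero; in particular all $y_{ij}$ are central): - $\mathcal F_{n,\delta}$: basis $x_k$ ($1\le k\le 2n+\delta$), $y_{ij}$ ($1\le i<j\le 2n+\delta$); $[x_i,x_j]=y_{ij}$ for $i<j$. - $\mathcal G_n$: basis $x_k$ ($1\le k\le 2n$), $y_{ij}$ ($1\le i,j\le n$); $[x_i,x_{n+j}]=y_{ij}$. - $\mathcal H_n$: basis $x_k$ ($1\le k\le 2n$), $y_{ij}$ ($1\le i\le j\le n$); $[x_i,x_{n+j}]=[x_j,x_{n+i}]=y_{ij}$ for $i\le j$. Group schemes. For $\Lambda\in\{\mathcal F_{n,\delta},\mathcal G_n,\mathcal H_n\}$, the associated unipotent group scheme over $\mathcal O$ is denoted $F_{n,\delta}$, $G_n$, $H_n$, respectively. For a commutative $\mathcal O$-algebra $R$, its group of $R$-points is the set $\Lambda\otimes_{\mathbb Z}R$ with multiplication $g*h=g+h+\beta(g,h)$, where $\beta$ is the $R$-bilinear map with $\beta(x_i,x_j)=[x_i,x_j]$ if $i>j$, $\beta(x_i,x_j)=0$ if $i\le j$, and $\beta=0$ if one argument is some $y_{ij}$. (Thus group commutators are given by the Lie bracket.) Class number zeta function. For a finite group $G$, $\mathrm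 k(G)$ denotes the number of its conjugacy classes. For $\mathbf G\in\{F_{n,\delta},G_n,H_n\}$, $$\zeta^{\mathrm k}_{\mathbf G(\mathcal O)}(s)=\sum_{(0)\ne I\unlhd\mathcal O}\mathrm k(\mathbf G(\mathcal O/I))\,|\mathcal O:I|^{-s},$$ the sum being over all nonzero ideals of $\mathcal O$, for a complex variable $s$ with sufficiently large real part. *)

theory Defs
  imports "HOL-Analysis.Infinite_Sum" "HOL-Analysis.Complex_Transcendental"
    "HOL-Computational_Algebra.Polynomial"
    "HOL-Algebra.Embedded_Algebras" "HOL-Algebra.QuotRing" "HOL-Algebra.Group_Action"
begin

section \<open>Number fields, their rings of integers and ideals\<close>

definition ring_on :: "'a::field set \<Rightarrow> 'a ring" where
  "ring_on S = \<lparr>carrier = S, mult = (*), one = 1, zero = 0, add = (+)\<rparr>"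

text \<open>
  A number field is a subfield, of finite degree over \<open>\<rat>\<close>, of an arbitrary field of
  characteristic 0; the ambient field may be \<open>K\<close> itself (\<open>K = UNIV\<close>) or, say, the complex
  numbers.
\<close>

definition number_field :: "'a::field_char_0 set \<Rightarrow> bool" where
  "number_field K \<longleftrightarrow>
     subfield K (ring_on UNIV) \<and> ring.finite_dimension (ring_on (UNIV :: 'a set)) \<rat> K"

definition ring_of_integers :: "'a::field_char_0 set \<Rightarrow> 'a ring" where
  "ring_of_integers K = ring_on {x \<in> K. algebraic_int x}"

definition nonzero_ideals :: "'a::field_char_0 set \<Rightarrow> 'a set set" where
  "nonzero_ideals K = {I. ideal I (ring_of_integers K) \<and> I \<noteq> {0}}"

definition nonzero_primes :: "'a::field_char_0 set \<Rightarrow> 'a set set" where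
  "nonzero_primes K = {P. primeideal P (ring_of_integers K) \<and> P \<noteq> {0}}"

definition ideal_index :: "'a::field_char_0 set \<Rightarrow> 'a set \<Rightarrow> nat" where
  "ideal_index K I = card (a_rcosets\<^bsub>ring_of_integers K\<^esub> I)"

section \<open>Lie lattices and the groups of points\<close>

datatype basis_elt = X nat | Y nat nat

text \<open>
  A class-2 Lie lattice given by a \<open>\<int>\<close>-basis and a set of relations: a triple \<open>(b, c, e)\<close>
  stands for the relation \<open>[b, c] = e\<close> between basis elements.
\<close>

record lie_lattice =
  lie_basis :: "basis_elt set"
  lie_rels :: "(basis_elt \<times> basis_elt \<times> basis_elt) set"

definition F_lat :: "nat \<Rightarrow> nat \<Rightarrow> lie_lattice" where
  "F_lat n \<delta> = \<lparr>
     lie_basis = X ` {1..2*n+\<delta>} \<union> {Y i j | i j. 1 \<le> i \<and> i < j \<and> j \<le> 2*n+\<delta>},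
     lie_rels = {(X i, X j, Y i j) | i j. 1 \<le> i \<and> i < j \<and> j \<le> 2*n+\<delta>}\<rparr>"

definition G_lat :: "nat \<Rightarrow> lie_lattice" where
  "G_lat n = \<lparr>
     lie_basis = X ` {1..2*n} \<union> {Y i j | i j. i \<in> {1..n} \<and> j \<in> {1..n}},
     lie_rels = {(X i, X (n+j), Y i j) | i j. i \<in> {1..n} \<and> j \<in> {1..n}}\<rparr>"

definition H_lat :: "nat \<Rightarrow> lie_lattice" where
  "H_lat n = \<lparr>
     lie_basis = X ` {1..2*n} \<union> {Y i j | i j. 1 \<le> i \<and> i \<le> j \<and> j \<le> n},
     lie_rels = {(X i, X (n+j), Y i j) | i j. 1 \<le> i \<and> i \<le> j \<and> j \<le> n}
              \<union> {(X j, X (n+i), Y i j) | i j. 1 \<le> i \<and> i \<le> j \<and> j \<le> n}\<rparr>"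

text \<open>
  The coordinate of \<open>[b, c]\<close> at the basis element \<open>e\<close>. The second summand accounts for
  antisymmetry.
\<close>

definition bracket_coeff :: "lie_lattice \<Rightarrow> basis_elt \<Rightarrow> basis_elt \<Rightarrow> basis_elt \<Rightarrow> int" where
  "bracket_coeff L b c e =
     of_bool ((b, c, e) \<in> lie_rels L) - of_bool ((c, b, e) \<in> lie_rels L)"

definition beta_coeff :: "lie_lattice \<Rightarrow> basis_elt \<Rightarrow> basis_elt \<Rightarrow> basis_elt \<Rightarrow> int" where
  "beta_coeff L b c e =
     (case (b, c) of (X i, X j) \<Rightarrow> if i > j then bracket_coeff L b c e else 0 | _ \<Rightarrow> 0)"

text \<open>
  Elements of \<open>\<Lambda> \<otimes> R\<close> are coordinate vectors with respect to the given basis of \<open>\<Lambda>\<close>.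
\<close>

definition beta ::
  "lie_lattice \<Rightarrow> ('r, 'm) ring_scheme \<Rightarrow> (basis_elt \<Rightarrow> 'r) \<Rightarrow> (basis_elt \<Rightarrow> 'r) \<Rightarrow> basis_elt \<Rightarrow> 'r"
where
  "beta L R g h e =
     finsum R (\<lambda>(b, c). [beta_coeff L b c e] \<cdot>\<^bsub>R\<^esub> (g b \<otimes>\<^bsub>R\<^esub> h c)) (lie_basis L \<times> lie_basis L)"

definition unipotent_group :: "lie_lattice \<Rightarrow> ('r, 'm) ring_scheme \<Rightarrow> (basis_elt \<Rightarrow> 'r) monoid" where
  "unipotent_group L R = \<lparr>
     carrier = lie_basis L \<rightarrow>\<^sub>E carrier R,
     mult = (\<lambda>g h. \<lambda>e\<in>lie_basis L. g e \<oplus>\<^bsub>R\<^esub> h e \<oplus>\<^bsub>R\<^esub> beta L R g h e),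
     one = (\<lambda>e\<in>lie_basis L. \<zero>\<^bsub>R\<^esub>)\<rparr>"

section \<open>Zeta functions and Euler products\<close>

definition class_number :: "('g, 'm) monoid_scheme \<Rightarrow> nat" where
  "class_number G =
     card (orbits G (carrier G) (\<lambda>g. \<lambda>h\<in>carrier G. g \<otimes>\<^bsub>G\<^esub> h \<otimes>\<^bsub>G\<^esub> inv\<^bsub>G\<^esub> g))"

definition class_zeta_term ::
  "lie_lattice \<Rightarrow> 'a::field_char_0 set \<Rightarrow> complex \<Rightarrow> 'a set \<Rightarrow> complex" where
  "class_zeta_term L K s I =
     of_nat (class_number (unipotent_group L (ring_of_integers K Quot I)))
       * of_nat (ideal_index K I) powr (- s)"

definition class_zeta :: "lie_lattice \<Rightarrow> 'a::field_char_0 set \<Rightarrow> complex \<Rightarrow> complex" where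
  "class_zeta L K s = (\<Sum>\<^sub>\<infinity>I\<in>nonzero_ideals K. class_zeta_term L K s I)"

text \<open>
  The Dedekind zeta function, by its Dirichlet series; only meaningful in the half-plane of
  convergence.
\<close>

definition dedekind_zeta_term :: "'a::field_char_0 set \<Rightarrow> complex \<Rightarrow> 'a set \<Rightarrow> complex" where
  "dedekind_zeta_term K s I = of_nat (ideal_index K I) powr (- s)"

definition dedekind_zeta :: "'a::field_char_0 set \<Rightarrow> complex \<Rightarrow> complex" where
  "dedekind_zeta K s = (\<Sum>\<^sub>\<infinity>I\<in>nonzero_ideals K. dedekind_zeta_term K s I)"

text \<open>
  Absolute convergence of an infinite product over an unordered index set, with value \<open>z\<close>
  (the analogue of \<^const>\<open>has_sum\<close> for products).
\<close>

definition has_abs_prod :: "('i \<Rightarrow> complex) \<Rightarrow> 'i set \<Rightarrow> complex \<Rightarrow> bool" where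
  "has_abs_prod f A z \<longleftrightarrow>
     (\<lambda>x. f x - 1) abs_summable_on A \<and> (prod f \<longlongrightarrow> z) (finite_subsets_at_top A)"

end

theory Submission
  imports Defs "Jordan_Normal_Form.Char_Poly" "HOL-Computational_Algebra.Primes"
begin

text \<open>
  Let \<open>L\<close> have \<open>d\<close> generators \<open>x\<^sub>k\<close> and \<open>m\<close> generators \<open>y\<^sub>i\<^sub>j\<close>. The class number of a finite group of
  order \<open>N\<close> is the number of its commuting pairs divided by \<open>N\<close>, and in a group of class 2 whether
  \<open>g\<close> and \<open>h\<close> commute only depends on their \<open>x\<close>-coordinates. So the class number of the group over
  \<open>\<O>/I\<close> is \<open>|\<O>:I|\<close> to the power \<open>m - d\<close> times the number of pairs of vectors in \<open>(\<O>/I)\<^sup>d\<close> killed by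
  the Lie bracket. This number is multiplicative in \<open>I\<close>, which gives an Euler product. For
  \<open>I = P\<^sup>k\<^sup>+\<^sup>1\<close> one separates the pairs \<open>(x, y)\<close> with \<open>x\<close> divisible by \<open>P\<close>, which are counted by the pairs
  modulo \<open>P\<^sup>k\<close>, from those with \<open>x\<close> primitive; the centralizer of a primitive \<open>x\<close> is computed by
  linear algebra over the local ring \<open>\<O>/P\<^sup>k\<^sup>+\<^sup>1\<close>, for \<open>H\<^sub>n\<close> with the help of Gauss' lemma for products of two
  linear forms. Summing the resulting linear recurrences in \<open>k\<close> yields the local factors.
\<close>

section \<open>Algebraic integers\<close>

text \<open>The arithmetic of \<open>\<O>\<close> has to come first, and it is reduced to
  finiteness. Instead of an integral basis, a maximal set that is independent modulo
  \<open>p\<close> is used; it has at most \<open>degree_bound\<close> elements, so residue rings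
  are finite. The pigeonhole principle then yields inverses modulo primes and integral closedness,
  and the index is the measure for inductions over ideals. Inverting \<open>P\<close> amounts to one
  element \<open>g\<close> of \<open>K\<close> outside \<open>\<O>\<close> with \<open>g P\<close>
  inside \<open>\<O>\<close>; prime powers, uniformizers and unique factorization are all expressed
  through \<open>g\<close>. No localization is formed: a statement over a local ring is a congruence
  modulo \<open>P^k\<close>, and cardinalities of quotients are numbers of classes of elements of
  \<open>K\<close>. Since only some half-plane of convergence is claimed, the crude bound
  \<open>p ^ degree_bound\<close> for the number of primes above \<open>p\<close> suffices; it is
  the source of the exponent \<open>degree_bound + 2\<close>. Residue characteristic 2 is not
  exceptional for \<open>H_lat\<close>, because its bracket is read as the coefficients of a
  polynomial and not as a symmetric matrix, which would have to be halved.\<close>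

definition int_span :: "('i \<Rightarrow> 'a::comm_ring_1) \<Rightarrow> 'i set \<Rightarrow> 'a set" where
  "int_span v I = {x. \<exists>c. x = (\<Sum>i\<in>I. of_int (c i) * v i)}"

lemma int_span_add: "x \<in> int_span v I \<Longrightarrow> y \<in> int_span v I \<Longrightarrow> x + y \<in> int_span v I"
proof -
  assume "x \<in> int_span v I" "y \<in> int_span v I"
  then obtain c d where "x = (\<Sum>i\<in>I. of_int (c i) * v i)" "y = (\<Sum>i\<in>I. of_int (d i) * v i)"
    by (auto simp: int_span_def)
  hence "x + y = (\<Sum>i\<in>I. of_int (c i + d i) * v i)"
    by (simp add: algebra_simps sum.distrib)
  thus ?thesis unfolding int_span_def by (intro CollectI exI)
qed

lemma int_span_0: "0 \<in> int_span v I"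
  unfolding int_span_def by (auto intro!: exI[of _ "\<lambda>_. 0"])

lemma int_span_scale: "x \<in> int_span v I \<Longrightarrow> of_int k * x \<in> int_span v I"
proof -
  assume "x \<in> int_span v I"
  then obtain c where "x = (\<Sum>i\<in>I. of_int (c i) * v i)"
    by (auto simp: int_span_def)
  hence "of_int k * x = (\<Sum>i\<in>I. of_int (k * c i) * v i)"
    by (simp add: sum_distrib_left algebra_simps)
  thus ?thesis unfolding int_span_def by (intro CollectI exI)
qed

lemma int_span_sum:
  "(\<And>j. j \<in> J \<Longrightarrow> f j \<in> int_span v I) \<Longrightarrow> (\<Sum>j\<in>J. of_int (c j) * f j) \<in> int_span v I"
  by (induction J rule: infinite_finite_induct) (auto intro: int_span_add int_span_0 int_span_scale)

lemma int_span_base: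
  assumes "finite I" "i \<in> I"
  shows "v i \<in> int_span v I"
proof -
  have "(\<Sum>j\<in>I. of_int (of_bool (j = i)) * v j) = (\<Sum>j\<in>I. if j = i then v j else 0)"
    by (intro sum.cong) auto
  also have "\<dots> = v i" using assms by simp
  finally show ?thesis unfolding int_span_def by (intro CollectI exI) (rule sym)
qed

text \<open>The multiplier ring of a lattice. It is closed under sums and products, so these are
  integral as soon as two elements multiply one common nonzero lattice into itself.\<close>

definition span_stabilizer :: "('i \<Rightarrow> 'a::comm_ring_1) \<Rightarrow> 'i set \<Rightarrow> 'a set" where
  "span_stabilizer v I = {x. \<forall>i\<in>I. x * v i \<in> int_span v I}"

lemma span_stabilizer_int_span:
  assumes "x \<in> span_stabilizer v I" "y \<in> int_span v I"
  shows "x * y \<in> int_span v I"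
proof -
  obtain c where "y = (\<Sum>i\<in>I. of_int (c i) * v i)"
    using assms by (auto simp: int_span_def)
  hence "x * y = (\<Sum>i\<in>I. of_int (c i) * (x * v i))"
    by (simp add: sum_distrib_left algebra_simps)
  thus ?thesis using assms by (auto intro!: int_span_sum simp: span_stabilizer_def)
qed

lemma span_stabilizer_mult:
  "x \<in> span_stabilizer v I \<Longrightarrow> y \<in> span_stabilizer v I \<Longrightarrow> x * y \<in> span_stabilizer v I"
  unfolding span_stabilizer_def using span_stabilizer_int_span[of x v I]
  by (auto simp: mult.assoc span_stabilizer_def)

lemma span_stabilizer_add:
  "x \<in> span_stabilizer v I \<Longrightarrow> y \<in> span_stabilizer v I \<Longrightarrow> x + y \<in> span_stabilizer v I"
  unfolding span_stabilizer_def by (auto simp: distrib_right intro: int_span_add)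

lemma span_stabilizer_power:
  assumes "x \<in> span_stabilizer v I" "y \<in> int_span v I"
  shows "x ^ n * y \<in> int_span v I"
  by (induction n) (use assms in \<open>auto simp: mult.assoc intro: span_stabilizer_int_span\<close>)

text \<open>The nonzero vector \<open>v\<close> is an eigenvector of the integer matrix
  \<open>A\<close> for the eigenvalue \<open>x\<close>, so \<open>x\<close> is a root of the
  characteristic polynomial, which is monic with integer coefficients.\<close>

lemma algebraic_int_matrix:
  fixes x :: "'a::field_char_0" and v :: "nat \<Rightarrow> 'a"
  assumes ev: "\<And>i. i < n \<Longrightarrow> x * v i = (\<Sum>j<n. of_int (A i j) * v j)" and nz: "k < n" "v k \<noteq> 0"
  shows "algebraic_int x"
proof -
  let ?M = "Matrix.mat n n (\<lambda>(i,j). A i j)"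
  let ?N = "map_mat of_int ?M :: 'a mat"
  interpret of_int_hom: comm_ring_hom "of_int :: int \<Rightarrow> 'a" by unfold_locales auto
  have M: "?M \<in> carrier_mat n n" and N: "?N \<in> carrier_mat n n" by auto
  have "eigenvector ?N (Matrix.vec n v) x"
    unfolding eigenvector_def
  proof (intro conjI)
    have "Matrix.vec n v $ k \<noteq> 0\<^sub>v n $ k" using nz by simp
    thus "Matrix.vec n v \<noteq> 0\<^sub>v (dim_row ?N)" by auto
    show "?N *\<^sub>v Matrix.vec n v = x \<cdot>\<^sub>v Matrix.vec n v"
      using ev by (intro eq_vecI) (auto simp: scalar_prod_def lessThan_atLeast0)
  qed auto
  hence "poly (char_poly ?N) x = 0"
    using eigenvalue_root_char_poly[OF N] by (auto simp: eigenvalue_def)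
  moreover have "char_poly ?N = map_poly of_int (char_poly ?M)"
    by (rule of_int_hom.char_poly_hom[OF M])
  moreover have "Polynomial.lead_coeff (char_poly ?M) = 1"
    using degree_monic_char_poly[OF M] by simp
  ultimately show ?thesis
    unfolding algebraic_int_altdef_ipoly by metis
qed

lemma algebraic_int_span_stabilizer:
  fixes x :: "'a::field_char_0"
  assumes fin: "finite I" and x: "x \<in> span_stabilizer v I" and nz: "k \<in> I" "v k \<noteq> 0"
  shows "algebraic_int x"
proof -
  obtain h where h: "bij_betw h {..<card I} I"
    using fin by (metis bij_betw_from_nat_into_finite lessThan_atLeast0 ex_bij_betw_nat_finite)
  have "\<forall>i. \<exists>c. i < card I \<longrightarrow> x * v (h i) = (\<Sum>j<card I. of_int (c j) * v (h j))"
  proof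
    fix i
    show "\<exists>c. i < card I \<longrightarrow> x * v (h i) = (\<Sum>j<card I. of_int (c j) * v (h j))"
    proof (cases "i < card I")
      case True
      hence "h i \<in> I" using h by (auto simp: bij_betw_def)
      then obtain c where "x * v (h i) = (\<Sum>j\<in>I. of_int (c j) * v j)"
        using x by (auto simp: span_stabilizer_def int_span_def)
      also have "\<dots> = (\<Sum>j<card I. of_int (c (h j)) * v (h j))"
        by (rule sum.reindex_bij_betw[OF h, symmetric])
      finally show ?thesis by (intro exI[of _ "\<lambda>j. c (h j)"]) simp
    qed auto
  qed
  then obtain A where A: "\<And>i. i < card I \<Longrightarrow> x * v (h i) = (\<Sum>j<card I. of_int (A i j) * v (h j))"
    by metis
  obtain k' where "k' \<in> {..<card I}" "h k' = k"
    using h nz by (metis bij_betw_imp_surj_on imageE)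
  thus ?thesis using algebraic_int_matrix[of "card I" x "\<lambda>i. v (h i)" A k'] A nz by auto
qed

lemma algebraic_int_power_eq:
  fixes x :: "'a::field_char_0"
  assumes "algebraic_int x"
  obtains n c where "n > 0" "x ^ n = (\<Sum>i<n. of_int (c i) * x ^ i)"
proof -
  obtain p where p: "poly (map_poly of_int p) x = 0" "Polynomial.lead_coeff p = 1"
    using assms algebraic_int_altdef_ipoly by auto
  \<comment> \<open>A monic polynomial of degree 0 is 1 and has no root. Positivity of the exponent
    guarantees that the lattices built from powers contain 1.\<close>
  have pos: "Polynomial.degree p > 0"
  proof (rule ccontr)
    assume "\<not> Polynomial.degree p > 0"
    then obtain a where "p = [:a:]" by (metis degree_eq_zeroE gr0I)
    thus False using p by simp
  qed
  have "(\<Sum>i\<le>Polynomial.degree p. of_int (Polynomial.coeff p i) * x ^ i) = 0"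
    using p(1) by (simp add: poly_altdef degree_map_poly coeff_map_poly)
  also have "{..Polynomial.degree p} = insert (Polynomial.degree p) {..<Polynomial.degree p}" by auto
  finally have "x ^ Polynomial.degree p = (\<Sum>i<Polynomial.degree p. of_int (- Polynomial.coeff p i) * x ^ i)"
    using p(2) by (simp add: sum_negf eq_neg_iff_add_eq_0)
  thus ?thesis using that[of "Polynomial.degree p" "\<lambda>i. - Polynomial.coeff p i"] pos by simp
qed

text \<open>The lattice is spanned by the monomials \<open>x^i y^j\<close> in a box. The equation
  for \<open>x\<close> may have coefficients in the ring generated by \<open>y\<close>, so the lemma
  serves two unrelated integral elements as well as the transitivity of integrality.\<close>

lemma two_generator_span_stabilizer:
  fixes x y :: "'a::comm_ring_1"
  defines "v \<equiv> (\<lambda>(i, j). x ^ i * y ^ j)"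
  assumes pos: "a > 0" "b > 0"
    and y: "y ^ b = (\<Sum>j<b. of_int (d j) * y ^ j)"
    and x: "x ^ a \<in> int_span v ({..<a} \<times> {..<b})"
  shows "x \<in> span_stabilizer v ({..<a} \<times> {..<b})" "y \<in> span_stabilizer v ({..<a} \<times> {..<b})"
proof -
  let ?I = "{..<a} \<times> {..<b}"
  have base: "x ^ i * y ^ j \<in> int_span v ?I" if "i < a" "j < b" for i j
    using int_span_base[of ?I "(i, j)" v] that by (auto simp: v_def)
  show Y: "y \<in> span_stabilizer v ?I"
    unfolding span_stabilizer_def
  proof (clarify)
    fix i j assume ij: "i < a" "j < b"
    show "y * v (i, j) \<in> int_span v ?I"
    proof (cases "Suc j < b")
      case True
      thus ?thesis using base[of i "Suc j"] ij by (simp add: v_def algebra_simps)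
    next
      case False
      hence "Suc j = b" using ij by auto
      hence "y * v (i, j) = x ^ i * y ^ b" by (auto simp: v_def algebra_simps)
      also have "\<dots> = (\<Sum>j<b. of_int (d j) * (x ^ i * y ^ j))"
        unfolding y by (simp add: sum_distrib_left algebra_simps)
      finally show ?thesis using ij base by (auto intro!: int_span_sum)
    qed
  qed
  show "x \<in> span_stabilizer v ?I"
    unfolding span_stabilizer_def
  proof (clarify)
    fix i j assume ij: "i < a" "j < b"
    show "x * v (i, j) \<in> int_span v ?I"
    proof (cases "Suc i < a")
      case True
      thus ?thesis using base[of "Suc i" j] ij by (simp add: v_def algebra_simps)
    next
      case False
      hence "Suc i = a" using ij by auto
      hence "x * v (i, j) = y ^ j * x ^ a" by (auto simp: v_def algebra_simps)
      thus ?thesis using span_stabilizer_power[OF Y x] by simp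
    qed
  qed
qed

lemma algebraic_int_add_mult:
  fixes x y :: "'a::field_char_0"
  assumes "algebraic_int x" "algebraic_int y"
  shows "algebraic_int (x + y)" "algebraic_int (x * y)"
proof -
  obtain a c where a: "a > 0" "x ^ a = (\<Sum>i<a. of_int (c i) * x ^ i)"
    using algebraic_int_power_eq[OF assms(1)] .
  obtain b d where b: "b > 0" "y ^ b = (\<Sum>i<b. of_int (d i) * y ^ i)"
    using algebraic_int_power_eq[OF assms(2)] .
  let ?v = "\<lambda>(i, j). x ^ i * y ^ j" and ?I = "{..<a} \<times> {..<b}"
  have "x ^ a \<in> int_span ?v ?I"
    unfolding a(2)
  proof (intro int_span_sum)
    fix i assume "i \<in> {..<a}"
    thus "x ^ i \<in> int_span ?v ?I" using int_span_base[of ?I "(i, 0)" ?v] b by auto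
  qed
  note * = two_generator_span_stabilizer[OF a(1) b(1) b(2) this]
  show "algebraic_int (x + y)" "algebraic_int (x * y)"
    using a(1) b(1) by (auto intro!: algebraic_int_span_stabilizer[of ?I _ ?v "(0,0)"]
      span_stabilizer_add span_stabilizer_mult *)
qed

text \<open>With \<open>y = x^i - x^j\<close>, the element \<open>x\<close> is a root of the monic
  polynomial \<open>X^i - X^j - y\<close> over the ring generated by the integral element
  \<open>y\<close>. Such differences of powers are what the pigeonhole principle delivers in
  \<open>integrally_closed\<close>.\<close>

lemma algebraic_int_power_diff:
  fixes x :: "'a::field_char_0"
  assumes "algebraic_int (x ^ i - x ^ j)" "j < i"
  shows "algebraic_int x"
proof -
  let ?y = "x ^ i - x ^ j"
  obtain b d where b: "b > 0" "?y ^ b = (\<Sum>i<b. of_int (d i) * ?y ^ i)"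
    using algebraic_int_power_eq[OF assms(1)] .
  let ?v = "\<lambda>(i, j). x ^ i * ?y ^ j" and ?I = "{..<i} \<times> {..<b}"
  have "?y \<in> int_span ?v ?I"
  \<comment> \<open>For \<open>b = 1\<close> the exponent pair \<open>(0, 1)\<close> is missing from
    the box, but then \<open>?y\<close> is a rational integer.\<close>
  proof (cases "b = 1")
    case True
    hence "?y = of_int (d 0) * 1" using b by simp
    moreover have "1 \<in> int_span ?v ?I"
      using int_span_base[of ?I "(0, 0)" ?v] b assms by auto
    ultimately show ?thesis using int_span_scale by metis
  next
    case False
    thus ?thesis using int_span_base[of ?I "(0, 1)" ?v] b assms by auto
  qed
  moreover have "x ^ j \<in> int_span ?v ?I"
    using int_span_base[of ?I "(j, 0)" ?v] b assms by auto
  ultimately have "?y + x ^ j \<in> int_span ?v ?I" by (rule int_span_add)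
  hence "x ^ i \<in> int_span ?v ?I" by simp
  from two_generator_span_stabilizer(1)[OF _ b(1) b(2) this] assms(2)
  show ?thesis using b by (auto intro!: algebraic_int_span_stabilizer[of ?I _ ?v "(0,0)"])
qed

section \<open>Counting equivalence classes\<close>

text \<open>A class is taken in the whole type and not cut down to \<open>U\<close>. So the set of
  classes grows with \<open>U\<close>, and a relation may ignore part of the data, such as
  coordinates outside an index set.\<close>

definition class_set :: "('x \<Rightarrow> 'x \<Rightarrow> bool) \<Rightarrow> 'x set \<Rightarrow> 'x set set" where
  "class_set E U = (\<lambda>x. {y. E x y}) ` U"

definition class_count :: "('x \<Rightarrow> 'x \<Rightarrow> bool) \<Rightarrow> 'x set \<Rightarrow> nat" where
  "class_count E U = card (class_set E U)"

lemma class_eq_iff: "equivp E \<Longrightarrow> {z. E x z} = {z. E y z} \<longleftrightarrow> E x y"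
  by (metis (full_types) Collect_mono_iff equivp_def mem_Collect_eq order_eq_refl)

text \<open>Injectivity and surjectivity of \<open>f\<close> are required only up to the relations;
  all later bijections between residue sets are used in this form.\<close>

lemma class_set_bij:
  assumes E: "equivp E" "equivp E'"
    and f: "\<And>x. x \<in> U \<Longrightarrow> f x \<in> V"
    and iff: "\<And>x y. x \<in> U \<Longrightarrow> y \<in> U \<Longrightarrow> E' (f x) (f y) \<longleftrightarrow> E x y"
    and surj: "\<And>v. v \<in> V \<Longrightarrow> \<exists>x\<in>U. E' (f x) v"
  shows "\<exists>h. bij_betw h (class_set E U) (class_set E' V)"
proof -
  \<comment> \<open>A class may contain elements outside \<open>U\<close>, so a representative
    inside \<open>U\<close> has to be chosen.\<close>
  define r where "r = (\<lambda>c. SOME x. x \<in> U \<and> c = {y. E x y})"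
  have r: "r {y. E x y} \<in> U \<and> E x (r {y. E x y})" if "x \<in> U" for x
  proof -
    have "r {y. E x y} \<in> U \<and> {y. E x y} = {y. E (r {y. E x y}) y}"
      unfolding r_def by (rule someI[of _ x]) (use that in auto)
    thus ?thesis using class_eq_iff[OF E(1)] by auto
  qed
  define h where "h = (\<lambda>c. {y. E' (f (r c)) y})"
  have h: "h {y. E x y} = {y. E' (f x) y}" if "x \<in> U" for x
    using r[OF that] that class_eq_iff[OF E(2)] iff unfolding h_def
    by (metis (no_types, lifting) E(1) equivp_symp)
  have "bij_betw h (class_set E U) (class_set E' V)"
    unfolding bij_betw_def
  proof
    show "inj_on h (class_set E U)"
      unfolding inj_on_def class_set_def using h class_eq_iff[OF E(1)] class_eq_iff[OF E(2)] iff
      by auto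
    show "h ` class_set E U = class_set E' V"
    proof (intro Set.set_eqI iffI)
      fix c assume "c \<in> h ` class_set E U"
      thus "c \<in> class_set E' V" using h f by (auto simp: class_set_def)
    next
      fix c assume "c \<in> class_set E' V"
      then obtain v where v: "v \<in> V" "c = {y. E' v y}" by (auto simp: class_set_def)
      obtain x where "x \<in> U" "E' (f x) v" using surj v by blast
      hence "c = h {y. E x y}" using h[of x] v class_eq_iff[OF E(2), of "f x" v] by simp
      thus "c \<in> h ` class_set E U" using \<open>x \<in> U\<close> by (auto simp: class_set_def)
    qed
  qed
  thus ?thesis by (rule exI[of _ h])
qed

lemma class_count_bij:
  assumes "equivp E" "equivp E'"
    and "\<And>x. x \<in> U \<Longrightarrow> f x \<in> V"
    and "\<And>x y. x \<in> U \<Longrightarrow> y \<in> U \<Longrightarrow> E' (f x) (f y) \<longleftrightarrow> E x y"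
    and "\<And>v. v \<in> V \<Longrightarrow> \<exists>x\<in>U. E' (f x) v"
  shows "class_count E U = class_count E' V"
  unfolding class_count_def using class_set_bij[of E E' U f V] assms bij_betw_same_card by blast

lemma class_count_le_card:
  assumes "equivp E" "finite T" "\<And>x. x \<in> U \<Longrightarrow> \<exists>t\<in>T. E x t"
  shows "finite (class_set E U)" "class_count E U \<le> card T"
proof -
  have "class_set E U \<subseteq> (\<lambda>x. {y. E x y}) ` T"
    using assms(3) class_eq_iff[OF assms(1)] by (fastforce simp: class_set_def)
  thus "finite (class_set E U)" "class_count E U \<le> card T"
    unfolding class_count_def using assms(2)
    by (auto intro: finite_subset order_trans[OF card_mono card_image_le])
qed

lemma class_set_mono: "U \<subseteq> V \<Longrightarrow> class_set E U \<subseteq> class_set E V"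
  by (auto simp: class_set_def)

lemma class_count_mono: "finite (class_set E V) \<Longrightarrow> U \<subseteq> V \<Longrightarrow> class_count E U \<le> class_count E V"
  unfolding class_count_def by (intro card_mono class_set_mono)

lemma class_count_pos: "finite (class_set E V) \<Longrightarrow> V \<noteq> {} \<Longrightarrow> class_count E V > 0"
  unfolding class_count_def by (auto simp: card_gt_0_iff class_set_def)

lemma class_count_Un:
  assumes "equivp E" "finite (class_set E (U \<union> V))" "\<And>x y. x \<in> U \<Longrightarrow> y \<in> V \<Longrightarrow> \<not> E x y"
  shows "class_count E (U \<union> V) = class_count E U + class_count E V"
proof -
  have "class_set E (U \<union> V) = class_set E U \<union> class_set E V"
    by (auto simp: class_set_def)
  moreover have "class_set E U \<inter> class_set E V = {}"
    using assms(3) class_eq_iff[OF assms(1)] by (fastforce simp: class_set_def)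
  ultimately show ?thesis
    unfolding class_count_def using assms(2) by (metis card_Un_disjoint finite_Un)
qed

text \<open>The map from classes to coarser classes is onto, and the pair \<open>x\<close>,
  \<open>y\<close> destroys its injectivity. This makes the index of ideals strictly
  decreasing.\<close>

lemma class_count_coarser_strict:
  assumes E: "equivp E" "equivp E'" and fin: "finite (class_set E U)"
    and le: "\<And>x y. x \<in> U \<Longrightarrow> y \<in> U \<Longrightarrow> E x y \<Longrightarrow> E' x y"
    and xy: "x \<in> U" "y \<in> U" "E' x y" "\<not> E x y"
  shows "class_count E' U < class_count E U"
proof -
  define r where "r = (\<lambda>c. SOME x. x \<in> U \<and> c = {y. E x y})"
  have r: "r {y. E x y} \<in> U \<and> E x (r {y. E x y})" if "x \<in> U" for x
  proof -
    have "r {y. E x y} \<in> U \<and> {y. E x y} = {y. E (r {y. E x y}) y}"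
      unfolding r_def by (rule someI[of _ x]) (use that in auto)
    thus ?thesis using class_eq_iff[OF E(1)] by auto
  qed
  define h where "h = (\<lambda>c. {y. E' (r c) y})"
  have h: "h {y. E x y} = {y. E' x y}" if "x \<in> U" for x
    using r[OF that] that class_eq_iff[OF E(2)] le unfolding h_def
    by (metis (no_types, lifting) E(2) equivp_symp)
  have im: "h ` class_set E U = class_set E' U"
    using h by (auto simp: class_set_def image_image cong: image_cong)
  have "\<not> inj_on h (class_set E U)"
    using h xy class_eq_iff[OF E(1)] class_eq_iff[OF E(2)] unfolding inj_on_def class_set_def
    by (metis (no_types, lifting) imageI)
  thus ?thesis
    unfolding class_count_def im[symmetric] using fin card_image_le[OF fin, of h]
    by (metis card_image_le eq_card_imp_inj_on le_neq_implies_less)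
qed

definition pair_rel :: "('x \<Rightarrow> 'x \<Rightarrow> bool) \<Rightarrow> ('y \<Rightarrow> 'y \<Rightarrow> bool) \<Rightarrow> 'x \<times> 'y \<Rightarrow> 'x \<times> 'y \<Rightarrow> bool"
  where "pair_rel E E' = (\<lambda>(x, y) (x', y'). E x x' \<and> E' y y')"

lemma pair_rel_simp [simp]: "pair_rel E E' (x, y) (x', y') \<longleftrightarrow> E x x' \<and> E' y y'"
  by (simp add: pair_rel_def)

lemma equivp_pair_rel: "equivp E \<Longrightarrow> equivp E' \<Longrightarrow> equivp (pair_rel E E')"
  unfolding pair_rel_def by (auto intro!: equivpI reflpI sympI transpI elim: equivp_reflp equivp_symp equivp_transp)

text \<open>A class of pairs is a product of two classes. As \<open>F\<close> is constant on
  classes, the classes of pairs fibre over those of \<open>U\<close>, with \<open>c\<close> of them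
  in each fibre.\<close>

lemma class_count_fiber:
  assumes E: "equivp E" "equivp E'"
    and fin: "finite (class_set E U)"
    and finF: "\<And>x. x \<in> U \<Longrightarrow> finite (class_set E' (F x))"
    and c: "\<And>x. x \<in> U \<Longrightarrow> class_count E' (F x) = c"
    and F: "\<And>x x'. x \<in> U \<Longrightarrow> x' \<in> U \<Longrightarrow> E x x' \<Longrightarrow> F x = F x'"
  shows "class_count (pair_rel E E') (SIGMA x:U. F x) = class_count E U * c"
    "finite (class_set (pair_rel E E') (SIGMA x:U. F x))"
proof -
  define r where "r = (\<lambda>c. SOME x. x \<in> U \<and> c = {y. E x y})"
  have r: "r {y. E x y} \<in> U \<and> E x (r {y. E x y})" if "x \<in> U" for x
  proof -
    have "r {y. E x y} \<in> U \<and> {y. E x y} = {y. E (r {y. E x y}) y}"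
      unfolding r_def by (rule someI[of _ x]) (use that in auto)
    thus ?thesis using class_eq_iff[OF E(1)] by auto
  qed
  have eq: "{z. pair_rel E E' (x, y) z} = {z. E x z} \<times> {z. E' y z}" for x y
    by auto
  have "class_set (pair_rel E E') (SIGMA x:U. F x) =
        (\<lambda>(c, d). c \<times> d) ` (SIGMA c:class_set E U. class_set E' (F (r c)))" (is "?L = ?R")
  proof (intro Set.set_eqI iffI)
    fix z assume "z \<in> ?L"
    then obtain x y where xy: "x \<in> U" "y \<in> F x" "z = {z. E x z} \<times> {z. E' y z}"
      unfolding class_set_def eq[symmetric] by auto
    have "F (r {y. E x y}) = F x" using F r[OF xy(1)] xy(1) by metis
    thus "z \<in> ?R" unfolding xy(3) by (auto simp: class_set_def intro!: rev_image_eqI[of "({z. E x z}, {z. E' y z})"] xy)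
  next
    fix z assume "z \<in> ?R"
    then obtain x y where xy: "x \<in> U" "y \<in> F (r {y. E x y})" "z = {z. E x z} \<times> {z. E' y z}"
      by (auto simp: class_set_def)
    have "F (r {y. E x y}) = F x" using F r[OF xy(1)] xy(1) by metis
    thus "z \<in> ?L" unfolding xy(3) eq[symmetric] using xy by (auto simp: class_set_def)
  qed
  moreover have "inj_on (\<lambda>(c, d). c \<times> d) (SIGMA c:class_set E U. class_set E' (F (r c)))"
  proof (rule inj_onI, clarify)
    fix c d c' d' assume "c \<in> class_set E U" "c' \<in> class_set E U"
      "d \<in> class_set E' (F (r c))" "d' \<in> class_set E' (F (r c'))" "c \<times> d = c' \<times> d'"
    moreover from this have "c \<noteq> {}" "c' \<noteq> {}" "d \<noteq> {}" "d' \<noteq> {}"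
      using E by (auto simp: class_set_def dest: equivp_reflp)
    ultimately show "c = c' \<and> d = d'" by (auto simp: times_eq_iff)
  qed
  moreover have fc: "finite (class_set E' (F (r c))) \<and> card (class_set E' (F (r c))) = class_count E' (F (r c)) \<and> r c \<in> U"
    if "c \<in> class_set E U" for c
    using that r finF by (auto simp: class_set_def class_count_def)
  ultimately show "class_count (pair_rel E E') (SIGMA x:U. F x) = class_count E U * c"
    using c fin by (simp add: class_count_def card_image card_SigmaI)
  show "finite (class_set (pair_rel E E') (SIGMA x:U. F x))"
    unfolding \<open>?L = ?R\<close> using fin fc by (intro finite_imageI finite_SigmaI) auto
qed

lemma class_count_times:
  assumes "equivp E" "equivp E'" "finite (class_set E U)" "finite (class_set E' V)"
  shows "class_count (pair_rel E E') (U \<times> V) = class_count E U * class_count E' V"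
    "finite (class_set (pair_rel E E') (U \<times> V))"
  using class_count_fiber[of E E' U "\<lambda>_. V"] assms by auto

section \<open>The ring of integers\<close>

lemma ring_on_simps [simp]:
  "carrier (ring_on S) = S" "mult (ring_on S) = (*)" "one (ring_on S) = 1"
  "zero (ring_on S) = 0" "add (ring_on S) = (+)"
  by (simp_all add: ring_on_def)

lemma cring_ring_on:
  fixes S :: "'a::field set"
  assumes "0 \<in> S" "1 \<in> S" "\<And>x. x \<in> S \<Longrightarrow> - x \<in> S"
    "\<And>x y. x \<in> S \<Longrightarrow> y \<in> S \<Longrightarrow> x + y \<in> S" "\<And>x y. x \<in> S \<Longrightarrow> y \<in> S \<Longrightarrow> x * y \<in> S"
  shows "cring (ring_on S)"
proof (intro cringI abelian_groupI comm_monoidI)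
  fix x assume "x \<in> carrier (ring_on S)"
  thus "\<exists>y\<in>carrier (ring_on S). y \<oplus>\<^bsub>ring_on S\<^esub> x = \<zero>\<^bsub>ring_on S\<^esub>"
    using assms by (intro bexI[of _ "- x"]) auto
qed (use assms in \<open>auto simp: algebra_simps\<close>)

lemma ring_ring_on_UNIV: "ring (ring_on (UNIV :: 'a::field set))"
  using cring_ring_on[of "UNIV :: 'a set"] cring.axioms(1) by auto

lemma vector_space_rat: "vector_space (\<lambda>(q::rat) (x::'a::field_char_0). of_rat q * x)"
  by unfold_locales (auto simp: algebra_simps of_rat_add of_rat_mult)

text \<open>Translates the inductively defined dimension into a spanning set in the sense of
  \<open>vector_space\<close>, where the size of independent sets is bounded.\<close>

lemma dimension_rat_span:
  assumes "ring.dimension (ring_on (UNIV :: 'a::field_char_0 set)) n \<rat> E"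
  shows "\<exists>B. finite B \<and> card B \<le> n \<and> E \<subseteq> module.span (\<lambda>(q::rat) (x::'a). of_rat q * x) B"
  using assms
proof (induction n "\<rat> :: 'a set" E rule: ring.dimension.induct[OF ring_ring_on_UNIV, consumes 1])
  case 1
  interpret vs: vector_space "\<lambda>(q::rat) (x::'a). of_rat q * x" by (rule vector_space_rat)
  show ?case by (intro exI[of _ "{}"]) auto
next
  case (2 v E n)
  interpret vs: vector_space "\<lambda>(q::rat) (x::'a). of_rat q * x" by (rule vector_space_rat)
  obtain B where B: "finite B" "card B \<le> n" "E \<subseteq> vs.span B" using 2 by blast
  have "x \<in> vs.span (insert v B)" if x: "x \<in> ring.line_extension (ring_on UNIV) \<rat> v E" for x
  proof -
    obtain k e where "k \<in> \<rat>" and e: "e \<in> E" "x = k * v + e"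
      using x ring.line_extension_mem_iff[OF ring_ring_on_UNIV, of x "\<rat>" v E] by auto
    then obtain q where "e \<in> E" "x = of_rat q * v + e" by (auto elim: Rats_cases)
    moreover from this have "e \<in> vs.span (insert v B)" using B vs.span_mono[of B "insert v B"] by auto
    moreover have "of_rat q * v \<in> vs.span (insert v B)"
      by (intro vs.span_scale vs.span_base) auto
    ultimately show ?thesis by (auto intro: vs.span_add)
  qed
  moreover have "card (insert v B) \<le> Suc n" using B card_insert_le_m1[of "Suc n" B v] by simp
  ultimately show ?case using B by (intro exI[of _ "insert v B"]) auto
qed

section \<open>Integral linear relations and finiteness of residue rings\<close>

lemma common_denominator:
  assumes "finite A"
  shows "\<exists>D>0. \<forall>a\<in>A. \<exists>k. of_int D * u a = (of_int k :: rat)"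
  using assms
proof induction
  case (insert a A)
  then obtain D where D: "D > 0" "\<forall>a\<in>A. \<exists>k. of_int D * u a = (of_int k :: rat)" by blast
  obtain r s where rs: "s > 0" "u a = of_int r / of_int s"
    by (metis quotient_of_div quotient_of_denom_pos surj_pair)
  show ?case
  proof (rule exI[of _ "s * D"], intro conjI ballI)
    show "s * D > 0" using rs D by simp
    fix b assume b: "b \<in> insert a A"
    show "\<exists>k. of_int (s * D) * u b = (of_int k :: rat)"
    proof (cases "b = a")
      case True
      thus ?thesis using rs by (intro exI[of _ "D * r"]) (simp add: field_simps)
    next
      case False
      then obtain k where "of_int D * u b = of_int k" using b D by auto
      thus ?thesis by (intro exI[of _ "s * k"]) (simp add: mult.assoc)
    qed
  qed
qed (auto intro: exI[of _ 1])

text \<open>The gcd \<open>g\<close> of all coefficients is divided out: if \<open>p\<close> divided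
  all quotients, then \<open>g p\<close> would divide \<open>g\<close>. This turns an integral
  relation into one that is nontrivial modulo \<open>p\<close>.\<close>

lemma primitive_multiple:
  fixes c :: "'i \<Rightarrow> int"
  assumes "finite A" "\<exists>a\<in>A. c a \<noteq> 0" "prime (p :: nat)"
  shows "\<exists>g c'. g \<noteq> 0 \<and> (\<forall>a\<in>A. c a = g * c' a) \<and> (\<exists>a\<in>A. \<not> int p dvd c' a)"
proof -
  define g where "g = Gcd (c ` A)"
  have g0: "g \<noteq> 0" using assms by (auto simp: g_def)
  have dv: "g dvd c a" if "a \<in> A" for a using that by (auto simp: g_def)
  have "\<exists>a\<in>A. \<not> int p dvd c a div g"
  proof (rule ccontr)
    assume "\<not> ?thesis"
    hence "\<forall>a\<in>A. g * int p dvd c a"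
      using dv g0 by (metis dvd_div_iff_mult dvd_mult_div_cancel mult_dvd_mono dvd_refl)
    hence "g * int p dvd Gcd (c ` A)" by (intro Gcd_greatest) auto
    hence "g * int p dvd g" by (simp only: g_def)
    hence "int p dvd 1" using g0 by (metis dvd_times_left_cancel_iff mult.right_neutral)
    thus False using assms(3) by (simp add: prime_nat_iff)
  qed
  thus ?thesis using g0 dv by (intro exI[of _ g] exI[of _ "\<lambda>a. c a div g"]) auto
qed

locale number_field_loc =
  fixes K :: "'a::field_char_0 set"
  assumes number_field: "number_field K"
begin

definition ints :: "'a set" ("\<O>") where "\<O> = {x \<in> K. algebraic_int x}"

lemma subfield_K: "subfield K (ring_on UNIV)"
  using number_field by (simp add: number_field_def)

lemmas subring_K = subfieldE(1)[OF subfield_K]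

lemma K_0: "0 \<in> K" and K_1: "1 \<in> K"
  using subringE(2,3)[OF subring_K] by simp_all

lemma K_minus: "x \<in> K \<Longrightarrow> - x \<in> K"
proof -
  interpret R: ring "ring_on (UNIV :: 'a set)" by (rule ring_ring_on_UNIV)
  have "\<ominus>\<^bsub>ring_on UNIV\<^esub> x = - x"
    by (rule R.minus_equality) auto
  thus "x \<in> K \<Longrightarrow> - x \<in> K" using subringE(5)[OF subring_K, of x] by simp
qed

lemma K_add: "x \<in> K \<Longrightarrow> y \<in> K \<Longrightarrow> x + y \<in> K"
  and K_mult: "x \<in> K \<Longrightarrow> y \<in> K \<Longrightarrow> x * y \<in> K"
  using subringE(6,7)[OF subring_K] by simp_all

lemma K_divide: "x \<in> K \<Longrightarrow> y \<in> K \<Longrightarrow> x / y \<in> K"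
proof (cases "y = 0")
  case False
  assume xy: "x \<in> K" "y \<in> K"
  interpret R: ring "ring_on (UNIV :: 'a set)" by (rule ring_ring_on_UNIV)
  let ?z = "inv\<^bsub>ring_on UNIV\<^esub> y"
  have "?z \<in> K" "y * ?z = 1"
    using R.subfield_m_inv[OF subfield_K, of y] xy False by auto
  hence "x / y = x * ?z" using False by (simp add: field_simps)
  thus ?thesis using xy \<open>?z \<in> K\<close> K_mult by simp
qed (auto simp: K_0)

lemma ints_0: "0 \<in> \<O>" and ints_1: "1 \<in> \<O>"
  by (simp_all add: ints_def K_0 K_1)

lemma ints_add: "x \<in> \<O> \<Longrightarrow> y \<in> \<O> \<Longrightarrow> x + y \<in> \<O>"
  and ints_mult: "x \<in> \<O> \<Longrightarrow> y \<in> \<O> \<Longrightarrow> x * y \<in> \<O>"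
  by (simp_all add: ints_def K_add K_mult algebraic_int_add_mult)

lemma ints_minus: "x \<in> \<O> \<Longrightarrow> - x \<in> \<O>"
  by (auto simp: ints_def K_minus)

lemma ints_diff: "x \<in> \<O> \<Longrightarrow> y \<in> \<O> \<Longrightarrow> x - y \<in> \<O>"
  using ints_add[of x "- y"] ints_minus by simp

lemma ints_power: "x \<in> \<O> \<Longrightarrow> x ^ n \<in> \<O>"
  by (induction n) (auto intro: ints_1 ints_mult)

lemma ints_sum: "(\<And>i. i \<in> I \<Longrightarrow> f i \<in> \<O>) \<Longrightarrow> sum f I \<in> \<O>"
  by (induction I rule: infinite_finite_induct) (auto intro: ints_0 ints_add)

lemma ints_of_nat: "of_nat n \<in> \<O>"
  by (induction n) (auto intro: ints_0 ints_1 ints_add)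

lemma ints_of_int: "of_int n \<in> \<O>"
  by (cases n) (auto intro: ints_of_nat ints_minus simp del: of_nat_Suc)

lemma ints_subset_K: "\<O> \<subseteq> K"
  by (auto simp: ints_def)

text \<open>A set larger than a spanning set is linearly dependent over the rationals, and a common
  denominator makes the relation integral.\<close>

lemma ex_integer_relation:
  "\<exists>n. \<forall>A. finite A \<and> A \<subseteq> K \<and> card A > n \<longrightarrow>
     (\<exists>c. (\<Sum>a\<in>A. of_int (c a) * a) = 0 \<and> (\<exists>a\<in>A. c a \<noteq> 0))"
proof -
  interpret vs: vector_space "\<lambda>(q::rat) (x::'a). of_rat q * x" by (rule vector_space_rat)
  obtain n where "ring.dimension (ring_on (UNIV :: 'a set)) n \<rat> K"
    using number_field ring.finite_dimension_def[OF ring_ring_on_UNIV]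
    by (auto simp: number_field_def)
  then obtain B where B: "finite B" "card B \<le> n" "K \<subseteq> vs.span B"
    using dimension_rat_span by blast
  show ?thesis
  proof (intro exI[of _ n] allI impI, elim conjE)
    fix A assume A: "finite A" "A \<subseteq> K" "card A > n"
    have "vs.dependent A" using vs.independent_span_bound[OF B(1), of A] A B by auto
    then obtain u where u: "\<exists>v\<in>A. u v \<noteq> 0" "(\<Sum>v\<in>A. of_rat (u v) * v) = 0"
      using vs.dependent_finite[OF A(1)] by auto
    obtain D where D: "D > 0" "\<forall>a\<in>A. \<exists>k. of_int D * u a = of_int k"
      using common_denominator[OF A(1), of u] by auto
    then obtain c where c: "\<And>a. a \<in> A \<Longrightarrow> of_int D * u a = of_int (c a)" by metis
    have "(\<Sum>a\<in>A. of_int (c a) * a) = (\<Sum>a\<in>A. of_int D * (of_rat (u a) * a))"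
    proof (intro sum.cong refl)
      fix a assume "a \<in> A"
      hence "of_rat (of_int (c a)) = (of_rat (of_int D * u a) :: 'a)" using c by simp
      thus "of_int (c a) * a = of_int D * (of_rat (u a) * a)" by (simp add: of_rat_mult)
    qed
    also have "\<dots> = 0" using u(2) by (simp add: sum_distrib_left[symmetric])
    finally have z: "(\<Sum>a\<in>A. of_int (c a) * a) = 0" .
    obtain v where v: "v \<in> A" "u v \<noteq> 0" using u(1) by blast
    hence "of_int (c v) \<noteq> (0::rat)" using c[OF v(1)] D(1) by (metis mult_eq_0_iff of_int_eq_0_iff less_irrefl)
    thus "\<exists>c. (\<Sum>a\<in>A. of_int (c a) * a) = 0 \<and> (\<exists>a\<in>A. c a \<noteq> 0)"
      using z v by (intro exI[of _ c]) auto
  qed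
qed

text \<open>An upper bound for the degree of \<open>K\<close> over \<open>\<rat>\<close>.\<close>

definition degree_bound :: nat where
  "degree_bound = (SOME n. \<forall>A. finite A \<and> A \<subseteq> K \<and> card A > n \<longrightarrow>
     (\<exists>c. (\<Sum>a\<in>A. of_int (c a) * a) = 0 \<and> (\<exists>a\<in>A. c a \<noteq> 0)))"

lemma integer_relation:
  assumes "finite A" "A \<subseteq> K" "card A > degree_bound"
  obtains c where "(\<Sum>a\<in>A. of_int (c a) * a) = 0" "\<exists>a\<in>A. c a \<noteq> 0"
proof -
  have "\<forall>A. finite A \<and> A \<subseteq> K \<and> card A > degree_bound \<longrightarrow>
     (\<exists>c. (\<Sum>a\<in>A. of_int (c a) * a) = 0 \<and> (\<exists>a\<in>A. c a \<noteq> 0))"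
    unfolding degree_bound_def by (rule someI_ex[OF ex_integer_relation])
  thus ?thesis using assms that by metis
qed

lemma primitive_integer_relation:
  assumes "finite A" "A \<subseteq> K" "card A > degree_bound" "prime p"
  obtains c where "(\<Sum>a\<in>A. of_int (c a) * a) = 0" "\<exists>a\<in>A. \<not> int p dvd c a"
proof -
  obtain c where c: "(\<Sum>a\<in>A. of_int (c a) * a) = 0" "\<exists>a\<in>A. c a \<noteq> 0"
    using integer_relation assms by blast
  obtain g c' where g: "g \<noteq> 0" "\<forall>a\<in>A. c a = g * c' a" "\<exists>a\<in>A. \<not> int p dvd c' a"
    using primitive_multiple[OF assms(1) c(2) assms(4)] by blast
  have "(\<Sum>a\<in>A. of_int (c a) * a) = of_int g * (\<Sum>a\<in>A. of_int (c' a) * a)"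
    using g(2) by (simp add: sum_distrib_left mult.assoc)
  thus ?thesis using that[of c'] c g by simp
qed

text \<open>Let \<open>A\<close> be of maximal size among the subsets of \<open>\<O>\<close> that
  are linearly independent modulo \<open>p\<close>. A set with more than \<open>degree_bound\<close>
  elements has a primitive integral relation, so \<open>A\<close> is small; by maximality it spans
  \<open>\<O>\<close> modulo \<open>p\<close>. Coefficients between 0 and \<open>p - 1\<close> then
  give all residues.\<close>

lemma residue_system_prime:
  assumes p: "prime p"
  shows "\<exists>T. finite T \<and> card T \<le> p ^ degree_bound \<and> (\<forall>x\<in>\<O>. \<exists>t\<in>T. \<exists>y\<in>\<O>. x - t = of_nat p * y)"
proof -
  define ind where "ind = (\<lambda>A. \<forall>c. (\<exists>y\<in>\<O>. (\<Sum>a\<in>A. of_int (c a) * a) = of_nat p * y) \<longrightarrow> (\<forall>a\<in>A. int p dvd c a))"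
  have le: "card A \<le> degree_bound" if A: "finite A" "A \<subseteq> \<O>" "ind A" for A
  proof (rule ccontr)
    assume "\<not> ?thesis"
    then obtain c where "(\<Sum>a\<in>A. of_int (c a) * a) = 0" "\<exists>a\<in>A. \<not> int p dvd c a"
      using primitive_integer_relation[of A p] A p ints_subset_K by (metis not_le_imp_less subset_trans)
    thus False using A(3) unfolding ind_def using ints_0 by (metis mult_zero_right)
  qed
  define P where "P = (\<lambda>m. \<exists>A. finite A \<and> A \<subseteq> \<O> \<and> ind A \<and> card A = m)"
  have "P 0" unfolding P_def by (intro exI[of _ "{}"]) (auto simp: ind_def)
  moreover have "m \<le> degree_bound" if "P m" for m using le that by (auto simp: P_def)
  ultimately obtain m where m: "P m" "\<And>m'. P m' \<Longrightarrow> m' \<le> m"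
    using ex_has_greatest_nat[of P 0 "\<lambda>x. x" "Suc degree_bound"] by (metis le_imp_less_Suc)
  then obtain A where A: "finite A" "A \<subseteq> \<O>" "ind A" "card A = m" by (auto simp: P_def)
  define T where "T = (\<lambda>c. \<Sum>a\<in>A. of_int (c a) * a) ` (A \<rightarrow>\<^sub>E {0..<int p})"
  have "finite T" unfolding T_def using A by (auto intro: finite_PiE)
  moreover have "card T \<le> p ^ degree_bound"
  proof -
    have "card T \<le> card (A \<rightarrow>\<^sub>E {0..<int p})"
      unfolding T_def by (intro card_image_le finite_PiE A) auto
    also have "\<dots> = p ^ card A" using A by (simp add: card_PiE)
    also have "\<dots> \<le> p ^ degree_bound" using le A p by (intro power_increasing) (auto simp: prime_gt_0_nat Suc_leI)
    finally show ?thesis .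
  qed
  moreover have "\<exists>t\<in>T. \<exists>y\<in>\<O>. x - t = of_nat p * y" if x: "x \<in> \<O>" for x
  proof -
    have "\<exists>d. \<exists>y\<in>\<O>. x = (\<Sum>a\<in>A. of_int (d a) * a) + of_nat p * y"
    proof (cases "x \<in> A")
      case True
      have "(\<Sum>a\<in>A. of_int (of_bool (a = x)) * a) = (\<Sum>a\<in>A. if a = x then a else 0)"
        by (intro sum.cong) auto
      also have "\<dots> = x" using A True by simp
      finally show ?thesis using ints_0 by (intro exI[of _ "\<lambda>a. of_bool (a = x)"] bexI[of _ 0]) auto
    next
      case False
      have "\<not> ind (insert x A)"
      proof
        assume "ind (insert x A)"
        hence "P (Suc m)" unfolding P_def using A x False by (intro exI[of _ "insert x A"]) auto
        thus False using m(2)[of "Suc m"] by simp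
      qed
      then obtain c y where c: "y \<in> \<O>" "(\<Sum>a\<in>insert x A. of_int (c a) * a) = of_nat p * y"
        "\<exists>a\<in>insert x A. \<not> int p dvd c a" by (auto simp: ind_def)
      have s: "(\<Sum>a\<in>A. of_int (c a) * a) = of_nat p * y - of_int (c x) * x"
        using c(2) False A by (simp add: eq_diff_eq add.commute)
      \<comment> \<open>Otherwise the term of \<open>x\<close> could be moved to the multiples of
        \<open>p\<close>, leaving a relation within \<open>A\<close> that contradicts independence.
        Hence \<open>c x\<close> is invertible modulo \<open>p\<close>, and Bezout solves the
        relation for \<open>x\<close>.\<close>
      have "\<not> int p dvd c x"
      proof
        assume "int p dvd c x"
        then obtain k where "c x = int p * k" by auto
        hence "(\<Sum>a\<in>A. of_int (c a) * a) = of_nat p * (y - of_int k * x)"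
          using s by (simp add: algebra_simps)
        moreover have "y - of_int k * x \<in> \<O>" using c(1) x by (auto intro: ints_diff ints_mult ints_of_int)
        ultimately have "\<forall>a\<in>A. int p dvd c a" using A(3) unfolding ind_def by blast
        thus False using c(3) \<open>int p dvd c x\<close> by auto
      qed
      hence "Rings.coprime (int p) (c x)" using p by (simp add: prime_imp_coprime)
      then obtain r s' where "r * int p + s' * c x = 1" by (metis bezout_int coprime_imp_gcd_eq_1)
      hence "of_int (r * int p + s' * c x) = (1::'a)" by simp
      hence rs: "of_int r * of_nat p + of_int s' * of_int (c x) = (1::'a)" by simp
      have "x = (of_int r * of_nat p + of_int s' * of_int (c x)) * x" using rs by simp
      also have "\<dots> = of_int (- s') * (of_nat p * y - of_int (c x) * x) + of_nat p * (of_int r * x + of_int s' * y)"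
        by (simp add: algebra_simps)
      also have "\<dots> = (\<Sum>a\<in>A. of_int (- s' * c a) * a) + of_nat p * (of_int r * x + of_int s' * y)"
        unfolding s[symmetric] by (simp add: sum_distrib_left mult.assoc)
      finally show ?thesis using x c(1)
        by (intro exI[of _ "\<lambda>a. - s' * c a"] bexI[of _ "of_int r * x + of_int s' * y"])
          (auto intro: ints_add ints_mult ints_of_int)
    qed
    then obtain d y where d: "y \<in> \<O>" "x = (\<Sum>a\<in>A. of_int (d a) * a) + of_nat p * y" by blast
    define t where "t = (\<Sum>a\<in>A. of_int ((\<lambda>a\<in>A. d a mod int p) a) * a)"
    have "t \<in> T" unfolding T_def t_def using p by (intro imageI) (auto simp: prime_gt_0_nat)
    moreover have "x - t = of_nat p * ((\<Sum>a\<in>A. of_int (d a div int p) * a) + y)"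
    proof -
      have "(\<Sum>a\<in>A. of_int (d a) * a) = (\<Sum>a\<in>A. of_int (int p * (d a div int p) + d a mod int p) * a)"
        by simp
      also have "\<dots> = of_nat p * (\<Sum>a\<in>A. of_int (d a div int p) * a) + t"
        unfolding t_def of_int_add distrib_right sum.distrib sum_distrib_left
        by (simp add: mult.assoc)
      finally show ?thesis using d(2) by (simp add: algebra_simps)
    qed
    moreover have "(\<Sum>a\<in>A. of_int (d a div int p) * a) + y \<in> \<O>"
      using A d(1) by (auto intro!: ints_add ints_sum ints_mult ints_of_int)
    ultimately show ?thesis by blast
  qed
  ultimately show ?thesis by blast
qed

text \<open>Digit expansion: a residue modulo \<open>p k\<close> is a residue modulo
  \<open>p\<close> plus \<open>p\<close> times a residue modulo \<open>k\<close>.\<close>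

lemma residue_system_nat:
  assumes "m > 0"
  shows "\<exists>T. finite T \<and> (\<forall>x\<in>\<O>. \<exists>t\<in>T. \<exists>y\<in>\<O>. x - t = of_nat m * y)"
  using assms
proof (induction m rule: less_induct)
  case (less m)
  show ?case
  proof (cases "m = 1")
    case True
    show ?thesis by (intro exI[of _ "{0}"]) (auto simp: True)
  next
    case False
    then obtain p where p: "prime p" "p dvd m" using prime_factor_nat by blast
    then obtain k where k: "m = p * k" by auto
    have "k < m" "k > 0" using k less.prems p prime_gt_1_nat[of p] by auto
    then obtain T where T: "finite T" "\<And>x. x \<in> \<O> \<Longrightarrow> \<exists>t\<in>T. \<exists>y\<in>\<O>. x - t = of_nat k * y"
      using less.IH[OF \<open>k < m\<close> \<open>k > 0\<close>] by (elim exE conjE) (metis (lifting))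
    obtain T' where T': "finite T'" "\<And>x. x \<in> \<O> \<Longrightarrow> \<exists>t\<in>T'. \<exists>y\<in>\<O>. x - t = of_nat p * y"
      using residue_system_prime[OF p(1)] by (elim exE conjE) (metis (lifting))
    show ?thesis
    proof (intro exI[of _ "(\<lambda>(t', t). t' + of_nat p * t) ` (T' \<times> T)"] conjI ballI)
      fix x assume "x \<in> \<O>"
      then obtain t' y where 1: "t' \<in> T'" "y \<in> \<O>" "x - t' = of_nat p * y" using T' by blast
      then obtain t z where 2: "t \<in> T" "z \<in> \<O>" "y - t = of_nat k * z" using T by blast
      have "x - (t' + of_nat p * t) = of_nat p * (y - t)" using 1 by (simp add: algebra_simps)
      hence "x - (t' + of_nat p * t) = of_nat m * z" using 2 k by (simp add: algebra_simps)
      thus "\<exists>t\<in>(\<lambda>(t', t). t' + of_nat p * t) ` (T' \<times> T). \<exists>y\<in>\<O>. x - t = of_nat m * y"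
        using 1 2 by (intro bexI[of _ "t' + of_nat p * t"] bexI[of _ z]) auto
    qed (use T T' in auto)
  qed
qed

lemma poly_ints: "x \<in> \<O> \<Longrightarrow> poly (map_poly of_int r) x \<in> \<O>"
  by (simp add: poly_altdef degree_map_poly coeff_map_poly)
    (auto intro!: ints_sum ints_mult ints_of_int ints_power)

text \<open>A substitute for the norm. Once all factors \<open>X\<close> have been cancelled from an
  integral equation of \<open>x\<close>, the constant term is a nonzero multiple of
  \<open>x\<close>.\<close>

lemma integer_multiple:
  assumes "x \<in> \<O>" "x \<noteq> 0"
  obtains n y where "n > 0" "y \<in> \<O>" "of_nat n = x * y"
proof -
  have *: "\<exists>k r. k \<noteq> 0 \<and> of_int k = x * poly (map_poly of_int r) x"
    if "q \<noteq> 0" "poly (map_poly of_int q) x = 0" for q :: "int poly"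
    using that
  proof (induction q rule: pCons_induct)
    case (pCons c q)
    have eq: "of_int c + x * poly (map_poly of_int q) x = 0"
      using pCons.prems by (simp add: map_poly_pCons)
    show ?case
    proof (cases "c = 0")
      case True
      thus ?thesis using eq pCons assms(2) by auto
    next
      case False
      have "of_int (- c) = x * poly (map_poly of_int q) x" using eq by (metis add_eq_0_iff2 of_int_minus minus_equation_iff)
      thus ?thesis using False by (intro exI[of _ "- c"] exI[of _ q]) simp
    qed
  qed auto
  obtain q where "poly (map_poly of_int q) x = 0" "lead_coeff q = 1"
    using assms algebraic_int_altdef_ipoly[of x] by (auto simp: ints_def)
  then obtain k r where kr: "k \<noteq> 0" "of_int k = x * poly (map_poly of_int r) x" using *[of q] by force
  let ?y = "of_int (sgn k) * poly (map_poly of_int r) x"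
  have "of_nat (nat \<bar>k\<bar>) = (of_int \<bar>k\<bar> :: 'a)" by simp
  also have "\<dots> = of_int (k * sgn k)" by (simp only: abs_sgn)
  also have "\<dots> = x * ?y" using kr by simp
  finally show ?thesis
    using that[of "nat \<bar>k\<bar>" ?y] kr assms by (auto intro: ints_mult ints_of_int poly_ints)
qed

end

section \<open>Ideals of the ring of integers\<close>

definition diff_rel :: "'a::ab_group_add set \<Rightarrow> 'a \<Rightarrow> 'a \<Rightarrow> bool" where
  "diff_rel I x y \<longleftrightarrow> x - y \<in> I"

context number_field_loc
begin

definition is_ideal :: "'a set \<Rightarrow> bool" where
  "is_ideal I \<longleftrightarrow> I \<subseteq> \<O> \<and> 0 \<in> I \<and> (\<forall>x\<in>I. \<forall>y\<in>I. x + y \<in> I) \<and> (\<forall>r\<in>\<O>. \<forall>x\<in>I. r * x \<in> I)"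

lemma idealD:
  assumes "is_ideal I"
  shows "x \<in> I \<Longrightarrow> x \<in> \<O>" "0 \<in> I" "x \<in> I \<Longrightarrow> y \<in> I \<Longrightarrow> x + y \<in> I"
    "r \<in> \<O> \<Longrightarrow> x \<in> I \<Longrightarrow> r * x \<in> I" "r \<in> \<O> \<Longrightarrow> x \<in> I \<Longrightarrow> x * r \<in> I"
  using assms by (auto simp: is_ideal_def mult.commute)

lemma ideal_minus: "is_ideal I \<Longrightarrow> x \<in> I \<Longrightarrow> - x \<in> I"
  using idealD(4)[of I "-1" x] ints_minus[OF ints_1] by simp

lemma ideal_diff: "is_ideal I \<Longrightarrow> x \<in> I \<Longrightarrow> y \<in> I \<Longrightarrow> x - y \<in> I"
  using idealD(3)[of I x "- y"] ideal_minus by simp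

lemma ideal_diff_commute: "is_ideal I \<Longrightarrow> x - y \<in> I \<longleftrightarrow> y - x \<in> I"
  using ideal_minus[of I "x - y"] ideal_minus[of I "y - x"] by auto

lemma ideal_sum: "is_ideal I \<Longrightarrow> (\<And>i. i \<in> A \<Longrightarrow> f i \<in> I) \<Longrightarrow> sum f A \<in> I"
  by (induction A rule: infinite_finite_induct) (auto intro: idealD)

lemma equivp_diff_rel: "is_ideal I \<Longrightarrow> equivp (diff_rel I)"
proof (intro equivpI reflpI sympI transpI)
  assume I: "is_ideal I"
  show "diff_rel I x x" for x using idealD(2)[OF I] by (simp add: diff_rel_def)
  show "diff_rel I x y \<Longrightarrow> diff_rel I y x" for x y
    using ideal_diff_commute[OF I] by (simp add: diff_rel_def)
  show "diff_rel I x y \<Longrightarrow> diff_rel I y z \<Longrightarrow> diff_rel I x z" for x y z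
    using idealD(3)[OF I, of "x - y" "y - z"] by (simp add: diff_rel_def)
qed

lemma is_ideal_ints: "is_ideal \<O>"
  by (auto simp: is_ideal_def ints_0 ints_add ints_mult)

lemma ideal_eq_ints: "is_ideal I \<Longrightarrow> 1 \<in> I \<Longrightarrow> I = \<O>"
  using idealD(1,4)[of I] by fastforce

lemma is_ideal_add: "is_ideal I \<Longrightarrow> is_ideal J \<Longrightarrow> is_ideal {x + y | x y. x \<in> I \<and> y \<in> J}"
  unfolding is_ideal_def
proof (intro conjI ballI, goal_cases)
  case 1 thus ?case by (auto intro: ints_add)
next
  case 2 thus ?case by force
next
  case (3 x y)
  then obtain a b c d where "a \<in> I" "b \<in> J" "c \<in> I" "d \<in> J" "x = a + b" "y = c + d" by auto
  thus ?case using 3 by (intro CollectI exI[of _ "a + c"] exI[of _ "b + d"]) auto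
next
  case (4 r x)
  then obtain a b where "a \<in> I" "b \<in> J" "x = a + b" by auto
  thus ?case using 4 by (intro CollectI exI[of _ "r * a"] exI[of _ "r * b"]) (auto simp: distrib_left)
qed

lemma is_ideal_principal: "a \<in> \<O> \<Longrightarrow> is_ideal ((*) a ` \<O>)"
  unfolding is_ideal_def
proof (intro conjI ballI, goal_cases)
  case 1 thus ?case by (auto intro: ints_mult)
next
  case 2 thus ?case using ints_0 by force
next
  case (3 x y) thus ?case using ints_add by (auto simp: distrib_left[symmetric])
next
  case (4 r x)
  then obtain y where "y \<in> \<O>" "x = a * y" by auto
  hence "r * x = a * (r * y)" "r * y \<in> \<O>" using 4 ints_mult by auto
  thus ?case by auto
qed

definition ideal_insert :: "'a \<Rightarrow> 'a set \<Rightarrow> 'a set" where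
  "ideal_insert a I = {x + y | x y. x \<in> I \<and> y \<in> (*) a ` \<O>}"

lemma ideal_insert: "is_ideal I \<Longrightarrow> a \<in> \<O> \<Longrightarrow> is_ideal (ideal_insert a I)"
  unfolding ideal_insert_def by (intro is_ideal_add is_ideal_principal)

lemma ideal_insert_iff: "x \<in> ideal_insert a I \<longleftrightarrow> (\<exists>y\<in>I. \<exists>r\<in>\<O>. x = y + a * r)"
  by (auto simp: ideal_insert_def)

lemma subset_ideal_insert: "I \<subseteq> ideal_insert a I"
  using ints_0 by (force simp: ideal_insert_iff)

lemma mem_ideal_insert: "is_ideal I \<Longrightarrow> a \<in> ideal_insert a I"
  using ints_1 idealD(2)[of I] unfolding ideal_insert_iff by (metis add_0 mult.right_neutral)

definition index :: "'a set \<Rightarrow> nat" where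
  "index I = class_count (diff_rel I) \<O>"

abbreviation proper_ideal :: "'a set \<Rightarrow> bool" where
  "proper_ideal I \<equiv> is_ideal I \<and> I \<noteq> {0}"

lemma nonzero_ideal_nat:
  assumes "proper_ideal I"
  obtains n where "n > 0" "of_nat n \<in> I"
proof -
  obtain x where x: "x \<in> I" "x \<noteq> 0" using assms idealD(2) by blast
  then obtain n y where "n > 0" "y \<in> \<O>" "of_nat n = x * y"
    using integer_multiple[of x] assms idealD(1) by metis
  thus ?thesis using that idealD(5)[of I y x] x assms by auto
qed

lemma finite_class_set_nat:
  assumes I: "is_ideal I" and n: "n > 0" "of_nat n \<in> I"
  shows "finite (class_set (diff_rel I) \<O>)"
proof -
  obtain T where T: "finite T" "\<forall>x\<in>\<O>. \<exists>t\<in>T. \<exists>y\<in>\<O>. x - t = of_nat n * y"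
    using residue_system_nat[OF n(1)] by auto
  show ?thesis
  proof (rule class_count_le_card(1)[OF equivp_diff_rel[OF I] T(1)])
    fix x assume "x \<in> \<O>"
    then obtain t y where "t \<in> T" "y \<in> \<O>" "x - t = of_nat n * y" using T(2) by blast
    thus "\<exists>t\<in>T. diff_rel I x t" using idealD(5)[OF I _ n(2), of y] by (intro bexI[of _ t]) (simp_all add: diff_rel_def)
  qed
qed

lemma finite_class_set: "proper_ideal I \<Longrightarrow> finite (class_set (diff_rel I) \<O>)"
  using nonzero_ideal_nat[of I] finite_class_set_nat by metis

lemma index_pos: "proper_ideal I \<Longrightarrow> index I > 0"
  unfolding index_def using finite_class_set ints_0 by (intro class_count_pos) auto

text \<open>Plays the role of the ascending chain condition: inductions over ideals run on the
  index.\<close>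

lemma index_strict_mono:
  assumes "proper_ideal I" "is_ideal J" "I \<subset> J"
  shows "index J < index I"
proof -
  obtain x where "x \<in> J" "x \<notin> I" using assms by blast
  thus ?thesis unfolding index_def
    using assms idealD(1)[of J x]
    by (intro class_count_coarser_strict[of _ _ _ x 0] equivp_diff_rel finite_class_set)
      (auto simp: diff_rel_def ints_0)
qed

text \<open>Pigeonhole principle for the powers of \<open>x\<close> in the finite ring
  \<open>\<O>/I\<close>; all inverses modulo primes and prime powers are obtained from it.\<close>

lemma power_cycle:
  assumes I: "proper_ideal I" and x: "x \<in> \<O>"
  obtains i j where "j < i" "x ^ i - x ^ j \<in> I"
proof -
  have "\<not> inj_on (\<lambda>i. {y. diff_rel I (x ^ i) y}) (UNIV :: nat set)"
  proof
    assume "inj_on (\<lambda>i. {y. diff_rel I (x ^ i) y}) (UNIV :: nat set)"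
    moreover have "(\<lambda>i. {y. diff_rel I (x ^ i) y}) ` UNIV \<subseteq> class_set (diff_rel I) \<O>"
      using x ints_power by (auto simp: class_set_def)
    ultimately show False using finite_class_set[OF I] by (metis finite_imageD finite_subset infinite_UNIV_nat)
  qed
  then obtain i j where "i \<noteq> j" "{y. diff_rel I (x ^ i) y} = {y. diff_rel I (x ^ j) y}"
    by (auto simp: inj_on_def)
  hence "diff_rel I (x ^ i) (x ^ j)" using class_eq_iff[OF equivp_diff_rel] I by metis
  hence *: "x ^ i - x ^ j \<in> I" "x ^ j - x ^ i \<in> I"
    using ideal_diff_commute[of I] I by (auto simp: diff_rel_def)
  show ?thesis
  proof (cases "j < i")
    case True thus ?thesis using that * by blast
  next
    case False
    thus ?thesis using that[of i j] * \<open>i \<noteq> j\<close> by auto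
  qed
qed

text \<open>The powers of \<open>g\<close> have the common denominator \<open>n\<close>, and
  \<open>\<O>\<close> modulo \<open>n\<close> is finite, so two of the numbers \<open>n g^k\<close>
  agree modulo \<open>n \<O>\<close>. Hence \<open>g^i - g^j\<close> is integral for some distinct
  \<open>i\<close>, \<open>j\<close>, and then so is \<open>g\<close>.\<close>

lemma integrally_closed:
  assumes g: "g \<in> K" and n: "n > 0" and gn: "\<And>k. of_nat n * g ^ k \<in> \<O>"
  shows "g \<in> \<O>"
proof -
  let ?I = "(*) (of_nat n) ` \<O>"
  have nI: "of_nat n \<in> ?I" using ints_1 by force
  have I: "is_ideal ?I" by (intro is_ideal_principal ints_of_nat)
  have fin: "finite (class_set (diff_rel ?I) \<O>)" using finite_class_set_nat[OF I n nI] .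
  have "\<not> inj_on (\<lambda>i. {y. diff_rel ?I (of_nat n * g ^ i) y}) (UNIV :: nat set)"
  proof
    assume "inj_on (\<lambda>i. {y. diff_rel ?I (of_nat n * g ^ i) y}) (UNIV :: nat set)"
    moreover have "(\<lambda>i. {y. diff_rel ?I (of_nat n * g ^ i) y}) ` UNIV \<subseteq> class_set (diff_rel ?I) \<O>"
      using gn by (auto simp: class_set_def)
    ultimately show False using fin by (metis finite_imageD finite_subset infinite_UNIV_nat)
  qed
  then obtain i j where ij: "i \<noteq> j" "{y. diff_rel ?I (of_nat n * g ^ i) y} = {y. diff_rel ?I (of_nat n * g ^ j) y}"
    by (auto simp: inj_on_def)
  hence "diff_rel ?I (of_nat n * g ^ i) (of_nat n * g ^ j)" using class_eq_iff[OF equivp_diff_rel[OF I]] by metis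
  then obtain y where y: "y \<in> \<O>" "of_nat n * g ^ i - of_nat n * g ^ j = of_nat n * y"
    by (auto simp: diff_rel_def)
  hence "of_nat n * (g ^ i - g ^ j) = of_nat n * y" by (simp add: algebra_simps)
  hence "g ^ i - g ^ j \<in> \<O>" "g ^ j - g ^ i \<in> \<O>" using n y ints_minus[OF y(1)] by auto
  hence "algebraic_int g" using algebraic_int_power_diff[of g i j] algebraic_int_power_diff[of g j i] ij(1)
    by (cases "j < i") (auto simp: ints_def)
  thus ?thesis using g by (simp add: ints_def)
qed

section \<open>Prime ideals\<close>

definition is_prime :: "'a set \<Rightarrow> bool" where
  "is_prime P \<longleftrightarrow> proper_ideal P \<and> P \<noteq> \<O> \<and> (\<forall>x\<in>\<O>. \<forall>y\<in>\<O>. x * y \<in> P \<longrightarrow> x \<in> P \<or> y \<in> P)"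

lemma primeD:
  assumes "is_prime P"
  shows "is_ideal P" "proper_ideal P" "P \<noteq> \<O>" "1 \<notin> P"
    "x \<in> \<O> \<Longrightarrow> y \<in> \<O> \<Longrightarrow> x * y \<in> P \<Longrightarrow> x \<in> P \<or> y \<in> P"
  using assms ideal_eq_ints by (auto simp: is_prime_def)

lemma prime_power_mem: "is_prime P \<Longrightarrow> x \<in> \<O> \<Longrightarrow> x ^ n \<in> P \<Longrightarrow> x \<in> P"
  by (induction n) (auto dest: primeD(4) primeD(5)[of P x] intro: ints_power)

text \<open>A finite domain is a field: the power cycle puts \<open>x^j\<close> times
  \<open>x^(i-j) - 1\<close> into \<open>P\<close>, and the first factor is outside
  \<open>P\<close>.\<close>

lemma prime_invertible:
  assumes P: "is_prime P" and x: "x \<in> \<O>" "x \<notin> P"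
  obtains y where "y \<in> \<O>" "x * y - 1 \<in> P"
proof -
  obtain i j where ij: "j < i" "x ^ i - x ^ j \<in> P"
    using power_cycle[OF primeD(2)[OF P] x(1)] .
  have "x ^ i - x ^ j = x ^ j * (x ^ (i - j) - 1)"
    using ij(1) by (simp add: algebra_simps flip: power_add)
  hence "x ^ j \<in> P \<or> x ^ (i - j) - 1 \<in> P"
    using ij(2) primeD(5)[OF P, of "x ^ j"] ints_power[OF x(1)] ints_1 ints_diff by metis
  moreover have "x ^ j \<notin> P" using prime_power_mem[OF P x(1)] x(2) by blast
  moreover have "x ^ (i - j) = x * x ^ (i - j - 1)"
    using ij(1) by (metis Suc_diff_1 power_Suc zero_less_diff)
  ultimately show ?thesis using that[of "x ^ (i - j - 1)"] ints_power[OF x(1)] by auto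
qed

lemma prime_maximal:
  assumes P: "is_prime P" and J: "is_ideal J" "P \<subseteq> J" "J \<noteq> \<O>"
  shows "J = P"
proof (rule ccontr)
  assume "J \<noteq> P"
  then obtain x where x: "x \<in> J" "x \<notin> P" using J by blast
  then obtain y where y: "y \<in> \<O>" "x * y - 1 \<in> P"
    using prime_invertible[OF P] idealD(1)[OF J(1)] by metis
  hence "1 \<in> J"
    using J(2) ideal_diff[OF J(1) idealD(5)[OF J(1) y(1) x(1)], of "x * y - 1"] by auto
  thus False using ideal_eq_ints J by blast
qed

lemma ex_prime_superset:
  assumes "proper_ideal I" "I \<noteq> \<O>"
  shows "\<exists>P. is_prime P \<and> I \<subseteq> P"
  using assms
proof (induction "index I" arbitrary: I rule: less_induct)
  case less
  show ?case
  proof (cases "is_prime I")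
    case False
    then obtain x y where xy: "x \<in> \<O>" "y \<in> \<O>" "x * y \<in> I" "x \<notin> I" "y \<notin> I"
      using less.prems by (auto simp: is_prime_def)
    let ?J = "ideal_insert x I"
    have J: "is_ideal ?J" using ideal_insert less.prems xy by auto
    \<comment> \<open>If \<open>1 = a + x r\<close> with \<open>a\<close> in \<open>I\<close>,
      multiplication by \<open>y\<close> puts \<open>y\<close> into \<open>I\<close>, because
      \<open>x y\<close> lies there.\<close>
    have "?J \<noteq> \<O>"
    proof
      assume "?J = \<O>"
      then obtain a r where a: "a \<in> I" "r \<in> \<O>" "1 = a + x * r" using ints_1 ideal_insert_iff by metis
      hence "y = y * (a + x * r)" by simp
      also have "\<dots> = y * a + r * (x * y)" by (simp add: algebra_simps)
      also have "\<dots> \<in> I" using a xy less.prems by (auto intro: idealD)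
      finally show False using xy by simp
    qed
    moreover have "I \<subset> ?J" using subset_ideal_insert mem_ideal_insert xy less.prems by blast
    ultimately show ?thesis
      using less.hyps[of ?J] less.prems J index_strict_mono[of I ?J] idealD(2)[of I] by blast
  qed (use less.prems in auto)
qed

section \<open>Inverting a prime ideal\<close>

text \<open>Products of elements without their sums: these generate the product of the ideals, and
  containment in an ideal can be tested on generators.\<close>

fun mixed_products :: "'a set list \<Rightarrow> 'a set" where
  "mixed_products [] = {1}"
| "mixed_products (P # Ps) = {x * y | x y. x \<in> P \<and> y \<in> mixed_products Ps}"

lemma mixed_products_append:
  "mixed_products (Ps @ Qs) = {x * y | x y. x \<in> mixed_products Ps \<and> y \<in> mixed_products Qs}"
proof (induction Ps)
  case (Cons P Ps)
  show ?case
  proof (intro subset_antisym subsetI)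
    fix z assume "z \<in> mixed_products ((P # Ps) @ Qs)"
    then obtain a b c where "a \<in> P" "b \<in> mixed_products Ps" "c \<in> mixed_products Qs" "z = a * (b * c)"
      using Cons by auto
    thus "z \<in> {x * y | x y. x \<in> mixed_products (P # Ps) \<and> y \<in> mixed_products Qs}"
      by (intro CollectI exI[of _ "a * b"] exI[of _ c]) (auto simp: mult.assoc)
  next
    fix z assume "z \<in> {x * y | x y. x \<in> mixed_products (P # Ps) \<and> y \<in> mixed_products Qs}"
    then obtain a b c where "a \<in> P" "b \<in> mixed_products Ps" "c \<in> mixed_products Qs" "z = (a * b) * c"
      by auto
    thus "z \<in> mixed_products ((P # Ps) @ Qs)"
      using Cons by (simp, intro exI[of _ a] exI[of _ "b * c"]) (auto simp: mult.assoc)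
  qed
qed auto

lemma mixed_products_ints: "(\<And>P. P \<in> set Ps \<Longrightarrow> is_prime P) \<Longrightarrow> mixed_products Ps \<subseteq> \<O>"
  by (induction Ps) (auto intro!: ints_1 ints_mult dest: primeD(1) idealD(1))

text \<open>Induction on the index. If \<open>x y\<close> lies in \<open>I\<close> but neither
  factor does, the two larger ideals generated by \<open>I\<close> with \<open>x\<close> and by
  \<open>I\<close> with \<open>y\<close> have their product inside \<open>I\<close>.\<close>

lemma ideal_contains_mixed_products:
  assumes "proper_ideal I"
  shows "\<exists>Ps. (\<forall>P\<in>set Ps. is_prime P) \<and> mixed_products Ps \<subseteq> I"
  using assms
proof (induction "index I" arbitrary: I rule: less_induct)
  case less
  consider "I = \<O>" | "is_prime I" | "I \<noteq> \<O>" "\<not> is_prime I" by blast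
  thus ?case
  proof cases
    case 1
    thus ?thesis by (intro exI[of _ "[]"]) (auto simp: ints_1)
  next
    case 2
    thus ?thesis by (intro exI[of _ "[I]"]) auto
  next
    case 3
    then obtain x y where xy: "x \<in> \<O>" "y \<in> \<O>" "x * y \<in> I" "x \<notin> I" "y \<notin> I"
      using less.prems by (auto simp: is_prime_def)
    have J: "\<exists>Ps. (\<forall>P\<in>set Ps. is_prime P) \<and> mixed_products Ps \<subseteq> ideal_insert z I" if "z \<in> \<O>" "z \<notin> I" for z
    proof -
      let ?J = "ideal_insert z I"
      have "is_ideal ?J" using ideal_insert less.prems that by auto
      moreover have "I \<subset> ?J" using subset_ideal_insert mem_ideal_insert that less.prems by blast
      ultimately show ?thesis using less.hyps[of ?J] less.prems index_strict_mono[of I ?J] idealD(2)[of I] by blast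
    qed
    obtain Ps Qs where Ps: "\<forall>P\<in>set Ps. is_prime P" "mixed_products Ps \<subseteq> ideal_insert x I"
      and Qs: "\<forall>P\<in>set Qs. is_prime P" "mixed_products Qs \<subseteq> ideal_insert y I"
      using J xy by meson
    show ?thesis
    proof (intro exI[of _ "Ps @ Qs"] conjI subsetI)
      fix z assume "z \<in> mixed_products (Ps @ Qs)"
      then obtain u v where uv: "u \<in> ideal_insert x I" "v \<in> ideal_insert y I" "z = u * v"
        using Ps(2) Qs(2) unfolding mixed_products_append by blast
      then obtain a r b s where ab: "a \<in> I" "r \<in> \<O>" "u = a + x * r" "b \<in> I" "s \<in> \<O>" "v = b + y * s"
        by (auto simp: ideal_insert_iff)
      have "z = (b + y * s) * a + (x * r) * b + (r * s) * (x * y)"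
        unfolding uv ab by (simp add: algebra_simps)
      also have I: "is_ideal I" using less.prems by blast
      have "(b + y * s) * a + (x * r) * b + (r * s) * (x * y) \<in> I"
        by (intro idealD(3,4)[OF I] ab xy ints_add ints_mult idealD(1)[OF I])
      finally show "z \<in> I" .
    qed (use Ps Qs in auto)
  qed
qed

text \<open>A prime factor contained in \<open>P\<close> equals \<open>P\<close> by maximality. If
  no factor is contained in \<open>P\<close>, elements of the factors outside \<open>P\<close> have
  a product outside \<open>P\<close>.\<close>

lemma prime_contains_mixed_products:
  assumes P: "is_prime P" and Ps: "\<forall>Q\<in>set Ps. is_prime Q" "mixed_products Ps \<subseteq> P"
  shows "P \<in> set Ps"
  using Ps
proof (induction Ps)
  case Nil
  thus ?case using primeD(4)[OF P] by simp
next
  case (Cons Q Ps)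
  show ?case
  proof (cases "Q \<subseteq> P")
    case True
    hence "P = Q" using prime_maximal[of Q P] Cons.prems P primeD by auto
    thus ?thesis by simp
  next
    case False
    then obtain q where q: "q \<in> Q" "q \<notin> P" by blast
    have "y \<in> P" if "y \<in> mixed_products Ps" for y
    proof -
      have "q * y \<in> mixed_products (Q # Ps)" using q that by auto
      hence "q * y \<in> P" using Cons.prems by blast
      moreover have "q \<in> \<O>" "y \<in> \<O>"
        using q that Cons.prems mixed_products_ints[of Ps] primeD(1)[of Q] idealD(1)[of Q] by auto
      ultimately show ?thesis using primeD(5)[OF P] q by blast
    qed
    thus ?thesis using Cons by auto
  qed
qed

text \<open>Take a nonzero \<open>a\<close> in \<open>P\<close> and a shortest list of primes whose
  product lies in \<open>(a)\<close>. The prime \<open>P\<close> occurs in it, and without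
  \<open>P\<close> the product is no longer inside \<open>(a)\<close>, so it has an element
  \<open>b\<close> outside \<open>(a)\<close>, while \<open>b P\<close> is inside. The multiplier is
  \<open>b / a\<close>.\<close>

lemma ex_prime_multiplier:
  assumes P: "is_prime P"
  shows "\<exists>g\<in>K. g \<notin> \<O> \<and> (\<forall>x\<in>P. g * x \<in> \<O>)"
proof -
  obtain a where a: "a \<in> P" "a \<noteq> 0" using primeD(2)[OF P] idealD(2) by blast
  hence aO: "a \<in> \<O>" using primeD(1)[OF P] idealD(1) by blast
  let ?A = "(*) a ` \<O>"
  have A: "is_ideal ?A" using is_ideal_principal[OF aO] .
  have "a \<in> ?A" using ints_1 by force
  hence "proper_ideal ?A" using A a by auto
  then have "\<exists>n. \<exists>Ps. length Ps = n \<and> (\<forall>P\<in>set Ps. is_prime P) \<and> mixed_products Ps \<subseteq> ?A"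
    using ideal_contains_mixed_products by blast
  then obtain n where n: "\<exists>Ps. length Ps = n \<and> (\<forall>P\<in>set Ps. is_prime P) \<and> mixed_products Ps \<subseteq> ?A"
    and min: "\<And>m. m < n \<Longrightarrow> \<not> (\<exists>Ps. length Ps = m \<and> (\<forall>P\<in>set Ps. is_prime P) \<and> mixed_products Ps \<subseteq> ?A)"
    using exists_least_iff[of "\<lambda>n. \<exists>Ps. length Ps = n \<and> (\<forall>P\<in>set Ps. is_prime P) \<and> mixed_products Ps \<subseteq> ?A"] by blast
  obtain Ps where Ps: "length Ps = n" "\<forall>P\<in>set Ps. is_prime P" "mixed_products Ps \<subseteq> ?A" using n by blast
  have "?A \<subseteq> P" using a primeD(1)[OF P] by (auto intro: idealD(5))
  hence "P \<in> set Ps" using prime_contains_mixed_products[OF P Ps(2)] Ps(3) by blast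
  then obtain Qs Rs where split: "Ps = Qs @ P # Rs" by (meson split_list)
  have "\<not> mixed_products (Qs @ Rs) \<subseteq> ?A"
  proof
    assume "mixed_products (Qs @ Rs) \<subseteq> ?A"
    moreover have "\<forall>P\<in>set (Qs @ Rs). is_prime P" "length (Qs @ Rs) < n" using Ps split by auto
    ultimately show False using min[of "length (Qs @ Rs)"] by blast
  qed
  then obtain b where b: "b \<in> mixed_products (Qs @ Rs)" "b \<notin> ?A" by blast
  have "mixed_products (Qs @ Rs) \<subseteq> \<O>" using mixed_products_ints[of "Qs @ Rs"] Ps(2) split by auto
  hence bO: "b \<in> \<O>" using b by blast
  have bP: "b * x \<in> ?A" if x: "x \<in> P" for x
  proof -
    obtain u v where "u \<in> mixed_products Qs" "v \<in> mixed_products Rs" "b = u * v"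
      using b by (auto simp: mixed_products_append)
    moreover from this have "x * v \<in> mixed_products (P # Rs)" using x by auto
    ultimately have "b * x \<in> mixed_products Ps"
      unfolding split mixed_products_append
      by (intro CollectI exI[of _ u] exI[of _ "x * v"]) (simp add: mult_ac)
    thus ?thesis using Ps by blast
  qed
  show ?thesis
  proof (intro bexI[of _ "b / a"] conjI ballI)
    show "b / a \<in> K" using K_divide ints_subset_K aO bO by blast
    show "b / a \<notin> \<O>"
    proof
      assume "b / a \<in> \<O>"
      hence "a * (b / a) \<in> ?A" by blast
      thus False using a b by simp
    qed
    fix x assume "x \<in> P"
    then obtain y where "y \<in> \<O>" "b * x = a * y" using bP by auto
    thus "b / a * x \<in> \<O>" using a by (simp add: field_simps)
  qed
qed

section \<open>Prime powers\<close>

definition multiplier :: "'a set \<Rightarrow> 'a" where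
  "multiplier P = (SOME g. g \<in> K \<and> g \<notin> \<O> \<and> (\<forall>x\<in>P. g * x \<in> \<O>))"

lemma multiplier:
  assumes "is_prime P"
  shows "multiplier P \<in> K" "multiplier P \<notin> \<O>" "x \<in> P \<Longrightarrow> multiplier P * x \<in> \<O>"
proof -
  have "\<exists>g. g \<in> K \<and> g \<notin> \<O> \<and> (\<forall>x\<in>P. g * x \<in> \<O>)"
    using ex_prime_multiplier[OF assms] by blast
  hence "multiplier P \<in> K \<and> multiplier P \<notin> \<O> \<and> (\<forall>x\<in>P. multiplier P * x \<in> \<O>)"
    unfolding multiplier_def by (rule someI_ex)
  thus "multiplier P \<in> K" "multiplier P \<notin> \<O>" "x \<in> P \<Longrightarrow> multiplier P * x \<in> \<O>" by auto
qed

text \<open>If \<open>g I\<close> were contained in \<open>I\<close>, a positive integer in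
  \<open>I\<close> would be a common denominator of all powers of \<open>g\<close>, and integral
  closedness would put \<open>g\<close> into \<open>\<O>\<close>.\<close>

lemma multiplier_not_stable:
  assumes P: "is_prime P" and I: "proper_ideal I"
  obtains x where "x \<in> I" "multiplier P * x \<notin> I"
proof (rule ccontr)
  assume "\<not> thesis"
  hence *: "multiplier P * x \<in> I" if "x \<in> I" for x using that \<open>\<And>x. x \<in> I \<Longrightarrow> multiplier P * x \<notin> I \<Longrightarrow> thesis\<close> by blast
  obtain n where n: "n > 0" "of_nat n \<in> I" using nonzero_ideal_nat[OF I] .
  have "of_nat n * multiplier P ^ k \<in> I" for k
  proof (induction k)
    case (Suc k)
    thus ?case using *[of "of_nat n * multiplier P ^ k"] by (simp add: mult_ac)
  qed (use n in simp)
  hence "multiplier P \<in> \<O>"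
    using I n idealD(1)[of I] by (intro integrally_closed[OF multiplier(1)[OF P] n(1)]) auto
  thus False using multiplier[OF P] by blast
qed

text \<open>An element of \<open>P\<close> outside the square of \<open>P\<close>, hence a local
  generator of \<open>P\<close>. Its product with the multiplier is integral and outside
  \<open>P\<close>, so the two are mutually inverse up to a unit at \<open>P\<close>.\<close>

definition uniformizer :: "'a set \<Rightarrow> 'a" where
  "uniformizer P = (SOME x. x \<in> P \<and> multiplier P * x \<notin> P)"

lemma uniformizer:
  assumes "is_prime P"
  shows "uniformizer P \<in> P" "multiplier P * uniformizer P \<notin> P" "uniformizer P \<in> \<O>"
    "multiplier P * uniformizer P \<in> \<O>"
proof -
  have "\<exists>x. x \<in> P \<and> multiplier P * x \<notin> P"
    using multiplier_not_stable[OF assms primeD(2)[OF assms]] by metis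
  hence *: "uniformizer P \<in> P \<and> multiplier P * uniformizer P \<notin> P"
    unfolding uniformizer_def by (rule someI_ex)
  thus "uniformizer P \<in> P" "multiplier P * uniformizer P \<notin> P" "uniformizer P \<in> \<O>"
    "multiplier P * uniformizer P \<in> \<O>"
    using primeD(1)[OF assms] idealD(1) multiplier(3)[OF assms] by auto
qed

text \<open>Writing \<open>g\<close> for the multiplier, \<open>\<O> + g\<O>\<close> is the inverse of \<open>P\<close>, so this is \<open>P\<^sup>k\<close>.\<close>

definition prime_pow :: "'a set \<Rightarrow> nat \<Rightarrow> 'a set" where
  "prime_pow P k = {x. \<forall>i\<le>k. multiplier P ^ i * x \<in> \<O>}"

lemma prime_pow_0 [simp]: "prime_pow P 0 = \<O>"
  by (simp add: prime_pow_def)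

lemma prime_pow_Suc_iff: "x \<in> prime_pow P (Suc k) \<longleftrightarrow> x \<in> \<O> \<and> multiplier P * x \<in> prime_pow P k"
proof
  assume *: "x \<in> prime_pow P (Suc k)"
  have "multiplier P ^ i * (multiplier P * x) \<in> \<O>" if "i \<le> k" for i
    using * that unfolding prime_pow_def by (auto dest: spec[of _ "Suc i"] simp: mult_ac)
  moreover have "x \<in> \<O>" using * by (auto simp: prime_pow_def dest: spec[of _ 0])
  ultimately show "x \<in> \<O> \<and> multiplier P * x \<in> prime_pow P k" by (auto simp: prime_pow_def)
next
  assume *: "x \<in> \<O> \<and> multiplier P * x \<in> prime_pow P k"
  show "x \<in> prime_pow P (Suc k)"
    unfolding prime_pow_def
  proof (intro CollectI allI impI)
    fix i assume "i \<le> Suc k"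
    thus "multiplier P ^ i * x \<in> \<O>"
      using * by (cases i) (auto simp: prime_pow_def mult_ac)
  qed
qed

lemma prime_pow_antimono: "j \<le> k \<Longrightarrow> prime_pow P k \<subseteq> prime_pow P j"
  by (auto simp: prime_pow_def)

lemma is_ideal_prime_pow: "is_ideal (prime_pow P k)"
  unfolding is_ideal_def
proof (intro conjI ballI)
  show "prime_pow P k \<subseteq> \<O>" using prime_pow_antimono[of 0 k] by simp
  show "0 \<in> prime_pow P k" by (simp add: prime_pow_def ints_0)
  show "x + y \<in> prime_pow P k" if "x \<in> prime_pow P k" "y \<in> prime_pow P k" for x y
    using that by (auto simp: prime_pow_def distrib_left intro: ints_add)
  show "r * x \<in> prime_pow P k" if "r \<in> \<O>" "x \<in> prime_pow P k" for r x
    using that by (auto simp: prime_pow_def mult.left_commute intro: ints_mult)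
qed

lemmas prime_pow_ideal = idealD[OF is_ideal_prime_pow]

lemma prime_pow_1:
  assumes P: "is_prime P"
  shows "prime_pow P (Suc 0) = P"
proof (rule prime_maximal[OF P is_ideal_prime_pow])
  show "P \<subseteq> prime_pow P (Suc 0)"
    using multiplier(3)[OF P] primeD(1)[OF P] idealD(1) by (auto simp: prime_pow_Suc_iff)
  have "1 \<notin> prime_pow P (Suc 0)" using multiplier(2)[OF P] by (simp add: prime_pow_Suc_iff)
  thus "prime_pow P (Suc 0) \<noteq> \<O>" using ints_1 by blast
qed

lemma prime_pow_Suc_subset: "is_prime P \<Longrightarrow> prime_pow P (Suc k) \<subseteq> P"
  using prime_pow_antimono[of "Suc 0" "Suc k" P] prime_pow_1 by simp

lemma power_mem_prime_pow:
  assumes P: "is_prime P" and x: "x \<in> P"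
  shows "x ^ k \<in> prime_pow P k"
proof (induction k)
  case (Suc k)
  have "multiplier P * x ^ Suc k = (multiplier P * x) * x ^ k" by simp
  also have "\<dots> \<in> prime_pow P k" using Suc multiplier(3)[OF P x] by (rule prime_pow_ideal(4)[rotated])
  finally show ?case
    using ints_power[of x "Suc k"] x primeD(1)[OF P] idealD(1) by (auto simp: prime_pow_Suc_iff)
qed (auto simp: ints_1)

lemma proper_prime_pow: "is_prime P \<Longrightarrow> proper_ideal (prime_pow P k)"
proof -
  assume P: "is_prime P"
  obtain x where "x \<in> P" "x \<noteq> 0" using primeD(2)[OF P] idealD(2) by blast
  hence "x ^ k \<in> prime_pow P k" "x ^ k \<noteq> 0" using power_mem_prime_pow[OF P] by auto
  thus ?thesis using is_ideal_prime_pow by blast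
qed

text \<open>\<open>P^k\<close> is \<open>P\<close>-primary. In the induction \<open>z\<close> lies
  in the prime \<open>P\<close>, so \<open>g z\<close> is integral, and the induction hypothesis
  applies to \<open>g z\<close>.\<close>

lemma prime_pow_primary:
  assumes P: "is_prime P" and t: "t \<in> \<O>" "t \<notin> P"
  shows "z \<in> \<O> \<Longrightarrow> t * z \<in> prime_pow P k \<Longrightarrow> z \<in> prime_pow P k"
proof (induction k arbitrary: z)
  case (Suc k)
  have "z \<in> P" using primeD(5)[OF P t(1)] Suc.prems prime_pow_Suc_subset[OF P] t(2) by blast
  hence "multiplier P * z \<in> \<O>" using multiplier(3)[OF P] by blast
  moreover have "t * (multiplier P * z) \<in> prime_pow P k"
    using Suc.prems(2) by (simp add: prime_pow_Suc_iff mult_ac)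
  ultimately show ?case using Suc by (simp add: prime_pow_Suc_iff)
qed simp

text \<open>Multiplying by \<open>g\<close> replaces the uniformizer by its product with
  \<open>g\<close>, which lies outside \<open>P\<close> and can be cancelled modulo
  \<open>P^k\<close>.\<close>

lemma uniformizer_mult_iff:
  assumes P: "is_prime P" and x: "x \<in> \<O>"
  shows "uniformizer P * x \<in> prime_pow P (Suc k) \<longleftrightarrow> x \<in> prime_pow P k"
proof -
  have "uniformizer P * x \<in> prime_pow P (Suc k) \<longleftrightarrow>
      (multiplier P * uniformizer P) * x \<in> prime_pow P k"
    using uniformizer[OF P] x ints_mult by (simp add: prime_pow_Suc_iff mult_ac)
  also have "\<dots> \<longleftrightarrow> x \<in> prime_pow P k"
    using prime_pow_primary[OF P uniformizer(4,2)[OF P] x] prime_pow_ideal(4)[OF uniformizer(4)[OF P]]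
    by blast
  finally show ?thesis .
qed

lemma uniformizer_power_iff:
  assumes P: "is_prime P" and x: "x \<in> \<O>"
  shows "uniformizer P ^ k * x \<in> prime_pow P (k + j) \<longleftrightarrow> x \<in> prime_pow P j"
proof (induction k)
  case (Suc k)
  have "uniformizer P ^ Suc k * x = uniformizer P * (uniformizer P ^ k * x)" by simp
  thus ?case using Suc uniformizer_mult_iff[OF P, of "uniformizer P ^ k * x" "k + j"]
      ints_mult[OF ints_power[OF uniformizer(3)[OF P]] x] by (simp add: mult.assoc)
qed simp

lemma uniformizer_power_mem:
  assumes "is_prime P"
  shows "uniformizer P ^ k \<in> prime_pow P k" "uniformizer P ^ k \<notin> prime_pow P (Suc k)"
  using uniformizer_power_iff[OF assms ints_1, of k 0] uniformizer_power_iff[OF assms ints_1, of k "Suc 0"]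
    prime_pow_1[OF assms] primeD(4)[OF assms] by (auto simp: ints_1)

lemma invertible_mod_prime_pow:
  assumes P: "is_prime P" and x: "x \<in> \<O>" "x \<notin> P"
  obtains y where "y \<in> \<O>" "x * y - 1 \<in> prime_pow P k"
proof -
  obtain i j where ij: "j < i" "x ^ i - x ^ j \<in> prime_pow P k"
    using power_cycle[OF proper_prime_pow[OF P] x(1)] .
  have "x ^ i - x ^ j = x ^ j * (x ^ (i - j) - 1)"
    using ij(1) by (simp add: algebra_simps flip: power_add)
  hence "x ^ (i - j) - 1 \<in> prime_pow P k"
    using ij(2) prime_pow_primary[OF P, of "x ^ j" "x ^ (i - j) - 1"] ints_power[OF x(1)] ints_1 ints_diff
      prime_power_mem[OF P x(1)] x(2) by metis
  moreover have "x ^ (i - j) = x * x ^ (i - j - 1)"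
    using ij(1) by (metis Suc_diff_1 power_Suc zero_less_diff)
  ultimately show ?thesis using that[of "x ^ (i - j - 1)"] ints_power[OF x(1)] by auto
qed

text \<open>Local principality of \<open>P\<close>. If \<open>u\<close> inverts the product of
  \<open>g\<close> and the uniformizer modulo \<open>P^k\<close>, then the quotient of
  \<open>x\<close> by the uniformizer is \<open>g x u\<close>.\<close>

lemma uniformizer_divides:
  assumes P: "is_prime P" and x: "x \<in> P"
  obtains y where "y \<in> \<O>" "x - uniformizer P * y \<in> prime_pow P k"
proof -
  let ?t = "multiplier P * uniformizer P"
  obtain u where u: "u \<in> \<O>" "?t * u - 1 \<in> prime_pow P k"
    using invertible_mod_prime_pow[OF P uniformizer(4,2)[OF P]] .
  have gx: "multiplier P * x \<in> \<O>" using multiplier(3)[OF P x] .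
  have "x \<in> \<O>" using x primeD(1)[OF P] idealD(1) by blast
  hence "- x * (?t * u - 1) \<in> prime_pow P k" using u ints_minus by (intro prime_pow_ideal(4))
  also have "- x * (?t * u - 1) = x - uniformizer P * (multiplier P * x * u)" by (simp add: algebra_simps)
  finally show ?thesis using that[of "multiplier P * x * u"] ints_mult[OF gx u(1)] by simp
qed

text \<open>The representative depends on the class only, so that the digit map in
  \<open>index_prime_pow\<close> respects congruences.\<close>

lemma prime_representatives:
  assumes P: "is_prime P"
  obtains \<rho> where "\<And>x. x \<in> \<O> \<Longrightarrow> \<rho> x \<in> \<O>" "\<And>x. x \<in> \<O> \<Longrightarrow> x - \<rho> x \<in> P"
    "\<And>x y. x \<in> \<O> \<Longrightarrow> y \<in> \<O> \<Longrightarrow> x - y \<in> P \<Longrightarrow> \<rho> x = \<rho> y"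
proof
  define \<rho> where "\<rho> = (\<lambda>x. SOME y. y \<in> \<O> \<and> diff_rel P x y)"
  show "\<rho> x \<in> \<O>" "x - \<rho> x \<in> P" if x: "x \<in> \<O>" for x
  proof -
    have "x \<in> \<O> \<and> diff_rel P x x" using x idealD(2)[OF primeD(1)[OF P]] by (simp add: diff_rel_def)
    hence "\<rho> x \<in> \<O> \<and> diff_rel P x (\<rho> x)" unfolding \<rho>_def by (rule someI)
    thus "\<rho> x \<in> \<O>" "x - \<rho> x \<in> P" by (auto simp: diff_rel_def)
  qed
  fix x y assume "x - y \<in> P"
  hence "diff_rel P x = diff_rel P y"
    using equivp_diff_rel[OF primeD(1)[OF P]] by (simp add: equivp_def diff_rel_def)
  thus "\<rho> x = \<rho> y" by (simp add: \<rho>_def)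
qed

text \<open>Digit expansion: \<open>\<rho> r\<close> plus the uniformizer times \<open>y\<close>
  runs through the residues modulo \<open>P^(k+1)\<close>, each once, as \<open>r\<close> runs
  modulo \<open>P\<close> and \<open>y\<close> modulo \<open>P^k\<close>.\<close>

lemma index_prime_pow:
  assumes P: "is_prime P"
  shows "index (prime_pow P k) = index P ^ k"
proof (induction k)
  case 0
  have "class_set (diff_rel \<O>) \<O> = {\<O>}"
    unfolding class_set_def
  proof (intro subset_antisym subsetI)
    fix c assume "c \<in> (\<lambda>x. {y. diff_rel \<O> x y}) ` \<O>"
    then obtain x where x: "x \<in> \<O>" "c = {y. diff_rel \<O> x y}" by auto
    have "x - y \<in> \<O> \<longleftrightarrow> y \<in> \<O>" for y using x(1) ints_diff[of x y] ints_diff[of x "x - y"] by auto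
    thus "c \<in> {\<O>}" using x by (auto simp: diff_rel_def)
  next
    fix c assume "c \<in> {\<O>}"
    moreover have "{y. diff_rel \<O> 0 y} = \<O>" using ints_minus by (force simp: diff_rel_def)
    ultimately show "c \<in> (\<lambda>x. {y. diff_rel \<O> x y}) ` \<O>" using ints_0 by (intro image_eqI[of _ _ 0]) auto
  qed
  thus ?case by (simp add: index_def class_count_def)
next
  case (Suc k)
  obtain \<rho> where \<rho>: "\<And>x. x \<in> \<O> \<Longrightarrow> \<rho> x \<in> \<O>" "\<And>x. x \<in> \<O> \<Longrightarrow> x - \<rho> x \<in> P"
    "\<And>x y. x \<in> \<O> \<Longrightarrow> y \<in> \<O> \<Longrightarrow> x - y \<in> P \<Longrightarrow> \<rho> x = \<rho> y"
    using prime_representatives[OF P] by blast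
  let ?p = "uniformizer P"
  note pP = uniformizer(1)[OF P] and pO = uniformizer(3)[OF P] and IP = primeD(1)[OF P]
  have "index P * index (prime_pow P k) =
      class_count (pair_rel (diff_rel P) (diff_rel (prime_pow P k))) (\<O> \<times> \<O>)"
    unfolding index_def
    by (intro class_count_times(1)[symmetric] equivp_diff_rel IP is_ideal_prime_pow finite_class_set
        primeD(2)[OF P] proper_prime_pow[OF P])
  also have "\<dots> = class_count (diff_rel (prime_pow P (Suc k))) \<O>"
  proof (rule class_count_bij[where f = "\<lambda>(r, y). \<rho> r + ?p * y"])
    show "equivp (pair_rel (diff_rel P) (diff_rel (prime_pow P k)))" "equivp (diff_rel (prime_pow P (Suc k)))"
      by (intro equivp_pair_rel equivp_diff_rel IP is_ideal_prime_pow)+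
    show "(\<lambda>(r, y). \<rho> r + ?p * y) z \<in> \<O>" if "z \<in> \<O> \<times> \<O>" for z
      using that by (auto intro!: ints_add ints_mult \<rho> pO)
    show "diff_rel (prime_pow P (Suc k)) ((\<lambda>(r, y). \<rho> r + ?p * y) z) ((\<lambda>(r, y). \<rho> r + ?p * y) z')
        \<longleftrightarrow> pair_rel (diff_rel P) (diff_rel (prime_pow P k)) z z'"
      if "z \<in> \<O> \<times> \<O>" "z' \<in> \<O> \<times> \<O>" for z z'
    proof -
      obtain r y r' y' where z: "z = (r, y)" "z' = (r', y')" and O: "r \<in> \<O>" "y \<in> \<O>" "r' \<in> \<O>" "y' \<in> \<O>"
        using \<open>z \<in> _\<close> \<open>z' \<in> _\<close> by (cases z, cases z') auto
      have "r - r' \<in> P" if *: "\<rho> r + ?p * y - (\<rho> r' + ?p * y') \<in> P"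
      proof -
        have "?p * (y' - y) \<in> P" using pP O by (intro idealD(5)[OF IP] ints_diff)
        from idealD(3)[OF IP * this] have "\<rho> r - \<rho> r' \<in> P" by (simp add: algebra_simps)
        from idealD(3)[OF IP ideal_diff[OF IP \<rho>(2)[OF O(1)] \<rho>(2)[OF O(3)]] this]
        show ?thesis by (simp add: algebra_simps)
      qed
      moreover have "?p * y - ?p * y' \<in> prime_pow P (Suc k) \<longleftrightarrow> y - y' \<in> prime_pow P k"
        using uniformizer_mult_iff[OF P ints_diff[OF O(2,4)]] by (simp add: right_diff_distrib)
      moreover have "\<rho> r = \<rho> r'" if "r - r' \<in> P" using \<rho>(3) O that by blast
      ultimately show ?thesis using prime_pow_Suc_subset[OF P, of k] unfolding z
        by (auto simp: diff_rel_def)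
    qed
    show "\<exists>z\<in>\<O> \<times> \<O>. diff_rel (prime_pow P (Suc k)) ((\<lambda>(r, y). \<rho> r + ?p * y) z) v" if v: "v \<in> \<O>" for v
    proof -
      obtain y where y: "y \<in> \<O>" "v - \<rho> v - ?p * y \<in> prime_pow P (Suc k)"
        using uniformizer_divides[OF P \<rho>(2)[OF v]] .
      hence "\<rho> v + ?p * y - v \<in> prime_pow P (Suc k)"
        using ideal_minus[OF is_ideal_prime_pow y(2)] by (simp add: algebra_simps)
      thus ?thesis using v y by (intro bexI[of _ "(v, y)"]) (auto simp: diff_rel_def)
    qed
  qed
  finally show ?case using Suc by (simp add: index_def)
qed

section \<open>Factorization of ideals\<close>

text \<open>The product of the powers of distinct primes, in the form of their intersection.\<close>

definition ideal_of :: "'a set set \<Rightarrow> ('a set \<Rightarrow> nat) \<Rightarrow> 'a set" where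
  "ideal_of A e = {x \<in> \<O>. \<forall>P\<in>A. x \<in> prime_pow P (e P)}"

lemma is_ideal_ideal_of: "is_ideal (ideal_of A e)"
  unfolding is_ideal_def ideal_of_def
  by (auto intro: ints_0 ints_add ints_mult prime_pow_ideal)

lemma ideal_of_insert: "ideal_of (insert P A) e = prime_pow P (e P) \<inter> ideal_of A e"
  by (auto simp: ideal_of_def)

lemma ideal_of_empty [simp]: "ideal_of {} e = \<O>"
  by (simp add: ideal_of_def)

lemma ideal_of_cong: "(\<And>P. P \<in> A \<Longrightarrow> e P = e' P) \<Longrightarrow> ideal_of A e = ideal_of A e'"
  by (auto simp: ideal_of_def)

lemma ideal_of_extend:
  "A \<subseteq> B \<Longrightarrow> ideal_of B (\<lambda>P. if P \<in> A then e P else 0) = ideal_of A e"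
  by (auto simp: ideal_of_def split: if_splits)

text \<open>Each other prime \<open>Q\<close> has an element outside \<open>P\<close>; the product
  of suitable powers of these elements stays outside \<open>P\<close>.\<close>

lemma coprime_element:
  assumes P: "is_prime P" and A: "finite A" "\<And>Q. Q \<in> A \<Longrightarrow> is_prime Q" "P \<notin> A"
  obtains t where "t \<in> ideal_of A e" "t \<notin> P"
proof -
  have "\<exists>t. t \<in> Q \<and> t \<notin> P" if "Q \<in> A" for Q
    using prime_maximal[of Q P] A that primeD[OF P] by blast
  then obtain t where t: "\<And>Q. Q \<in> A \<Longrightarrow> t Q \<in> Q \<and> t Q \<notin> P" by metis
  have tO: "t Q \<in> \<O>" if "Q \<in> A" for Q using t that A primeD(1) idealD(1) by blast
  have "(\<Prod>Q\<in>B. t Q ^ e Q) \<in> ideal_of B e \<and> (\<Prod>Q\<in>B. t Q ^ e Q) \<notin> P" if "B \<subseteq> A" for B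
    using finite_subset[OF that A(1)] that
  proof (induction B rule: finite_induct)
    case empty
    thus ?case using primeD(4)[OF P] by (simp add: ints_1)
  next
    case (insert Q B)
    hence 1: "t Q ^ e Q \<in> prime_pow Q (e Q)" using power_mem_prime_pow t A by blast
    have 2: "t Q ^ e Q \<in> \<O>" using tO insert.prems by (auto intro: ints_power)
    have 3: "(\<Prod>Q\<in>B. t Q ^ e Q) \<in> \<O>" using insert by (auto simp: ideal_of_def)
    have "t Q ^ e Q \<notin> P" using prime_power_mem[OF P, of "t Q"] t tO insert.prems by blast
    hence "t Q ^ e Q * (\<Prod>Q\<in>B. t Q ^ e Q) \<notin> P" using primeD(5)[OF P 2 3] insert by blast
    moreover have "t Q ^ e Q * (\<Prod>Q\<in>B. t Q ^ e Q) \<in> prime_pow Q (e Q)"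
      using 1 3 by (rule prime_pow_ideal(5)[rotated])
    moreover have "t Q ^ e Q * (\<Prod>Q\<in>B. t Q ^ e Q) \<in> ideal_of B e"
      using 2 insert by (intro idealD(4)[OF is_ideal_ideal_of]) auto
    ultimately show ?case using insert.hyps by (simp add: ideal_of_insert)
  qed
  thus ?thesis using that by blast
qed

lemma comaximal_elements:
  assumes P: "is_prime P" and A: "finite A" "\<And>Q. Q \<in> A \<Longrightarrow> is_prime Q" "P \<notin> A"
  obtains a b where "a \<in> prime_pow P k" "b \<in> ideal_of A e" "a + b = 1"
proof -
  obtain t where t: "t \<in> ideal_of A e" "t \<notin> P" using coprime_element[OF assms] by blast
  hence tO: "t \<in> \<O>" by (simp add: ideal_of_def)
  obtain u where u: "u \<in> \<O>" "t * u - 1 \<in> prime_pow P k"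
    using invertible_mod_prime_pow[OF P tO t(2)] .
  thus ?thesis using that[of "- (t * u - 1)" "t * u"] idealD(5)[OF is_ideal_ideal_of u(1) t(1)]
      ideal_minus[OF is_ideal_prime_pow u(2)] by simp
qed

lemma proper_ideal_of:
  assumes A: "finite A" "\<And>Q. Q \<in> A \<Longrightarrow> is_prime Q"
  shows "proper_ideal (ideal_of A e)"
  using A
proof (induction A rule: finite_induct)
  case empty
  have "\<O> \<noteq> {0}" using ints_1 by (metis singletonD zero_neq_one)
  thus ?case using is_ideal_ints by simp
next
  case (insert P A)
  obtain m where m: "m > 0" "of_nat m \<in> prime_pow P (e P)"
    using nonzero_ideal_nat[OF proper_prime_pow[of P "e P"]] insert.prems by blast
  obtain n where n: "n > 0" "of_nat n \<in> ideal_of A e"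
    using nonzero_ideal_nat[OF insert.IH] insert.prems by blast
  define x y :: 'a where "x = of_nat m" and "y = of_nat n"
  have xy: "x \<in> prime_pow P (e P)" "x \<noteq> 0" "y \<in> ideal_of A e" "y \<noteq> 0"
    using m n by (simp_all add: x_def y_def)
  hence "x * y \<in> ideal_of (insert P A) e"
    unfolding ideal_of_insert using prime_pow_ideal(1)[OF xy(1)] idealD(1)[OF is_ideal_ideal_of xy(3)]
    by (auto intro: prime_pow_ideal(5) idealD(4)[OF is_ideal_ideal_of])
  moreover have "x * y \<noteq> 0" using xy by simp
  ultimately show ?case using is_ideal_ideal_of by (metis singletonD)
qed

text \<open>Test element: \<open>t\<close> from \<open>coprime_element\<close> times the
  \<open>m\<close>-th power of the uniformizer, where \<open>m\<close> is the exponent of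
  \<open>P\<close>. It lies in the ideal but not in \<open>P^(m+1)\<close>.\<close>

lemma ideal_of_le:
  assumes P: "is_prime P" and A: "finite A" "\<And>Q. Q \<in> A \<Longrightarrow> is_prime Q"
    and sub: "ideal_of A e \<subseteq> prime_pow P k"
  shows "k \<le> (if P \<in> A then e P else 0)" (is "k \<le> ?m")
proof (rule ccontr)
  assume "\<not> k \<le> ?m"
  hence k: "Suc ?m \<le> k" by simp
  obtain t where t: "t \<in> ideal_of (A - {P}) e" "t \<notin> P"
    using coprime_element[OF P, of "A - {P}"] A by blast
  hence tO: "t \<in> \<O>" by (simp add: ideal_of_def)
  let ?z = "t * uniformizer P ^ ?m"
  have pO: "uniformizer P ^ n \<in> \<O>" for n using ints_power uniformizer(3)[OF P] by blast
  have "?z \<in> prime_pow P ?m" using uniformizer_power_mem(1)[OF P] tO by (rule prime_pow_ideal(4)[rotated])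
  moreover have "?z \<in> ideal_of (A - {P}) e" using t pO by (intro idealD(5)[OF is_ideal_ideal_of])
  ultimately have "?z \<in> ideal_of A e" by (auto simp: ideal_of_def)
  hence "?z \<in> prime_pow P (Suc ?m)" using sub prime_pow_antimono[OF k] by blast
  hence "uniformizer P ^ ?m \<in> prime_pow P (Suc ?m)"
    using prime_pow_primary[OF P tO t(2) pO] by blast
  thus False using uniformizer_power_mem(2)[OF P] by blast
qed

lemma ideal_of_inj:
  assumes A: "finite A" "\<And>Q. Q \<in> A \<Longrightarrow> is_prime Q"
    and eq: "ideal_of A e = ideal_of A e'" and P: "P \<in> A"
  shows "e P = e' P"
proof -
  have "ideal_of A e \<subseteq> prime_pow P (e P)" "ideal_of A e' \<subseteq> prime_pow P (e' P)"
    using P by (auto simp: ideal_of_def)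
  hence "e P \<le> e' P" "e' P \<le> e P"
    using ideal_of_le[OF A(2)[OF P] A, of e' "e P"] ideal_of_le[OF A(2)[OF P] A, of e "e' P"] eq P by auto
  thus ?thesis by simp
qed

text \<open>Since \<open>\<O> + g \<O>\<close> is inverse to \<open>P\<close>, the left-hand side is
  the product of the ideal with \<open>P\<close>. At another prime \<open>Q\<close> the condition on
  \<open>g x\<close> costs nothing: some \<open>t\<close> in \<open>P\<close> lies outside
  \<open>Q\<close>, \<open>g t\<close> is integral, and \<open>t\<close> can be cancelled modulo
  powers of \<open>Q\<close>.\<close>

lemma ideal_of_Suc:
  assumes P: "is_prime P" and A: "\<And>Q. Q \<in> A \<Longrightarrow> is_prime Q"
  shows "{x \<in> ideal_of A e. multiplier P * x \<in> ideal_of A e} =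
    ideal_of (insert P A) (e(P := Suc (if P \<in> A then e P else 0)))" (is "?L = ideal_of ?A ?e")
proof (intro subset_antisym subsetI)
  fix x assume "x \<in> ?L"
  thus "x \<in> ideal_of ?A ?e" by (auto simp: ideal_of_def prime_pow_Suc_iff)
next
  fix x assume x: "x \<in> ideal_of ?A ?e"
  let ?g = "multiplier P"
  have xO: "x \<in> \<O>" and xP: "x \<in> prime_pow P (Suc (if P \<in> A then e P else 0))"
    using x by (auto simp: ideal_of_def)
  have xQ: "x \<in> prime_pow Q (e Q)" if "Q \<in> A" "Q \<noteq> P" for Q
  proof -
    have "x \<in> prime_pow Q (?e Q)" using x that(1) unfolding ideal_of_def by blast
    thus ?thesis using that(2) by (metis fun_upd_other)
  qed
  have gO: "?g * x \<in> \<O>" using xP prime_pow_ideal(1) by (auto simp: prime_pow_Suc_iff)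
  have "x \<in> prime_pow Q (e Q) \<and> ?g * x \<in> prime_pow Q (e Q)" if Q: "Q \<in> A" for Q
  proof (cases "Q = P")
    case True
    thus ?thesis using xP Q prime_pow_antimono[of "e P" "Suc (e P)" P] by (auto simp: prime_pow_Suc_iff)
  next
    case False
    obtain t where t: "t \<in> P" "t \<notin> Q" using prime_maximal[OF P, of Q] False A[OF Q] primeD[of Q] by blast
    have "t * (?g * x) = (?g * t) * x" by simp
    also have "\<dots> \<in> prime_pow Q (e Q)" using xQ[OF Q False] multiplier(3)[OF P t(1)]
      by (rule prime_pow_ideal(4)[rotated])
    finally have "?g * x \<in> prime_pow Q (e Q)"
      using prime_pow_primary[OF A[OF Q] _ t(2) gO] t primeD(1)[OF P] idealD(1) by blast
    thus ?thesis using xQ[OF Q False] by simp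
  qed
  thus "x \<in> ?L" using xO gO by (auto simp: ideal_of_def)
qed

text \<open>Induction through \<open>J = I + g I\<close>, the product of \<open>I\<close> with the
  inverse of a prime \<open>P\<close> containing \<open>I\<close>. It is an integral ideal because
  \<open>I\<close> lies in \<open>P\<close>, and it is strictly larger by
  \<open>multiplier_not_stable\<close>; multiplying its factorization by \<open>P\<close> gives back
  \<open>I\<close>.\<close>

theorem ideal_factorization:
  assumes "proper_ideal I"
  shows "\<exists>A e. finite A \<and> (\<forall>P\<in>A. is_prime P) \<and> I = ideal_of A e"
  using assms
proof (induction "index I" arbitrary: I rule: less_induct)
  case less
  show ?case
  proof (cases "I = \<O>")
    case True
    thus ?thesis by (intro exI[of _ "{}"]) auto
  next
    case False
    note I = conjunct1[OF less.prems]
    obtain P where P: "is_prime P" "I \<subseteq> P" using ex_prime_superset less.prems False by blast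
    let ?g = "multiplier P"
    define J where "J = {x + ?g * y | x y. x \<in> I \<and> y \<in> I}"
    have gI: "?g * x \<in> \<O>" if "x \<in> I" for x using multiplier(3)[OF P(1)] P that by blast
    have J: "is_ideal J"
      unfolding is_ideal_def J_def
    proof (intro conjI ballI, goal_cases)
      case 1 thus ?case using gI idealD(1)[OF I] by (auto intro: ints_add)
    next
      case 2 thus ?case using idealD(2)[OF I] by force
    next
      case (3 x y)
      then obtain a b c d where "a \<in> I" "b \<in> I" "c \<in> I" "d \<in> I" "x = a + ?g * b" "y = c + ?g * d" by auto
      thus ?case using idealD(3)[OF I]
        by (intro CollectI exI[of _ "a + c"] exI[of _ "b + d"]) (auto simp: algebra_simps)
    next
      case (4 r x)
      then obtain a b where "a \<in> I" "b \<in> I" "x = a + ?g * b" by auto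
      thus ?case using 4 idealD(4)[OF I]
        by (intro CollectI exI[of _ "r * a"] exI[of _ "r * b"]) (simp add: distrib_left mult.left_commute)
    qed
    have IJ: "I \<subseteq> J" "\<And>x. x \<in> I \<Longrightarrow> ?g * x \<in> J"
      unfolding J_def using idealD(2)[OF I] by force+
    obtain x where "x \<in> I" "?g * x \<notin> I" using multiplier_not_stable[OF P(1) less.prems] .
    hence "I \<subset> J" using IJ by blast
    then obtain A e where A: "finite A" "\<forall>Q\<in>A. is_prime Q" "J = ideal_of A e"
      using less.hyps[of J] index_strict_mono[of I J] less.prems J idealD(2)[OF I] by blast
    have "I = {x \<in> J. ?g * x \<in> J}"
    proof (intro subset_antisym subsetI)
      fix x assume "x \<in> {x \<in> J. ?g * x \<in> J}"
      then obtain a b c d where ab: "a \<in> I" "b \<in> I" "x = a + ?g * b" and cd: "c \<in> I" "d \<in> I" "?g * x = c + ?g * d"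
        by (auto simp: J_def)
      let ?p = "uniformizer P"
      obtain y where y: "y \<in> \<O>" "?g * ?p * y - 1 \<in> P"
        using prime_invertible[OF P(1) uniformizer(4,2)[OF P(1)]] .
      have q: "?p * y \<in> P"
        by (rule idealD(5)[OF primeD(1)[OF P(1)] y(1) uniformizer(1)[OF P(1)]])
      have PI: "z * w \<in> I \<and> z * (?g * w) \<in> I" if "z \<in> P" "w \<in> I" for z w
      proof -
        have "z \<in> \<O>" using that primeD(1)[OF P(1)] idealD(1) by blast
        moreover have "z * (?g * w) = (?g * z) * w" by simp
        ultimately show ?thesis using that multiplier(3)[OF P(1)] idealD(4)[OF I] by metis
      qed
      \<comment> \<open>Both coefficients lie in \<open>P\<close>, and \<open>PI\<close> says that
        \<open>P\<close> times \<open>J\<close> is contained in \<open>I\<close>.\<close>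
      have "x = (?p * y) * (?g * x) - (?g * ?p * y - 1) * x" by (simp add: algebra_simps)
      also have "\<dots> = ((?p * y) * c + (?p * y) * (?g * d)) - ((?g * ?p * y - 1) * a + (?g * ?p * y - 1) * (?g * b))"
        unfolding cd(3) unfolding ab(3) by (simp add: algebra_simps)
      also have "\<dots> \<in> I" using PI[OF q(1)] PI[OF y(2)] ab cd
        by (intro ideal_diff[OF I] idealD(3)[OF I]) auto
      finally show "x \<in> I" .
    qed (use IJ in auto)
    also have "\<dots> = ideal_of (insert P A) (e(P := Suc (if P \<in> A then e P else 0)))"
      unfolding A(3) using A(2) by (intro ideal_of_Suc P(1)) auto
    finally show ?thesis using A P by (intro exI[of _ "insert P A"] exI) auto
  qed
qed

end

section \<open>Counting primes and Euler products\<close>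

text \<open>Chinese remainder theorem for counts, through the diagonal map.\<close>

lemma class_count_inter:
  assumes E: "equivp E1" "equivp E2" and fin: "finite (class_set E1 U)" "finite (class_set E2 V)"
    and iff: "\<And>x y. E x y \<longleftrightarrow> E1 x y \<and> E2 x y"
    and crt: "\<And>x y. x \<in> U \<Longrightarrow> y \<in> V \<Longrightarrow> \<exists>z\<in>U \<inter> V. E1 z x \<and> E2 z y"
  shows "class_count E (U \<inter> V) = class_count E1 U * class_count E2 V"
proof -
  have "equivp E" using E unfolding equivp_def iff fun_eq_iff by metis
  hence "class_count E (U \<inter> V) = class_count (pair_rel E1 E2) (U \<times> V)"
    using crt by (intro class_count_bij[where f = "\<lambda>x. (x, x)"] equivp_pair_rel E) (auto simp: iff)
  thus ?thesis using class_count_times(1)[OF E fin] by simp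
qed

context number_field_loc
begin

lemma index_Int:
  assumes I: "proper_ideal I" and J: "proper_ideal J" and ab: "a \<in> I" "b \<in> J" "a + b = 1"
  shows "index (I \<inter> J) = index I * index J"
proof -
  have "class_count (diff_rel (I \<inter> J)) (\<O> \<inter> \<O>) = index I * index J"
    unfolding index_def
  proof (rule class_count_inter)
    fix x y assume xy: "x \<in> \<O>" "y \<in> \<O>"
    \<comment> \<open>Modulo \<open>I\<close> the coefficients \<open>a\<close>, \<open>b\<close>
      are 0, 1, and modulo \<open>J\<close> they are 1, 0.\<close>
    let ?z = "a * y + b * x"
    have aO: "a \<in> \<O>" "b \<in> \<O>" using ab I J idealD(1) by blast+
    have "?z - x = a * (y - x) + (a + b - 1) * x" "?z - y = b * (x - y) + (a + b - 1) * y"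
      by (simp_all add: algebra_simps)
    hence "?z - x \<in> I" "?z - y \<in> J" "?z \<in> \<O>"
      using ab xy aO I J by (auto intro!: idealD(5) ints_diff ints_add ints_mult)
    thus "\<exists>z\<in>\<O> \<inter> \<O>. diff_rel I z x \<and> diff_rel J z y" by (auto simp: diff_rel_def)
  qed (use I J in \<open>auto simp: diff_rel_def intro: equivp_diff_rel finite_class_set\<close>)
  thus ?thesis by (simp add: index_def)
qed

section \<open>Prime ideals above a prime number\<close>

lemma prime_contains_prime_nat:
  assumes P: "is_prime P"
  obtains p where "prime p" "of_nat p \<in> P"
proof -
  obtain n where "n > 0" "of_nat n \<in> P" using nonzero_ideal_nat[OF primeD(2)[OF P]] .
  hence "\<exists>p. prime p \<and> of_nat p \<in> P"
  proof (induction n rule: less_induct)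
    case (less n)
    have "n \<noteq> 1" using less.prems primeD(4)[OF P] by auto
    then obtain p where p: "prime p" "p dvd n" using prime_factor_nat by blast
    then obtain k where k: "n = p * k" by auto
    hence "of_nat p \<in> P \<or> of_nat k \<in> P"
      using less.prems primeD(5)[OF P ints_of_nat ints_of_nat, of p k] by simp
    moreover have "k < n" "k > 0" using k less.prems p prime_gt_1_nat[of p] by auto
    ultimately show ?case using less.IH[of k] p by blast
  qed
  thus ?thesis using that by blast
qed

text \<open>The numbers below \<open>p\<close> are pairwise incongruent modulo \<open>P\<close>: a
  difference in \<open>P\<close> would be coprime to \<open>p\<close>, and Bezout would put 1 into
  \<open>P\<close>.\<close>

lemma prime_le_index:
  assumes P: "is_prime P" and p: "prime p" "of_nat p \<in> P"
  shows "p \<le> index P"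
proof -
  have inj: "inj_on (\<lambda>i. {y. diff_rel P (of_nat i) y}) {..<p}"
  proof (rule inj_onI)
    have *: "i = j" if ij: "i \<le> j" "j < p" "diff_rel P (of_nat i) (of_nat j)" for i j
    proof (rule ccontr)
      assume "i \<noteq> j"
      hence d: "0 < j - i" "j - i < p" using ij by auto
      have "Rings.coprime (int p) (int (j - i))"
        using p(1) d by (metis coprime_commute coprime_int_iff nat_dvd_not_less prime_imp_coprime)
      then obtain r s where "r * int p + s * int (j - i) = 1" by (metis bezout_int coprime_imp_gcd_eq_1)
      hence "of_int (r * int p + s * int (j - i)) = (1::'a)" by simp
      hence 1: "of_int r * of_nat p + of_int s * of_nat (j - i) = (1::'a)"
        by (metis of_int_add of_int_mult of_int_of_nat_eq)
      have "of_nat (j - i) \<in> P"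
        using ij(1,3) ideal_diff_commute[OF primeD(1)[OF P], of "of_nat i" "of_nat j"] by (simp add: diff_rel_def of_nat_diff)
      hence "of_int r * of_nat p + of_int s * of_nat (j - i) \<in> P"
        using p(2) by (intro idealD(3,4)[OF primeD(1)[OF P]] ints_of_int)
      thus False using 1 primeD(4)[OF P] by simp
    qed
    fix i j assume "i \<in> {..<p}" "j \<in> {..<p}" "{y. diff_rel P (of_nat i) y} = {y. diff_rel P (of_nat j) y}"
    thus "i = j" using *[of i j] *[of j i] equivp_diff_rel[OF primeD(1)[OF P]]
        class_eq_iff[of "diff_rel P"] by (metis lessThan_iff linear)
  qed
  have "p = card ((\<lambda>i. {y. diff_rel P (of_nat i) y}) ` {..<p})" using inj by (simp add: card_image)
  also have "\<dots> \<le> index P" unfolding index_def class_count_def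
    by (intro card_mono finite_class_set primeD(2)[OF P]) (auto simp: class_set_def ints_of_nat)
  finally show ?thesis .
qed

lemma index_prime_ge_2: "is_prime P \<Longrightarrow> index P \<ge> 2"
  by (metis prime_contains_prime_nat prime_le_index prime_ge_2_nat order_trans)

text \<open>For each \<open>P\<close> in \<open>S\<close> choose an element outside \<open>P\<close>
  but inside all other members of \<open>S\<close>. Modulo \<open>p\<close> these elements have
  distinct representatives, since all members of \<open>S\<close> contain \<open>p\<close>. The
  bound is far from the degree, but it needs only the residue system modulo
  \<open>p\<close>.\<close>

lemma card_primes_above_le:
  assumes p: "prime p" and S: "finite S" "\<And>P. P \<in> S \<Longrightarrow> is_prime P \<and> of_nat p \<in> P"
  shows "card S \<le> p ^ degree_bound"
proof -
  obtain T where T: "finite T" "card T \<le> p ^ degree_bound" "\<forall>x\<in>\<O>. \<exists>t\<in>T. \<exists>y\<in>\<O>. x - t = of_nat p * y"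
    using residue_system_prime[OF p] by auto
  have "\<exists>t\<in>T. (\<exists>x. x \<notin> P \<and> x - t \<in> P \<and> (\<forall>Q\<in>S - {P}. x \<in> Q \<and> x - t \<in> Q))" if P: "P \<in> S" for P
  proof -
    obtain x where x: "x \<in> ideal_of (S - {P}) (\<lambda>_. Suc 0)" "x \<notin> P"
      using coprime_element[of P "S - {P}"] S P by blast
    then obtain t y where t: "t \<in> T" "y \<in> \<O>" "x - t = of_nat p * y" using T(3) by (auto simp: ideal_of_def)
    have "x - t \<in> Q" if "Q \<in> S" for Q
      unfolding t(3) using S(2)[OF that] t(2) primeD(1) idealD(5) by blast
    moreover have "x \<in> Q" if "Q \<in> S - {P}" for Q
      using x(1) that S(2)[of Q] prime_pow_1[of Q] by (auto simp: ideal_of_def)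
    ultimately show ?thesis using t(1) x(2) P by blast
  qed
  hence "\<forall>P. \<exists>t. \<exists>x. P \<in> S \<longrightarrow> t \<in> T \<and> x \<notin> P \<and> x - t \<in> P \<and> (\<forall>Q\<in>S - {P}. x \<in> Q \<and> x - t \<in> Q)"
    by blast
  from choice[OF this] obtain t where
    "\<forall>P. \<exists>x. P \<in> S \<longrightarrow> t P \<in> T \<and> x \<notin> P \<and> x - t P \<in> P \<and> (\<forall>Q\<in>S - {P}. x \<in> Q \<and> x - t P \<in> Q)" ..
  from choice[OF this] obtain x where
    *: "\<forall>P. P \<in> S \<longrightarrow> t P \<in> T \<and> x P \<notin> P \<and> x P - t P \<in> P \<and> (\<forall>Q\<in>S - {P}. x P \<in> Q \<and> x P - t P \<in> Q)" ..
  have t: "\<And>P. P \<in> S \<Longrightarrow> t P \<in> T" "\<And>P. P \<in> S \<Longrightarrow> x P \<notin> P" "\<And>P. P \<in> S \<Longrightarrow> x P - t P \<in> P"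
    "\<And>P Q. P \<in> S \<Longrightarrow> Q \<in> S - {P} \<Longrightarrow> x P \<in> Q" "\<And>P Q. P \<in> S \<Longrightarrow> Q \<in> S - {P} \<Longrightarrow> x P - t P \<in> Q"
    using * by blast+
  have "inj_on t S"
  proof (rule inj_onI, rule ccontr)
    fix P Q assume PQ: "P \<in> S" "Q \<in> S" "t P = t Q" "P \<noteq> Q"
    have I: "is_ideal P" using S(2)[OF PQ(1)] primeD(1) by blast
    moreover have *: "x Q \<in> P" "x Q - t Q \<in> P" "x P - t P \<in> P"
      using t(3)[OF PQ(1)] t(4,5)[OF PQ(2), of P] PQ by blast+
    ultimately have "x P - t P + (x Q - (x Q - t Q)) \<in> P"
      by (intro idealD(3)[OF I *(3)] ideal_diff[OF I *(1,2)])
    thus False using PQ t(2)[OF PQ(1)] by simp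
  qed
  hence "card S \<le> card T" using t(1) T(1) by (intro card_inj_on_le[of t]) auto
  thus ?thesis using T(2) by simp
qed

text \<open>Grouping by the prime number below: at most \<open>p ^ degree_bound\<close> primes lie
  above \<open>p\<close>, each of index at least \<open>p\<close>, so the exponent leaves
  \<open>1 / p^2\<close>.\<close>

lemma summable_primes:
  "(\<lambda>P. 1 / real (index P) ^ (degree_bound + 2)) summable_on {P. is_prime P}"
proof (rule nonneg_bdd_above_summable_on)
  define p where "p = (\<lambda>P :: 'a set. SOME p. prime p \<and> of_nat p \<in> P)"
  have p: "prime (p P) \<and> of_nat (p P) \<in> P" if "is_prime P" for P
    unfolding p_def by (rule someI_ex) (use prime_contains_prime_nat[OF that] in blast)
  have sm: "summable (\<lambda>n. 1 / real n ^ 2)"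
    using inverse_power_summable[of 2, where 'a = real] by (simp add: inverse_eq_divide)
  have "sum (\<lambda>P. 1 / real (index P) ^ (degree_bound + 2)) F \<le> (\<Sum>n. 1 / real n ^ 2)"
    if F: "F \<subseteq> {P. is_prime P}" "finite F" for F
  proof -
    have "sum (\<lambda>P. 1 / real (index P) ^ (degree_bound + 2)) F \<le> sum (\<lambda>P. 1 / real (p P) ^ (degree_bound + 2)) F"
    proof (rule sum_mono)
      fix P assume "P \<in> F"
      hence P: "is_prime P" using F by auto
      have "0 < real (p P)" "real (p P) \<le> real (index P)"
        using p[OF P] prime_le_index[OF P, of "p P"] prime_gt_0_nat[of "p P"] by simp_all
      thus "1 / real (index P) ^ (degree_bound + 2) \<le> 1 / real (p P) ^ (degree_bound + 2)"
        by (intro divide_left_mono power_mono mult_pos_pos zero_less_power) auto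
    qed
    also have "\<dots> = (\<Sum>m\<in>p ` F. \<Sum>P\<in>{P\<in>F. p P = m}. 1 / real (p P) ^ (degree_bound + 2))"
      by (rule sum.image_gen[OF F(2)])
    also have "\<dots> \<le> (\<Sum>m\<in>p ` F. 1 / real m ^ 2)"
    proof (rule sum_mono)
      fix m assume m: "m \<in> p ` F"
      hence pm: "prime m" using p F by auto
      have "(\<Sum>P\<in>{P\<in>F. p P = m}. 1 / real (p P) ^ (degree_bound + 2)) =
          real (card {P\<in>F. p P = m}) / real m ^ (degree_bound + 2)" by simp
      also have "\<dots> \<le> real (m ^ degree_bound) / real m ^ (degree_bound + 2)"
        using p F by (intro divide_right_mono of_nat_mono card_primes_above_le pm) auto
      also have "\<dots> = 1 / real m ^ 2" using prime_gt_0_nat[OF pm] by (simp add: power_add power2_eq_square)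
      finally show "(\<Sum>P\<in>{P\<in>F. p P = m}. 1 / real (p P) ^ (degree_bound + 2)) \<le> 1 / real m ^ 2" .
    qed
    also have "\<dots> \<le> (\<Sum>n. 1 / real n ^ 2)"
      using F by (intro sum_le_suminf sm) auto
    finally show ?thesis .
  qed
  thus "bdd_above (sum (\<lambda>P. 1 / real (index P) ^ (degree_bound + 2)) ` {F. F \<subseteq> {P. is_prime P} \<and> finite F})"
    by (intro bdd_aboveI[of _ "\<Sum>n. 1 / real n ^ 2"]) auto
qed auto

section \<open>Ideals with finite support and the Euler product\<close>

lemma proper_ideal_ints: "proper_ideal \<O>"
  using proper_ideal_of[of "{}"] by simp

lemma index_ints: "index \<O> = 1"
proof -
  \<comment> \<open>\<open>\<O>\<close> is comaximal with itself, so its index is a positive number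
    equal to its own square.\<close>
  have "index (\<O> \<inter> \<O>) = index \<O> * index \<O>"
    by (rule index_Int[OF proper_ideal_ints proper_ideal_ints ints_0 ints_1]) simp
  thus ?thesis using index_pos[OF proper_ideal_ints] by simp
qed

text \<open>The missing primes get exponent 0. Restricting the exponent function to \<open>B\<close>
  makes it unique, as \<open>ideal_of_inj_on\<close> needs.\<close>

lemma ideal_of_mem_image:
  assumes "C \<subseteq> B"
  shows "ideal_of C e \<in> ideal_of B ` (B \<rightarrow>\<^sub>E UNIV)"
proof -
  define e' where "e' = (\<lambda>P\<in>B. if P \<in> C then e P else 0)"
  have "ideal_of C e = ideal_of B (\<lambda>P. if P \<in> C then e P else 0)"
    using ideal_of_extend[OF assms] by simp
  also have "\<dots> = ideal_of B e'" unfolding e'_def by (intro ideal_of_cong) auto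
  finally have "ideal_of C e = ideal_of B e'" .
  moreover have "e' \<in> B \<rightarrow>\<^sub>E UNIV" by (simp add: e'_def)
  ultimately show ?thesis by (metis imageI)
qed

lemma ex_common_support:
  assumes "finite F" "\<And>I. I \<in> F \<Longrightarrow> proper_ideal I"
  shows "\<exists>A. finite A \<and> (\<forall>P\<in>A. is_prime P) \<and> F \<subseteq> ideal_of A ` (A \<rightarrow>\<^sub>E UNIV)"
  using assms
proof (induction F rule: finite_induct)
  case (insert I F)
  have "\<exists>A. finite A \<and> (\<forall>P\<in>A. is_prime P) \<and> F \<subseteq> ideal_of A ` (A \<rightarrow>\<^sub>E UNIV)"
    by (rule insert.IH) (simp add: insert.prems)
  then obtain A where A: "finite A" "\<forall>P\<in>A. is_prime P" "F \<subseteq> ideal_of A ` (A \<rightarrow>\<^sub>E UNIV)"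
    by (elim exE conjE)
  have I: "proper_ideal I" by (simp add: insert.prems)
  obtain B e where B: "finite B" "\<forall>P\<in>B. is_prime P" "I = ideal_of B e"
    using ideal_factorization[OF I] by (elim exE conjE)
  have 1: "ideal_of A ` (A \<rightarrow>\<^sub>E UNIV) \<subseteq> ideal_of (A \<union> B) ` (A \<union> B \<rightarrow>\<^sub>E UNIV)"
    by (intro image_subsetI ideal_of_mem_image) simp
  have 2: "I \<in> ideal_of (A \<union> B) ` (A \<union> B \<rightarrow>\<^sub>E UNIV)" using ideal_of_mem_image[of B "A \<union> B" e] B(3) by simp
  have "insert I F \<subseteq> ideal_of (A \<union> B) ` (A \<union> B \<rightarrow>\<^sub>E UNIV)"
    by (simp only: insert_subset 2 subset_trans[OF A(3) 1])
  moreover have "finite (A \<union> B) \<and> (\<forall>P\<in>A \<union> B. is_prime P)" using A B by blast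
  ultimately show ?case by blast
qed (rule exI[of _ "{}"], simp)

lemma common_support:
  assumes "finite F" "\<And>I. I \<in> F \<Longrightarrow> proper_ideal I"
  obtains A where "finite A" "\<forall>P\<in>A. is_prime P" "F \<subseteq> ideal_of A ` (A \<rightarrow>\<^sub>E UNIV)"
proof -
  have "\<exists>A. finite A \<and> (\<forall>P\<in>A. is_prime P) \<and> F \<subseteq> ideal_of A ` (A \<rightarrow>\<^sub>E UNIV)"
    by (rule ex_common_support[OF assms(1)]) (rule assms(2))
  thus ?thesis by (elim exE conjE) (rule that)
qed

lemma ideal_of_image_mono:
  "A \<subseteq> B \<Longrightarrow> ideal_of A ` (A \<rightarrow>\<^sub>E UNIV) \<subseteq> ideal_of B ` (B \<rightarrow>\<^sub>E UNIV)"
  by (intro image_subsetI ideal_of_mem_image)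

lemma ideal_of_inj_on:
  assumes "finite A" "\<And>P. P \<in> A \<Longrightarrow> is_prime P"
  shows "inj_on (ideal_of A) (A \<rightarrow>\<^sub>E UNIV)"
proof (rule inj_onI)
  fix e e' :: "'a set \<Rightarrow> nat" assume e: "e \<in> A \<rightarrow>\<^sub>E UNIV" "e' \<in> A \<rightarrow>\<^sub>E UNIV" "ideal_of A e = ideal_of A e'"
  show "e = e'"
    by (rule PiE_ext[OF e(1,2)]) (use ideal_of_inj[OF assms e(3)] in auto)
qed

text \<open>Splitting off one prime power at a time is what the induction over the support uses; by
  unique factorization it determines \<open>f\<close> from its values at prime powers.\<close>

definition multiplicative :: "('a set \<Rightarrow> complex) \<Rightarrow> bool" where
  "multiplicative f \<longleftrightarrow> f \<O> = 1 \<and> (\<forall>P A k e. is_prime P \<and> finite A \<and> (\<forall>Q\<in>A. is_prime Q) \<and> P \<notin> A \<longrightarrow>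
     f (prime_pow P k \<inter> ideal_of A e) = f (prime_pow P k) * f (ideal_of A e))"

lemma multiplicative_ideal_of:
  assumes f: "multiplicative f" and A: "finite A" "\<And>Q. Q \<in> A \<Longrightarrow> is_prime Q"
  shows "f (ideal_of A e) = (\<Prod>P\<in>A. f (prime_pow P (e P)))"
  using A by (induction A rule: finite_induct)
    (use f in \<open>auto simp: multiplicative_def ideal_of_insert\<close>)

text \<open>By unique factorization the product over a finite set of primes is the sum over the
  ideals supported there. The inequalities \<open>1/(1-C) \<le> 1+2C \<le> exp (2C)\<close>, the
  first of which uses \<open>C \<le> 1/2\<close>, bound all such sums of norms by \<open>exp\<close>
  of twice the sum of \<open>C\<close>. This gives absolute convergence, which in turn controls the
  ideals that a finite product misses.\<close>

theorem euler_product: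
  assumes f: "multiplicative f"
    and bound: "\<And>P k. is_prime P \<Longrightarrow> norm (f (prime_pow P k)) \<le> C P ^ k"
    and C: "\<And>P. is_prime P \<Longrightarrow> 0 \<le> C P \<and> C P \<le> 1 / 2" "C summable_on {P. is_prime P}"
  shows "f summable_on {I. proper_ideal I}"
    "has_abs_prod (\<lambda>P. \<Sum>k. f (prime_pow P k)) {P. is_prime P} (\<Sum>\<^sub>\<infinity>I\<in>{I. proper_ideal I}. f I)"
proof -
  let ?Pr = "{P. is_prime P}" and ?Id = "{I. proper_ideal I}"
  define L where "L = (\<lambda>P. \<Sum>k. f (prime_pow P k))"
  have f1: "f \<O> = 1" using f by (simp add: multiplicative_def)
  have sumC: "summable (\<lambda>k. C P ^ k)" if "is_prime P" for P
    using C(1)[OF that] by (intro summable_geometric) auto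
  have geo: "(\<Sum>k. C P ^ k) \<le> 1 + 2 * C P" if "is_prime P" for P
  proof -
    have "(\<Sum>k. C P ^ k) = 1 / (1 - C P)" using C(1)[OF that] by (intro suminf_geometric) auto
    also have "\<dots> \<le> 1 + 2 * C P"
      using C(1)[OF that] mult_left_mono[of "2 * C P" 1 "C P"] by (simp add: field_simps)
    finally show ?thesis .
  qed
  have sumn: "summable (\<lambda>k. norm (f (prime_pow P k)))" if "is_prime P" for P
    using bound that by (intro summable_comparison_test[OF _ sumC[OF that]]) auto
  have geo': "(\<Sum>k\<le>N. norm (f (prime_pow P k))) \<le> exp (2 * C P)" if "is_prime P" for P N
  proof -
    have "(\<Sum>k\<le>N. norm (f (prime_pow P k))) \<le> (\<Sum>k\<le>N. C P ^ k)" using bound that by (intro sum_mono) auto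
    also have "\<dots> \<le> (\<Sum>k. C P ^ k)" using C(1)[OF that] by (intro sum_le_suminf sumC that) auto
    also have "\<dots> \<le> 1 + 2 * C P" using geo that by blast
    also have "\<dots> \<le> exp (2 * C P)" by (rule exp_ge_add_one_self)
    finally show ?thesis .
  qed
  have abs_summable: "f abs_summable_on ?Id"
  proof (rule nonneg_bdd_above_summable_on)
    have "sum (\<lambda>I. norm (f I)) F \<le> exp (2 * infsum C ?Pr)" if F: "F \<subseteq> ?Id" "finite F" for F
    proof -
      have FI: "\<And>I. I \<in> F \<Longrightarrow> proper_ideal I" using F(1) by blast
      obtain A where A: "finite A" "\<forall>P\<in>A. is_prime P" "F \<subseteq> ideal_of A ` (A \<rightarrow>\<^sub>E UNIV)"
        using common_support[OF F(2) FI] by metis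
      then obtain G where G: "G \<subseteq> A \<rightarrow>\<^sub>E UNIV" "finite G" "F = ideal_of A ` G"
        using finite_subset_image[OF F(2) A(3)] by blast
      \<comment> \<open>A bound for the exponents of the finitely many ideals in \<open>F\<close>,
        so that they all occur when a product of truncated local sums is expanded.\<close>
      define N where "N = Max (insert 0 ((\<lambda>(e, P). e P) ` (G \<times> A)))"
      have N: "e P \<le> N" if "e \<in> G" "P \<in> A" for e P
        unfolding N_def using G(2) A(1) that by (intro Max_ge) (auto intro!: rev_image_eqI[of "(e, P)"])
      have "sum (\<lambda>I. norm (f I)) F = (\<Sum>e\<in>G. norm (f (ideal_of A e)))"
        unfolding G(3) using ideal_of_inj_on[OF A(1)] A(2) G(1)
        by (subst sum.reindex) (auto intro: inj_on_subset)
      also have "\<dots> = (\<Sum>e\<in>G. \<Prod>P\<in>A. norm (f (prime_pow P (e P))))"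
        using A by (simp add: multiplicative_ideal_of[OF f] prod_norm)
      also have "\<dots> \<le> (\<Sum>e\<in>A \<rightarrow>\<^sub>E {..N}. \<Prod>P\<in>A. norm (f (prime_pow P (e P))))"
      proof (rule sum_mono2)
        show "finite (A \<rightarrow>\<^sub>E {..N})" using A by (intro finite_PiE) auto
        show "G \<subseteq> A \<rightarrow>\<^sub>E {..N}"
        proof
          fix e assume e: "e \<in> G"
          hence "e \<in> A \<rightarrow>\<^sub>E UNIV" using G(1) by blast
          thus "e \<in> A \<rightarrow>\<^sub>E {..N}" using N[OF e] by (intro PiE_I) (auto simp: PiE_def extensional_def)
        qed
      qed (auto intro: prod_nonneg)
      also have "\<dots> = (\<Prod>P\<in>A. \<Sum>k\<le>N. norm (f (prime_pow P k)))"
        using A by (subst prod_sum_PiE) auto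
      also have "\<dots> \<le> (\<Prod>P\<in>A. exp (2 * C P))" using geo' A by (intro prod_mono) (auto intro: sum_nonneg)
      also have "\<dots> = exp (2 * sum C A)" using A by (simp add: exp_sum sum_distrib_left)
      also have "\<dots> \<le> exp (2 * infsum C ?Pr)"
        using A C finite_sum_le_infsum[OF C(2), of A] by auto
      finally show ?thesis .
    qed
    thus "bdd_above (sum (\<lambda>I. norm (f I)) ` {F. F \<subseteq> ?Id \<and> finite F})"
      by (intro bdd_aboveI[of _ "exp (2 * infsum C ?Pr)"]) auto
  qed auto
  thus sum: "f summable_on ?Id" by (rule abs_summable_summable)
  have smooth_sub: "ideal_of A ` (A \<rightarrow>\<^sub>E UNIV) \<subseteq> ?Id" if "finite A" "A \<subseteq> ?Pr" for A
    using that by (intro image_subsetI CollectI proper_ideal_of) auto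
  have prod: "prod L A = infsum f (ideal_of A ` (A \<rightarrow>\<^sub>E UNIV))" if A: "finite A" "A \<subseteq> ?Pr" for A
  proof -
    have inj: "inj_on (ideal_of A) (A \<rightarrow>\<^sub>E UNIV)"
      using A(2) by (intro ideal_of_inj_on A(1)) auto
    have hs: "((\<lambda>k. f (prime_pow P k)) has_sum L P) UNIV" if "P \<in> A" for P
    proof -
      have P: "is_prime P" using A(2) that by auto
      show ?thesis unfolding L_def
        by (rule norm_summable_imp_has_sum[OF sumn[OF P] summable_sums[OF summable_norm_cancel[OF sumn[OF P]]]])
    qed
    have abs: "(\<lambda>k. f (prime_pow P k)) abs_summable_on UNIV" if "P \<in> A" for P
      using sumn A that by (intro norm_summable_imp_summable_on) auto
    have "infsum f (ideal_of A ` (A \<rightarrow>\<^sub>E UNIV)) = infsum (f \<circ> ideal_of A) (A \<rightarrow>\<^sub>E UNIV)"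
      by (rule infsum_reindex[OF inj])
    also have "\<dots> = infsum (\<lambda>e. \<Prod>P\<in>A. f (prime_pow P (e P))) (A \<rightarrow>\<^sub>E UNIV)"
      using A multiplicative_ideal_of[OF f, of A] by (intro infsum_cong) auto
    also have "\<dots> = (\<Prod>P\<in>A. \<Sum>\<^sub>\<infinity>k. f (prime_pow P k))"
      by (rule infsum_prod_PiE_abs[OF A(1) abs])
    also have "\<dots> = prod L A" using hs by (intro prod.cong) (auto intro: infsumI)
    finally show ?thesis by simp
  qed
  have "(prod L \<longlongrightarrow> infsum f ?Id) (finite_subsets_at_top ?Pr)"
    unfolding tendsto_iff eventually_finite_subsets_at_top
  proof (intro allI impI)
    fix \<epsilon> :: real assume \<epsilon>: "\<epsilon> > 0"
    define S where "S = infsum (\<lambda>I. norm (f I)) ?Id"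
    have "((\<lambda>I. norm (f I)) has_sum S) ?Id" unfolding S_def using abs_summable by (rule has_sum_infsum)
    \<comment> \<open>\<open>F\<close> carries all but \<open>\<epsilon> / 2\<close> of the sum of
      norms. Once the primes in a product support every ideal of \<open>F\<close>, the product
      misses only ideals outside \<open>F\<close>.\<close>
    from has_sum_finite_approximation[OF this, of "\<epsilon> / 2"] obtain F where
      F: "finite F" "F \<subseteq> ?Id" "dist (sum (\<lambda>I. norm (f I)) F) S \<le> \<epsilon> / 2" using \<epsilon> by auto
    have FI: "\<And>I. I \<in> F \<Longrightarrow> proper_ideal I" using F(2) by blast
    obtain A where A: "finite A" "\<forall>P\<in>A. is_prime P" "F \<subseteq> ideal_of A ` (A \<rightarrow>\<^sub>E UNIV)"
      using common_support[OF F(1) FI] by metis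
    have "dist (prod L B) (infsum f ?Id) < \<epsilon>" if B: "finite B" "A \<subseteq> B" "B \<subseteq> ?Pr" for B
    proof -
      let ?B = "ideal_of B ` (B \<rightarrow>\<^sub>E UNIV)"
      have sub: "?B \<subseteq> ?Id" using smooth_sub B by blast
      have FB: "F \<subseteq> ?B" using A(3) ideal_of_image_mono[OF B(2)] by blast
      have sB: "(\<lambda>I. norm (f I)) summable_on X" if "X \<subseteq> ?Id" for X
        using summable_on_subset_banach[OF abs_summable that] .
      have "infsum f ?Id = infsum f ?B + infsum f (?Id - ?B)"
        using infsum_Un_disjoint[of f ?B "?Id - ?B"] sum sub
        by (metis (no_types, lifting) Diff_disjoint Diff_subset Un_Diff_cancel sup.absorb2 summable_on_subset_banach)
      hence "dist (prod L B) (infsum f ?Id) = norm (infsum f (?Id - ?B))"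
        using prod[OF B(1,3)] by (simp add: dist_norm)
      also have "\<dots> \<le> infsum (\<lambda>I. norm (f I)) (?Id - ?B)"
        by (intro norm_infsum_bound sB) auto
      also have "\<dots> \<le> infsum (\<lambda>I. norm (f I)) (?Id - F)"
        using FB by (intro infsum_mono2 sB) auto
      also have "\<dots> = S - sum (\<lambda>I. norm (f I)) F"
      proof -
        have "S = infsum (\<lambda>I. norm (f I)) F + infsum (\<lambda>I. norm (f I)) (?Id - F)"
          unfolding S_def using infsum_Un_disjoint[of "\<lambda>I. norm (f I)" F "?Id - F"] sB F
          by (metis (no_types, lifting) Diff_disjoint Diff_subset Un_Diff_cancel sup.absorb2)
        thus ?thesis using F(1) by simp
      qed
      also have "\<dots> < \<epsilon>" using F(3) \<epsilon> by (auto simp: dist_real_def abs_if split: if_splits)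
      finally show ?thesis .
    qed
    thus "\<exists>X. finite X \<and> X \<subseteq> ?Pr \<and> (\<forall>Y. finite Y \<and> X \<subseteq> Y \<and> Y \<subseteq> ?Pr \<longrightarrow> dist (prod L Y) (infsum f ?Id) < \<epsilon>)"
      using A by (intro exI[of _ A]) auto
  qed
  moreover have "(\<lambda>P. L P - 1) abs_summable_on ?Pr"
  proof (rule summable_on_comparison_test[OF summable_on_cmult_right[OF C(2), of 2]])
    fix P assume "P \<in> ?Pr"
    hence P: "is_prime P" by simp
    have s: "summable (\<lambda>k. f (prime_pow P k))" using sumn[OF P] by (rule summable_norm_cancel)
    have "L P - 1 = (\<Sum>k. f (prime_pow P (Suc k)))"
      unfolding L_def using suminf_split_head[OF s] f1 by simp
    also have "norm \<dots> \<le> (\<Sum>k. norm (f (prime_pow P (Suc k))))"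
      using sumn[OF P] by (intro summable_norm) (subst summable_Suc_iff)
    also have "\<dots> = (\<Sum>k. norm (f (prime_pow P k))) - 1"
      using suminf_split_head[OF sumn[OF P]] f1 by simp
    also have "\<dots> \<le> (\<Sum>k. C P ^ k) - 1"
      using bound[OF P] by (intro diff_right_mono suminf_le sumn[OF P] sumC[OF P])
    also have "\<dots> \<le> 2 * C P" using geo[OF P] by simp
    finally show "norm (L P - 1) \<le> 2 * C P" .
  qed auto
  ultimately show "has_abs_prod (\<lambda>P. \<Sum>k. f (prime_pow P k)) ?Pr (infsum f ?Id)"
    unfolding has_abs_prod_def L_def by blast
qed

end

section \<open>The groups of points\<close>

definition two_step :: "lie_lattice \<Rightarrow> bool" where
  "two_step L \<longleftrightarrow> finite (lie_basis L) \<and>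
     (\<forall>(b, c, e)\<in>lie_rels L. b \<in> range X \<and> c \<in> range X \<and> e \<notin> range X)"

lemma beta_coeff_eq_0:
  "two_step L \<Longrightarrow> b \<notin> range X \<or> c \<notin> range X \<or> e \<in> range X \<Longrightarrow> beta_coeff L b c e = 0"
  unfolding two_step_def beta_coeff_def bracket_coeff_def
  by (auto split: basis_elt.splits simp: of_bool_def)

locale unipotent = cring R for R (structure) +
  fixes L :: lie_lattice
  assumes two_step: "two_step L"
begin

abbreviation "B \<equiv> lie_basis L"
abbreviation "\<beta> \<equiv> beta L R"
abbreviation "G \<equiv> unipotent_group L R"

lemma finite_basis: "finite B"
  using two_step by (simp add: two_step_def)

lemma int_add_pow_0: "[(0::int)] \<cdot> x = \<zero>"
  by (simp add: add_pow_int_ge)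

lemma beta_term_closed:
  "g \<in> B \<rightarrow> carrier R \<Longrightarrow> h \<in> B \<rightarrow> carrier R \<Longrightarrow>
   (\<lambda>(b, c). [beta_coeff L b c e] \<cdot> (g b \<otimes> h c)) \<in> B \<times> B \<rightarrow> carrier R"
  by (auto intro!: add.int_pow_closed)

lemma beta_closed: "g \<in> B \<rightarrow> carrier R \<Longrightarrow> h \<in> B \<rightarrow> carrier R \<Longrightarrow> \<beta> g h e \<in> carrier R"
  unfolding beta_def by (rule finsum_closed[OF beta_term_closed])

text \<open>\<open>\<beta>\<close> sees only \<open>X\<close> coordinates, so \<open>k\<close> is
  compared with the sum only there. A group product meets this condition although its
  \<open>Y\<close> coordinates contain a further term.\<close>

lemma beta_add_left:
  assumes "g \<in> B \<rightarrow> carrier R" "g' \<in> B \<rightarrow> carrier R" "h \<in> B \<rightarrow> carrier R" "k \<in> B \<rightarrow> carrier R"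
    and k: "\<And>i. X i \<in> B \<Longrightarrow> k (X i) = g (X i) \<oplus> g' (X i)"
  shows "\<beta> k h e = \<beta> g h e \<oplus> \<beta> g' h e"
proof -
  have "\<beta> k h e = finsum R (\<lambda>z. (\<lambda>(b, c). [beta_coeff L b c e] \<cdot> (g b \<otimes> h c)) z \<oplus>
      (\<lambda>(b, c). [beta_coeff L b c e] \<cdot> (g' b \<otimes> h c)) z) (B \<times> B)"
    unfolding beta_def
  proof (rule finsum_cong'[OF refl])
    fix z assume "z \<in> B \<times> B"
    then obtain b c where z: "z = (b, c)" "b \<in> B" "c \<in> B" by auto
    have cl: "g b \<in> carrier R" "g' b \<in> carrier R" "h c \<in> carrier R" using assms z by auto
    show "(case z of (b, c) \<Rightarrow> [beta_coeff L b c e] \<cdot> (k b \<otimes> h c)) =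
      (\<lambda>(b, c). [beta_coeff L b c e] \<cdot> (g b \<otimes> h c)) z \<oplus> (\<lambda>(b, c). [beta_coeff L b c e] \<cdot> (g' b \<otimes> h c)) z"
    proof (cases b)
      case (X i)
      thus ?thesis using k[of i] z cl by (simp add: l_distr add.int_pow_distrib)
    next
      case (Y i j)
      hence "beta_coeff L b c e = 0" using beta_coeff_eq_0[OF two_step] by auto
      thus ?thesis using z by (simp add: int_add_pow_0)
    qed
  qed (use assms in \<open>auto intro!: a_closed add.int_pow_closed m_closed simp: Pi_iff\<close>)
  also have "\<dots> = \<beta> g h e \<oplus> \<beta> g' h e"
    unfolding beta_def by (rule finsum_addf[OF beta_term_closed beta_term_closed]) (use assms in auto)
  finally show ?thesis .
qed

lemma beta_add_right:
  assumes "g \<in> B \<rightarrow> carrier R" "g' \<in> B \<rightarrow> carrier R" "h \<in> B \<rightarrow> carrier R" "k \<in> B \<rightarrow> carrier R"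
    and k: "\<And>i. X i \<in> B \<Longrightarrow> k (X i) = g (X i) \<oplus> g' (X i)"
  shows "\<beta> h k e = \<beta> h g e \<oplus> \<beta> h g' e"
proof -
  have "\<beta> h k e = finsum R (\<lambda>z. (\<lambda>(b, c). [beta_coeff L b c e] \<cdot> (h b \<otimes> g c)) z \<oplus>
      (\<lambda>(b, c). [beta_coeff L b c e] \<cdot> (h b \<otimes> g' c)) z) (B \<times> B)"
    unfolding beta_def
  proof (rule finsum_cong'[OF refl])
    fix z assume "z \<in> B \<times> B"
    then obtain b c where z: "z = (b, c)" "b \<in> B" "c \<in> B" by auto
    have cl: "g c \<in> carrier R" "g' c \<in> carrier R" "h b \<in> carrier R" using assms z by auto
    show "(case z of (b, c) \<Rightarrow> [beta_coeff L b c e] \<cdot> (h b \<otimes> k c)) =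
      (\<lambda>(b, c). [beta_coeff L b c e] \<cdot> (h b \<otimes> g c)) z \<oplus> (\<lambda>(b, c). [beta_coeff L b c e] \<cdot> (h b \<otimes> g' c)) z"
    proof (cases c)
      case (X i)
      thus ?thesis using k[of i] z cl by (simp add: r_distr add.int_pow_distrib)
    next
      case (Y i j)
      hence "beta_coeff L b c e = 0" using beta_coeff_eq_0[OF two_step] by auto
      thus ?thesis using z by (simp add: int_add_pow_0)
    qed
  qed (use assms in \<open>auto intro!: a_closed add.int_pow_closed m_closed simp: Pi_iff\<close>)
  also have "\<dots> = \<beta> h g e \<oplus> \<beta> h g' e"
    unfolding beta_def by (rule finsum_addf[OF beta_term_closed beta_term_closed]) (use assms in auto)
  finally show ?thesis .
qed

lemma beta_X: "\<beta> g h (X i) = \<zero>"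
proof -
  have "(\<lambda>(b, c). [beta_coeff L b c (X i)] \<cdot> (g b \<otimes> h c)) = (\<lambda>z. \<zero>)"
    using beta_coeff_eq_0[OF two_step] by (auto simp: fun_eq_iff int_add_pow_0)
  thus ?thesis unfolding beta_def by simp
qed

lemma carrier_G: "carrier G = B \<rightarrow>\<^sub>E carrier R"
  and mult_G: "g \<otimes>\<^bsub>G\<^esub> h = (\<lambda>e\<in>B. g e \<oplus> h e \<oplus> \<beta> g h e)"
  and one_G: "\<one>\<^bsub>G\<^esub> = (\<lambda>e\<in>B. \<zero>)"
  by (simp_all add: unipotent_group_def)

lemma PiE_Pi: "g \<in> B \<rightarrow>\<^sub>E carrier R \<Longrightarrow> g \<in> B \<rightarrow> carrier R"
  by auto

lemma mult_closed_G:
  assumes "g \<in> B \<rightarrow>\<^sub>E carrier R" "h \<in> B \<rightarrow>\<^sub>E carrier R"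
  shows "(\<lambda>e\<in>B. g e \<oplus> h e \<oplus> \<beta> g h e) \<in> B \<rightarrow>\<^sub>E carrier R"
  using assms beta_closed[OF PiE_Pi PiE_Pi] by (auto intro!: a_closed)

lemma zero_closed_G: "(\<lambda>e\<in>B. \<zero>) \<in> B \<rightarrow>\<^sub>E carrier R"
  by auto

lemma beta_zero_left:
  assumes "h \<in> B \<rightarrow> carrier R"
  shows "\<beta> (\<lambda>e\<in>B. \<zero>) h e = \<zero>"
proof -
  note Z = PiE_Pi[OF zero_closed_G]
  have "\<beta> (\<lambda>e\<in>B. \<zero>) h e = \<beta> (\<lambda>e\<in>B. \<zero>) h e \<oplus> \<beta> (\<lambda>e\<in>B. \<zero>) h e"
    by (rule beta_add_left[OF Z Z assms Z]) auto
  thus ?thesis using beta_closed[OF Z assms] by (metis add.l_cancel_one')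
qed

text \<open>Biadditivity makes \<open>\<beta>\<close> a 2-cocycle, and the cocycle identity is
  associativity.\<close>

lemma group_G: "Group.group G"
proof (rule groupI, unfold carrier_G mult_G one_G)
  fix x y assume xy: "x \<in> B \<rightarrow>\<^sub>E carrier R" "y \<in> B \<rightarrow>\<^sub>E carrier R"
  show "(\<lambda>e\<in>B. x e \<oplus> y e \<oplus> \<beta> x y e) \<in> B \<rightarrow>\<^sub>E carrier R" by (rule mult_closed_G[OF xy])
next
  show "(\<lambda>e\<in>B. \<zero>) \<in> B \<rightarrow>\<^sub>E carrier R" by auto
next
  fix x y z assume xyz: "x \<in> B \<rightarrow>\<^sub>E carrier R" "y \<in> B \<rightarrow>\<^sub>E carrier R" "z \<in> B \<rightarrow>\<^sub>E carrier R"
  let ?xy = "\<lambda>e\<in>B. x e \<oplus> y e \<oplus> \<beta> x y e" and ?yz = "\<lambda>e\<in>B. y e \<oplus> z e \<oplus> \<beta> y z e"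
  note P = xyz[THEN PiE_Pi] PiE_Pi[OF mult_closed_G[OF xyz(1,2)]] PiE_Pi[OF mult_closed_G[OF xyz(2,3)]]
  have 1: "\<beta> ?xy z e = \<beta> x z e \<oplus> \<beta> y z e" for e
    by (rule beta_add_left[OF P(1,2,3,4)]) (use P in \<open>auto simp: beta_X intro!: r_zero\<close>)
  have 2: "\<beta> x ?yz e = \<beta> x y e \<oplus> \<beta> x z e" for e
    by (rule beta_add_right[OF P(2,3,1,5)]) (use P in \<open>auto simp: beta_X intro!: r_zero\<close>)
  show "(\<lambda>e\<in>B. ?xy e \<oplus> z e \<oplus> \<beta> ?xy z e) = (\<lambda>e\<in>B. x e \<oplus> ?yz e \<oplus> \<beta> x ?yz e)"
  proof (rule restrict_ext)
    fix e assume e: "e \<in> B"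
    have "x e \<in> carrier R" "y e \<in> carrier R" "z e \<in> carrier R" using P e by auto
    thus "?xy e \<oplus> z e \<oplus> \<beta> ?xy z e = x e \<oplus> ?yz e \<oplus> \<beta> x ?yz e"
      unfolding 1 2 using e beta_closed[OF P(1,2)] beta_closed[OF P(1,3)] beta_closed[OF P(2,3)]
      by (simp add: a_ac)
  qed
next
  fix x assume x: "x \<in> B \<rightarrow>\<^sub>E carrier R"
  note P = PiE_Pi[OF x]
  have "(\<lambda>e\<in>B. (\<lambda>e\<in>B. \<zero>) e \<oplus> x e \<oplus> \<beta> (\<lambda>e\<in>B. \<zero>) x e) = restrict x B"
  proof (rule restrict_ext)
    fix e assume e: "e \<in> B"
    hence "x e \<in> carrier R" using P by auto
    thus "(\<lambda>e\<in>B. \<zero>) e \<oplus> x e \<oplus> \<beta> (\<lambda>e\<in>B. \<zero>) x e = x e" using e beta_zero_left[OF P] by simp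
  qed
  thus "(\<lambda>e\<in>B. (\<lambda>e\<in>B. \<zero>) e \<oplus> x e \<oplus> \<beta> (\<lambda>e\<in>B. \<zero>) x e) = x"
    using x by (simp add: PiE_restrict)
next
  fix x assume x: "x \<in> B \<rightarrow>\<^sub>E carrier R"
  note P = PiE_Pi[OF x]
  \<comment> \<open>\<open>y\<close> has the \<open>X\<close> coordinates of the negative of
    \<open>x\<close>, so \<open>\<beta> y x\<close> is the negative of \<open>\<beta> x x\<close>
    and cancels the added term.\<close>
  define y where "y = (\<lambda>e\<in>B. \<ominus> x e \<oplus> \<beta> x x e)"
  have y: "y \<in> B \<rightarrow>\<^sub>E carrier R" using P beta_closed[OF P P] by (auto simp: y_def)
  have "\<beta> (\<lambda>e\<in>B. \<zero>) x e = \<beta> y x e \<oplus> \<beta> x x e" for e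
  proof (rule beta_add_left[OF PiE_Pi[OF y] P P PiE_Pi[OF zero_closed_G]])
    fix i assume i: "X i \<in> B"
    hence "x (X i) \<in> carrier R" using P by auto
    thus "(\<lambda>e\<in>B. \<zero>) (X i) = y (X i) \<oplus> x (X i)" using i by (simp add: y_def beta_X l_neg)
  qed
  hence s: "\<beta> y x e \<oplus> \<beta> x x e = \<zero>" for e using beta_zero_left[OF P] by metis
  have "(\<lambda>e\<in>B. y e \<oplus> x e \<oplus> \<beta> y x e) = (\<lambda>e\<in>B. \<zero>)"
  proof (rule restrict_ext)
    fix e assume e: "e \<in> B"
    have cl: "x e \<in> carrier R" "\<beta> x x e \<in> carrier R" "\<beta> y x e \<in> carrier R"
      using P e beta_closed[OF P P] beta_closed[OF PiE_Pi[OF y] P] by auto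
    have "y e \<oplus> x e \<oplus> \<beta> y x e = (\<ominus> x e \<oplus> x e) \<oplus> (\<beta> y x e \<oplus> \<beta> x x e)"
      using cl e by (simp add: y_def a_ac)
    thus "y e \<oplus> x e \<oplus> \<beta> y x e = \<zero>" using cl s by (simp add: l_neg)
  qed
  thus "\<exists>y\<in>B \<rightarrow>\<^sub>E carrier R. (\<lambda>e\<in>B. y e \<oplus> x e \<oplus> \<beta> y x e) = (\<lambda>e\<in>B. \<zero>)" using y by blast
qed

lemma commute_iff:
  assumes "g \<in> carrier G" "h \<in> carrier G"
  shows "g \<otimes>\<^bsub>G\<^esub> h = h \<otimes>\<^bsub>G\<^esub> g \<longleftrightarrow> (\<forall>e\<in>B. \<beta> g h e = \<beta> h g e)"
proof -
  note P = assms[unfolded carrier_G, THEN PiE_Pi]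
  have "g e \<oplus> h e \<oplus> \<beta> g h e = h e \<oplus> g e \<oplus> \<beta> h g e \<longleftrightarrow> \<beta> g h e = \<beta> h g e" if e: "e \<in> B" for e
  proof -
    have "g e \<in> carrier R" "h e \<in> carrier R" using P e by auto
    thus ?thesis using beta_closed[OF P, of e] beta_closed[OF P(2,1), of e]
      by (simp add: a_comm[of "g e" "h e"])
  qed
  thus ?thesis unfolding mult_G by (auto simp: restrict_def fun_eq_iff)
qed

text \<open>Burnside's lemma for conjugation: the fixed points of \<open>g\<close> form its
  centralizer, and summing over \<open>g\<close> counts commuting pairs.\<close>

lemma class_number_card:
  assumes fin: "finite (carrier R)"
  shows "class_number G * card (carrier R) ^ card B =
    card {(g, h). g \<in> carrier G \<and> h \<in> carrier G \<and> (\<forall>e\<in>B. \<beta> g h e = \<beta> h g e)}"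
proof -
  interpret GG: Group.group G by (rule group_G)
  let ?\<phi> = "\<lambda>g. \<lambda>h\<in>carrier G. g \<otimes>\<^bsub>G\<^esub> h \<otimes>\<^bsub>G\<^esub> inv\<^bsub>G\<^esub> g"
  interpret act: group_action G "carrier G" ?\<phi> by (rule GG.action_by_conjugation)
  have finG: "finite (carrier G)" using fin finite_basis by (auto simp: carrier_G intro: finite_PiE)
  have ord: "order G = card (carrier R) ^ card B"
    using finite_basis by (simp add: order_def carrier_G card_PiE)
  have inv: "invariants (carrier G) ?\<phi> g = {h \<in> carrier G. \<forall>e\<in>B. \<beta> g h e = \<beta> h g e}"
    if g: "g \<in> carrier G" for g
  proof -
    have "g \<otimes>\<^bsub>G\<^esub> h \<otimes>\<^bsub>G\<^esub> inv\<^bsub>G\<^esub> g = h \<longleftrightarrow> g \<otimes>\<^bsub>G\<^esub> h = h \<otimes>\<^bsub>G\<^esub> g" if h: "h \<in> carrier G" for h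
      using g h GG.inv_solve_right'[of h "g \<otimes>\<^bsub>G\<^esub> h" g] by (metis GG.m_closed)
    thus ?thesis unfolding invariants_def using commute_iff[OF g] by auto
  qed
  have "class_number G * order G = (\<Sum>g\<in>carrier G. card (invariants (carrier G) ?\<phi> g))"
    unfolding class_number_def by (rule act.burnside[OF finG finG])
  also have "\<dots> = (\<Sum>g\<in>carrier G. card {h \<in> carrier G. \<forall>e\<in>B. \<beta> g h e = \<beta> h g e})"
    using inv by (intro sum.cong) auto
  also have "\<dots> = card (SIGMA g:carrier G. {h \<in> carrier G. \<forall>e\<in>B. \<beta> g h e = \<beta> h g e})"
    using finG by (intro card_SigmaI[symmetric]) auto
  also have "(SIGMA g:carrier G. {h \<in> carrier G. \<forall>e\<in>B. \<beta> g h e = \<beta> h g e}) =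
      {(g, h). g \<in> carrier G \<and> h \<in> carrier G \<and> (\<forall>e\<in>B. \<beta> g h e = \<beta> h g e)}" by auto
  finally show ?thesis unfolding ord .
qed

end

lemma (in ring_hom_cring) hom_add_pow_int:
  assumes "x \<in> carrier R"
  shows "h ([(k::int)] \<cdot>\<^bsub>R\<^esub> x) = [k] \<cdot>\<^bsub>S\<^esub> h x"
proof -
  have nat: "h ([(n::nat)] \<cdot>\<^bsub>R\<^esub> x) = [n] \<cdot>\<^bsub>S\<^esub> h x" for n
    using assms by (induction n) auto
  show ?thesis
    using nat assms add_pow_int_ge[of k R x] add_pow_int_ge[of k S "h x"]
      add_pow_int_lt[of k R x] add_pow_int_lt[of k S "h x"]
    by (cases "k \<ge> 0") auto
qed

text \<open>The structure constants are integers, so \<open>\<beta>\<close> commutes with ring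
  homomorphisms, here with reduction modulo an ideal.\<close>

lemma (in ring_hom_cring) hom_beta:
  assumes g: "g \<in> lie_basis L \<rightarrow> carrier R" "k \<in> lie_basis L \<rightarrow> carrier R"
    and g': "\<And>b. b \<in> lie_basis L \<Longrightarrow> g' b = h (g b)" "\<And>b. b \<in> lie_basis L \<Longrightarrow> k' b = h (k b)"
  shows "h (beta L R g k e) = beta L S g' k' e"
proof -
  have cl: "(\<lambda>(b, c). [beta_coeff L b c e] \<cdot>\<^bsub>R\<^esub> (g b \<otimes>\<^bsub>R\<^esub> k c)) \<in> lie_basis L \<times> lie_basis L \<rightarrow> carrier R"
    using g by (auto intro!: R.add.int_pow_closed)
  show ?thesis
    unfolding beta_def hom_finsum[OF cl]
  proof (rule S.finsum_cong'[OF refl])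
    show "(\<lambda>(b, c). [beta_coeff L b c e] \<cdot>\<^bsub>S\<^esub> (g' b \<otimes>\<^bsub>S\<^esub> k' c)) \<in> lie_basis L \<times> lie_basis L \<rightarrow> carrier S"
      using g g' by (auto intro!: S.add.int_pow_closed S.m_closed hom_closed)
    fix z assume "z \<in> lie_basis L \<times> lie_basis L"
    then obtain b c where z: "z = (b, c)" "b \<in> lie_basis L" "c \<in> lie_basis L" by auto
    moreover have "g b \<in> carrier R" "k c \<in> carrier R" using g z by auto
    ultimately show "(h \<circ> (\<lambda>(b, c). [beta_coeff L b c e] \<cdot>\<^bsub>R\<^esub> (g b \<otimes>\<^bsub>R\<^esub> k c))) z =
      (case z of (b, c) \<Rightarrow> [beta_coeff L b c e] \<cdot>\<^bsub>S\<^esub> (g' b \<otimes>\<^bsub>S\<^esub> k' c))"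
      using g' by (simp add: hom_add_pow_int)
  qed
qed

section \<open>Class numbers as counts of commuting pairs\<close>

context number_field_loc
begin

lemma ring_of_integers_eq: "ring_of_integers K = ring_on \<O>"
  by (simp add: ring_of_integers_def ints_def)

lemma cring_ints: "cring (ring_on \<O>)"
  by (intro cring_ring_on ints_0 ints_1 ints_minus ints_add ints_mult)

interpretation OK: cring "ring_on \<O>" by (rule cring_ints)

lemma a_inv_ring_on: "x \<in> \<O> \<Longrightarrow> \<ominus>\<^bsub>ring_on \<O>\<^esub> x = - x"
  by (rule OK.minus_equality) (auto intro: ints_minus)

lemma ideal_iff: "ideal I (ring_on \<O>) \<longleftrightarrow> is_ideal I"
proof
  assume "ideal I (ring_on \<O>)"
  then interpret I: ideal I "ring_on \<O>" .
  show "is_ideal I"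
    unfolding is_ideal_def using I.a_subset I.zero_closed I.a_closed I.I_l_closed by auto
next
  assume I: "is_ideal I"
  show "ideal I (ring_on \<O>)"
  proof (rule idealI[OF OK.ring_axioms])
    have "\<ominus>\<^bsub>ring_on \<O>\<^esub> x \<in> I" if "x \<in> I" for x
      using that a_inv_ring_on[of x] ideal_minus[OF I] idealD(1)[OF I] by simp
    thus "subgroup I (add_monoid (ring_on \<O>))"
      using idealD(1-3)[OF I] by (intro OK.add.subgroupI) auto
  qed (auto intro: idealD[OF I])
qed

lemma nonzero_ideals_eq: "nonzero_ideals K = {I. proper_ideal I}"
  by (simp add: nonzero_ideals_def ring_of_integers_eq ideal_iff)

lemma nonzero_primes_eq: "nonzero_primes K = {P. is_prime P}"
proof -
  have "primeideal P (ring_on \<O>) \<and> P \<noteq> {0} \<longleftrightarrow> is_prime P" for P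
  proof
    assume "primeideal P (ring_on \<O>) \<and> P \<noteq> {0}"
    then interpret P: primeideal P "ring_on \<O>" by blast
    show "is_prime P" unfolding is_prime_def
      using P.I_notcarr P.I_prime P.ideal_axioms \<open>_ \<and> P \<noteq> {0}\<close> by (auto simp: ideal_iff)
  next
    assume P: "is_prime P"
    have "primeideal P (ring_on \<O>)"
      by (rule primeidealI) (use P cring_ints ideal_iff[of P] in \<open>auto simp: is_prime_def\<close>)
    thus "primeideal P (ring_on \<O>) \<and> P \<noteq> {0}" using primeD(2)[OF P] by simp
  qed
  thus ?thesis by (simp add: nonzero_primes_def ring_of_integers_eq)
qed

lemma coset_eq: "is_ideal I \<Longrightarrow> I +>\<^bsub>ring_on \<O>\<^esub> x = {y. diff_rel I x y}"
proof -
  assume I: "is_ideal I"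
  have "(\<exists>h\<in>I. y = h + x) \<longleftrightarrow> x - y \<in> I" for y
    using ideal_diff_commute[OF I, of x y] by (metis add_diff_cancel_right' diff_add_cancel)
  thus ?thesis by (auto simp: a_r_coset_def' diff_rel_def)
qed

lemma carrier_Quot: "is_ideal I \<Longrightarrow> carrier (ring_on \<O> Quot I) = class_set (diff_rel I) \<O>"
  using coset_eq by (auto simp: FactRing_def A_RCOSETS_def' class_set_def)

lemma ideal_index_eq: "is_ideal I \<Longrightarrow> ideal_index K I = index I"
  using carrier_Quot[of I]
  by (simp add: ideal_index_def ring_of_integers_eq index_def class_count_def FactRing_def)

text \<open>Vectors are functions on the whole index type, constrained on \<open>A\<close> only. The
  relation \<open>vec_rel\<close> does not see other values, so restricting to a smaller index set
  and gluing need no conversion.\<close>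

definition vecs :: "'i set \<Rightarrow> ('i \<Rightarrow> 'a) set" where
  "vecs A = {x. \<forall>i\<in>A. x i \<in> \<O>}"

definition vec_rel :: "'a set \<Rightarrow> 'i set \<Rightarrow> ('i \<Rightarrow> 'a) \<Rightarrow> ('i \<Rightarrow> 'a) \<Rightarrow> bool" where
  "vec_rel I A x y \<longleftrightarrow> (\<forall>i\<in>A. x i - y i \<in> I)"

lemma equivp_vec_rel: "is_ideal I \<Longrightarrow> equivp (vec_rel I A)"
proof -
  assume I: "is_ideal I"
  have *: "vec_rel I A x y \<longleftrightarrow> (\<forall>i\<in>A. diff_rel I (x i) (y i))" for x y
    by (simp add: vec_rel_def diff_rel_def)
  show ?thesis
    using equivp_diff_rel[OF I] by (intro equivpI reflpI sympI transpI)
      (auto simp: * intro: equivp_reflp equivp_symp equivp_transp[of "diff_rel I"])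
qed

lemma vecsD: "x \<in> vecs A \<Longrightarrow> i \<in> A \<Longrightarrow> x i \<in> \<O>"
  by (simp add: vecs_def)

lemma class_count_vecs:
  fixes A :: "'i set"
  assumes A: "finite A" and I: "proper_ideal I"
  shows "class_count (vec_rel I A) (vecs A) = index I ^ card A"
    and "finite (class_set (vec_rel I A) (vecs A))"
proof -
  note I' = conjunct1[OF I]
  have "class_count (vec_rel I A) (vecs A) = index I ^ card A \<and> finite (class_set (vec_rel I A) (vecs A))"
    using A
  proof (induction A rule: finite_induct)
    case empty
    have "class_set (vec_rel I {}) (vecs {}) = {UNIV :: ('i \<Rightarrow> 'a) set}"
      by (auto simp: class_set_def vec_rel_def vecs_def)
    thus ?case by (simp add: class_count_def)
  next
    case (insert a A)
    let ?E = "pair_rel (vec_rel I A) (diff_rel I)"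
    have E: "equivp ?E" "equivp (vec_rel I (insert a A))" "equivp (vec_rel I A)" "equivp (diff_rel I)"
      by (intro equivp_pair_rel equivp_vec_rel equivp_diff_rel I')+
    have ex: "\<exists>h. bij_betw h (class_set (vec_rel I (insert a A)) (vecs (insert a A))) (class_set ?E (vecs A \<times> \<O>))"
    proof (rule class_set_bij[OF E(2,1), where f = "\<lambda>x. (x, x a)"])
      fix v assume "v \<in> vecs A \<times> \<O>"
      then obtain x y where xy: "v = (x, y)" "x \<in> vecs A" "y \<in> \<O>" by auto
      hence "x(a := y) \<in> vecs (insert a A)" by (auto simp: vecs_def)
      moreover have "?E (x(a := y), (x(a := y)) a) v"
        using insert.hyps idealD(2)[OF I'] xy by (auto simp: vec_rel_def diff_rel_def)
      ultimately show "\<exists>x\<in>vecs (insert a A). ?E (x, x a) v" by blast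
    qed (auto simp: vecs_def vec_rel_def diff_rel_def)
    have prod: "class_count ?E (vecs A \<times> \<O>) = index I ^ card A * index I" "finite (class_set ?E (vecs A \<times> \<O>))"
      using class_count_times[OF E(3,4) _ finite_class_set[OF I]] insert.IH by (auto simp: index_def)
    show ?case
      using ex prod insert.hyps bij_betw_finite bij_betw_same_card unfolding class_count_def
      by (metis card_insert_disjoint mult.commute power_Suc)
  qed
  thus "class_count (vec_rel I A) (vecs A) = index I ^ card A" "finite (class_set (vec_rel I A) (vecs A))" by auto
qed

definition x_basis :: "lie_lattice \<Rightarrow> basis_elt set" where
  "x_basis L = lie_basis L \<inter> range X"

text \<open>The coordinate at \<open>e\<close> of the bracket, that is, of
  \<open>\<beta>(x,y) - \<beta>(y,x)\<close>.\<close>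

definition lie_form :: "lie_lattice \<Rightarrow> basis_elt \<Rightarrow> (basis_elt \<Rightarrow> 'a) \<Rightarrow> (basis_elt \<Rightarrow> 'a) \<Rightarrow> 'a" where
  "lie_form L e x y = (\<Sum>(b, c)\<in>x_basis L \<times> x_basis L. of_int (beta_coeff L b c e) * (x b * y c - y b * x c))"

definition comm_pairs :: "lie_lattice \<Rightarrow> 'a set \<Rightarrow> ((basis_elt \<Rightarrow> 'a) \<times> (basis_elt \<Rightarrow> 'a)) set" where
  "comm_pairs L I = {(x, y). x \<in> vecs (x_basis L) \<and> y \<in> vecs (x_basis L) \<and> (\<forall>e\<in>lie_basis L. lie_form L e x y \<in> I)}"

definition comm_count :: "lie_lattice \<Rightarrow> 'a set \<Rightarrow> nat" where
  "comm_count L I = class_count (pair_rel (vec_rel I (x_basis L)) (vec_rel I (x_basis L))) (comm_pairs L I)"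

lemma lie_form_cong_mod:
  assumes I: "is_ideal I" and x: "x \<in> vecs (x_basis L)" "x' \<in> vecs (x_basis L)" "vec_rel I (x_basis L) x x'"
    and y: "y \<in> vecs (x_basis L)" "y' \<in> vecs (x_basis L)" "vec_rel I (x_basis L) y y'"
  shows "lie_form L e x y - lie_form L e x' y' \<in> I"
proof -
  have "of_int (beta_coeff L b c e) * (x b * y c - y b * x c) -
      of_int (beta_coeff L b c e) * (x' b * y' c - y' b * x' c) \<in> I"
    if bc: "b \<in> x_basis L" "c \<in> x_basis L" for b c
  proof -
    have *: "x b - x' b \<in> I" "x c - x' c \<in> I" "y b - y' b \<in> I" "y c - y' c \<in> I"
      using x y bc by (auto simp: vec_rel_def)
    note O = vecsD[OF x(1)] vecsD[OF x(2)] vecsD[OF y(1)] vecsD[OF y(2)]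
    have "of_int (beta_coeff L b c e) * (x b * y c - y b * x c) -
      of_int (beta_coeff L b c e) * (x' b * y' c - y' b * x' c) =
      of_int (beta_coeff L b c e) * ((y c * (x b - x' b) + x' b * (y c - y' c)) - (x c * (y b - y' b) + y' b * (x c - x' c)))"
      by (simp add: algebra_simps)
    also have "\<dots> \<in> I"
      by (intro idealD(4)[OF I] ideal_diff[OF I] idealD(3)[OF I] ints_of_int * O bc)
    finally show ?thesis .
  qed
  thus ?thesis unfolding lie_form_def sum_subtractf[symmetric] by (intro ideal_sum[OF I]) auto
qed

lemma finsum_ring_on: "finite A \<Longrightarrow> f \<in> A \<rightarrow> \<O> \<Longrightarrow> finsum (ring_on \<O>) f A = sum f A"
  by (induction A rule: finite_induct) (simp_all add: Pi_def)

lemma add_pow_ring_on: "x \<in> \<O> \<Longrightarrow> [(k::int)] \<cdot>\<^bsub>ring_on \<O>\<^esub> x = of_int k * x"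
proof -
  assume x: "x \<in> \<O>"
  have nat: "[(n::nat)] \<cdot>\<^bsub>ring_on \<O>\<^esub> x = of_nat n * x" for n
    using x by (induction n) (auto simp: algebra_simps)
  show ?thesis
  proof (cases "k \<ge> 0")
    case True
    thus ?thesis using nat[of "nat k"] by (simp add: add_pow_int_ge)
  next
    case False
    hence "[k] \<cdot>\<^bsub>ring_on \<O>\<^esub> x = \<ominus>\<^bsub>ring_on \<O>\<^esub> (of_nat (nat (- k)) * x)"
      by (simp add: add_pow_int_lt nat del: of_nat_nat)
    also have "\<dots> = - (of_nat (nat (- k)) * x)"
      by (intro a_inv_ring_on ints_mult ints_of_nat x)
    also have "\<dots> = of_int k * x" using False by simp
    finally show ?thesis .
  qed
qed

lemma lie_form_beta:
  assumes L: "two_step L" and x: "x \<in> vecs (lie_basis L)" and y: "y \<in> vecs (lie_basis L)"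
  shows "beta L (ring_on \<O>) x y e - beta L (ring_on \<O>) y x e = lie_form L e x y"
    "beta L (ring_on \<O>) x y e \<in> \<O>"
proof -
  let ?B = "lie_basis L"
  have fin: "finite (?B \<times> ?B)" using L by (simp add: two_step_def)
  have b: "beta L (ring_on \<O>) x y e = (\<Sum>(b, c)\<in>?B \<times> ?B. of_int (beta_coeff L b c e) * (x b * y c))"
    if "x \<in> vecs ?B" "y \<in> vecs ?B" for x y
  proof -
    have "beta L (ring_on \<O>) x y e =
        (\<Sum>z\<in>?B \<times> ?B. (\<lambda>(b, c). [beta_coeff L b c e] \<cdot>\<^bsub>ring_on \<O>\<^esub> (x b * y c)) z)"
      unfolding beta_def ring_on_simps
      by (rule finsum_ring_on[OF fin]) (use that in \<open>auto simp: add_pow_ring_on vecs_def ints_mult ints_of_int\<close>)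
    also have "\<dots> = (\<Sum>(b, c)\<in>?B \<times> ?B. of_int (beta_coeff L b c e) * (x b * y c))"
      by (intro sum.cong) (use that in \<open>auto simp: add_pow_ring_on vecs_def ints_mult\<close>)
    finally show ?thesis .
  qed
  show "beta L (ring_on \<O>) x y e \<in> \<O>"
    unfolding b[OF x y] using x y by (intro ints_sum) (auto simp: vecs_def intro!: ints_mult ints_of_int)
  have "beta L (ring_on \<O>) x y e - beta L (ring_on \<O>) y x e =
      (\<Sum>(b, c)\<in>?B \<times> ?B. of_int (beta_coeff L b c e) * (x b * y c - y b * x c))"
    unfolding b[OF x y] b[OF y x] sum_subtractf[symmetric]
    by (intro sum.cong) (auto simp: algebra_simps)
  also have "\<dots> = lie_form L e x y"
    unfolding lie_form_def
    by (rule sum.mono_neutral_right[OF fin]) (auto simp: x_basis_def intro!: beta_coeff_eq_0[OF L])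
  finally show "beta L (ring_on \<O>) x y e - beta L (ring_on \<O>) y x e = lie_form L e x y" .
qed

lemma lie_form_cong:
  "(\<And>b. b \<in> x_basis L \<Longrightarrow> x b = x' b) \<Longrightarrow> (\<And>b. b \<in> x_basis L \<Longrightarrow> y b = y' b) \<Longrightarrow>
    lie_form L e x y = lie_form L e x' y'"
  unfolding lie_form_def by (intro sum.cong) auto

lemma finite_comm_pairs:
  assumes L: "two_step L" and I: "proper_ideal I"
  shows "finite (class_set (pair_rel (vec_rel I (x_basis L)) (vec_rel I (x_basis L))) (comm_pairs L I))"
    and "comm_count L I \<le> index I ^ (2 * card (x_basis L))"
proof -
  have fin: "finite (x_basis L)" using L by (simp add: two_step_def x_basis_def)
  note E = equivp_vec_rel[OF conjunct1[OF I], of "x_basis L"]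
  let ?V = "vecs (x_basis L)" and ?E = "pair_rel (vec_rel I (x_basis L)) (vec_rel I (x_basis L))"
  have V: "class_count ?E (?V \<times> ?V) = index I ^ card (x_basis L) * index I ^ card (x_basis L)"
    "finite (class_set ?E (?V \<times> ?V))"
    using class_count_times[OF E E] class_count_vecs[OF fin I] by simp_all
  have sub: "comm_pairs L I \<subseteq> ?V \<times> ?V" by (auto simp: comm_pairs_def)
  show "finite (class_set ?E (comm_pairs L I))"
    by (rule finite_subset[OF class_set_mono[OF sub] V(2)])
  show "comm_count L I \<le> index I ^ (2 * card (x_basis L))"
    unfolding comm_count_def using class_count_mono[OF V(2) sub] V(1) by (simp add: mult_2 power_add)
qed

text \<open>Let \<open>N\<close> be the index and let there be \<open>d\<close> generators
  \<open>X\<close> and \<open>m\<close> generators \<open>Y\<close>. The \<open>Y\<close>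
  coordinates of a commuting pair are free, which gives a factor \<open>N^(2m)\<close>, and the
  group has order \<open>N^(d+m)\<close>. Keeping \<open>N^d\<close> on the left avoids
  division.\<close>

theorem class_number_comm_count:
  assumes L: "two_step L" and I: "proper_ideal I"
  shows "class_number (unipotent_group L (ring_of_integers K Quot I)) * index I ^ card (x_basis L) =
    index I ^ card (lie_basis L - x_basis L) * comm_count L I"
proof -
  let ?B = "lie_basis L" and ?S = "ring_on \<O> Quot I"
  note I' = conjunct1[OF I]
  interpret II: ideal I "ring_on \<O>" using I' ideal_iff by blast
  interpret h: ring_hom_cring "ring_on \<O>" ?S "(+>\<^bsub>ring_on \<O>\<^esub>) I"
    by (rule II.rcos_ring_hom_cring[OF cring_ints])
  interpret U: unipotent ?S L
    using L h.S.cring_axioms by (simp add: unipotent_def unipotent_axioms_def)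
  have fin: "finite ?B" using L by (simp add: two_step_def)
  have card_S: "card (carrier ?S) = index I" "finite (carrier ?S)"
    using carrier_Quot[OF I'] finite_class_set[OF I] by (auto simp: index_def class_count_def)
  define \<pi> where "\<pi> = (\<lambda>x :: basis_elt \<Rightarrow> 'a. \<lambda>b\<in>?B. I +>\<^bsub>ring_on \<O>\<^esub> x b)"
  have eq_iff: "I +>\<^bsub>ring_on \<O>\<^esub> x = I +>\<^bsub>ring_on \<O>\<^esub> y \<longleftrightarrow> x - y \<in> I" for x y
    unfolding coset_eq[OF I'] class_eq_iff[OF equivp_diff_rel[OF I']] by (rule diff_rel_def)
  let ?Pairs = "{(g, h). g \<in> carrier (unipotent_group L ?S) \<and> h \<in> carrier (unipotent_group L ?S) \<and>
      (\<forall>e\<in>?B. beta L ?S g h e = beta L ?S h g e)}"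
  let ?U = "{(x, y). x \<in> vecs ?B \<and> y \<in> vecs ?B \<and> (\<forall>e\<in>?B. lie_form L e x y \<in> I)}"
  let ?E = "pair_rel (vec_rel I ?B) (vec_rel I ?B)"
  have \<pi>: "\<pi> x \<in> carrier (unipotent_group L ?S)" if "x \<in> vecs ?B" for x
    using that unfolding U.carrier_G \<pi>_def by (auto simp: vecs_def)
  have \<pi>_eq: "\<pi> x = \<pi> y \<longleftrightarrow> vec_rel I ?B x y" for x y
    unfolding \<pi>_def vec_rel_def using eq_iff by (auto simp: fun_eq_iff restrict_def)
  have comm: "(\<forall>e\<in>?B. beta L ?S (\<pi> x) (\<pi> y) e = beta L ?S (\<pi> y) (\<pi> x) e) \<longleftrightarrow> (\<forall>e\<in>?B. lie_form L e x y \<in> I)"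
    if xy: "x \<in> vecs ?B" "y \<in> vecs ?B" for x y
  proof -
    have b: "beta L ?S (\<pi> x) (\<pi> y) e = I +>\<^bsub>ring_on \<O>\<^esub> beta L (ring_on \<O>) x y e"
      if "x \<in> vecs ?B" "y \<in> vecs ?B" for x y e
      by (rule h.hom_beta[symmetric]) (use that in \<open>auto simp: \<pi>_def vecs_def\<close>)
    show ?thesis unfolding b[OF xy] b[OF xy(2,1)] eq_iff lie_form_beta(1)[OF L xy] ..
  qed
  have surj: "\<exists>x\<in>vecs ?B. \<pi> x = g" if g: "g \<in> carrier (unipotent_group L ?S)" for g
  proof -
    have "\<forall>b. \<exists>x. b \<in> ?B \<longrightarrow> x \<in> \<O> \<and> g b = I +>\<^bsub>ring_on \<O>\<^esub> x"
    proof
      fix b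
      show "\<exists>x. b \<in> ?B \<longrightarrow> x \<in> \<O> \<and> g b = I +>\<^bsub>ring_on \<O>\<^esub> x"
      proof (cases "b \<in> ?B")
        case True
        hence "g b \<in> carrier ?S" using g by (auto simp: U.carrier_G)
        thus ?thesis by (auto simp: carrier_Quot[OF I'] class_set_def coset_eq[OF I'])
      qed simp
    qed
    from choice[OF this] obtain x where x: "\<forall>b. b \<in> ?B \<longrightarrow> x b \<in> \<O> \<and> g b = I +>\<^bsub>ring_on \<O>\<^esub> x b" by blast
    have "\<pi> x = g"
    proof
      fix b show "\<pi> x b = g b" using x g by (cases "b \<in> ?B") (auto simp: \<pi>_def U.carrier_G PiE_def extensional_def)
    qed
    thus ?thesis using x by (auto simp: vecs_def)
  qed
  have E: "equivp ?E" by (intro equivp_pair_rel equivp_vec_rel I')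
  have "card ?Pairs = class_count (=) ?Pairs"
    by (auto simp: class_count_def class_set_def card_image inj_on_def)
  also have "\<dots> = class_count ?E ?U"
  proof (rule class_count_bij[symmetric, where f = "\<lambda>(x, y). (\<pi> x, \<pi> y)"])
    show "equivp ((=) :: _ \<Rightarrow> (basis_elt \<Rightarrow> 'a set) \<times> (basis_elt \<Rightarrow> 'a set) \<Rightarrow> bool)" by (rule identity_equivp)
    show "(\<lambda>(x, y). (\<pi> x, \<pi> y)) z \<in> ?Pairs" if "z \<in> ?U" for z
      using that comm \<pi> by auto
    show "(\<lambda>(x, y). (\<pi> x, \<pi> y)) z = (\<lambda>(x, y). (\<pi> x, \<pi> y)) z' \<longleftrightarrow> ?E z z'" for z z'
      by (cases z, cases z') (simp add: \<pi>_eq)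
    show "\<exists>x\<in>?U. (\<lambda>(x, y). (\<pi> x, \<pi> y)) x = v" if v: "v \<in> ?Pairs" for v
    proof -
      obtain g k where gk: "v = (g, k)" "g \<in> carrier (unipotent_group L ?S)" "k \<in> carrier (unipotent_group L ?S)"
        "\<forall>e\<in>?B. beta L ?S g k e = beta L ?S k g e" using v by auto
      obtain x y where xy: "x \<in> vecs ?B" "\<pi> x = g" "y \<in> vecs ?B" "\<pi> y = k" using surj gk by blast
      hence "(x, y) \<in> ?U" using comm[of x y] gk(4) by simp
      thus ?thesis using gk(1) xy by (intro bexI[of _ "(x, y)"]) auto
    qed
  qed (rule E)
  also have "\<dots> = class_count (pair_rel (pair_rel (vec_rel I (x_basis L)) (vec_rel I (x_basis L)))
        (pair_rel (vec_rel I (?B - x_basis L)) (vec_rel I (?B - x_basis L))))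
      (comm_pairs L I \<times> (vecs (?B - x_basis L) \<times> vecs (?B - x_basis L)))" (is "_ = class_count (pair_rel ?EX ?EY) _")
  \<comment> \<open>The same pair is read twice, once modulo its \<open>X\<close> coordinates and
    once modulo its \<open>Y\<close> coordinates.\<close>
  proof (rule class_count_bij[where f = "\<lambda>z. (z, z)"])
    show "equivp (pair_rel ?EX ?EY)" by (intro equivp_pair_rel equivp_vec_rel I')
    have sp: "?B = x_basis L \<union> (?B - x_basis L)" by (auto simp: x_basis_def)
    show "(z, z) \<in> comm_pairs L I \<times> (vecs (?B - x_basis L) \<times> vecs (?B - x_basis L))" if "z \<in> ?U" for z
      using that by (auto simp: comm_pairs_def vecs_def x_basis_def)
    show "pair_rel ?EX ?EY (z, z) (z', z') \<longleftrightarrow> ?E z z'" for z z'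
      by (cases z, cases z', subst (3 4) sp) (auto simp: vec_rel_def)
    show "\<exists>x\<in>?U. pair_rel ?EX ?EY (x, x) v"
      if v: "v \<in> comm_pairs L I \<times> (vecs (?B - x_basis L) \<times> vecs (?B - x_basis L))" for v
    proof -
      obtain x y x' y' where xy: "v = ((x, y), (x', y'))" "(x, y) \<in> comm_pairs L I"
        "x' \<in> vecs (?B - x_basis L)" "y' \<in> vecs (?B - x_basis L)" using v by auto
      define z w where "z = (\<lambda>b. if b \<in> x_basis L then x b else x' b)" and "w = (\<lambda>b. if b \<in> x_basis L then y b else y' b)"
      have "lie_form L e z w = lie_form L e x y" for e by (intro lie_form_cong) (auto simp: z_def w_def)
      hence "(z, w) \<in> ?U" using xy by (auto simp: vecs_def z_def w_def comm_pairs_def)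
      moreover have "pair_rel ?EX ?EY ((z, w), (z, w)) v"
        unfolding xy(1) using idealD(2)[OF I'] by (auto simp: vec_rel_def z_def w_def)
      ultimately show ?thesis by blast
    qed
  qed (rule E)
  also have "\<dots> = comm_count L I * (index I ^ card (?B - x_basis L) * index I ^ card (?B - x_basis L))"
  proof -
    have f: "finite (?B - x_basis L)" using fin by simp
    note c = class_count_vecs[OF f I] and e = equivp_vec_rel[OF I']
    have cc: "class_count ?EY (vecs (?B - x_basis L) \<times> vecs (?B - x_basis L)) =
        index I ^ card (?B - x_basis L) * index I ^ card (?B - x_basis L)"
      "finite (class_set ?EY (vecs (?B - x_basis L) \<times> vecs (?B - x_basis L)))"
      using class_count_times[OF e e c(2) c(2)] c(1) by simp_all
    show ?thesis
      unfolding class_count_times(1)[OF equivp_pair_rel[OF e e] equivp_pair_rel[OF e e] finite_comm_pairs(1)[OF L I] cc(2)]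
        cc(1) comm_count_def ..
  qed
  finally have "class_number (unipotent_group L ?S) * index I ^ card ?B =
      comm_count L I * (index I ^ card (?B - x_basis L) * index I ^ card (?B - x_basis L))"
    using U.class_number_card[OF card_S(2)] card_S(1) by simp
  moreover have "card ?B = card (x_basis L) + card (?B - x_basis L)"
    using fin card_Un_disjoint[of "x_basis L" "?B - x_basis L"]
    by (metis Diff_disjoint Diff_partition Int_lower1 finite_Diff finite_subset x_basis_def)
  ultimately show ?thesis
    using index_pos[OF I] by (simp add: power_add ring_of_integers_eq mult_ac)
qed

text \<open>Chinese remainder theorem in each coordinate; the bracket conditions transfer because
  \<open>lie_form\<close> respects congruences modulo \<open>I\<close> and modulo
  \<open>J\<close>.\<close>

lemma comm_count_Int:
  assumes L: "two_step L" and I: "proper_ideal I" and J: "proper_ideal J"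
    and ab: "a \<in> I" "b \<in> J" "a + b = 1"
  shows "comm_count L (I \<inter> J) = comm_count L I * comm_count L J"
proof -
  let ?A = "x_basis L"
  note I' = conjunct1[OF I] and J' = conjunct1[OF J]
  have "comm_pairs L (I \<inter> J) = comm_pairs L I \<inter> comm_pairs L J" by (auto simp: comm_pairs_def)
  moreover have "class_count (pair_rel (vec_rel (I \<inter> J) ?A) (vec_rel (I \<inter> J) ?A)) (comm_pairs L I \<inter> comm_pairs L J) =
      comm_count L I * comm_count L J"
    unfolding comm_count_def
  proof (rule class_count_inter)
    show "equivp (pair_rel (vec_rel I ?A) (vec_rel I ?A))" "equivp (pair_rel (vec_rel J ?A) (vec_rel J ?A))"
      by (intro equivp_pair_rel equivp_vec_rel I' J')+
    show "pair_rel (vec_rel (I \<inter> J) ?A) (vec_rel (I \<inter> J) ?A) z w \<longleftrightarrow>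
      pair_rel (vec_rel I ?A) (vec_rel I ?A) z w \<and> pair_rel (vec_rel J ?A) (vec_rel J ?A) z w" for z w
      by (cases z, cases w) (auto simp: vec_rel_def)
    fix u v assume uv: "u \<in> comm_pairs L I" "v \<in> comm_pairs L J"
    obtain x y x' y' where [simp]: "u = (x, y)" "v = (x', y')" by (cases u, cases v)
    have O: "x \<in> vecs ?A" "y \<in> vecs ?A" "x' \<in> vecs ?A" "y' \<in> vecs ?A" using uv by (auto simp: comm_pairs_def)
    have abO: "a \<in> \<O>" "b \<in> \<O>" using ab I' J' idealD(1) by blast+
    define m where "m = (\<lambda>(x :: basis_elt \<Rightarrow> 'a) x' i. a * x' i + b * x i)"
    have m: "m x x' \<in> vecs ?A" "vec_rel I ?A (m x x') x" "vec_rel J ?A (m x x') x'"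
      if "x \<in> vecs ?A" "x' \<in> vecs ?A" for x x'
    proof -
      show "m x x' \<in> vecs ?A" using that abO by (auto simp: m_def vecs_def intro!: ints_add ints_mult)
      have "m x x' i - x i = a * (x' i - x i) + (a + b - 1) * x i" "m x x' i - x' i = b * (x i - x' i) + (a + b - 1) * x' i" for i
        by (simp_all add: m_def algebra_simps)
      thus "vec_rel I ?A (m x x') x" "vec_rel J ?A (m x x') x'"
        using ab that by (auto simp: vec_rel_def vecs_def intro!: idealD(5)[OF I'] idealD(5)[OF J'] ints_diff)
    qed
    have "lie_form L e (m x x') (m y y') \<in> I \<inter> J" if e: "e \<in> lie_basis L" for e
    proof -
      have "lie_form L e (m x x') (m y y') - lie_form L e x y \<in> I"
        "lie_form L e (m x x') (m y y') - lie_form L e x' y' \<in> J"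
        using m O by (intro lie_form_cong_mod I' J'; simp)+
      moreover have "lie_form L e x y \<in> I" "lie_form L e x' y' \<in> J" using uv e by (auto simp: comm_pairs_def)
      ultimately show ?thesis using idealD(3)[OF I'] idealD(3)[OF J'] by (metis IntI diff_add_cancel)
    qed
    hence "(m x x', m y y') \<in> comm_pairs L I \<inter> comm_pairs L J" using m O by (auto simp: comm_pairs_def)
    thus "\<exists>z\<in>comm_pairs L I \<inter> comm_pairs L J. pair_rel (vec_rel I ?A) (vec_rel I ?A) z u \<and> pair_rel (vec_rel J ?A) (vec_rel J ?A) z v"
      using m O by (intro bexI[of _ "(m x x', m y y')"]) auto
  qed (use finite_comm_pairs(1)[OF L] I J in auto)
  ultimately show ?thesis by (simp add: comm_count_def)
qed

end

section \<open>Counting modulo prime powers\<close>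

text \<open>Used to pass between counts modulo \<open>P^k\<close> and \<open>P^(k+1)\<close>, where
  every fibre of the reduction map has the same number of elements.\<close>

lemma class_count_refine:
  assumes E: "equivp E" "equivp E'" and fin: "finite (class_set E U)"
    and le: "\<And>x y. x \<in> U \<Longrightarrow> y \<in> U \<Longrightarrow> E x y \<Longrightarrow> E' x y"
    and c: "\<And>u. u \<in> U \<Longrightarrow> class_count E {v \<in> U. E' u v} = c"
  shows "class_count E U = class_count E' U * c"
proof -
  have sub: "finite (class_set E {v \<in> U. E' u v})" for u
    by (rule finite_subset[OF class_set_mono fin]) auto
  have "class_set E' U = (\<lambda>c. \<Union>x\<in>c \<inter> U. {y. E' x y}) ` class_set E U"
  proof -
    have "{y. E' x y} = (\<Union>z\<in>{y. E x y} \<inter> U. {y. E' z y})" if "x \<in> U" for x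
    proof (intro subset_antisym subsetI)
      fix y assume "y \<in> {y. E' x y}"
      thus "y \<in> (\<Union>z\<in>{y. E x y} \<inter> U. {y. E' z y})" using that equivp_reflp[OF E(1)] by auto
    next
      fix y assume "y \<in> (\<Union>z\<in>{y. E x y} \<inter> U. {y. E' z y})"
      then obtain z where "E x z" "z \<in> U" "E' z y" by auto
      thus "y \<in> {y. E' x y}" using le[OF that, of z] equivp_transp[OF E(2)] by blast
    qed
    thus ?thesis by (simp add: class_set_def image_image cong: image_cong)
  qed
  hence fin': "finite (class_set E' U)" using fin by simp
  have "class_count E U = class_count (pair_rel E' E) (SIGMA u:U. {v \<in> U. E' u v})"
  proof (rule class_count_bij[symmetric, where f = snd])
    show "E (snd x) (snd y) \<longleftrightarrow> pair_rel E' E x y"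
      if xy: "x \<in> (SIGMA u:U. {v \<in> U. E' u v})" "y \<in> (SIGMA u:U. {v \<in> U. E' u v})" for x y
    proof -
      obtain u v u' v' where [simp]: "x = (u, v)" "y = (u', v')" by (cases x, cases y)
      have uv: "E' u v" "E' u' v'" "v \<in> U" "v' \<in> U" using xy by simp_all
      have "E' u u'" if "E v v'"
        using equivp_transp[OF E(2) equivp_transp[OF E(2) uv(1) le[OF uv(3,4) that]] equivp_symp[OF E(2) uv(2)]] .
      thus ?thesis by auto
    qed
    show "\<exists>x\<in>SIGMA u:U. {v \<in> U. E' u v}. E (snd x) v" if "v \<in> U" for v
      using that equivp_reflp[OF E(1)] equivp_reflp[OF E(2)] by (intro bexI[of _ "(v, v)"]) auto
  qed (auto intro: equivp_pair_rel E)
  also have "\<dots> = class_count E' U * c"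
  proof (rule class_count_fiber(1)[OF E(2,1) fin' sub c])
    fix x x' assume "E' x x'"
    hence "E' x = E' x'" using E(2) by (simp add: equivp_def)
    thus "{v \<in> U. E' x v} = {v \<in> U. E' x' v}" by simp
  qed
  finally show ?thesis .
qed

locale prime_ideal_loc = number_field_loc +
  fixes P :: "'a set"
  assumes P: "is_prime P"
begin

abbreviation "M \<equiv> prime_pow P"
abbreviation "q \<equiv> index P"
abbreviation "\<pi> \<equiv> uniformizer P"

abbreviation vrel :: "nat \<Rightarrow> 'i set \<Rightarrow> ('i \<Rightarrow> 'a) \<Rightarrow> ('i \<Rightarrow> 'a) \<Rightarrow> bool" where
  "vrel k \<equiv> vec_rel (M k)"

lemma idP: "is_ideal P" using primeD(1)[OF P] .

lemma idM: "is_ideal (M k)" by (rule is_ideal_prime_pow)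

lemma equivp_vrel: "equivp (vrel k A)" by (rule equivp_vec_rel[OF idM])

lemma equivp_drel: "equivp (diff_rel (M k))" by (rule equivp_diff_rel[OF idM])

lemma M_Suc_P: "x \<in> M (Suc k) \<Longrightarrow> x \<in> P" using prime_pow_Suc_subset[OF P] by blast

lemma M_O: "x \<in> M k \<Longrightarrow> x \<in> \<O>" by (rule prime_pow_ideal(1))

lemma P_O: "x \<in> P \<Longrightarrow> x \<in> \<O>" by (rule idealD(1)[OF idP])

lemma M_mult_iff: "x \<in> \<O> \<Longrightarrow> \<pi> * x \<in> M (Suc k) \<longleftrightarrow> x \<in> M k"
  by (rule uniformizer_mult_iff[OF P])

lemma unit_cancel: "t \<in> \<O> \<Longrightarrow> t \<notin> P \<Longrightarrow> z \<in> \<O> \<Longrightarrow> t * z \<in> M k \<longleftrightarrow> z \<in> M k"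
  using prime_pow_primary[OF P, of t z k] prime_pow_ideal(4)[of t z P k] by blast

lemma M_cong: "x - y \<in> M k \<Longrightarrow> x \<in> M k \<longleftrightarrow> y \<in> M k"
  using prime_pow_ideal(3)[of "x - y" P k y] ideal_diff[OF idM, of x k "x - y"] by auto

definition pvecs :: "'i set \<Rightarrow> ('i \<Rightarrow> 'a) set" where
  "pvecs A = {x. \<forall>i\<in>A. x i \<in> P}"

text \<open>Unimodular vectors: a coordinate outside \<open>P\<close> is a unit modulo every power
  of \<open>P\<close>.\<close>

definition prim_vecs :: "'i set \<Rightarrow> ('i \<Rightarrow> 'a) set" where
  "prim_vecs A = {x \<in> vecs A. \<exists>i\<in>A. x i \<notin> P}"

lemma vecs_split: "vecs A = prim_vecs A \<union> pvecs A"
  using P_O by (auto simp: vecs_def pvecs_def prim_vecs_def)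

lemma prim_not_pvecs:
  assumes "x \<in> prim_vecs A" "y \<in> pvecs A"
  shows "\<not> vrel (Suc k) A x y"
proof
  assume "vrel (Suc k) A x y"
  obtain i where i: "i \<in> A" "x i \<notin> P" using assms by (auto simp: prim_vecs_def)
  hence "x i - y i \<in> P" "y i \<in> P" using \<open>vrel (Suc k) A x y\<close> assms(2) M_Suc_P by (auto simp: vec_rel_def pvecs_def)
  thus False using i idealD(3)[OF idP, of "x i - y i" "y i"] by simp
qed

lemma count_vecs:
  assumes "finite A"
  shows "class_count (vrel k A) (vecs A) = q ^ (k * card A)" "finite (class_set (vrel k A) (vecs A))"
  using class_count_vecs[OF assms proper_prime_pow[OF P]] index_prime_pow[OF P] by (auto simp: power_mult)

lemma finite_class_vecs: "finite A \<Longrightarrow> U \<subseteq> vecs A \<Longrightarrow> finite (class_set (vrel k A) U)"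
  using count_vecs(2)[of A k] class_set_mono[of U "vecs A" "vrel k A"] finite_subset by blast

lemma count_ints: "class_count (diff_rel (M k)) \<O> = q ^ k" "finite (class_set (diff_rel (M k)) \<O>)"
  using index_prime_pow[OF P, of k] finite_class_set[OF proper_prime_pow[OF P, of k]] by (auto simp: index_def)

lemma finite_class_pair:
  assumes "finite A" "finite B" "U \<subseteq> vecs A \<times> vecs B"
  shows "finite (class_set (pair_rel (vrel k A) (vrel l B)) U)"
proof (rule finite_subset[OF class_set_mono[OF assms(3)]])
  show "finite (class_set (pair_rel (vrel k A) (vrel l B)) (vecs A \<times> vecs B))"
    by (rule class_count_times(2)[OF equivp_vrel equivp_vrel count_vecs(2) count_vecs(2)]) fact+
qed

text \<open>Together with the next two lemmas: multiplication by the uniformizer identifies vectors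
  modulo \<open>P^k\<close> with vectors divisible by \<open>P\<close> modulo
  \<open>P^(k+1)\<close>.\<close>

lemma scale_mem: "w \<in> vecs A \<Longrightarrow> (\<lambda>i. \<pi> * w i) \<in> pvecs A"
  using uniformizer(1)[OF P] idealD(5)[OF idP] by (auto simp: vecs_def pvecs_def)

lemma scale_rel:
  "w \<in> vecs A \<Longrightarrow> w' \<in> vecs A \<Longrightarrow> vrel (Suc k) A (\<lambda>i. \<pi> * w i) (\<lambda>i. \<pi> * w' i) \<longleftrightarrow> vrel k A w w'"
proof -
  assume w: "w \<in> vecs A" "w' \<in> vecs A"
  have "\<pi> * w i - \<pi> * w' i \<in> M (Suc k) \<longleftrightarrow> w i - w' i \<in> M k" if "i \<in> A" for i
    using M_mult_iff[of "w i - w' i" k] w that by (simp add: right_diff_distrib vecs_def ints_diff)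
  thus ?thesis by (simp add: vec_rel_def)
qed

lemma scale_surj:
  assumes "v \<in> pvecs A"
  obtains w where "w \<in> vecs A" "vrel k A (\<lambda>i. \<pi> * w i) v"
proof -
  have "\<forall>i. \<exists>y. i \<in> A \<longrightarrow> y \<in> \<O> \<and> v i - \<pi> * y \<in> M k"
    using uniformizer_divides[OF P] assms unfolding pvecs_def by (metis (mono_tags, lifting) mem_Collect_eq)
  from choice[OF this] obtain w where w: "\<forall>i. i \<in> A \<longrightarrow> w i \<in> \<O> \<and> v i - \<pi> * w i \<in> M k" by blast
  thus ?thesis using that[of w] ideal_diff_commute[OF idM] by (auto simp: vecs_def vec_rel_def)
qed

lemma count_pvecs:
  assumes "finite A"
  shows "class_count (vrel (Suc k) A) (pvecs A) = q ^ (k * card A)"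
proof -
  have "class_count (vrel k A) (vecs A) = class_count (vrel (Suc k) A) (pvecs A)"
  proof (rule class_count_bij[OF equivp_vrel equivp_vrel, where f = "\<lambda>w i. \<pi> * w i"])
    show "\<exists>w\<in>vecs A. vrel (Suc k) A (\<lambda>i. \<pi> * w i) v" if "v \<in> pvecs A" for v
      using scale_surj[OF that, of "Suc k"] by blast
  qed (auto simp: scale_mem scale_rel)
  thus ?thesis using count_vecs(1)[OF assms, of k] by simp
qed

lemma count_prim_vecs:
  assumes "finite A"
  shows "class_count (vrel (Suc k) A) (prim_vecs A) + q ^ (k * card A) = q ^ (Suc k * card A)"
  using class_count_Un[OF equivp_vrel, where U = "prim_vecs A" and V = "pvecs A" and k1 = "Suc k" and A1 = A]
    vecs_split[of A] count_vecs[OF assms, of "Suc k"] count_pvecs[OF assms, of k] prim_not_pvecs by metis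

lemma count_P: "class_count (diff_rel (M (Suc k))) P = q ^ k"
proof -
  have "class_count (diff_rel (M k)) \<O> = class_count (diff_rel (M (Suc k))) P"
  proof (rule class_count_bij[OF equivp_drel equivp_drel, where f = "\<lambda>w. \<pi> * w"])
    show "\<pi> * x \<in> P" if "x \<in> \<O>" for x using that uniformizer(1)[OF P] by (rule idealD(5)[OF idP])
    show "diff_rel (M (Suc k)) (\<pi> * x) (\<pi> * y) \<longleftrightarrow> diff_rel (M k) x y" if "x \<in> \<O>" "y \<in> \<O>" for x y
      using M_mult_iff[OF ints_diff[OF that]] by (simp add: diff_rel_def right_diff_distrib)
    show "\<exists>x\<in>\<O>. diff_rel (M (Suc k)) (\<pi> * x) v" if "v \<in> P" for v
      using uniformizer_divides[OF P that, of "Suc k"] ideal_diff_commute[OF idM] by (metis diff_rel_def)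
  qed
  thus ?thesis using count_ints(1) by simp
qed

text \<open>All fibres of reduction from \<open>P^(k+1)\<close> to \<open>P^k\<close> are translates
  of the fibre over 0, and comparing the total numbers of vectors gives their common size.\<close>

lemma count_translate:
  assumes A: "finite A" and u: "u \<in> vecs A"
  shows "class_count (vrel (Suc k) A) {v \<in> vecs A. vrel k A u v} = q ^ card A"
proof -
  let ?Z = "{v :: 'b \<Rightarrow> 'a. \<forall>i\<in>A. v i \<in> M k}"
  have tr: "class_count (vrel (Suc k) A) {v \<in> vecs A. vrel k A u v} = class_count (vrel (Suc k) A) ?Z"
    if u: "u \<in> vecs A" for u
  proof (rule class_count_bij[OF equivp_vrel equivp_vrel, where f = "\<lambda>v i. v i - u i"])
    show "(\<lambda>i. v i - u i) \<in> ?Z" if "v \<in> {v \<in> vecs A. vrel k A u v}" for v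
      using that ideal_diff_commute[OF idM] by (auto simp: vec_rel_def)
    show "\<exists>x\<in>{v \<in> vecs A. vrel k A u v}. vrel (Suc k) A (\<lambda>i. x i - u i) v" if v: "v \<in> ?Z" for v
    proof (intro bexI[of _ "\<lambda>i. u i + v i"])
      show "vrel (Suc k) A (\<lambda>i. u i + v i - u i) v" using idealD(2)[OF idM] by (simp add: vec_rel_def)
      show "(\<lambda>i. u i + v i) \<in> {v \<in> vecs A. vrel k A u v}"
      proof -
        have "u i + v i \<in> \<O>" if "i \<in> A" for i
          using u v that by (intro ints_add M_O[of "v i" k]) (auto simp: vecs_def)
        thus ?thesis using v ideal_minus[OF idM] by (auto simp: vecs_def vec_rel_def)
      qed
    qed
  qed (auto simp: vec_rel_def)
  have "class_count (vrel (Suc k) A) (vecs A) = class_count (vrel k A) (vecs A) * class_count (vrel (Suc k) A) ?Z"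
  proof (rule class_count_refine[OF equivp_vrel equivp_vrel count_vecs(2)[OF A]])
    show "vrel k A x y" if "vrel (Suc k) A x y" for x y :: "'b \<Rightarrow> 'a"
      using that prime_pow_antimono[of k "Suc k" P] by (auto simp: vec_rel_def)
  qed (rule tr)
  moreover have "q ^ (Suc k * card A) = q ^ (k * card A) * q ^ card A" by (simp add: power_add mult.commute)
  ultimately have "q ^ (k * card A) * q ^ card A = q ^ (k * card A) * class_count (vrel (Suc k) A) ?Z"
    using count_vecs(1)[OF A, of "Suc k"] count_vecs(1)[OF A, of k] by metis
  moreover have "q \<noteq> 0" using index_pos[OF primeD(2)[OF P]] by simp
  ultimately show ?thesis using tr[OF u] by simp
qed

text \<open>The descent step of every recursion. Dividing \<open>w\<close> by the uniformizer turns
  a bilinear condition modulo \<open>P^(k+1)\<close> into one modulo \<open>P^k\<close>, which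
  depends on \<open>z\<close> modulo \<open>P^k\<close> only; the factor counts the lifts of
  \<open>z\<close>.\<close>

lemma scale_lift:
  assumes A: "finite A" and B: "finite B"
    and C: "\<And>w z. w \<in> vecs A \<Longrightarrow> z \<in> vecs B \<Longrightarrow> C' (\<lambda>i. \<pi> * w i) z \<longleftrightarrow> C w z"
    and satw: "\<And>w w' z. w \<in> vecs A \<Longrightarrow> w' \<in> vecs A \<Longrightarrow> z \<in> vecs B \<Longrightarrow> vrel (Suc k) A w w' \<Longrightarrow> C' w z \<Longrightarrow> C' w' z"
    and satz: "\<And>w z z'. w \<in> vecs A \<Longrightarrow> z \<in> vecs B \<Longrightarrow> z' \<in> vecs B \<Longrightarrow> vrel k B z z' \<Longrightarrow> C w z \<Longrightarrow> C w z'"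
  shows "class_count (pair_rel (vrel (Suc k) A) (vrel (Suc k) B)) {(w, z). w \<in> pvecs A \<and> z \<in> vecs B \<and> C' w z} =
    q ^ card B * class_count (pair_rel (vrel k A) (vrel k B)) {(w, z). w \<in> vecs A \<and> z \<in> vecs B \<and> C w z}"
proof -
  let ?U = "{(w, z). w \<in> vecs A \<and> z \<in> vecs B \<and> C w z}"
  have sub: "pvecs A \<subseteq> vecs A" using vecs_split by blast
  have "class_count (pair_rel (vrel (Suc k) A) (vrel (Suc k) B)) {(w, z). w \<in> pvecs A \<and> z \<in> vecs B \<and> C' w z} =
    class_count (pair_rel (vrel k A) (vrel (Suc k) B)) ?U"
  proof (rule class_count_bij[symmetric, where f = "\<lambda>(w, z). (\<lambda>i. \<pi> * w i, z)"])
    show "\<exists>x\<in>?U. pair_rel (vrel (Suc k) A) (vrel (Suc k) B) ((\<lambda>(w, z). (\<lambda>i. \<pi> * w i, z)) x) v"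
      if v: "v \<in> {(w, z). w \<in> pvecs A \<and> z \<in> vecs B \<and> C' w z}" for v
    proof -
      obtain w z where [simp]: "v = (w, z)" and wz: "w \<in> pvecs A" "z \<in> vecs B" "C' w z" using v by auto
      obtain y where y: "y \<in> vecs A" "vrel (Suc k) A (\<lambda>i. \<pi> * y i) w" using scale_surj[OF wz(1)] .
      have "C' (\<lambda>i. \<pi> * y i) z"
        using satw[of w "\<lambda>i. \<pi> * y i" z] wz y sub scale_mem[OF y(1)] equivp_symp[OF equivp_vrel] by blast
      hence "C y z" using C y wz by blast
      thus ?thesis using y wz equivp_reflp[OF equivp_vrel] by (intro bexI[of _ "(y, z)"]) auto
    qed
  qed (auto intro!: equivp_pair_rel equivp_vrel simp: scale_mem scale_rel C)
  also have "\<dots> = class_count (pair_rel (vrel k A) (vrel k B)) ?U * q ^ card B"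
  proof (rule class_count_refine)
    show "equivp (pair_rel (vrel k A) (vrel (Suc k) B))" "equivp (pair_rel (vrel k A) (vrel k B))"
      by (intro equivp_pair_rel equivp_vrel)+
    show "finite (class_set (pair_rel (vrel k A) (vrel (Suc k) B)) ?U)"
      by (rule finite_class_pair[OF A B]) auto
    show "pair_rel (vrel k A) (vrel k B) x y" if "pair_rel (vrel k A) (vrel (Suc k) B) x y" for x y
      using that prime_pow_antimono[of k "Suc k" P] by (cases x, cases y) (auto simp: vec_rel_def)
    fix u assume u: "u \<in> ?U"
    obtain w z where [simp]: "u = (w, z)" and wz: "w \<in> vecs A" "z \<in> vecs B" "C w z" using u by auto
    have "class_count (vrel (Suc k) B) {z' \<in> vecs B. vrel k B z z'} =
      class_count (pair_rel (vrel k A) (vrel (Suc k) B)) {v \<in> ?U. pair_rel (vrel k A) (vrel k B) u v}"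
    proof (rule class_count_bij[OF equivp_vrel, where f = "\<lambda>z'. (w, z')"])
      show "equivp (pair_rel (vrel k A) (vrel (Suc k) B))" by (intro equivp_pair_rel equivp_vrel)
      show "(w, z') \<in> {v \<in> ?U. pair_rel (vrel k A) (vrel k B) u v}" if "z' \<in> {z' \<in> vecs B. vrel k B z z'}" for z'
        using that wz satz equivp_reflp[OF equivp_vrel] by auto
      show "\<exists>z'\<in>{z' \<in> vecs B. vrel k B z z'}. pair_rel (vrel k A) (vrel (Suc k) B) (w, z') v"
        if "v \<in> {v \<in> ?U. pair_rel (vrel k A) (vrel k B) u v}" for v
        using that equivp_reflp[OF equivp_vrel] by (cases v) auto
    qed (auto intro: equivp_reflp[OF equivp_vrel])
    thus "class_count (pair_rel (vrel k A) (vrel (Suc k) B)) {v \<in> ?U. pair_rel (vrel k A) (vrel k B) u v} = q ^ card B"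
      using count_translate[OF B wz(2), of k] by simp
  qed
  finally show ?thesis by (simp add: mult.commute)
qed

section \<open>Pairs of vectors with vanishing tensor product\<close>

definition ann_pairs :: "nat \<Rightarrow> ('i \<Rightarrow> 'a) set \<Rightarrow> 'i set \<Rightarrow> 'j set \<Rightarrow> (('i \<Rightarrow> 'a) \<times> ('j \<Rightarrow> 'a)) set" where
  "ann_pairs k W A B = {(w, z). w \<in> W \<and> z \<in> vecs B \<and> (\<forall>i\<in>A. \<forall>j\<in>B. w i * z j \<in> M k)}"

text \<open>The number of \<open>w\<close> of length \<open>m\<close> and \<open>z\<close> of length
  \<open>e\<close> modulo \<open>P^k\<close> whose tensor product is 0. A primitive \<open>w\<close>
  forces \<open>z = 0\<close>, which is the first summand; a \<open>w\<close> divisible by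
  \<open>P\<close> is handled by \<open>scale_lift\<close>.\<close>

fun ann_count :: "nat \<Rightarrow> nat \<Rightarrow> nat \<Rightarrow> nat" where
  "ann_count m e 0 = 1"
| "ann_count m e (Suc k) = (q ^ (Suc k * m) - q ^ (k * m)) + q ^ e * ann_count m e k"

lemma mult_cong_left:
  assumes "x - y \<in> M k" "z \<in> \<O>" "y * z \<in> M k"
  shows "x * z \<in> M k"
proof -
  have "x * z = (x - y) * z + y * z" by (simp add: algebra_simps)
  thus ?thesis using assms prime_pow_ideal(3,5) by metis
qed

lemma count_ann_pvecs:
  assumes A: "finite A" and B: "finite B"
  shows "class_count (pair_rel (vrel (Suc k) A) (vrel (Suc k) B)) (ann_pairs (Suc k) (pvecs A) A B) =
    q ^ card B * class_count (pair_rel (vrel k A) (vrel k B)) (ann_pairs k (vecs A) A B)"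
  unfolding ann_pairs_def
proof (rule scale_lift[OF A B])
  show "(\<forall>i\<in>A. \<forall>j\<in>B. (\<pi> * w i) * z j \<in> M (Suc k)) \<longleftrightarrow> (\<forall>i\<in>A. \<forall>j\<in>B. w i * z j \<in> M k)"
    if "w \<in> vecs A" "z \<in> vecs B" for w z
    using that by (auto simp: mult.assoc M_mult_iff vecs_def ints_mult)
  show "\<forall>i\<in>A. \<forall>j\<in>B. w' i * z j \<in> M (Suc k)"
    if "z \<in> vecs B" "vrel (Suc k) A w w'" "\<forall>i\<in>A. \<forall>j\<in>B. w i * z j \<in> M (Suc k)" for w w' z
  proof (intro ballI)
    fix i j assume "i \<in> A" "j \<in> B"
    thus "w' i * z j \<in> M (Suc k)" using that ideal_diff_commute[OF idM, of "w i" "w' i" "Suc k"]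
      by (intro mult_cong_left[of "w' i" "w i"]) (auto simp: vec_rel_def vecs_def)
  qed
  show "\<forall>i\<in>A. \<forall>j\<in>B. w i * z' j \<in> M k"
    if "w \<in> vecs A" "vrel k B z z'" "\<forall>i\<in>A. \<forall>j\<in>B. w i * z j \<in> M k" for w z z'
  proof (intro ballI)
    fix i j assume "i \<in> A" "j \<in> B"
    hence "z' j * w i \<in> M k" using that ideal_diff_commute[OF idM, of "z j" "z' j" k]
      by (intro mult_cong_left[of "z' j" "z j"]) (auto simp: vec_rel_def vecs_def mult.commute)
    thus "w i * z' j \<in> M k" by (simp add: mult.commute)
  qed
qed

text \<open>A primitive \<open>w\<close> has a unit coordinate, which forces \<open>z\<close> to
  vanish, so only \<open>w\<close> is counted.\<close>

lemma count_ann_prim: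
  assumes A: "finite A" and B: "finite B"
  shows "class_count (pair_rel (vrel k A) (vrel k B)) (ann_pairs k (prim_vecs A) A B) =
    class_count (vrel k A) (prim_vecs A)"
proof (rule class_count_bij[symmetric, where f = "\<lambda>w. (w, \<lambda>_. 0)"])
  show "(w, \<lambda>_. 0) \<in> ann_pairs k (prim_vecs A) A B" if "w \<in> prim_vecs A" for w
    using that idealD(2)[OF idM] ints_0 by (auto simp: ann_pairs_def vecs_def)
  show "\<exists>w\<in>prim_vecs A. pair_rel (vrel k A) (vrel k B) (w, \<lambda>_. 0) v" if v: "v \<in> ann_pairs k (prim_vecs A) A B" for v
  proof -
    obtain w z where [simp]: "v = (w, z)" and wz: "w \<in> prim_vecs A" "z \<in> vecs B" "\<forall>i\<in>A. \<forall>j\<in>B. w i * z j \<in> M k"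
      using v by (auto simp: ann_pairs_def)
    obtain i where i: "i \<in> A" "w i \<in> \<O>" "w i \<notin> P" using wz by (auto simp: prim_vecs_def vecs_def)
    hence "z j \<in> M k" if "j \<in> B" for j using unit_cancel[OF i(2,3), of "z j"] wz that by (auto simp: vecs_def)
    hence "vrel k B (\<lambda>_. 0) z" using ideal_minus[OF idM] by (auto simp: vec_rel_def)
    thus ?thesis using wz(1) equivp_reflp[OF equivp_vrel] by (intro bexI[of _ w]) auto
  qed
qed (auto intro!: equivp_pair_rel equivp_vrel equivp_reflp[OF equivp_vrel])

lemma count_ann:
  assumes A: "finite A" and B: "finite B"
  shows "class_count (pair_rel (vrel k A) (vrel k B)) (ann_pairs k (vecs A) A B) = ann_count (card A) (card B) k"
proof (induction k)
  case 0
  have "ann_pairs 0 (vecs A) A B = vecs A \<times> vecs B" by (auto simp: ann_pairs_def vecs_def ints_mult)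
  thus ?case using class_count_times(1)[OF equivp_vrel equivp_vrel count_vecs(2) count_vecs(2), of A B 0 0]
      count_vecs(1)[of A 0] count_vecs(1)[of B 0] A B by simp
next
  case (Suc k)
  have "ann_pairs (Suc k) (vecs A) A B = ann_pairs (Suc k) (prim_vecs A) A B \<union> ann_pairs (Suc k) (pvecs A) A B"
    unfolding vecs_split[of A] by (auto simp: ann_pairs_def)
  moreover have "class_count (pair_rel (vrel (Suc k) A) (vrel (Suc k) B))
      (ann_pairs (Suc k) (prim_vecs A) A B \<union> ann_pairs (Suc k) (pvecs A) A B) =
    class_count (pair_rel (vrel (Suc k) A) (vrel (Suc k) B)) (ann_pairs (Suc k) (prim_vecs A) A B) +
    class_count (pair_rel (vrel (Suc k) A) (vrel (Suc k) B)) (ann_pairs (Suc k) (pvecs A) A B)"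
  proof (rule class_count_Un)
    show "equivp (pair_rel (vrel (Suc k) A) (vrel (Suc k) B))" by (intro equivp_pair_rel equivp_vrel)
    show "finite (class_set (pair_rel (vrel (Suc k) A) (vrel (Suc k) B))
      (ann_pairs (Suc k) (prim_vecs A) A B \<union> ann_pairs (Suc k) (pvecs A) A B))"
      by (rule finite_class_pair[OF A B]) (use vecs_split[of A] in \<open>auto simp: ann_pairs_def\<close>)
    show "\<not> pair_rel (vrel (Suc k) A) (vrel (Suc k) B) x y"
      if "x \<in> ann_pairs (Suc k) (prim_vecs A) A B" "y \<in> ann_pairs (Suc k) (pvecs A) A B" for x y
      using that prim_not_pvecs[of "fst x" A "fst y" k] by (cases x, cases y) (auto simp: ann_pairs_def)
  qed
  ultimately show ?case
    using count_ann_prim[OF A B, of "Suc k"] count_ann_pvecs[OF A B, of k] Suc count_prim_vecs[OF A, of k] by simp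
qed

end

section \<open>Centralizers modulo prime powers\<close>

definition zero_at :: "'i \<Rightarrow> ('i \<Rightarrow> 'b::zero) \<Rightarrow> 'i \<Rightarrow> 'b" where
  "zero_at a z i = (if i = a then 0 else z i)"

text \<open>The diagonal term is taken once, as in the relation
  \<open>[x_i, x_(n+i)] = y_ii\<close>. No factor 2 appears, so residue characteristic 2 needs no
  separate treatment.\<close>

definition quad :: "(nat \<Rightarrow> 'a) \<Rightarrow> (nat \<Rightarrow> 'a) \<Rightarrow> nat \<Rightarrow> nat \<Rightarrow> 'a::comm_ring_1" where
  "quad x y i j = (if i = j then x i * y i else x i * y j + x j * y i)"

lemma quad_commute: "quad x y i j = quad y x i j"
  by (simp add: quad_def mult.commute add.commute)

lemma quad_sym: "quad x y i j = quad x y j i"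
  by (simp add: quad_def add.commute)

context prime_ideal_loc
begin

lemma mult_diff_mem:
  assumes "c - c' \<in> M k" "x - x' \<in> M k" "c \<in> \<O>" "x' \<in> \<O>"
  shows "c * x - c' * x' \<in> M k"
proof -
  have "c * (x - x') + (c - c') * x' \<in> M k"
    by (rule prime_pow_ideal(3)[OF prime_pow_ideal(4)[OF assms(3,2)] prime_pow_ideal(5)[OF assms(4,1)]])
  moreover have "c * (x - x') + (c - c') * x' = c * x - c' * x'" by (simp add: algebra_simps)
  ultimately show ?thesis by simp
qed

lemma quad_O: "x \<in> vecs A \<Longrightarrow> y \<in> vecs A \<Longrightarrow> i \<in> A \<Longrightarrow> j \<in> A \<Longrightarrow> quad x y i j \<in> \<O>"
  by (auto simp: quad_def vecs_def intro!: ints_add ints_mult)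

lemma quad_mem:
  assumes "x \<in> vecs A" "\<And>i. i \<in> A \<Longrightarrow> y i \<in> M k" "i \<in> A" "j \<in> A"
  shows "quad x y i j \<in> M k"
  using assms by (auto simp: quad_def vecs_def intro!: prime_pow_ideal(3,4))

lemma quad_cong_right:
  assumes "x \<in> vecs A" "vrel k A y y'" "i \<in> A" "j \<in> A"
  shows "quad x y i j - quad x y' i j \<in> M k"
proof -
  have "quad x y i j - quad x y' i j = quad x (\<lambda>i. y i - y' i) i j"
    by (simp add: quad_def algebra_simps)
  thus ?thesis using assms by (auto intro!: quad_mem simp: vec_rel_def)
qed

text \<open>If \<open>y\<close> is divisible by \<open>P\<close>, the uniformizer cancels and the
  exponent drops by one. The induction hypothesis is passed in for a fixed \<open>x\<close>, so the
  same lemma applies with the two vectors exchanged.\<close>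

lemma gauss_step:
  assumes x: "x \<in> vecs A" and y: "y \<in> pvecs A"
    and xy: "\<And>i j. i \<in> A \<Longrightarrow> j \<in> A \<Longrightarrow> quad x y i j \<in> M (Suc k)"
    and IH: "\<And>y. y \<in> vecs A \<Longrightarrow> (\<And>i j. i \<in> A \<Longrightarrow> j \<in> A \<Longrightarrow> quad x y i j \<in> M k) \<Longrightarrow>
      (\<And>i j. i \<in> A \<Longrightarrow> j \<in> A \<Longrightarrow> x i * y j \<in> M k)"
    and ij: "i \<in> A" "j \<in> A"
  shows "x i * y j \<in> M (Suc k)"
proof -
  obtain w where w: "w \<in> vecs A" "vrel (Suc k) A (\<lambda>i. \<pi> * w i) y" using scale_surj[OF y] .
  have "quad x w i j \<in> M k" if "i \<in> A" "j \<in> A" for i j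
  proof -
    have "quad x (\<lambda>i. \<pi> * w i) i j \<in> M (Suc k)"
      using M_cong[OF quad_cong_right[OF x w(2) that]] xy[OF that] by blast
    moreover have "quad x (\<lambda>i. \<pi> * w i) i j = \<pi> * quad x w i j" by (simp add: quad_def algebra_simps)
    ultimately show ?thesis using M_mult_iff[OF quad_O[OF x w(1) that]] by simp
  qed
  from IH[OF w(1) this ij] have xw: "x i * w j \<in> M k" .
  hence "\<pi> * (x i * w j) \<in> M (Suc k)" using M_mult_iff[OF M_O[OF xw], of k] by simp
  hence "(\<pi> * w j) * x i \<in> M (Suc k)" by (simp add: mult_ac)
  moreover have "y j - \<pi> * w j \<in> M (Suc k)" using w(2) ij ideal_diff_commute[OF idM] by (auto simp: vec_rel_def)
  ultimately have "y j * x i \<in> M (Suc k)" using x ij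
    by (intro mult_cong_left[of "y j" "\<pi> * w j"]) (auto simp: vecs_def)
  thus ?thesis by (simp add: mult.commute)
qed

text \<open>Gauss' lemma: the \<open>quad x y i j\<close> are the coefficients of the product of two linear forms.\<close>

lemma gauss_lemma:
  assumes "x \<in> vecs A" "y \<in> vecs A" "\<And>i j. i \<in> A \<Longrightarrow> j \<in> A \<Longrightarrow> quad x y i j \<in> M k" "i \<in> A" "j \<in> A"
  shows "x i * y j \<in> M k"
  using assms
proof (induction k arbitrary: x y i j)
  case 0
  thus ?case by (auto simp: vecs_def ints_mult)
next
  case (Suc k)
  consider "y \<in> pvecs A" | "x \<in> pvecs A" | "\<exists>i\<in>A. x i \<notin> P" "\<exists>i\<in>A. y i \<notin> P" by (auto simp: pvecs_def)
  thus ?case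
  proof cases
    case 1
    show ?thesis
      by (rule gauss_step[OF Suc.prems(1) 1 Suc.prems(3) _ Suc.prems(4,5)]) (use Suc.IH Suc.prems(1) in auto)
  next
    case 2
    have "y j * x i \<in> M (Suc k)"
    proof (rule gauss_step[OF Suc.prems(2) 2 _ _ Suc.prems(5,4)])
      show "quad y x i j \<in> M (Suc k)" if "i \<in> A" "j \<in> A" for i j
        using Suc.prems(3)[OF that] quad_commute by metis
    qed (use Suc.IH Suc.prems(2) in auto)
    thus ?thesis by (simp add: mult.commute)
  next
    case 3
    \<comment> \<open>The first coordinates outside \<open>P\<close>. In the coefficient at
      \<open>(a, b)\<close> the term \<open>x a * y b\<close> is outside \<open>P\<close>, while the
      other term, present when \<open>a\<close> and \<open>b\<close> differ, lies in
      \<open>P\<close> by minimality.\<close>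
    define a b where "a = (LEAST i. i \<in> A \<and> x i \<notin> P)" and "b = (LEAST i. i \<in> A \<and> y i \<notin> P)"
    have a: "a \<in> A" "x a \<notin> P" using LeastI_ex[of "\<lambda>i. i \<in> A \<and> x i \<notin> P"] 3 by (auto simp: a_def)
    have b: "b \<in> A" "y b \<notin> P" using LeastI_ex[of "\<lambda>i. i \<in> A \<and> y i \<notin> P"] 3 by (auto simp: b_def)
    have a': "x i \<in> P" if "i < a" "i \<in> A" for i using not_less_Least[of i "\<lambda>i. i \<in> A \<and> x i \<notin> P"] that by (auto simp: a_def)
    have b': "y i \<in> P" if "i < b" "i \<in> A" for i using not_less_Least[of i "\<lambda>i. i \<in> A \<and> y i \<notin> P"] that by (auto simp: b_def)
    have O: "x i \<in> \<O>" "y i \<in> \<O>" if "i \<in> A" for i using Suc.prems that by (auto simp: vecs_def)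
    have ab: "x a * y b \<notin> P" using a b O primeD(5)[OF P] by blast
    have m: "quad x y a b \<in> P" using Suc.prems(3)[OF a(1) b(1)] M_Suc_P by blast
    have False
    proof (cases "a = b")
      case True
      thus False using m ab by (simp add: quad_def)
    next
      case False
      have "x b * y a \<in> P"
      proof (cases "a < b")
        case True
        thus ?thesis using b'[OF True a(1)] O[OF b(1)] idealD(4)[OF idP] by blast
      next
        case False
        hence "b < a" using \<open>a \<noteq> b\<close> by simp
        thus ?thesis using a'[OF _ b(1)] O[OF a(1)] idealD(5)[OF idP] by blast
      qed
      hence "quad x y a b - x b * y a \<in> P" using m ideal_diff[OF idP] by blast
      thus False using ab False by (simp add: quad_def)
    qed
    thus ?thesis ..
  qed
qed

section \<open>Coordinates adapted to a primitive vector\<close>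

lemma zero_at_vecs: "z \<in> vecs (A - {a}) \<Longrightarrow> zero_at a z \<in> vecs A"
  by (auto simp: vecs_def zero_at_def ints_0)

lemma inverse_coordinate:
  assumes "u \<in> vecs A" "a \<in> A" "u a \<notin> P"
  obtains t where "t \<in> \<O>" "u a * t - 1 \<in> M k"
  using invertible_mod_prime_pow[OF P, of "u a" k] assms by (auto simp: vecs_def)

text \<open>As \<open>u a\<close> is a unit modulo \<open>P^k\<close>, the vector \<open>u\<close>
  and the unit vectors other than the one at \<open>a\<close> form a basis; \<open>c\<close> and
  \<open>z\<close> are the coordinates in it.\<close>

lemma centralizer_param_rel:
  assumes u: "u \<in> vecs A" "a \<in> A" "u a \<notin> P" and c: "c \<in> \<O>" "c' \<in> \<O>"
  shows "vrel k A (\<lambda>i. c * u i + zero_at a z i) (\<lambda>i. c' * u i + zero_at a z' i) \<longleftrightarrow>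
    diff_rel (M k) c c' \<and> vrel k (A - {a}) z z'"
proof
  assume *: "vrel k A (\<lambda>i. c * u i + zero_at a z i) (\<lambda>i. c' * u i + zero_at a z' i)"
  hence "c * u a - c' * u a \<in> M k" using u(2) by (auto simp: vec_rel_def zero_at_def)
  hence "u a * (c - c') \<in> M k" by (simp add: algebra_simps)
  hence cc: "c - c' \<in> M k" using unit_cancel[of "u a" "c - c'" k] u c ints_diff by (auto simp: vecs_def)
  have "z i - z' i \<in> M k" if "i \<in> A - {a}" for i
  proof -
    have H: "c * u i + z i - (c' * u i + z' i) \<in> M k" using * that by (auto simp: vec_rel_def zero_at_def)
    have uO: "u i \<in> \<O>" using u that by (auto simp: vecs_def)
    have "c * u i + z i - (c' * u i + z' i) - (c - c') * u i \<in> M k"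
      by (rule ideal_diff[OF idM H prime_pow_ideal(5)[OF uO cc]])
    thus ?thesis by (simp add: algebra_simps)
  qed
  thus "diff_rel (M k) c c' \<and> vrel k (A - {a}) z z'" using cc by (auto simp: diff_rel_def vec_rel_def)
next
  assume *: "diff_rel (M k) c c' \<and> vrel k (A - {a}) z z'"
  have "c * u i + zero_at a z i - (c' * u i + zero_at a z' i) \<in> M k" if "i \<in> A" for i
  proof -
    have "(c - c') * u i + (zero_at a z i - zero_at a z' i) \<in> M k"
      using * u that idealD(2)[OF idM] by (intro prime_pow_ideal(3,5))
        (auto simp: diff_rel_def vec_rel_def zero_at_def vecs_def)
    thus ?thesis by (simp add: algebra_simps)
  qed
  thus "vrel k A (\<lambda>i. c * u i + zero_at a z i) (\<lambda>i. c' * u i + zero_at a z' i)" by (simp add: vec_rel_def)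
qed

lemma centralizer_param_surj:
  assumes u: "u \<in> vecs A" "a \<in> A" "u a \<notin> P" and v: "v \<in> vecs A"
  obtains c z where "c \<in> \<O>" "z \<in> vecs (A - {a})" "vrel k A (\<lambda>i. c * u i + zero_at a z i) v"
proof -
  obtain t where t: "t \<in> \<O>" "u a * t - 1 \<in> M k" using inverse_coordinate[OF u] .
  let ?c = "v a * t" and ?z = "\<lambda>i. v i - v a * t * u i"
  have O: "?c \<in> \<O>" "?z \<in> vecs (A - {a})" using t v u by (auto simp: vecs_def intro!: ints_mult ints_diff)
  have "?c * u i + zero_at a ?z i - v i \<in> M k" if "i \<in> A" for i
  proof (cases "i = a")
    case True
    have "v a * (u a * t - 1) \<in> M k" using t v u by (intro prime_pow_ideal(4)) (auto simp: vecs_def)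
    thus ?thesis using True by (simp add: zero_at_def algebra_simps)
  qed (use idealD(2)[OF idM] in \<open>simp add: zero_at_def\<close>)
  thus ?thesis using that O by (auto simp: vec_rel_def)
qed

text \<open>If all 2 by 2 minors of \<open>u\<close> and \<open>y\<close> vanish and
  \<open>u a\<close> is a unit, then \<open>y\<close> is the multiple of \<open>u\<close> with
  factor \<open>y a / u a\<close>. So the centralizer is a free line.\<close>

lemma count_centralizer_line:
  assumes u: "u \<in> prim_vecs A"
  shows "class_count (vrel k A) {y \<in> vecs A. \<forall>b\<in>A. \<forall>c\<in>A. u b * y c - y b * u c \<in> M k} = q ^ k"
proof -
  have u': "u \<in> vecs A" using u by (simp add: prim_vecs_def)
  obtain a where a: "a \<in> A" "u a \<notin> P" using u by (auto simp: prim_vecs_def)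
  have O: "u i \<in> \<O>" if "i \<in> A" for i using u' that by (simp add: vecs_def)
  have "class_count (diff_rel (M k)) \<O> = class_count (vrel k A) {y \<in> vecs A. \<forall>b\<in>A. \<forall>c\<in>A. u b * y c - y b * u c \<in> M k}"
  proof (rule class_count_bij[OF equivp_drel equivp_vrel, where f = "\<lambda>c i. c * u i"])
    show "(\<lambda>i. c * u i) \<in> {y \<in> vecs A. \<forall>b\<in>A. \<forall>c\<in>A. u b * y c - y b * u c \<in> M k}" if "c \<in> \<O>" for c
      using that O idealD(2)[OF idM] by (auto simp: vecs_def algebra_simps ints_mult)
    show "vrel k A (\<lambda>i. c * u i) (\<lambda>i. c' * u i) \<longleftrightarrow> diff_rel (M k) c c'" if "c \<in> \<O>" "c' \<in> \<O>" for c c'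
      using centralizer_param_rel[OF u' a that, of k "\<lambda>_. 0" "\<lambda>_. 0"] idealD(2)[OF idM]
      by (simp add: zero_at_def vec_rel_def)
    show "\<exists>c\<in>\<O>. vrel k A (\<lambda>i. c * u i) y"
      if y: "y \<in> {y \<in> vecs A. \<forall>b\<in>A. \<forall>c\<in>A. u b * y c - y b * u c \<in> M k}" for y
    proof -
      obtain t where t: "t \<in> \<O>" "u a * t - 1 \<in> M k" using inverse_coordinate[OF u' a] .
      have yO: "y i \<in> \<O>" if "i \<in> A" for i using y that by (simp add: vecs_def)
      have "y a * t * u i - y i \<in> M k" if i: "i \<in> A" for i
      proof -
        have H: "u a * y i - y a * u i \<in> M k" using y a i by blast
        have "y i * (u a * t - 1) - t * (u a * y i - y a * u i) \<in> M k"
          by (rule ideal_diff[OF idM prime_pow_ideal(4)[OF yO[OF i] t(2)] prime_pow_ideal(4)[OF t(1) H]])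
        thus ?thesis by (simp add: algebra_simps)
      qed
      thus ?thesis using t yO[OF a(1)] by (intro bexI[of _ "y a * t"]) (auto simp: vec_rel_def ints_mult)
    qed
  qed
  thus ?thesis using count_ints(1) by simp
qed

text \<open>Write \<open>u' = c u + z\<close> with \<open>z\<close> zero at \<open>a\<close>. In the
  equation between tensors, row \<open>a\<close> gives \<open>v' = c v\<close>, and the remaining
  rows say that \<open>v\<close> and \<open>z\<close> have zero tensor product. Hence
  \<open>c\<close> is free and \<open>(v, z)\<close> runs through \<open>ann_pairs\<close>.\<close>

lemma count_centralizer_tensor:
  assumes A: "finite A" and u: "u \<in> vecs A" "a \<in> A" "u a \<notin> P" and W: "W \<subseteq> vecs A"
  shows "class_count (pair_rel (vrel k A) (pair_rel (vrel k A) (vrel k A)))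
      {(v, u', v'). v \<in> W \<and> u' \<in> vecs A \<and> v' \<in> vecs A \<and> (\<forall>i\<in>A. \<forall>j\<in>A. u i * v' j - u' i * v j \<in> M k)} =
    q ^ k * class_count (pair_rel (vrel k A) (vrel k (A - {a}))) (ann_pairs k W A (A - {a}))" (is "class_count ?E ?U = _")
proof -
  let ?R = "ann_pairs k W A (A - {a})" and ?ER = "pair_rel (vrel k A) (vrel k (A - {a}))"
  have EE: "equivp ?ER" "equivp ?E" by (intro equivp_pair_rel equivp_vrel)+
  have "finite (class_set ?ER ?R)"
    by (rule finite_class_pair) (use A W in \<open>auto simp: ann_pairs_def\<close>)
  hence "q ^ k * class_count ?ER ?R = class_count (pair_rel (diff_rel (M k)) ?ER) (\<O> \<times> ?R)"
    using class_count_times(1)[OF equivp_drel EE(1) count_ints(2)] count_ints(1) by metis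
  also have "\<dots> = class_count ?E ?U"
  proof (rule class_count_bij[OF equivp_pair_rel[OF equivp_drel EE(1)] EE(2),
        where f = "\<lambda>(c, (v, z)). (v, \<lambda>i. c * u i + zero_at a z i, \<lambda>i. c * v i)"])
    fix x assume x: "x \<in> \<O> \<times> ?R"
    obtain c v z where [simp]: "x = (c, (v, z))" by (cases x)
    have c: "c \<in> \<O>" "v \<in> W" "v \<in> vecs A" "z \<in> vecs (A - {a})" and ann: "\<And>i j. i \<in> A \<Longrightarrow> j \<in> A - {a} \<Longrightarrow> v i * z j \<in> M k"
      using x W by (auto simp: ann_pairs_def)
    have "u i * (c * v j) - (c * u i + zero_at a z i) * v j \<in> M k" if ij: "i \<in> A" "j \<in> A" for i j
    proof (cases "i = a")
      case False
      hence "- (v j * z i) \<in> M k" using ann ij ideal_minus[OF idM] by blast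
      thus ?thesis using False by (simp add: zero_at_def algebra_simps)
    qed (use idealD(2)[OF idM] in \<open>simp add: zero_at_def algebra_simps\<close>)
    thus "(\<lambda>(c, (v, z)). (v, \<lambda>i. c * u i + zero_at a z i, \<lambda>i. c * v i)) x \<in> ?U"
      using c zero_at_vecs[OF c(4)] u by (auto simp: vecs_def intro!: ints_add ints_mult)
  next
    fix x y assume x: "x \<in> \<O> \<times> ?R" and y: "y \<in> \<O> \<times> ?R"
    obtain c v z where [simp]: "x = (c, (v, z))" by (cases x)
    obtain c' v' z' where [simp]: "y = (c', (v', z'))" by (cases y)
    have c: "c \<in> \<O>" "c' \<in> \<O>" "v \<in> vecs A" "v' \<in> vecs A" using x y W by (auto simp: ann_pairs_def)
    have "vrel k A (\<lambda>i. c * v i) (\<lambda>i. c' * v' i)" if "diff_rel (M k) c c'" "vrel k A v v'"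
      using that c by (auto simp: vec_rel_def diff_rel_def vecs_def intro!: mult_diff_mem)
    thus "?E ((\<lambda>(c, (v, z)). (v, \<lambda>i. c * u i + zero_at a z i, \<lambda>i. c * v i)) x)
        ((\<lambda>(c, (v, z)). (v, \<lambda>i. c * u i + zero_at a z i, \<lambda>i. c * v i)) y) \<longleftrightarrow> pair_rel (diff_rel (M k)) ?ER x y"
      using centralizer_param_rel[OF u c(1,2)] by auto
  next
    fix x assume x: "x \<in> ?U"
    obtain v u' v' where [simp]: "x = (v, u', v')" by (cases x)
    have v: "v \<in> W" "v \<in> vecs A" "u' \<in> vecs A" "v' \<in> vecs A"
      and cond: "\<And>i j. i \<in> A \<Longrightarrow> j \<in> A \<Longrightarrow> u i * v' j - u' i * v j \<in> M k" using x W by auto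
    obtain c z where cz: "c \<in> \<O>" "z \<in> vecs (A - {a})" "vrel k A (\<lambda>i. c * u i + zero_at a z i) u'"
      using centralizer_param_surj[OF u v(3)] .
    let ?u = "\<lambda>i. c * u i + zero_at a z i"
    have cond': "u i * v' j - ?u i * v j \<in> M k" if ij: "i \<in> A" "j \<in> A" for i j
    proof -
      have "u i * v' j - u' i * v j - (?u i - u' i) * v j \<in> M k"
        by (rule ideal_diff[OF idM cond[OF ij] prime_pow_ideal(5)])
          (use cz(3) ij v in \<open>auto simp: vec_rel_def vecs_def\<close>)
      thus ?thesis by (simp add: algebra_simps)
    qed
    \<comment> \<open>Row \<open>a\<close> of the equation, where \<open>z\<close> does not
      contribute and the unit \<open>u a\<close> cancels.\<close>
    have d: "v' j - c * v j \<in> M k" if j: "j \<in> A" for j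
    proof -
      have "u a * (v' j - c * v j) \<in> M k" using cond'[OF u(2) j] by (simp add: zero_at_def algebra_simps)
      thus ?thesis using unit_cancel[of "u a" "v' j - c * v j" k] u v j cz(1)
        by (auto simp: vecs_def intro!: ints_diff ints_mult)
    qed
    have "v j * z i \<in> M k" if ij: "i \<in> A - {a}" "j \<in> A" for i j
    proof -
      have "u i * (v' j - c * v j) - (u i * v' j - ?u i * v j) \<in> M k"
        by (rule ideal_diff[OF idM prime_pow_ideal(4)[OF _ d[OF ij(2)]] cond'])
          (use ij u in \<open>auto simp: vecs_def\<close>)
      thus ?thesis using ij by (simp add: zero_at_def algebra_simps)
    qed
    hence "(c, (v, z)) \<in> \<O> \<times> ?R" using cz v by (auto simp: ann_pairs_def)
    moreover have "?E (v, ?u, \<lambda>i. c * v i) x"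
      using cz(3) d ideal_diff_commute[OF idM] equivp_reflp[OF equivp_vrel] by (auto simp: vec_rel_def idealD(2)[OF idM])
    ultimately show "\<exists>x'\<in>\<O> \<times> ?R. ?E ((\<lambda>(c, (v, z)). (v, \<lambda>i. c * u i + zero_at a z i, \<lambda>i. c * v i)) x') x"
      by (intro bexI[of _ "(c, (v, z))"]) auto
  qed
  finally show ?thesis by simp
qed

text \<open>Vectors are read as linear forms and \<open>quad\<close> as their product. With
  \<open>u' = c u + z\<close> and \<open>v = l u + w\<close>, where \<open>z\<close> and
  \<open>w\<close> vanish at \<open>a\<close>, the equation \<open>u v' = u' v\<close> becomes
  \<open>u D = z w\<close> for \<open>D = v' - (c v + l z)\<close>. The coefficients involving
  \<open>a\<close> force \<open>D = 0\<close>, so \<open>z w = 0\<close>, and Gauss' lemma makes the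
  tensor product vanish. The sets \<open>\<Lambda>\<close> and \<open>W0\<close> describe
  \<open>W\<close> in the coordinates \<open>(l, w)\<close>.\<close>

lemma count_centralizer_quad:
  assumes A: "finite A" and u: "u \<in> vecs A" "a \<in> A" "u a \<notin> P"
    and W: "W \<subseteq> vecs A" and sat: "\<And>x y. x \<in> W \<Longrightarrow> y \<in> vecs A \<Longrightarrow> vrel k A x y \<Longrightarrow> y \<in> W"
    and L: "\<Lambda> \<subseteq> \<O>" and W0: "W0 \<subseteq> vecs (A - {a})"
    and W_iff: "\<And>l w. l \<in> \<O> \<Longrightarrow> w \<in> vecs (A - {a}) \<Longrightarrow> (\<lambda>i. l * u i + zero_at a w i) \<in> W \<longleftrightarrow> l \<in> \<Lambda> \<and> w \<in> W0"
  shows "class_count (pair_rel (vrel k A) (pair_rel (vrel k A) (vrel k A)))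
      {(v, u', v'). v \<in> W \<and> u' \<in> vecs A \<and> v' \<in> vecs A \<and> (\<forall>i\<in>A. \<forall>j\<in>A. quad u v' i j - quad u' v i j \<in> M k)} =
    q ^ k * class_count (diff_rel (M k)) \<Lambda> *
      class_count (pair_rel (vrel k (A - {a})) (vrel k (A - {a}))) (ann_pairs k W0 (A - {a}) (A - {a}))" (is "class_count ?E ?U = _")
proof -
  let ?A = "A - {a}"
  let ?R = "ann_pairs k W0 ?A ?A" and ?ER = "pair_rel (vrel k ?A) (vrel k ?A)" and ?D = "pair_rel (diff_rel (M k)) (diff_rel (M k))"
  have EE: "equivp ?ER" "equivp ?E" "equivp ?D" by (intro equivp_pair_rel equivp_vrel equivp_drel)+
  have fL: "finite (class_set (diff_rel (M k)) \<Lambda>)" by (rule finite_subset[OF class_set_mono[OF L] count_ints(2)])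
  have fR: "finite (class_set ?ER ?R)"
    by (rule finite_class_pair) (use A W0 in \<open>auto simp: ann_pairs_def\<close>)
  note tm = class_count_times[OF equivp_drel equivp_drel count_ints(2) fL]
  let ?f = "\<lambda>((c, l), (w, z)). (\<lambda>i. l * u i + zero_at a w i, \<lambda>i. c * u i + zero_at a z i,
      \<lambda>i. c * (l * u i + zero_at a w i) + l * zero_at a z i)"
  have "q ^ k * class_count (diff_rel (M k)) \<Lambda> * class_count ?ER ?R = class_count (pair_rel ?D ?ER) ((\<O> \<times> \<Lambda>) \<times> ?R)"
    using class_count_times(1)[OF EE(3,1) tm(2) fR] tm(1) count_ints(1) by metis
  also have "\<dots> = class_count ?E ?U"
  proof (rule class_count_bij[OF equivp_pair_rel[OF EE(3,1)] EE(2), where f = ?f])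
    fix x assume x: "x \<in> (\<O> \<times> \<Lambda>) \<times> ?R"
    obtain c l w z where [simp]: "x = ((c, l), (w, z))" by (metis surj_pair)
    have c: "c \<in> \<O>" "l \<in> \<Lambda>" "l \<in> \<O>" "w \<in> W0" "w \<in> vecs ?A" "z \<in> vecs ?A"
      and ann: "\<And>i j. i \<in> ?A \<Longrightarrow> j \<in> ?A \<Longrightarrow> w i * z j \<in> M k"
      using x W0 L by (auto simp: ann_pairs_def)
    let ?v = "\<lambda>i. l * u i + zero_at a w i" and ?u = "\<lambda>i. c * u i + zero_at a z i"
    let ?w = "\<lambda>i. c * (l * u i + zero_at a w i) + l * zero_at a z i"
    have O: "zero_at a z i \<in> \<O>" "zero_at a w i \<in> \<O>" "u i \<in> \<O>" if "i \<in> A" for i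
      using zero_at_vecs[OF c(5)] zero_at_vecs[OF c(6)] u(1) that by (auto simp: vecs_def)
    have "quad u ?w i j - quad ?u ?v i j \<in> M k" if ij: "i \<in> A" "j \<in> A" for i j
    proof -
      have "quad u ?w i j - quad ?u ?v i j = - quad (zero_at a z) (zero_at a w) i j"
        by (simp add: quad_def algebra_simps)
      moreover have zw: "zero_at a z i * zero_at a w j \<in> M k" if "i \<in> A" "j \<in> A" for i j
        using ann[of j i] that idealD(2)[OF idM] by (auto simp: zero_at_def mult.commute)
      moreover have "quad (zero_at a z) (zero_at a w) i j \<in> M k"
        using zw ij by (auto simp: quad_def intro!: prime_pow_ideal(3))
      ultimately show ?thesis using ideal_minus[OF idM] by simp
    qed
    moreover have "?v \<in> W" using W_iff c by blast
    ultimately show "?f x \<in> ?U" using c O by (auto simp: vecs_def intro!: ints_add ints_mult)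
  next
    fix x y assume x: "x \<in> (\<O> \<times> \<Lambda>) \<times> ?R" and y: "y \<in> (\<O> \<times> \<Lambda>) \<times> ?R"
    obtain c l w z where [simp]: "x = ((c, l), (w, z))" by (metis surj_pair)
    obtain c' l' w' z' where [simp]: "y = ((c', l'), (w', z'))" by (metis surj_pair)
    have c: "c \<in> \<O>" "l \<in> \<O>" "w \<in> vecs ?A" "z \<in> vecs ?A" "c' \<in> \<O>" "l' \<in> \<O>" "w' \<in> vecs ?A" "z' \<in> vecs ?A"
      using x y W0 L by (auto simp: ann_pairs_def)
    have "vrel k A (\<lambda>i. c * (l * u i + zero_at a w i) + l * zero_at a z i) (\<lambda>i. c' * (l' * u i + zero_at a w' i) + l' * zero_at a z' i)"
      if h: "diff_rel (M k) c c'" "diff_rel (M k) l l'" "vrel k ?A w w'" "vrel k ?A z z'"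
      unfolding vec_rel_def
    proof (intro ballI)
      fix i assume i: "i \<in> A"
      have O: "zero_at a z' i \<in> \<O>" "zero_at a w' i \<in> \<O>" "u i \<in> \<O>"
        using zero_at_vecs[OF c(7)] zero_at_vecs[OF c(8)] u(1) i by (auto simp: vecs_def)
      have d: "c - c' \<in> M k" "l - l' \<in> M k" "zero_at a z i - zero_at a z' i \<in> M k"
        using h i idealD(2)[OF idM] by (auto simp: diff_rel_def vec_rel_def zero_at_def)
      have v: "(l * u i + zero_at a w i) - (l' * u i + zero_at a w' i) \<in> M k"
        using centralizer_param_rel[OF u c(2,6), of k w w'] h i by (auto simp: vec_rel_def)
      have "(c * (l * u i + zero_at a w i) - c' * (l' * u i + zero_at a w' i)) + (l * zero_at a z i - l' * zero_at a z' i) \<in> M k"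
        by (intro prime_pow_ideal(3) mult_diff_mem d v c O ints_add ints_mult)
      moreover have "(c * (l * u i + zero_at a w i) - c' * (l' * u i + zero_at a w' i)) + (l * zero_at a z i - l' * zero_at a z' i) =
        c * (l * u i + zero_at a w i) + l * zero_at a z i - (c' * (l' * u i + zero_at a w' i) + l' * zero_at a z' i)" by simp
      ultimately show "c * (l * u i + zero_at a w i) + l * zero_at a z i - (c' * (l' * u i + zero_at a w' i) + l' * zero_at a z' i) \<in> M k"
        by metis
    qed
    thus "?E (?f x) (?f y) \<longleftrightarrow> pair_rel ?D ?ER x y"
      using centralizer_param_rel[OF u c(1,5), of k z z'] centralizer_param_rel[OF u c(2,6), of k w w'] by auto
  next
    fix x assume x: "x \<in> ?U"
    obtain v u' v' where [simp]: "x = (v, u', v')" by (cases x)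
    have v: "v \<in> W" "v \<in> vecs A" "u' \<in> vecs A" "v' \<in> vecs A"
      and cond: "\<And>i j. i \<in> A \<Longrightarrow> j \<in> A \<Longrightarrow> quad u v' i j - quad u' v i j \<in> M k" using x W by auto
    obtain c z where cz: "c \<in> \<O>" "z \<in> vecs ?A" "vrel k A (\<lambda>i. c * u i + zero_at a z i) u'"
      using centralizer_param_surj[OF u v(3)] .
    obtain l w where lw: "l \<in> \<O>" "w \<in> vecs ?A" "vrel k A (\<lambda>i. l * u i + zero_at a w i) v"
      using centralizer_param_surj[OF u v(2)] .
    let ?z = "zero_at a z" and ?w = "zero_at a w"
    let ?v = "\<lambda>i. l * u i + ?w i" and ?u = "\<lambda>i. c * u i + ?z i"
    have zO: "?z \<in> vecs A" "?w \<in> vecs A" by (rule zero_at_vecs[OF cz(2)], rule zero_at_vecs[OF lw(2)])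
    have vO: "?v \<in> vecs A" "?u \<in> vecs A" using zO cz lw u by (auto simp: vecs_def intro!: ints_add ints_mult)
    have "?v \<in> W" using sat[OF v(1) vO(1)] lw(3) equivp_symp[OF equivp_vrel] by blast
    hence W0': "l \<in> \<Lambda>" "w \<in> W0" using W_iff lw by auto
    \<comment> \<open>The deviation of \<open>v'\<close> from the value that the parametrization
      predicts; it has to vanish modulo \<open>P^k\<close>.\<close>
    define D where "D = (\<lambda>i. v' i - (c * ?v i + l * ?z i))"
    have DO: "D i \<in> \<O>" if "i \<in> A" for i
      using that vO zO v cz lw u(1) unfolding D_def by (intro ints_diff ints_add ints_mult) (auto simp: vecs_def)
    have cond': "quad u D i j - quad ?z ?w i j \<in> M k" if ij: "i \<in> A" "j \<in> A" for i j
    proof -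
      have 1: "quad u' ?v i j - quad u' v i j \<in> M k" by (rule quad_cong_right[OF v(3) lw(3) ij])
      have "quad ?v ?u i j - quad ?v u' i j \<in> M k" by (rule quad_cong_right[OF vO(1) cz(3) ij])
      hence 2: "quad ?u ?v i j - quad u' ?v i j \<in> M k"
        by (simp only: quad_commute[of ?v ?u] quad_commute[of ?v u'])
      have "(quad u v' i j - quad u' v i j) - ((quad ?u ?v i j - quad u' ?v i j) + (quad u' ?v i j - quad u' v i j)) \<in> M k"
        by (intro ideal_diff[OF idM] prime_pow_ideal(3) 1 2 cond ij)
      hence "quad u v' i j - quad ?u ?v i j \<in> M k" by (simp add: algebra_simps)
      also have "quad u v' i j - quad ?u ?v i j = quad u D i j - quad ?z ?w i j"
        by (simp add: quad_def D_def algebra_simps)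
      finally show ?thesis .
    qed
    have za: "?z a = 0" "?w a = 0" by (auto simp: zero_at_def)
    have uO: "u i \<in> \<O>" if "i \<in> A" for i using u that by (auto simp: vecs_def)
    have Da: "D a \<in> M k"
      using cond'[OF u(2) u(2)] za unit_cancel[OF uO[OF u(2)] u(3) DO[OF u(2)]] by (simp add: quad_def)
    \<comment> \<open>\<open>D a\<close> comes from the square of the variable at \<open>a\<close>.
      Next the mixed coefficient at \<open>a\<close> and \<open>i\<close> gives \<open>D i\<close>,
      since \<open>z\<close> and \<open>w\<close> vanish at \<open>a\<close>.\<close>
    have Di: "D i \<in> M k" if i: "i \<in> A" for i
    proof (cases "i = a")
      case False
      hence "u a * D i + u i * D a \<in> M k" using cond'[OF u(2) i] za by (simp add: quad_def)
      from ideal_diff[OF idM this prime_pow_ideal(4)[OF uO[OF i] Da]] have "u a * D i \<in> M k" by simp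
      thus ?thesis using unit_cancel[OF uO[OF u(2)] u(3) DO[OF i]] by simp
    qed (use Da in simp)
    have "quad w z i j \<in> M k" if ij: "i \<in> ?A" "j \<in> ?A" for i j
    proof -
      have "quad u D i j - (quad u D i j - quad ?z ?w i j) \<in> M k"
        using ij by (intro ideal_diff[OF idM] cond' quad_mem[OF u(1)] Di) auto
      moreover have "quad ?z ?w i j = quad w z i j" using ij by (auto simp: quad_def zero_at_def mult.commute add.commute)
      ultimately show ?thesis by simp
    qed
    hence "w i * z j \<in> M k" if "i \<in> ?A" "j \<in> ?A" for i j
      using gauss_lemma[OF lw(2) cz(2)] that by blast
    hence "((c, l), (w, z)) \<in> (\<O> \<times> \<Lambda>) \<times> ?R" using cz W0' by (auto simp: ann_pairs_def)
    moreover have "?E (?v, ?u, \<lambda>i. c * ?v i + l * ?z i) x"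
      using cz(3) lw(3) Di ideal_diff_commute[OF idM] by (auto simp: vec_rel_def D_def)
    ultimately show "\<exists>x'\<in>(\<O> \<times> \<Lambda>) \<times> ?R. ?E (?f x') x"
      by (intro bexI[of _ "((c, l), (w, z))"]) auto
  qed
  finally show ?thesis by simp
qed

end

section \<open>Commuting pairs in the three families\<close>

lemma card_triangle: "card {(i, j). 1 \<le> i \<and> i < j \<and> j \<le> (d::nat)} = d choose 2"
proof (induction d)
  case 0
  have "{(i, j). 1 \<le> i \<and> i < j \<and> j \<le> (0::nat)} = {}" by auto
  thus ?case by (simp only: card.empty) simp
next
  case (Suc d)
  have "{(i, j). 1 \<le> i \<and> i < j \<and> j \<le> Suc d} = {(i, j). 1 \<le> i \<and> i < j \<and> j \<le> d} \<union> {1..d} \<times> {Suc d}"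
    by auto
  moreover have "finite {(i, j). 1 \<le> i \<and> i < j \<and> j \<le> d}"
    by (rule finite_subset[of _ "{..d} \<times> {..d}"]) auto
  moreover have "{(i, j). 1 \<le> i \<and> i < j \<and> j \<le> d} \<inter> {1..d} \<times> {Suc d} = {}" by auto
  ultimately have "card {(i, j). 1 \<le> i \<and> i < j \<and> j \<le> Suc d} = (d choose 2) + d"
    using Suc by (simp add: card_Un_disjoint card_cartesian_product)
  thus ?case by (simp add: numeral_2_eq_2)
qed

lemma card_triangle_le: "card {(i, j). 1 \<le> i \<and> i \<le> j \<and> j \<le> (n::nat)} = (n + 1) choose 2"
proof (induction n)
  case 0
  have "{(i, j). 1 \<le> i \<and> i \<le> j \<and> j \<le> (0::nat)} = {}" by auto
  thus ?case by (simp only: card.empty) (simp add: numeral_2_eq_2)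
next
  case (Suc n)
  have "{(i, j). 1 \<le> i \<and> i \<le> j \<and> j \<le> Suc n} = {(i, j). 1 \<le> i \<and> i \<le> j \<and> j \<le> n} \<union> {1..Suc n} \<times> {Suc n}"
    by auto
  moreover have "finite {(i, j). 1 \<le> i \<and> i \<le> j \<and> j \<le> n}"
    by (rule finite_subset[of _ "{..n} \<times> {..n}"]) auto
  moreover have "{(i, j). 1 \<le> i \<and> i \<le> j \<and> j \<le> n} \<inter> {1..Suc n} \<times> {Suc n} = {}" by auto
  ultimately have "card {(i, j). 1 \<le> i \<and> i \<le> j \<and> j \<le> Suc n} = ((n + 1) choose 2) + Suc n"
    using Suc by (simp add: card_Un_disjoint card_cartesian_product)
  thus ?case by (simp add: numeral_2_eq_2)
qed

lemma inj_X: "inj_on X A" by (auto simp: inj_on_def)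

lemma card_Y: "card {Y i j | i j. Q i j} = card {(i, j). Q i j}"
proof -
  have "{Y i j | i j. Q i j} = (\<lambda>(i, j). Y i j) ` {(i, j). Q i j}" by auto
  thus ?thesis by (simp add: card_image inj_on_def)
qed

lemma finite_Y: "finite {(i, j). Q i j} \<Longrightarrow> finite {Y i j | i j. Q i j}"
proof -
  have "{Y i j | i j. Q i j} = (\<lambda>(i, j). Y i j) ` {(i, j). Q i j}" by auto
  thus "finite {(i, j). Q i j} \<Longrightarrow> finite {Y i j | i j. Q i j}" by simp
qed

lemma two_step_F: "two_step (F_lat n \<delta>)"
proof -
  have "finite {(i, j). 1 \<le> i \<and> i < j \<and> j \<le> 2*n+\<delta>}"
    by (rule finite_subset[of _ "{..2*n+\<delta>} \<times> {..2*n+\<delta>}"]) auto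
  hence "finite (lie_basis (F_lat n \<delta>))" by (simp add: F_lat_def finite_Y)
  moreover have "\<forall>(b, c, e)\<in>lie_rels (F_lat n \<delta>). b \<in> range X \<and> c \<in> range X \<and> e \<notin> range X"
    by (auto simp: F_lat_def)
  ultimately show ?thesis unfolding two_step_def ..
qed

lemma two_step_G: "two_step (G_lat n)"
proof -
  have "finite {(i, j). i \<in> {1..n} \<and> j \<in> {1..n}}"
    by (rule finite_subset[of _ "{..n} \<times> {..n}"]) auto
  hence "finite (lie_basis (G_lat n))" by (simp add: G_lat_def finite_Y)
  moreover have "\<forall>(b, c, e)\<in>lie_rels (G_lat n). b \<in> range X \<and> c \<in> range X \<and> e \<notin> range X"
    by (auto simp: G_lat_def)
  ultimately show ?thesis unfolding two_step_def ..
qed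

lemma two_step_H: "two_step (H_lat n)"
proof -
  have "finite {(i, j). 1 \<le> i \<and> i \<le> j \<and> j \<le> n}"
    by (rule finite_subset[of _ "{..n} \<times> {..n}"]) auto
  hence "finite (lie_basis (H_lat n))" by (simp add: H_lat_def finite_Y)
  moreover have "\<forall>(b, c, e)\<in>lie_rels (H_lat n). b \<in> range X \<and> c \<in> range X \<and> e \<notin> range X"
    by (auto simp: H_lat_def)
  ultimately show ?thesis unfolding two_step_def ..
qed

lemma rels_F_iff: "(X s, X t, Y i j) \<in> lie_rels (F_lat n \<delta>) \<longleftrightarrow> s = i \<and> t = j \<and> 1 \<le> i \<and> i < j \<and> j \<le> 2*n+\<delta>"
  by (auto simp: F_lat_def)

lemma rels_G_iff: "(X s, X t, Y i j) \<in> lie_rels (G_lat n) \<longleftrightarrow> s = i \<and> t = n + j \<and> i \<in> {1..n} \<and> j \<in> {1..n}"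
  by (auto simp: G_lat_def)

lemma rels_H_iff: "(X s, X t, Y i j) \<in> lie_rels (H_lat n) \<longleftrightarrow>
    (s = i \<and> t = n + j \<or> s = j \<and> t = n + i) \<and> 1 \<le> i \<and> i \<le> j \<and> j \<le> n"
  by (auto simp: H_lat_def)

context number_field_loc
begin

lemma x_basis_F: "x_basis (F_lat n \<delta>) = X ` {1..2*n+\<delta>}"
  by (auto simp: x_basis_def F_lat_def)

lemma x_basis_G: "x_basis (G_lat n) = X ` {1..2*n}"
  by (auto simp: x_basis_def G_lat_def)

lemma x_basis_H: "x_basis (H_lat n) = X ` {1..2*n}"
  by (auto simp: x_basis_def H_lat_def)

lemma y_basis_F: "card (lie_basis (F_lat n \<delta>) - x_basis (F_lat n \<delta>)) = (2*n+\<delta>) choose 2"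
proof -
  have "lie_basis (F_lat n \<delta>) - x_basis (F_lat n \<delta>) = {Y i j | i j. 1 \<le> i \<and> i < j \<and> j \<le> 2*n+\<delta>}"
    by (subst x_basis_F) (auto simp: F_lat_def)
  thus ?thesis by (simp only: card_Y card_triangle)
qed

lemma y_basis_G: "card (lie_basis (G_lat n) - x_basis (G_lat n)) = n ^ 2"
proof -
  have "lie_basis (G_lat n) - x_basis (G_lat n) = {Y i j | i j. i \<in> {1..n} \<and> j \<in> {1..n}}"
    by (subst x_basis_G) (auto simp: G_lat_def)
  moreover have "{(i, j). i \<in> {1..n} \<and> j \<in> {1..n}} = {1..n} \<times> {1..n}" by auto
  ultimately show ?thesis by (simp only: card_Y) (simp add: power2_eq_square)
qed

lemma y_basis_H: "card (lie_basis (H_lat n) - x_basis (H_lat n)) = (n + 1) choose 2"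
proof -
  have "lie_basis (H_lat n) - x_basis (H_lat n) = {Y i j | i j. 1 \<le> i \<and> i \<le> j \<and> j \<le> n}"
    by (subst x_basis_H) (auto simp: H_lat_def)
  thus ?thesis by (simp only: card_Y card_triangle_le)
qed

text \<open>In all three lattices the relations list the smaller index first, while
  \<open>\<beta>\<close> is supported on pairs with the larger index first. So the nonzero
  coefficients are -1, at the reversed pairs.\<close>

lemma lie_form_eq:
  assumes L: "two_step L" and S: "S \<subseteq> x_basis L \<times> x_basis L"
    and b: "\<And>b c. b \<in> x_basis L \<Longrightarrow> c \<in> x_basis L \<Longrightarrow> beta_coeff L b c e = (if (b, c) \<in> S then -1 else 0)"
  shows "lie_form L e x y = (\<Sum>(b, c)\<in>S. y b * x c - x b * y c)"
proof -
  have fin: "finite (x_basis L \<times> x_basis L)" using L by (simp add: two_step_def x_basis_def)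
  have "lie_form L e x y = (\<Sum>(b, c)\<in>S. of_int (beta_coeff L b c e) * (x b * y c - y b * x c))"
    unfolding lie_form_def by (rule sum.mono_neutral_right[OF fin S]) (auto simp: b)
  also have "\<dots> = (\<Sum>(b, c)\<in>S. y b * x c - x b * y c)"
  proof (rule sum.cong[OF refl])
    fix z assume "z \<in> S"
    then obtain b c where "z = (b, c)" "beta_coeff L b c e = -1" using b S by (cases z) fastforce
    thus "(case z of (b, c) \<Rightarrow> of_int (beta_coeff L b c e) * (x b * y c - y b * x c)) =
      (case z of (b, c) \<Rightarrow> y b * x c - x b * y c)" by (simp add: algebra_simps)
  qed
  finally show ?thesis .
qed

lemma lie_form_X: "two_step L \<Longrightarrow> lie_form L (X i) x y = 0"
  unfolding lie_form_def using beta_coeff_eq_0[of L] by (intro sum.neutral) auto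

lemma lie_form_F:
  assumes "1 \<le> i" "i < j" "j \<le> 2*n+\<delta>"
  shows "lie_form (F_lat n \<delta>) (Y i j) x y = x (X i) * y (X j) - y (X i) * x (X j)"
proof -
  have "lie_form (F_lat n \<delta>) (Y i j) x y = (\<Sum>(b, c)\<in>{(X j, X i)}. y b * x c - x b * y c)"
  proof (rule lie_form_eq[OF two_step_F])
    show "{(X j, X i)} \<subseteq> x_basis (F_lat n \<delta>) \<times> x_basis (F_lat n \<delta>)" using assms by (auto simp: x_basis_F)
    show "beta_coeff (F_lat n \<delta>) b c (Y i j) = (if (b, c) \<in> {(X j, X i)} then - 1 else 0)"
      if bc: "b \<in> x_basis (F_lat n \<delta>)" "c \<in> x_basis (F_lat n \<delta>)" for b c
    proof -
      obtain r t where [simp]: "b = X r" "c = X t" using bc unfolding x_basis_F by blast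
      show ?thesis using assms by (auto simp: beta_coeff_def bracket_coeff_def rels_F_iff)
    qed
  qed
  thus ?thesis by (simp add: algebra_simps)
qed

lemma lie_form_G:
  assumes "i \<in> {1..n}" "j \<in> {1..n}"
  shows "lie_form (G_lat n) (Y i j) x y = x (X i) * y (X (n + j)) - y (X i) * x (X (n + j))"
proof -
  have "lie_form (G_lat n) (Y i j) x y = (\<Sum>(b, c)\<in>{(X (n + j), X i)}. y b * x c - x b * y c)"
  proof (rule lie_form_eq[OF two_step_G])
    show "{(X (n + j), X i)} \<subseteq> x_basis (G_lat n) \<times> x_basis (G_lat n)" using assms by (auto simp: x_basis_G)
    show "beta_coeff (G_lat n) b c (Y i j) = (if (b, c) \<in> {(X (n + j), X i)} then - 1 else 0)"
      if bc: "b \<in> x_basis (G_lat n)" "c \<in> x_basis (G_lat n)" for b c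
    proof -
      obtain r t where [simp]: "b = X r" "c = X t" using bc unfolding x_basis_G by blast
      show ?thesis using assms by (auto simp: beta_coeff_def bracket_coeff_def rels_G_iff)
    qed
  qed
  thus ?thesis by (simp add: algebra_simps)
qed

lemma lie_form_H:
  assumes "1 \<le> i" "i \<le> j" "j \<le> n"
  shows "lie_form (H_lat n) (Y i j) x y =
    quad (\<lambda>i. x (X i)) (\<lambda>j. y (X (n + j))) i j - quad (\<lambda>i. y (X i)) (\<lambda>j. x (X (n + j))) i j"
proof -
  \<comment> \<open>For \<open>i = j\<close> the two pairs coincide and the set has one element, in
    accordance with the diagonal case of \<open>quad\<close>.\<close>
  have "lie_form (H_lat n) (Y i j) x y = (\<Sum>(b, c)\<in>{(X (n + j), X i), (X (n + i), X j)}. y b * x c - x b * y c)"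
  proof (rule lie_form_eq[OF two_step_H])
    show "{(X (n + j), X i), (X (n + i), X j)} \<subseteq> x_basis (H_lat n) \<times> x_basis (H_lat n)"
      using assms by (auto simp: x_basis_H)
    show "beta_coeff (H_lat n) b c (Y i j) = (if (b, c) \<in> {(X (n + j), X i), (X (n + i), X j)} then - 1 else 0)"
      if bc: "b \<in> x_basis (H_lat n)" "c \<in> x_basis (H_lat n)" for b c
    proof -
      obtain r t where [simp]: "b = X r" "c = X t" using bc unfolding x_basis_H by blast
      show ?thesis using assms by (auto simp: beta_coeff_def bracket_coeff_def rels_H_iff)
    qed
  qed
  thus ?thesis by (auto simp: quad_def algebra_simps)
qed

lemma lie_form_scale: "lie_form L e (\<lambda>i. p * w i) z = p * lie_form L e w z"
  unfolding lie_form_def sum_distrib_left by (intro sum.cong) (auto simp: algebra_simps)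

lemma lie_form_O: "x \<in> vecs (x_basis L) \<Longrightarrow> y \<in> vecs (x_basis L) \<Longrightarrow> lie_form L e x y \<in> \<O>"
  unfolding lie_form_def by (rule ints_sum) (auto simp: vecs_def intro!: ints_mult ints_diff ints_of_int)

end

section \<open>Recurrences for the numbers of commuting pairs\<close>

context prime_ideal_loc
begin

abbreviation "prim_pairs L k \<equiv> {(x, y) \<in> comm_pairs L (M k). x \<in> prim_vecs (x_basis L)}"

lemma comm_count_0:
  assumes L: "two_step L"
  shows "comm_count L (M 0) = 1"
proof -
  have fin: "finite (x_basis L)" using L by (simp add: two_step_def x_basis_def)
  have "comm_pairs L (M 0) = vecs (x_basis L) \<times> vecs (x_basis L)" by (auto simp: comm_pairs_def lie_form_O)
  thus ?thesis unfolding comm_count_def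
    using class_count_times(1)[OF equivp_vrel equivp_vrel count_vecs(2) count_vecs(2), OF fin fin, of 0 0]
      count_vecs(1)[OF fin, of 0] by simp
qed

text \<open>The power of \<open>q\<close> counts the lifts of the second vector: once the first
  vector is divided by the uniformizer, the condition sees the second one modulo \<open>P^k\<close>
  only.\<close>

lemma comm_count_Suc:
  assumes L: "two_step L"
  shows "comm_count L (M (Suc k)) = q ^ card (x_basis L) * comm_count L (M k) +
    class_count (pair_rel (vrel (Suc k) (x_basis L)) (vrel (Suc k) (x_basis L))) (prim_pairs L (Suc k))"
proof -
  let ?A = "x_basis L"
  have fin: "finite ?A" using L by (simp add: two_step_def x_basis_def)
  let ?E = "pair_rel (vrel (Suc k) ?A) (vrel (Suc k) ?A)"
  let ?P = "{(w, z). w \<in> pvecs ?A \<and> z \<in> vecs ?A \<and> (\<forall>e\<in>lie_basis L. lie_form L e w z \<in> M (Suc k))}"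
  have "comm_pairs L (M (Suc k)) = ?P \<union> prim_pairs L (Suc k)"
    using vecs_split[of ?A] by (auto simp: comm_pairs_def prim_vecs_def)
  hence "comm_count L (M (Suc k)) = class_count ?E (?P \<union> prim_pairs L (Suc k))" by (simp add: comm_count_def)
  also have "\<dots> = class_count ?E ?P + class_count ?E (prim_pairs L (Suc k))"
  proof (rule class_count_Un)
    show "equivp ?E" by (intro equivp_pair_rel equivp_vrel)
    show "finite (class_set ?E (?P \<union> prim_pairs L (Suc k)))"
      by (rule finite_class_pair[OF fin fin]) (use vecs_split[of ?A] in \<open>auto simp: comm_pairs_def\<close>)
    show "\<not> ?E x y" if "x \<in> ?P" "y \<in> prim_pairs L (Suc k)" for x y
      using that prim_not_pvecs[of "fst y" ?A "fst x" k] equivp_symp[OF equivp_vrel, of "Suc k" ?A "fst x" "fst y"]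
      by (cases x, cases y) auto
  qed
  also have "class_count ?E ?P = q ^ card ?A * comm_count L (M k)"
    unfolding comm_count_def comm_pairs_def
  proof (rule scale_lift[OF fin fin])
    show "(\<forall>e\<in>lie_basis L. lie_form L e (\<lambda>i. \<pi> * w i) z \<in> M (Suc k)) \<longleftrightarrow> (\<forall>e\<in>lie_basis L. lie_form L e w z \<in> M k)"
      if "w \<in> vecs ?A" "z \<in> vecs ?A" for w z
      using M_mult_iff[OF lie_form_O[OF that]] by (simp add: lie_form_scale)
    show "\<forall>e\<in>lie_basis L. lie_form L e w' z \<in> M (Suc k)"
      if "w \<in> vecs ?A" "w' \<in> vecs ?A" "z \<in> vecs ?A" "vrel (Suc k) ?A w w'" "\<forall>e\<in>lie_basis L. lie_form L e w z \<in> M (Suc k)" for w w' z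
      using that M_cong[OF lie_form_cong_mod[OF idM that(1,2,4) that(3,3) equivp_reflp[OF equivp_vrel]]] by blast
    show "\<forall>e\<in>lie_basis L. lie_form L e w z' \<in> M k"
      if "w \<in> vecs ?A" "z \<in> vecs ?A" "z' \<in> vecs ?A" "vrel k ?A z z'" "\<forall>e\<in>lie_basis L. lie_form L e w z \<in> M k" for w z z'
      using that M_cong[OF lie_form_cong_mod[OF idM that(1,1) equivp_reflp[OF equivp_vrel] that(2,3,4)]] by blast
  qed
  finally show ?thesis .
qed

text \<open>Here the bracket consists of all 2 by 2 minors, so a primitive vector commutes exactly
  with its multiples, which gives the factor \<open>q ^ Suc k\<close>.\<close>

lemma comm_count_F:
  "comm_count (F_lat n \<delta>) (M (Suc k)) = q ^ (2*n+\<delta>) * comm_count (F_lat n \<delta>) (M k) +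
    (q ^ (Suc k * (2*n+\<delta>)) - q ^ (k * (2*n+\<delta>))) * q ^ Suc k"
proof -
  let ?L = "F_lat n \<delta>"
  let ?A = "x_basis ?L" and ?d = "2*n+\<delta>"
  let ?F = "\<lambda>x. {y \<in> vecs ?A. \<forall>b\<in>?A. \<forall>c\<in>?A. x b * y c - y b * x c \<in> M (Suc k)}"
  have A: "finite ?A" "card ?A = ?d" by (simp_all add: x_basis_F card_image inj_X)
  have cond: "(\<forall>e\<in>lie_basis ?L. lie_form ?L e x y \<in> M (Suc k)) \<longleftrightarrow> (\<forall>b\<in>?A. \<forall>c\<in>?A. x b * y c - y b * x c \<in> M (Suc k))" for x y
  proof
    assume *: "\<forall>e\<in>lie_basis ?L. lie_form ?L e x y \<in> M (Suc k)"
    have lt: "x (X i) * y (X j) - y (X i) * x (X j) \<in> M (Suc k)" if "1 \<le> i" "i < j" "j \<le> ?d" for i j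
    proof -
      have "Y i j \<in> lie_basis ?L" using that by (simp add: F_lat_def)
      thus ?thesis using * lie_form_F[OF that] by metis
    qed
    have "x (X i) * y (X j) - y (X i) * x (X j) \<in> M (Suc k)" if ij: "i \<in> {1..?d}" "j \<in> {1..?d}" for i j
    proof (cases i j rule: linorder_cases)
      case equal
      thus ?thesis using idealD(2)[OF idM] by (simp add: mult.commute)
    next
      case greater
      have "- (x (X j) * y (X i) - y (X j) * x (X i)) \<in> M (Suc k)"
        by (rule ideal_minus[OF idM lt]) (use greater ij in auto)
      thus ?thesis by (simp add: algebra_simps)
    qed (use lt ij in auto)
    thus "\<forall>b\<in>?A. \<forall>c\<in>?A. x b * y c - y b * x c \<in> M (Suc k)" by (auto simp: x_basis_F)
  next
    assume *: "\<forall>b\<in>?A. \<forall>c\<in>?A. x b * y c - y b * x c \<in> M (Suc k)"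
    show "\<forall>e\<in>lie_basis ?L. lie_form ?L e x y \<in> M (Suc k)"
    proof
      fix e assume e: "e \<in> lie_basis ?L"
      show "lie_form ?L e x y \<in> M (Suc k)"
      proof (cases e)
        case (X i)
        thus ?thesis using lie_form_X[OF two_step_F] idealD(2)[OF idM] by simp
      next
        case (Y i j)
        hence ij: "1 \<le> i" "i < j" "j \<le> ?d" using e by (auto simp: F_lat_def)
        hence "X i \<in> ?A" "X j \<in> ?A" by (auto simp: x_basis_F)
        thus ?thesis using lie_form_F[OF ij] * Y by simp
      qed
    qed
  qed
  have "prim_pairs ?L (Suc k) = (SIGMA x:prim_vecs ?A. ?F x)"
    unfolding comm_pairs_def cond by (auto simp: prim_vecs_def)
  moreover have "class_count (pair_rel (vrel (Suc k) ?A) (vrel (Suc k) ?A)) (SIGMA x:prim_vecs ?A. ?F x) =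
      class_count (vrel (Suc k) ?A) (prim_vecs ?A) * q ^ Suc k"
  proof (rule class_count_fiber(1)[OF equivp_vrel equivp_vrel])
    show "finite (class_set (vrel (Suc k) ?A) (prim_vecs ?A))"
      by (rule finite_class_vecs[OF A(1)]) (auto simp: prim_vecs_def)
    show "finite (class_set (vrel (Suc k) ?A) (?F x))" for x
      by (rule finite_class_vecs[OF A(1)]) auto
    show "class_count (vrel (Suc k) ?A) (?F x) = q ^ Suc k" if "x \<in> prim_vecs ?A" for x
      by (rule count_centralizer_line[OF that])
    fix x x' assume x: "x \<in> prim_vecs ?A" "x' \<in> prim_vecs ?A" "vrel (Suc k) ?A x x'"
    have "lie_form ?L e x y \<in> M (Suc k) \<longleftrightarrow> lie_form ?L e x' y \<in> M (Suc k)" if "y \<in> vecs ?A" for y e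
      using x that by (intro M_cong lie_form_cong_mod[OF idM] equivp_reflp[OF equivp_vrel]) (auto simp: prim_vecs_def)
    thus "?F x = ?F x'" unfolding cond[symmetric] by auto
  qed
  moreover have "class_count (vrel (Suc k) ?A) (prim_vecs ?A) = q ^ (Suc k * ?d) - q ^ (k * ?d)"
    using count_prim_vecs[OF A(1), of k] A(2) by simp
  ultimately show ?thesis using comm_count_Suc[OF two_step_F, of n \<delta> k] A(2) by simp
qed

text \<open>
  In terms of the halves \<open>(u, v)\<close> and \<open>(u', v')\<close> of two vectors, the bracket is \<open>u \<otimes> v' - u' \<otimes> v\<close> for
  \<open>G_lat\<close>, and its symmetrization for \<open>H_lat\<close>.
\<close>

definition low :: "(basis_elt \<Rightarrow> 'a) \<Rightarrow> nat \<Rightarrow> 'a" where "low x i = x (X i)"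

definition high :: "nat \<Rightarrow> (basis_elt \<Rightarrow> 'a) \<Rightarrow> nat \<Rightarrow> 'a" where "high n x i = x (X (n + i))"

definition join :: "nat \<Rightarrow> (nat \<Rightarrow> 'a) \<Rightarrow> (nat \<Rightarrow> 'a) \<Rightarrow> basis_elt \<Rightarrow> 'a" where
  "join n u v b = (case b of X i \<Rightarrow> if i \<le> n then u i else v (i - n) | Y i j \<Rightarrow> 0)"

lemma ball_halves: "(\<forall>b\<in>X ` {1..2*n}. Q b) \<longleftrightarrow> (\<forall>i\<in>{1..n}. Q (X i)) \<and> (\<forall>i\<in>{1..n}. Q (X (n + i)))"
proof (intro iffI conjI ballI)
  assume *: "(\<forall>i\<in>{1..n}. Q (X i)) \<and> (\<forall>i\<in>{1..n}. Q (X (n + i)))"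
  fix b assume "b \<in> X ` {1..2*n}"
  then obtain i where i: "b = X i" "1 \<le> i" "i \<le> 2 * n" by auto
  show "Q b"
  proof (cases "i \<le> n")
    case True
    thus ?thesis using * i by auto
  next
    case False
    hence "i - n \<in> {1..n}" "i = n + (i - n)" using i by auto
    thus ?thesis using * i(1) by metis
  qed
qed auto

lemma vecs_halves: "x \<in> vecs (X ` {1..2*n}) \<longleftrightarrow> low x \<in> vecs {1..n} \<and> high n x \<in> vecs {1..n}"
  unfolding vecs_def low_def high_def mem_Collect_eq by (rule ball_halves)

lemma vrel_halves: "vrel k (X ` {1..2*n}) x y \<longleftrightarrow> vrel k {1..n} (low x) (low y) \<and> vrel k {1..n} (high n x) (high n y)"
  unfolding vec_rel_def low_def high_def by (rule ball_halves)

lemma pvecs_halves: "x \<in> pvecs (X ` {1..2*n}) \<longleftrightarrow> low x \<in> pvecs {1..n} \<and> high n x \<in> pvecs {1..n}"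
  unfolding pvecs_def low_def high_def mem_Collect_eq by (rule ball_halves)

lemma prim_vecs_iff: "x \<in> prim_vecs A \<longleftrightarrow> x \<in> vecs A \<and> x \<notin> pvecs A"
  by (auto simp: prim_vecs_def pvecs_def)

lemma low_join: "i \<in> {1..n} \<Longrightarrow> low (join n u v) i = u i"
  and high_join: "i \<in> {1..n} \<Longrightarrow> high n (join n u v) i = v i"
  by (auto simp: low_def high_def join_def)

lemma vrel_join: "vrel k {1..n} (low (join n u v)) u" "vrel k {1..n} (high n (join n u v)) v"
  using idealD(2)[OF idM] by (auto simp: vec_rel_def low_join high_join)

lemma vecs_join: "low (join n u v) \<in> vecs {1..n} \<longleftrightarrow> u \<in> vecs {1..n}" "high n (join n u v) \<in> vecs {1..n} \<longleftrightarrow> v \<in> vecs {1..n}"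
    "low (join n u v) \<in> pvecs {1..n} \<longleftrightarrow> u \<in> pvecs {1..n}" "high n (join n u v) \<in> pvecs {1..n} \<longleftrightarrow> v \<in> pvecs {1..n}"
  by (auto simp: vecs_def pvecs_def low_join high_join)

text \<open>A primitive vector \<open>(u, v)\<close> has either \<open>u\<close> primitive, or
  \<open>u\<close> divisible by \<open>P\<close> and \<open>v\<close> primitive. The symmetry
  \<open>swap\<close> turns the second case into the first with the other half confined to
  \<open>pvecs\<close>; this is why the count \<open>N\<close> depends on a set
  \<open>W\<close>.\<close>

lemma count_prim_pairs_halves:
  fixes C :: "(nat \<Rightarrow> 'a) \<Rightarrow> (nat \<Rightarrow> 'a) \<Rightarrow> (nat \<Rightarrow> 'a) \<Rightarrow> (nat \<Rightarrow> 'a) \<Rightarrow> bool"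
  assumes L: "x_basis L = X ` {1..2*n}"
    and C: "\<And>x y. x \<in> vecs (x_basis L) \<Longrightarrow> y \<in> vecs (x_basis L) \<Longrightarrow>
      (\<forall>e\<in>lie_basis L. lie_form L e x y \<in> M (Suc k)) \<longleftrightarrow> C (low x) (high n x) (low y) (high n y)"
    and swap: "\<And>u v u' v'. u \<in> vecs {1..n} \<Longrightarrow> v \<in> vecs {1..n} \<Longrightarrow> u' \<in> vecs {1..n} \<Longrightarrow> v' \<in> vecs {1..n} \<Longrightarrow>
      C u v u' v' \<longleftrightarrow> C v u v' u'"
    and cnt: "\<And>u a W. u \<in> vecs {1..n} \<Longrightarrow> a \<in> {1..n} \<Longrightarrow> u a \<notin> P \<Longrightarrow> W \<in> {vecs {1..n}, pvecs {1..n}} \<Longrightarrow>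
      class_count (pair_rel (vrel (Suc k) {1..n}) (pair_rel (vrel (Suc k) {1..n}) (vrel (Suc k) {1..n})))
        {(v, u', v'). v \<in> W \<and> u' \<in> vecs {1..n} \<and> v' \<in> vecs {1..n} \<and> C u v u' v'} = N W"
    and sat: "\<And>u v u' v' w z w' z'. u \<in> vecs {1..n} \<Longrightarrow> v \<in> vecs {1..n} \<Longrightarrow> u' \<in> vecs {1..n} \<Longrightarrow> v' \<in> vecs {1..n} \<Longrightarrow>
      w \<in> vecs {1..n} \<Longrightarrow> z \<in> vecs {1..n} \<Longrightarrow> w' \<in> vecs {1..n} \<Longrightarrow> z' \<in> vecs {1..n} \<Longrightarrow>
      vrel (Suc k) {1..n} u w \<Longrightarrow> vrel (Suc k) {1..n} v z \<Longrightarrow> vrel (Suc k) {1..n} u' w' \<Longrightarrow> vrel (Suc k) {1..n} v' z' \<Longrightarrow>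
      C u v u' v' \<Longrightarrow> C w z w' z'"
  shows "class_count (pair_rel (vrel (Suc k) (x_basis L)) (vrel (Suc k) (x_basis L))) (prim_pairs L (Suc k)) =
    (q ^ (Suc k * n) - q ^ (k * n)) * (N (vecs {1..n}) + N (pvecs {1..n}))"
proof -
  let ?B = "{1..n}" and ?K = "Suc k"
  let ?E = "vrel ?K ?B :: (nat \<Rightarrow> 'a) \<Rightarrow> _" and ?EX = "vrel ?K (x_basis L) :: (basis_elt \<Rightarrow> 'a) \<Rightarrow> _"
  let ?V = "vecs ?B" and ?Pv = "pvecs ?B" and ?Pr = "prim_vecs ?B"
  let ?F = "\<lambda>W u. {(v, u', v'). v \<in> W \<and> u' \<in> ?V \<and> v' \<in> ?V \<and> C u v u' v'}"
  let ?EE = "pair_rel ?E (pair_rel ?E (pair_rel ?E ?E))"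
  have finB: "finite ?B" by simp
  have PV: "?Pv \<subseteq> ?V" using vecs_split by blast
  have eqs: "equivp ?E" "equivp ?EX" "equivp (pair_rel ?EX ?EX)" "equivp (pair_rel ?E (pair_rel ?E ?E))" "equivp ?EE"
    by (intro equivp_pair_rel equivp_vrel)+
  note refl = equivp_reflp[OF eqs(1)] and sym = equivp_symp[OF eqs(1)]
  have finT: "finite (class_set (pair_rel ?E (pair_rel ?E ?E)) U)" if "U \<subseteq> ?V \<times> (?V \<times> ?V)" for U
    by (rule finite_subset[OF class_set_mono[OF that]],
        rule class_count_times(2)[OF eqs(1) equivp_pair_rel[OF eqs(1,1)] count_vecs(2)[OF finB]
          class_count_times(2)[OF eqs(1,1) count_vecs(2)[OF finB] count_vecs(2)[OF finB]]])
  have count_T: "class_count ?EE (SIGMA u:?Pr. ?F W u) = class_count ?E ?Pr * N W" if W: "W \<in> {?V, ?Pv}" for W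
  proof (rule class_count_fiber(1)[OF eqs(1,4)])
    have WV: "W \<subseteq> ?V" using W PV by auto
    show "finite (class_set ?E ?Pr)" by (rule finite_class_vecs[OF finB]) (auto simp: prim_vecs_def)
    show "finite (class_set (pair_rel ?E (pair_rel ?E ?E)) (?F W u))" for u
      by (rule finT) (use WV in auto)
    show "class_count (pair_rel ?E (pair_rel ?E ?E)) (?F W u) = N W" if u: "u \<in> ?Pr" for u
    proof -
      obtain a where "u \<in> ?V" "a \<in> ?B" "u a \<notin> P" using u by (auto simp: prim_vecs_def)
      thus ?thesis using cnt W by blast
    qed
    fix u w assume u: "u \<in> ?Pr" "w \<in> ?Pr" "?E u w"
    hence O: "u \<in> ?V" "w \<in> ?V" by (auto simp: prim_vecs_def)
    have "C u v u' v' \<longleftrightarrow> C w v u' v'" if "v \<in> W" "u' \<in> ?V" "v' \<in> ?V" for v u' v'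
    proof -
      have v: "v \<in> ?V" using that WV by blast
      show ?thesis
        using sat[OF O(1) v that(2,3) O(2) v that(2,3) u(3) refl refl refl]
          sat[OF O(2) v that(2,3) O(1) v that(2,3) sym[OF u(3)] refl refl refl] by blast
    qed
    thus "?F W u = ?F W w" by auto
  qed
  \<comment> \<open>The two disjoint cases: \<open>?Z1\<close> has a primitive lower half,
    \<open>?Z2\<close> a lower half divisible by \<open>P\<close> and a primitive upper
    half.\<close>
  let ?Z1 = "{(x, y). x \<in> vecs (x_basis L) \<and> y \<in> vecs (x_basis L) \<and> low x \<in> ?Pr \<and> C (low x) (high n x) (low y) (high n y)}"
  let ?Z2 = "{(x, y). x \<in> vecs (x_basis L) \<and> y \<in> vecs (x_basis L) \<and> low x \<in> ?Pv \<and> high n x \<in> ?Pr \<and>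
      C (low x) (high n x) (low y) (high n y)}"
  have vb: "x \<in> vecs (x_basis L) \<longleftrightarrow> low x \<in> ?V \<and> high n x \<in> ?V" for x unfolding L by (rule vecs_halves)
  have rb: "?EX x y \<longleftrightarrow> ?E (low x) (low y) \<and> ?E (high n x) (high n y)" for x y unfolding L by (rule vrel_halves)
  have PrV: "u \<in> ?Pr \<Longrightarrow> u \<in> ?V" for u by (simp add: prim_vecs_def)
  have jC: "C (low (join n u v)) (high n (join n u v)) (low (join n u' v')) (high n (join n u' v'))"
    if "C u v u' v'" "u \<in> ?V" "v \<in> ?V" "u' \<in> ?V" "v' \<in> ?V" for u v u' v'
    by (rule sat[OF that(2-5) _ _ _ _ sym[OF vrel_join(1)] sym[OF vrel_join(2)] sym[OF vrel_join(1)] sym[OF vrel_join(2)] that(1)])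
      (simp_all only: vecs_join that)
  have c1: "class_count (pair_rel ?EX ?EX) ?Z1 = class_count ?EE (SIGMA u:?Pr. ?F ?V u)"
  proof (rule class_count_bij[OF eqs(3,5), where f = "\<lambda>(x, y). (low x, (high n x, (low y, high n y)))"])
    show "\<exists>z\<in>?Z1. ?EE ((\<lambda>(x, y). (low x, (high n x, (low y, high n y)))) z) t" if t: "t \<in> (SIGMA u:?Pr. ?F ?V u)" for t
    proof -
      obtain u v u' v' where teq: "t = (u, (v, (u', v')))" by (metis surj_pair)
      have h: "u \<in> ?Pr" "u \<in> ?V" "v \<in> ?V" "u' \<in> ?V" "v' \<in> ?V" "C u v u' v'" using t PrV unfolding teq by auto
      have "low (join n u v) \<in> ?Pr" using h(1) unfolding prim_vecs_iff vecs_join .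
      hence "(join n u v, join n u' v') \<in> ?Z1" using h jC[OF h(6,2-5)] by (simp only: vb vecs_join mem_Collect_eq prod.case simp_thms)
      thus ?thesis by (rule rev_bexI) (simp only: teq prod.case pair_rel_simp vrel_join simp_thms)
    qed
  qed (auto simp: vb rb)
  have c2: "class_count (pair_rel ?EX ?EX) ?Z2 = class_count ?EE (SIGMA u:?Pr. ?F ?Pv u)"
  proof (rule class_count_bij[OF eqs(3,5), where f = "\<lambda>(x, y). (high n x, (low x, (high n y, low y)))"])
    show "(\<lambda>(x, y). (high n x, (low x, (high n y, low y)))) z \<in> (SIGMA u:?Pr. ?F ?Pv u)" if z: "z \<in> ?Z2" for z
    proof -
      obtain x y where [simp]: "z = (x, y)" by (cases z)
      have O: "low x \<in> ?V" "high n x \<in> ?V" "low y \<in> ?V" "high n y \<in> ?V" using z vb by auto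
      show ?thesis using z O swap[OF O] by auto
    qed
    show "\<exists>z\<in>?Z2. ?EE ((\<lambda>(x, y). (high n x, (low x, (high n y, low y)))) z) t" if t: "t \<in> (SIGMA u:?Pr. ?F ?Pv u)" for t
    proof -
      obtain u v u' v' where teq: "t = (u, (v, (u', v')))" by (metis surj_pair)
      have h: "u \<in> ?Pr" "v \<in> ?Pv" "u \<in> ?V" "v \<in> ?V" "u' \<in> ?V" "v' \<in> ?V" "C u v u' v'" using t PrV PV unfolding teq by auto
      have C': "C v u v' u'" using swap[OF h(3-6)] h(7) by blast
      have "high n (join n v u) \<in> ?Pr" using h(1) unfolding prim_vecs_iff vecs_join .
      hence "(join n v u, join n v' u') \<in> ?Z2" using h jC[OF C' h(4,3,6,5)] by (simp only: vb vecs_join mem_Collect_eq prod.case simp_thms)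
      thus ?thesis by (rule rev_bexI) (simp only: teq prod.case pair_rel_simp vrel_join simp_thms)
    qed
    show "?EE ((\<lambda>(x, y). (high n x, (low x, (high n y, low y)))) z) ((\<lambda>(x, y). (high n x, (low x, (high n y, low y)))) w)
        \<longleftrightarrow> pair_rel ?EX ?EX z w" for z w
      by (cases z, cases w) (auto simp: rb)
  qed
  have "x \<in> prim_vecs (x_basis L) \<longleftrightarrow> x \<in> vecs (x_basis L) \<and> (low x \<in> ?Pr \<or> low x \<in> ?Pv \<and> high n x \<in> ?Pr)" for x
    using vb[of x] pvecs_halves[of x n] unfolding prim_vecs_iff L by blast
  hence "prim_pairs L ?K = ?Z1 \<union> ?Z2"
    using C by (auto simp: comm_pairs_def)
  moreover have "class_count (pair_rel ?EX ?EX) (?Z1 \<union> ?Z2) = class_count (pair_rel ?EX ?EX) ?Z1 + class_count (pair_rel ?EX ?EX) ?Z2"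
  proof (rule class_count_Un[OF eqs(3)])
    show "finite (class_set (pair_rel ?EX ?EX) (?Z1 \<union> ?Z2))"
      by (rule finite_class_pair) (auto simp: L)
    show "\<not> pair_rel ?EX ?EX z w" if "z \<in> ?Z1" "w \<in> ?Z2" for z w
      using that prim_not_pvecs[of "low (fst z)" ?B "low (fst w)" k] by (cases z, cases w) (auto simp: rb)
  qed
  moreover have "class_count ?E ?Pr = q ^ (?K * n) - q ^ (k * n)"
    using count_prim_vecs[OF finB, of k] by simp
  ultimately show ?thesis using c1 c2 count_T[of ?V] count_T[of ?Pv] by (simp add: distrib_left)
qed

lemma count_ann_pvecs':
  "finite A \<Longrightarrow> finite B \<Longrightarrow> class_count (pair_rel (vrel (Suc k) A) (vrel (Suc k) B)) (ann_pairs (Suc k) (pvecs A) A B) =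
    q ^ card B * ann_count (card A) (card B) k"
  using count_ann_pvecs[of A B k] count_ann[of A B k] by simp

text \<open>The two inner summands come from the other half ranging over all vectors and over those
  divisible by \<open>P\<close>; the index \<open>n - 1\<close> records that one coordinate of
  \<open>z\<close> is fixed to 0.\<close>

lemma comm_count_G:
  assumes n: "n \<ge> 1"
  shows "comm_count (G_lat n) (M (Suc k)) = q ^ (2 * n) * comm_count (G_lat n) (M k) +
    (q ^ (Suc k * n) - q ^ (k * n)) * (q ^ Suc k * (ann_count n (n - 1) (Suc k) + q ^ (n - 1) * ann_count n (n - 1) k))"
proof -
  let ?L = "G_lat n" and ?B = "{1..n}"
  define C where "C = (\<lambda>u v u' v' :: nat \<Rightarrow> 'a. \<forall>i\<in>?B. \<forall>j\<in>?B. u i * v' j - u' i * v j \<in> M (Suc k))"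
  define N where "N = (\<lambda>W. if W = vecs ?B then q ^ Suc k * ann_count n (n - 1) (Suc k)
      else q ^ Suc k * (q ^ (n - 1) * ann_count n (n - 1) k))"
  \<comment> \<open>The case distinction inside \<open>N\<close> separates the two sets only if they
    differ, which requires a nonempty index set.\<close>
  have "pvecs ?B \<noteq> vecs ?B"
  proof
    assume "pvecs ?B = vecs ?B"
    moreover have "(\<lambda>_. 1) \<in> vecs ?B" by (simp add: vecs_def ints_1)
    moreover have "(\<lambda>_. 1) \<notin> pvecs ?B" using n primeD(4)[OF P] by (auto simp: pvecs_def)
    ultimately show False by blast
  qed
  hence NW: "N (vecs ?B) = q ^ Suc k * ann_count n (n - 1) (Suc k)"
    "N (pvecs ?B) = q ^ Suc k * (q ^ (n - 1) * ann_count n (n - 1) k)" by (simp_all add: N_def)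
  have "class_count (pair_rel (vrel (Suc k) (x_basis ?L)) (vrel (Suc k) (x_basis ?L))) (prim_pairs ?L (Suc k)) =
    (q ^ (Suc k * n) - q ^ (k * n)) * (N (vecs ?B) + N (pvecs ?B))"
  proof (rule count_prim_pairs_halves[where C = C, OF x_basis_G])
    fix x y assume "x \<in> vecs (x_basis ?L)" "y \<in> vecs (x_basis ?L)"
    show "(\<forall>e\<in>lie_basis ?L. lie_form ?L e x y \<in> M (Suc k)) \<longleftrightarrow> C (low x) (high n x) (low y) (high n y)"
    proof
      assume *: "\<forall>e\<in>lie_basis ?L. lie_form ?L e x y \<in> M (Suc k)"
      have "low x i * high n y j - low y i * high n x j \<in> M (Suc k)" if "i \<in> ?B" "j \<in> ?B" for i j
      proof -
        have "Y i j \<in> lie_basis ?L" using that by (simp add: G_lat_def)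
        thus ?thesis using * lie_form_G[OF that] unfolding low_def high_def by metis
      qed
      thus "C (low x) (high n x) (low y) (high n y)" by (simp add: C_def)
    next
      assume *: "C (low x) (high n x) (low y) (high n y)"
      show "\<forall>e\<in>lie_basis ?L. lie_form ?L e x y \<in> M (Suc k)"
      proof
        fix e assume e: "e \<in> lie_basis ?L"
        show "lie_form ?L e x y \<in> M (Suc k)"
        proof (cases e)
          case (X i)
          thus ?thesis using lie_form_X[OF two_step_G] idealD(2)[OF idM] by simp
        next
          case (Y i j)
          hence ij: "i \<in> ?B" "j \<in> ?B" using e by (auto simp: G_lat_def)
          thus ?thesis using lie_form_G[OF ij] * Y by (simp add: C_def low_def high_def)
        qed
      qed
    qed
  next
    fix u v u' v' :: "nat \<Rightarrow> 'a"
    have "u i * v' j - u' i * v j \<in> M (Suc k) \<longleftrightarrow> v j * u' i - v' j * u i \<in> M (Suc k)" for i j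
      using ideal_diff_commute[OF idM, of "u i * v' j" "u' i * v j" "Suc k"] by (simp add: mult.commute)
    thus "C u v u' v' \<longleftrightarrow> C v u v' u'" unfolding C_def by blast
  next
    fix u a and W :: "(nat \<Rightarrow> 'a) set"
    assume u: "u \<in> vecs ?B" "a \<in> ?B" "u a \<notin> P" and W: "W \<in> {vecs ?B, pvecs ?B}"
    have WV: "W \<subseteq> vecs ?B" using W vecs_split by auto
    have f: "finite ?B" "finite (?B - {a})" "card ?B = n" "card (?B - {a}) = n - 1" using u by simp_all
    have "class_count (pair_rel (vrel (Suc k) ?B) (vrel (Suc k) (?B - {a}))) (ann_pairs (Suc k) W ?B (?B - {a})) * q ^ Suc k = N W"
    proof (cases "W = vecs ?B")
      case True
      thus ?thesis using count_ann[OF f(1,2), of "Suc k"] NW(1) f(3,4) by simp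
    next
      case False
      hence "W = pvecs ?B" using W by blast
      thus ?thesis using count_ann_pvecs'[OF f(1,2), of k] NW(2) f(3,4) by simp
    qed
    thus "class_count (pair_rel (vrel (Suc k) ?B) (pair_rel (vrel (Suc k) ?B) (vrel (Suc k) ?B)))
        {(v, u', v'). v \<in> W \<and> u' \<in> vecs ?B \<and> v' \<in> vecs ?B \<and> C u v u' v'} = N W"
      unfolding C_def count_centralizer_tensor[OF f(1) u WV] by (simp add: mult.commute)
  next
    fix u v u' v' w z w' z' :: "nat \<Rightarrow> 'a"
    assume O: "u \<in> vecs ?B" "v \<in> vecs ?B" "u' \<in> vecs ?B" "v' \<in> vecs ?B"
      "w \<in> vecs ?B" "z \<in> vecs ?B" "w' \<in> vecs ?B" "z' \<in> vecs ?B"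
      and r: "vrel (Suc k) ?B u w" "vrel (Suc k) ?B v z" "vrel (Suc k) ?B u' w'" "vrel (Suc k) ?B v' z'"
      and c: "C u v u' v'"
    have "w i * z' j - w' i * z j \<in> M (Suc k)" if ij: "i \<in> ?B" "j \<in> ?B" for i j
    proof -
      have 1: "u i * v' j - w i * z' j \<in> M (Suc k)"
        by (rule mult_diff_mem) (use O r ij in \<open>auto simp: vec_rel_def vecs_def\<close>)
      have 2: "u' i * v j - w' i * z j \<in> M (Suc k)"
        by (rule mult_diff_mem) (use O r ij in \<open>auto simp: vec_rel_def vecs_def\<close>)
      from ideal_diff[OF idM 1 2] have "(u i * v' j - u' i * v j) - (w i * z' j - w' i * z j) \<in> M (Suc k)"
        by (simp add: algebra_simps)
      thus ?thesis using M_cong c ij unfolding C_def by blast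
    qed
    thus "C w z w' z'" by (simp add: C_def)
  qed
  thus ?thesis using comm_count_Suc[OF two_step_G, of n k] NW by (simp add: x_basis_G card_image inj_X distrib_left)
qed

text \<open>Compared with \<open>G_lat\<close> there is one more free parameter, the coefficient
  \<open>l\<close> of \<open>u\<close> in the other half. It ranges over \<open>\<O>\<close> or over
  \<open>P\<close>, hence the factors \<open>q ^ Suc k\<close> and \<open>q ^ k\<close>.\<close>

lemma comm_count_H:
  assumes n: "n \<ge> 1"
  shows "comm_count (H_lat n) (M (Suc k)) = q ^ (2 * n) * comm_count (H_lat n) (M k) +
    (q ^ (Suc k * n) - q ^ (k * n)) * (q ^ Suc k * (q ^ Suc k * ann_count (n - 1) (n - 1) (Suc k) +
      q ^ k * (q ^ (n - 1) * ann_count (n - 1) (n - 1) k)))"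
proof -
  let ?L = "H_lat n" and ?B = "{1..n}"
  define C where "C = (\<lambda>u v u' v' :: nat \<Rightarrow> 'a. \<forall>i\<in>?B. \<forall>j\<in>?B. quad u v' i j - quad u' v i j \<in> M (Suc k))"
  define N where "N = (\<lambda>W. if W = vecs ?B then q ^ Suc k * q ^ Suc k * ann_count (n - 1) (n - 1) (Suc k)
      else q ^ Suc k * q ^ k * (q ^ (n - 1) * ann_count (n - 1) (n - 1) k))"
  have "pvecs ?B \<noteq> vecs ?B"
  proof
    assume "pvecs ?B = vecs ?B"
    moreover have "(\<lambda>_. 1) \<in> vecs ?B" by (simp add: vecs_def ints_1)
    moreover have "(\<lambda>_. 1) \<notin> pvecs ?B" using n primeD(4)[OF P] by (auto simp: pvecs_def)
    ultimately show False by blast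
  qed
  hence NW: "N (vecs ?B) = q ^ Suc k * q ^ Suc k * ann_count (n - 1) (n - 1) (Suc k)"
    "N (pvecs ?B) = q ^ Suc k * q ^ k * (q ^ (n - 1) * ann_count (n - 1) (n - 1) k)" by (simp_all add: N_def)
  have "class_count (pair_rel (vrel (Suc k) (x_basis ?L)) (vrel (Suc k) (x_basis ?L))) (prim_pairs ?L (Suc k)) =
    (q ^ (Suc k * n) - q ^ (k * n)) * (N (vecs ?B) + N (pvecs ?B))"
  proof (rule count_prim_pairs_halves[where C = C, OF x_basis_H])
    fix x y assume "x \<in> vecs (x_basis ?L)" "y \<in> vecs (x_basis ?L)"
    show "(\<forall>e\<in>lie_basis ?L. lie_form ?L e x y \<in> M (Suc k)) \<longleftrightarrow> C (low x) (high n x) (low y) (high n y)"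
    proof
      assume *: "\<forall>e\<in>lie_basis ?L. lie_form ?L e x y \<in> M (Suc k)"
      have lt: "quad (low x) (high n y) i j - quad (low y) (high n x) i j \<in> M (Suc k)"
        if "1 \<le> i" "i \<le> j" "j \<le> n" for i j
      proof -
        have "Y i j \<in> lie_basis ?L" using that by (simp add: H_lat_def)
        hence "lie_form ?L (Y i j) x y \<in> M (Suc k)" using * by blast
        thus ?thesis unfolding lie_form_H[OF that] low_def[abs_def] high_def[abs_def] .
      qed
      have "quad (low x) (high n y) i j - quad (low y) (high n x) i j \<in> M (Suc k)" if "i \<in> ?B" "j \<in> ?B" for i j
      proof (cases "i \<le> j")
        case False
        thus ?thesis using lt[of j i] that by (simp add: quad_sym[of _ _ i j])
      qed (use lt that in auto)
      thus "C (low x) (high n x) (low y) (high n y)" by (simp add: C_def)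
    next
      assume *: "C (low x) (high n x) (low y) (high n y)"
      show "\<forall>e\<in>lie_basis ?L. lie_form ?L e x y \<in> M (Suc k)"
      proof
        fix e assume e: "e \<in> lie_basis ?L"
        show "lie_form ?L e x y \<in> M (Suc k)"
        proof (cases e)
          case (X i)
          thus ?thesis using lie_form_X[OF two_step_H] idealD(2)[OF idM] by simp
        next
          case (Y i j)
          hence ij: "1 \<le> i" "i \<le> j" "j \<le> n" using e by (auto simp: H_lat_def)
          hence "quad (low x) (high n y) i j - quad (low y) (high n x) i j \<in> M (Suc k)" using * by (simp add: C_def)
          thus ?thesis unfolding Y lie_form_H[OF ij] low_def[abs_def] high_def[abs_def] .
        qed
      qed
    qed
  next
    fix u v u' v' :: "nat \<Rightarrow> 'a"
    have "quad u v' i j - quad u' v i j \<in> M (Suc k) \<longleftrightarrow> quad v u' i j - quad v' u i j \<in> M (Suc k)" for i j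
      using ideal_diff_commute[OF idM, of "quad u v' i j" "quad u' v i j" "Suc k"]
      by (simp only: quad_commute[of v u'] quad_commute[of v' u])
    thus "C u v u' v' \<longleftrightarrow> C v u v' u'" unfolding C_def by blast
  next
    fix u a and W :: "(nat \<Rightarrow> 'a) set"
    assume u: "u \<in> vecs ?B" "a \<in> ?B" "u a \<notin> P" and W: "W \<in> {vecs ?B, pvecs ?B}"
    have f: "finite ?B" "finite (?B - {a})" "card (?B - {a}) = n - 1" using u by simp_all
    note uO = vecsD[OF u(1)]
    show "class_count (pair_rel (vrel (Suc k) ?B) (pair_rel (vrel (Suc k) ?B) (vrel (Suc k) ?B)))
        {(v, u', v'). v \<in> W \<and> u' \<in> vecs ?B \<and> v' \<in> vecs ?B \<and> C u v u' v'} = N W"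
    proof (cases "W = vecs ?B")
      case True
      have "(\<lambda>i. l * u i + zero_at a w i) \<in> vecs ?B" if "l \<in> \<O>" "w \<in> vecs (?B - {a})" for l w
        using zero_at_vecs[OF that(2)] that uO by (auto simp: vecs_def intro!: ints_add ints_mult)
      hence "class_count (pair_rel (vrel (Suc k) ?B) (pair_rel (vrel (Suc k) ?B) (vrel (Suc k) ?B)))
        {(v, u', v'). v \<in> vecs ?B \<and> u' \<in> vecs ?B \<and> v' \<in> vecs ?B \<and> C u v u' v'} =
        q ^ Suc k * class_count (diff_rel (M (Suc k))) \<O> *
        class_count (pair_rel (vrel (Suc k) (?B - {a})) (vrel (Suc k) (?B - {a}))) (ann_pairs (Suc k) (vecs (?B - {a})) (?B - {a}) (?B - {a}))"
        unfolding C_def by (intro count_centralizer_quad[OF f(1) u]) auto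
      thus ?thesis using True NW(1) count_ann[OF f(2,2), of "Suc k"] count_ints(1) f(3) by simp
    next
      case False
      hence W: "W = pvecs ?B" using W by blast
      \<comment> \<open>Since \<open>u a\<close> is outside \<open>P\<close>, divisibility of the
        combination by \<open>P\<close> passes first to \<open>l\<close>, through coordinate
        \<open>a\<close>, and then to \<open>w\<close>.\<close>
      have "(\<lambda>i. l * u i + zero_at a w i) \<in> pvecs ?B \<longleftrightarrow> l \<in> P \<and> w \<in> pvecs (?B - {a})"
        if lw: "l \<in> \<O>" "w \<in> vecs (?B - {a})" for l w
      proof
        assume *: "(\<lambda>i. l * u i + zero_at a w i) \<in> pvecs ?B"
        hence "l * u a + zero_at a w a \<in> P" using u(2) unfolding pvecs_def by blast
        hence "l * u a \<in> P" by (simp add: zero_at_def)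
        hence lP: "l \<in> P" using primeD(5)[OF P lw(1) uO[OF u(2)]] u(3) by blast
        have "w i \<in> P" if "i \<in> ?B - {a}" for i
        proof -
          have i: "i \<in> ?B" "i \<noteq> a" using that by auto
          have "l * u i + zero_at a w i \<in> P" using * i by (auto simp: pvecs_def)
          from ideal_diff[OF idP this idealD(5)[OF idP uO[OF i(1)] lP]] show ?thesis using i by (simp add: zero_at_def)
        qed
        thus "l \<in> P \<and> w \<in> pvecs (?B - {a})" using lP by (simp add: pvecs_def)
      next
        assume *: "l \<in> P \<and> w \<in> pvecs (?B - {a})"
        show "(\<lambda>i. l * u i + zero_at a w i) \<in> pvecs ?B"
          using * uO idealD(2)[OF idP] by (auto simp: pvecs_def zero_at_def intro!: idealD(3)[OF idP] idealD(5)[OF idP])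
      qed
      moreover have "y \<in> pvecs ?B" if "x \<in> pvecs ?B" "vrel (Suc k) ?B x y" for x y
      proof -
        have "y i \<in> P" if "i \<in> ?B" for i
        proof -
          have 1: "x i \<in> P" using \<open>x \<in> pvecs ?B\<close> that unfolding pvecs_def by blast
          have "x i - y i \<in> M (Suc k)" using \<open>vrel (Suc k) ?B x y\<close> that unfolding vec_rel_def by blast
          from ideal_diff[OF idP 1 M_Suc_P[OF this]] show ?thesis by simp
        qed
        thus ?thesis by (simp add: pvecs_def)
      qed
      ultimately have "class_count (pair_rel (vrel (Suc k) ?B) (pair_rel (vrel (Suc k) ?B) (vrel (Suc k) ?B)))
        {(v, u', v'). v \<in> pvecs ?B \<and> u' \<in> vecs ?B \<and> v' \<in> vecs ?B \<and> C u v u' v'} =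
        q ^ Suc k * class_count (diff_rel (M (Suc k))) P *
        class_count (pair_rel (vrel (Suc k) (?B - {a})) (vrel (Suc k) (?B - {a}))) (ann_pairs (Suc k) (pvecs (?B - {a})) (?B - {a}) (?B - {a}))"
        unfolding C_def using vecs_split P_O by (intro count_centralizer_quad[OF f(1) u]) blast+
      thus ?thesis using W NW(2) count_ann_pvecs'[OF f(2,2), of k] count_P f(3) by simp
    qed
  next
    fix u v u' v' w z w' z' :: "nat \<Rightarrow> 'a"
    assume O: "u \<in> vecs ?B" "v \<in> vecs ?B" "u' \<in> vecs ?B" "v' \<in> vecs ?B"
      "w \<in> vecs ?B" "z \<in> vecs ?B" "w' \<in> vecs ?B" "z' \<in> vecs ?B"
      and r: "vrel (Suc k) ?B u w" "vrel (Suc k) ?B v z" "vrel (Suc k) ?B u' w'" "vrel (Suc k) ?B v' z'"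
      and c: "C u v u' v'"
    have "quad w z' i j - quad w' z i j \<in> M (Suc k)" if ij: "i \<in> ?B" "j \<in> ?B" for i j
    proof -
      have q: "quad x y i j - quad x' y' i j \<in> M (Suc k)"
        if "x \<in> vecs ?B" "y' \<in> vecs ?B" "vrel (Suc k) ?B x x'" "vrel (Suc k) ?B y y'" for x y x' y'
      proof -
        have "quad x y i j - quad x y' i j \<in> M (Suc k)" by (rule quad_cong_right[OF that(1,4) ij])
        moreover have "quad y' x i j - quad y' x' i j \<in> M (Suc k)" by (rule quad_cong_right[OF that(2,3) ij])
        ultimately have "(quad x y i j - quad x y' i j) + (quad y' x i j - quad y' x' i j) \<in> M (Suc k)"
          by (rule prime_pow_ideal(3))
        thus ?thesis by (simp add: quad_commute[of y'])
      qed
      from ideal_diff[OF idM q[OF O(1,8) r(1,4)] q[OF O(3,6) r(3,2)]]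
      have "(quad u v' i j - quad u' v i j) - (quad w z' i j - quad w' z i j) \<in> M (Suc k)"
        by (simp add: algebra_simps)
      thus ?thesis using M_cong c ij unfolding C_def by blast
    qed
    thus "C w z w' z'" by (simp add: C_def)
  qed
  thus ?thesis using comm_count_Suc[OF two_step_H, of n k] NW
    by (simp add: x_basis_H card_image inj_X distrib_left mult_ac)
qed

end

section \<open>Generating functions\<close>

text \<open>Cauchy product with the geometric series; \<open>y\<close> is the sequence of increments
  of \<open>x\<close>.\<close>

lemma partial_sums_gf:
  fixes x y :: "nat \<Rightarrow> complex"
  assumes y: "summable (\<lambda>k. norm (y k * t ^ k))" and t: "norm t < 1"
    and x: "x 0 = y 0" "\<And>k. x (Suc k) = x k + y (Suc k)"
  shows "summable (\<lambda>k. norm (x k * t ^ k))"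
    and "(\<Sum>k. x k * t ^ k) = (\<Sum>k. y k * t ^ k) / (1 - t)"
proof -
  have xs: "x k = (\<Sum>i\<le>k. y i)" for k by (induction k) (simp_all add: x)
  have st: "summable (\<lambda>k. norm (t ^ k))" using t by (simp add: norm_power summable_geometric)
  have eq: "(\<Sum>i\<le>k. (y i * t ^ i) * t ^ (k - i)) = x k * t ^ k" for k
  proof -
    have "(\<Sum>i\<le>k. (y i * t ^ i) * t ^ (k - i)) = (\<Sum>i\<le>k. y i * t ^ k)"
      by (intro sum.cong) (auto simp: mult.assoc power_add[symmetric])
    thus ?thesis by (simp add: xs sum_distrib_right)
  qed
  have "(\<lambda>k. x k * t ^ k) sums ((\<Sum>k. y k * t ^ k) * (\<Sum>k. t ^ k))"
    using Cauchy_product_sums[OF y st] by (simp add: eq)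
  thus "(\<Sum>k. x k * t ^ k) = (\<Sum>k. y k * t ^ k) / (1 - t)"
    using suminf_geometric[OF t] by (simp add: sums_iff)
  have "summable (\<lambda>k. \<Sum>i\<le>k. norm (y i * t ^ i) * norm (t ^ (k - i)))"
    by (rule summable_Cauchy_product) (use y st in simp_all)
  moreover have "norm (norm (x k * t ^ k)) \<le> (\<Sum>i\<le>k. norm (y i * t ^ i) * norm (t ^ (k - i)))" for k
    unfolding eq[symmetric] by (simp add: norm_mult[symmetric] norm_sum)
  ultimately show "summable (\<lambda>k. norm (x k * t ^ k))" by (rule summable_comparison_test'[where N = 0])
qed

lemma suminf_head:
  fixes f :: "nat \<Rightarrow> complex"
  assumes "summable (\<lambda>k. norm (f k))"
  shows "(\<Sum>k. f k) = f 0 + (\<Sum>k. f (Suc k))"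
  using suminf_split_head[OF summable_norm_cancel[OF assms]] by simp

text \<open>The increments in the recurrences are geometric from index 1 on, but start with 1
  instead of \<open>c\<close>.\<close>

lemma geometric_tail_gf:
  fixes c z :: complex
  assumes y: "\<And>k. y k * t ^ k = (if k = 0 then 1 else c * z ^ k)" and z: "norm z < 1"
  shows "summable (\<lambda>k. norm (y k * t ^ k))" "(\<Sum>k. y k * t ^ k) = 1 + c * (z / (1 - z))"
proof -
  have g: "summable (\<lambda>k. norm (c * z ^ k))"
    using z by (simp add: norm_mult norm_power summable_mult summable_geometric)
  show s: "summable (\<lambda>k. norm (y k * t ^ k))"
    by (rule summable_comparison_test'[OF g, of 1]) (simp add: y)
  have "(\<Sum>k. c * z * z ^ k) = c * z * (\<Sum>k. z ^ k)"
    using z by (intro suminf_mult summable_geometric)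
  hence "(\<Sum>k. y (Suc k) * t ^ Suc k) = c * z / (1 - z)"
    unfolding y using suminf_geometric[OF z] by (simp add: mult.assoc)
  moreover have "y 0 * t ^ 0 = 1" using y[of 0] by simp
  ultimately show "(\<Sum>k. y k * t ^ k) = 1 + c * (z / (1 - z))" using suminf_head[OF s] by simp
qed

text \<open>The common shape of the increments for \<open>G_lat\<close>, where \<open>z = t\<close>,
  and \<open>H_lat\<close>, where \<open>z = Q t\<close>.\<close>

lemma two_term_gf:
  fixes a t :: complex and \<alpha> y :: "nat \<Rightarrow> complex"
  assumes A: "summable (\<lambda>k. norm (\<alpha> k * z ^ k))" and a0: "\<alpha> 0 = 1"
    and y0: "y 0 = 1" and y: "\<And>k. y (Suc k) * t ^ Suc k = a * (\<alpha> (Suc k) * z ^ Suc k + t * (\<alpha> k * z ^ k))"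
  shows "summable (\<lambda>k. norm (y k * t ^ k))"
    "(\<Sum>k. y k * t ^ k) = 1 + a * ((\<Sum>k. \<alpha> k * z ^ k) - 1 + t * (\<Sum>k. \<alpha> k * z ^ k))"
proof -
  let ?A = "\<Sum>k. \<alpha> k * z ^ k"
  have s: "summable (\<lambda>k. \<alpha> k * z ^ k)" by (rule summable_norm_cancel[OF A])
  have s1: "summable (\<lambda>k. norm (\<alpha> (Suc k) * z ^ Suc k))" using A by (subst summable_Suc_iff)
  have sg: "summable (\<lambda>k. norm a * (norm (\<alpha> (Suc k) * z ^ Suc k) + norm t * norm (\<alpha> k * z ^ k)))"
    by (intro summable_mult summable_add s1 A)
  have "norm (norm (y (Suc k) * t ^ Suc k)) \<le> norm a * (norm (\<alpha> (Suc k) * z ^ Suc k) + norm t * norm (\<alpha> k * z ^ k))" for k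
  proof -
    have "norm (y (Suc k) * t ^ Suc k) = norm a * norm (\<alpha> (Suc k) * z ^ Suc k + t * (\<alpha> k * z ^ k))"
      unfolding y by (rule norm_mult)
    also have "\<dots> \<le> norm a * (norm (\<alpha> (Suc k) * z ^ Suc k) + norm (t * (\<alpha> k * z ^ k)))"
      by (intro mult_left_mono norm_triangle_ineq norm_ge_zero)
    also have "norm (t * (\<alpha> k * z ^ k)) = norm t * norm (\<alpha> k * z ^ k)" by (rule norm_mult)
    finally show ?thesis unfolding real_norm_def abs_norm_cancel .
  qed
  from summable_comparison_test'[OF sg this] have "summable (\<lambda>k. norm (y (Suc k) * t ^ Suc k))" .
  thus sy: "summable (\<lambda>k. norm (y k * t ^ k))" by (subst (asm) summable_Suc_iff)
  have "(\<lambda>k. \<alpha> (Suc k) * z ^ Suc k) sums (?A - 1)"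
    using summable_sums[OF s] a0 by (subst sums_Suc_iff) simp
  moreover have "(\<lambda>k. t * (\<alpha> k * z ^ k)) sums (t * ?A)" by (intro sums_mult summable_sums s)
  ultimately have "(\<lambda>k. y (Suc k) * t ^ Suc k) sums (a * (?A - 1 + t * ?A))"
    unfolding y by (rule sums_mult[OF sums_add])
  thus "(\<Sum>k. y k * t ^ k) = 1 + a * (?A - 1 + t * ?A)"
    using suminf_head[OF sy] y0 by (simp add: sums_iff)
qed

text \<open>To be read with \<open>Q\<close> the index of \<open>P\<close>,
  \<open>a = Q^(-d)\<close>, \<open>c k\<close> the number of commuting pairs divided by
  \<open>Q^(kd)\<close>, and \<open>t\<close> the local variable.\<close>

lemma gf_F:
  fixes c :: "nat \<Rightarrow> complex"
  assumes c: "c 0 = 1" "\<And>k. c (Suc k) = c k + (1 - a) * Q ^ Suc k"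
    and t: "norm t < 1" "norm (Q * t) < 1"
  shows "(\<Sum>k. c k * t ^ k) = (1 - Q * a * t) / ((1 - t) * (1 - Q * t))"
proof -
  define y where "y = (\<lambda>k. if k = 0 then 1 else (1 - a) * Q ^ k)"
  have "y k * t ^ k = (if k = 0 then 1 else (1 - a) * (Q * t) ^ k)" for k
    by (simp add: y_def power_mult_distrib)
  note g = geometric_tail_gf[OF this t(2)]
  have "(\<Sum>k. c k * t ^ k) = (1 + (1 - a) * (Q * t / (1 - Q * t))) / (1 - t)"
    unfolding g(2)[symmetric] by (rule partial_sums_gf(2)[OF g(1) t(1)]) (simp_all add: c y_def)
  moreover have "1 - t \<noteq> 0" "1 - Q * t \<noteq> 0" using t by auto
  ultimately show ?thesis by (simp add: field_simps)
qed

lemma clear_denominators: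
  fixes d e :: complex
  assumes "d \<noteq> 0" "e \<noteq> 0"
  shows "(1 + b * (z / e)) / d * (d * e) = e + b * z"
  using assms by (simp add: field_simps)

text \<open>Here \<open>a = Q^(-n)\<close> and \<open>\<alpha>\<close> is the normalized
  \<open>ann_count\<close>. Both \<open>\<alpha>\<close> and \<open>c\<close> are obtained by
  summing increments, hence the square of \<open>1 - t\<close>.\<close>

lemma gf_G:
  fixes c \<alpha> :: "nat \<Rightarrow> complex"
  assumes \<alpha>: "\<alpha> 0 = 1" "\<And>k. \<alpha> (Suc k) = \<alpha> k + (1 - a) * Q ^ Suc k"
    and c: "c 0 = 1" "\<And>k. c (Suc k) = c k + (1 - a) * (\<alpha> (Suc k) + \<alpha> k)"
    and t: "norm t < 1" "norm (Q * t) < 1"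
  shows "(\<Sum>k. c k * t ^ k) = ((1 - a * t) * (1 - Q * a * t) + t * (1 - a) * (1 - Q * a)) / ((1 - t)^2 * (1 - Q * t))"
proof -
  define y where "y = (\<lambda>k. if k = 0 then 1 else (1 - a) * Q ^ k)"
  have "y k * t ^ k = (if k = 0 then 1 else (1 - a) * (Q * t) ^ k)" for k
    by (simp add: y_def power_mult_distrib)
  note g = geometric_tail_gf[OF this t(2)]
  have sA: "summable (\<lambda>k. norm (\<alpha> k * t ^ k))"
    by (rule partial_sums_gf(1)[OF g(1) t(1)]) (simp_all add: \<alpha> y_def)
  have A: "(\<Sum>k. \<alpha> k * t ^ k) = (1 + (1 - a) * (Q * t / (1 - Q * t))) / (1 - t)" (is "?A = _")
    unfolding g(2)[symmetric] by (rule partial_sums_gf(2)[OF g(1) t(1)]) (simp_all add: \<alpha> y_def)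
  define x where "x = (\<lambda>k. case k of 0 \<Rightarrow> 1 | Suc k \<Rightarrow> (1 - a) * (\<alpha> (Suc k) + \<alpha> k))"
  have "x (Suc k) * t ^ Suc k = (1 - a) * (\<alpha> (Suc k) * t ^ Suc k + t * (\<alpha> k * t ^ k))" for k
    by (simp add: x_def algebra_simps)
  moreover have "x 0 = 1" by (simp add: x_def)
  ultimately have X: "summable (\<lambda>k. norm (x k * t ^ k))" "(\<Sum>k. x k * t ^ k) = 1 + (1 - a) * (?A - 1 + t * ?A)"
    using two_term_gf[OF sA \<alpha>(1), of x t "1 - a"] by auto
  have "(\<Sum>k. c k * t ^ k) = (1 + (1 - a) * (?A - 1 + t * ?A)) / (1 - t)"
    unfolding X(2)[symmetric] by (rule partial_sums_gf(2)[OF X(1) t(1)]) (simp_all add: c x_def)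
  also have "1 + (1 - a) * (?A - 1 + t * ?A) = 1 + (1 - a) * ((1 + t) * ?A - 1)" by (simp add: algebra_simps)
  also have "(1 + (1 - a) * ((1 + t) * ?A - 1)) / (1 - t) =
      ((1 - a * t) * (1 - Q * a * t) + t * (1 - a) * (1 - Q * a)) / ((1 - t)^2 * (1 - Q * t))"
  proof -
    have nz: "1 - t \<noteq> 0" "1 - Q * t \<noteq> 0" using t by auto
    \<comment> \<open>With the denominators of \<open>?A\<close> cleared, the rest is a polynomial
      identity.\<close>
    have A': "?A * ((1 - t) * (1 - Q * t)) = (1 - Q * t) + (1 - a) * (Q * t)"
      unfolding A using clear_denominators[OF nz] by simp
    have "(1 + (1 - a) * ((1 + t) * ?A - 1)) * ((1 - t) * (1 - Q * t)) =
        a * ((1 - t) * (1 - Q * t)) + (1 - a) * (1 + t) * (?A * ((1 - t) * (1 - Q * t)))"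
      by (simp add: algebra_simps)
    also have "\<dots> = (1 - a * t) * (1 - Q * a * t) + t * (1 - a) * (1 - Q * a)"
      unfolding A' by (simp add: algebra_simps)
    finally have "1 + (1 - a) * ((1 + t) * ?A - 1) =
        ((1 - a * t) * (1 - Q * a * t) + t * (1 - a) * (1 - Q * a)) / ((1 - t) * (1 - Q * t))"
      using nz by (simp add: eq_divide_eq)
    thus ?thesis by (simp add: power2_eq_square mult_ac)
  qed
  finally show ?thesis .
qed

text \<open>Here \<open>\<beta>\<close> grows linearly and appears with weight \<open>Q^k\<close>,
  which squares the factor \<open>1 - Q t\<close> instead of \<open>1 - t\<close>.\<close>

lemma gf_H:
  fixes c \<beta> :: "nat \<Rightarrow> complex"
  assumes \<beta>: "\<beta> 0 = 1" "\<And>k. \<beta> (Suc k) = \<beta> k + (1 - Q * a)"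
    and c: "c 0 = 1" "\<And>k. c (Suc k) = c k + (1 - a) * (Q ^ Suc k * \<beta> (Suc k) + Q ^ k * \<beta> k)"
    and t: "norm t < 1" "norm (Q * t) < 1"
  shows "(\<Sum>k. c k * t ^ k) = ((1 - a * t) * (1 - Q^2 * a * t) + t * (1 - Q * a)^2) / ((1 - t) * (1 - Q * t)^2)"
proof -
  let ?z = "Q * t"
  define y where "y = (\<lambda>k :: nat. if k = 0 then 1 else 1 - Q * a)"
  have "y k * ?z ^ k = (if k = 0 then 1 else (1 - Q * a) * ?z ^ k)" for k
    by (simp add: y_def)
  note g = geometric_tail_gf[OF this t(2)]
  have sA: "summable (\<lambda>k. norm (\<beta> k * ?z ^ k))"
    by (rule partial_sums_gf(1)[OF g(1) t(2)]) (simp_all add: \<beta> y_def)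
  have A: "(\<Sum>k. \<beta> k * ?z ^ k) = (1 + (1 - Q * a) * (?z / (1 - ?z))) / (1 - ?z)" (is "?A = _")
    unfolding g(2)[symmetric] by (rule partial_sums_gf(2)[OF g(1) t(2)]) (simp_all add: \<beta> y_def)
  define x where "x = (\<lambda>k. case k of 0 \<Rightarrow> 1 | Suc k \<Rightarrow> (1 - a) * (Q ^ Suc k * \<beta> (Suc k) + Q ^ k * \<beta> k))"
  have "x (Suc k) * t ^ Suc k = (1 - a) * (\<beta> (Suc k) * ?z ^ Suc k + t * (\<beta> k * ?z ^ k))" for k
    by (simp add: x_def algebra_simps power_mult_distrib)
  moreover have "x 0 = 1" by (simp add: x_def)
  ultimately have X: "summable (\<lambda>k. norm (x k * t ^ k))" "(\<Sum>k. x k * t ^ k) = 1 + (1 - a) * (?A - 1 + t * ?A)"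
    using two_term_gf[OF sA \<beta>(1), of x t "1 - a"] by auto
  have "(\<Sum>k. c k * t ^ k) = (1 + (1 - a) * (?A - 1 + t * ?A)) / (1 - t)"
    unfolding X(2)[symmetric] by (rule partial_sums_gf(2)[OF X(1) t(1)]) (simp_all add: c x_def)
  also have "1 + (1 - a) * (?A - 1 + t * ?A) = 1 + (1 - a) * ((1 + t) * ?A - 1)" by (simp add: algebra_simps)
  also have "(1 + (1 - a) * ((1 + t) * ?A - 1)) / (1 - t) =
      ((1 - a * t) * (1 - Q^2 * a * t) + t * (1 - Q * a)^2) / ((1 - t) * (1 - Q * t)^2)"
  proof -
    have nz: "1 - t \<noteq> 0" "1 - Q * t \<noteq> 0" using t by auto
    have A': "?A * (1 - Q * t)^2 = (1 - Q * t) + (1 - Q * a) * (Q * t)"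
      unfolding A using clear_denominators[OF nz(2) nz(2)] by (simp add: power2_eq_square)
    have "(1 + (1 - a) * ((1 + t) * ?A - 1)) * (1 - Q * t)^2 =
        a * (1 - Q * t)^2 + (1 - a) * (1 + t) * (?A * (1 - Q * t)^2)"
      by (simp add: algebra_simps)
    also have "\<dots> = (1 - a * t) * (1 - Q^2 * a * t) + t * (1 - Q * a)^2"
      unfolding A' by (simp add: algebra_simps power2_eq_square)
    finally have "1 + (1 - a) * ((1 + t) * ?A - 1) =
        ((1 - a * t) * (1 - Q^2 * a * t) + t * (1 - Q * a)^2) / (1 - Q * t)^2"
      using nz by (simp add: eq_divide_eq)
    thus ?thesis by (simp add: mult_ac)
  qed
  finally show ?thesis .
qed

section \<open>Euler factors\<close>

lemma has_abs_prod_cong: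
  assumes "\<And>x. x \<in> A \<Longrightarrow> f x = g x"
  shows "has_abs_prod f A z \<longleftrightarrow> has_abs_prod g A z"
proof -
  have "(\<lambda>x. f x - 1) abs_summable_on A \<longleftrightarrow> (\<lambda>x. g x - 1) abs_summable_on A"
    by (intro summable_on_cong) (simp add: assms)
  moreover have "(prod f \<longlongrightarrow> z) (finite_subsets_at_top A) \<longleftrightarrow> (prod g \<longlongrightarrow> z) (finite_subsets_at_top A)"
  proof (rule tendsto_cong)
    show "\<forall>\<^sub>F F in finite_subsets_at_top A. prod f F = prod g F"
      using assms by (intro eventually_finite_subsets_at_top_weakI prod.cong) auto
  qed
  ultimately show ?thesis by (simp add: has_abs_prod_def)
qed

lemma of_nat_mult_powr: "(of_nat (m * n) :: complex) powr z = of_nat m powr z * of_nat n powr z"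
  using powr_times_real[of "of_nat m" "of_nat n" z] by simp

lemma of_nat_power_powr: "n > 0 \<Longrightarrow> (of_nat (n ^ k) :: complex) powr z = (of_nat n powr z) ^ k"
proof (induction k)
  case (Suc k)
  have "(of_nat (n ^ Suc k) :: complex) powr z = of_nat n powr z * of_nat (n ^ k) powr z"
    using of_nat_mult_powr[of n "n ^ k" z] by simp
  thus ?case using Suc by simp
qed simp

lemma norm_of_nat_powr: "n > 0 \<Longrightarrow> norm ((of_nat n :: complex) powr z) = real n powr Re z"
  using norm_powr_real_powr[of "of_nat n" z] by simp

section \<open>Multiplicativity of the Dirichlet coefficients and their majorant\<close>

context number_field_loc
begin

text \<open>As for the index, the count at \<open>\<O>\<close> is positive and equal to its own
  square.\<close>

lemma comm_count_ints: "two_step L \<Longrightarrow> comm_count L \<O> = 1"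
proof -
  assume L: "two_step L"
  have "comm_count L (\<O> \<inter> \<O>) = comm_count L \<O> * comm_count L \<O>"
    by (rule comm_count_Int[OF L proper_ideal_ints proper_ideal_ints ints_0 ints_1]) simp
  moreover have "comm_count L \<O> > 0"
    unfolding comm_count_def
  proof (rule class_count_pos[OF finite_comm_pairs(1)[OF L proper_ideal_ints]])
    have "(\<lambda>_. 0, \<lambda>_. 0) \<in> comm_pairs L \<O>"
      by (auto simp: comm_pairs_def vecs_def lie_form_def ints_0 intro!: ints_sum)
    thus "comm_pairs L \<O> \<noteq> {}" by blast
  qed
  ultimately show ?thesis by simp
qed

abbreviation "xdim L \<equiv> card (x_basis L)"
abbreviation "ydim L \<equiv> card (lie_basis L - x_basis L)"

lemma class_zeta_term_eq:
  assumes L: "two_step L" and I: "proper_ideal I"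
  shows "class_zeta_term L K s I = of_nat (index I) ^ ydim L * of_nat (comm_count L I) /
      of_nat (index I) ^ xdim L * of_nat (index I) powr (- s)"
proof -
  have pos: "of_nat (index I) \<noteq> (0::complex)" using index_pos[OF I] by simp
  let ?c = "class_number (unipotent_group L (ring_of_integers K Quot I))"
  have "of_nat (?c * index I ^ xdim L) = (of_nat (index I ^ ydim L * comm_count L I) :: complex)"
    using class_number_comm_count[OF L I] by simp
  hence "(of_nat ?c :: complex) = of_nat (index I) ^ ydim L * of_nat (comm_count L I) / of_nat (index I) ^ xdim L"
    using pos by (simp add: eq_divide_eq)
  thus ?thesis using I by (simp add: class_zeta_term_def ideal_index_eq)
qed

text \<open>Reduces multiplicativity to comaximal ideals, since a prime power and an ideal supported
  on other primes are comaximal.\<close>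

lemma multiplicativeI:
  assumes 1: "f \<O> = 1"
    and f: "\<And>I J a b. proper_ideal I \<Longrightarrow> proper_ideal J \<Longrightarrow> proper_ideal (I \<inter> J) \<Longrightarrow>
      a \<in> I \<Longrightarrow> b \<in> J \<Longrightarrow> a + b = 1 \<Longrightarrow> f (I \<inter> J) = f I * f J"
  shows "multiplicative f"
  unfolding multiplicative_def
proof (intro conjI allI impI, rule 1, elim conjE)
  fix P A k e assume P: "is_prime P" and A: "finite A" "\<forall>Q\<in>A. is_prime Q" "P \<notin> A"
  have Q: "\<And>Q. Q \<in> A \<Longrightarrow> is_prime Q" using A(2) by blast
  obtain a b where ab: "a \<in> prime_pow P k" "b \<in> ideal_of A e" "a + b = 1"
    by (rule comaximal_elements[OF P A(1) Q A(3)])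
  have eq: "prime_pow P k \<inter> ideal_of A e = ideal_of (insert P A) (e(P := k))"
    using A(3) by (auto simp: ideal_of_def is_ideal_prime_pow split: if_splits)
  have "proper_ideal (ideal_of (insert P A) (e(P := k)))"
    by (rule proper_ideal_of) (use A P in auto)
  thus "f (prime_pow P k \<inter> ideal_of A e) = f (prime_pow P k) * f (ideal_of A e)"
    using f[OF proper_prime_pow[OF P] proper_ideal_of[OF A(1) Q] _ ab] eq by simp
qed

lemma multiplicative_class_zeta_term:
  assumes L: "two_step L"
  shows "multiplicative (class_zeta_term L K s)"
proof (rule multiplicativeI)
  show "class_zeta_term L K s \<O> = 1"
    by (simp add: class_zeta_term_eq[OF L proper_ideal_ints] index_ints comm_count_ints[OF L])
  fix I J a b assume h: "proper_ideal I" "proper_ideal J" "proper_ideal (I \<inter> J)" and ab: "a \<in> I" "b \<in> J" "a + b = 1"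
  show "class_zeta_term L K s (I \<inter> J) = class_zeta_term L K s I * class_zeta_term L K s J"
    unfolding class_zeta_term_eq[OF L h(1)] class_zeta_term_eq[OF L h(2)] class_zeta_term_eq[OF L h(3)]
      index_Int[OF h(1,2) ab] comm_count_Int[OF L h(1,2) ab] of_nat_mult_powr
    by (simp add: power_mult_distrib field_simps)
qed

lemma multiplicative_dedekind_zeta_term: "multiplicative (dedekind_zeta_term K w)"
proof (rule multiplicativeI)
  show "dedekind_zeta_term K w \<O> = 1"
    by (simp add: dedekind_zeta_term_def ideal_index_eq is_ideal_ints index_ints)
  fix I J a b assume h: "proper_ideal I" "proper_ideal J" "proper_ideal (I \<inter> J)" and ab: "a \<in> I" "b \<in> J" "a + b = 1"
  show "dedekind_zeta_term K w (I \<inter> J) = dedekind_zeta_term K w I * dedekind_zeta_term K w J"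
    using h by (simp add: dedekind_zeta_term_def ideal_index_eq index_Int[OF h(1,2) ab] of_nat_mult_powr del: of_nat_mult)
qed

text \<open>These are the values of \<open>C\<close> for \<open>euler_product\<close>; their sum
  over all primes converges by \<open>summable_primes\<close>.\<close>

lemma majorant:
  assumes P: "is_prime P"
  shows "0 \<le> 1 / real (index P) ^ (degree_bound + 2) \<and> 1 / real (index P) ^ (degree_bound + 2) \<le> 1 / 2"
proof -
  have "2 \<le> real (index P)" using index_prime_ge_2[OF P] by simp
  moreover from this have "real (index P) ^ 1 \<le> real (index P) ^ (degree_bound + 2)"
    by (intro power_increasing) auto
  ultimately have "2 \<le> real (index P) ^ (degree_bound + 2)" unfolding power_one_right by (rule order_trans)
  moreover have "0 \<le> 1 / x \<and> 1 / x \<le> 1 / 2" if "2 \<le> x" for x :: real using that by (simp add: field_simps)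
  ultimately show ?thesis by blast
qed

lemma prime_powr_bound:
  assumes P: "is_prime P" and w: "Re w \<ge> degree_bound + 2"
  shows "norm ((of_nat (index P) :: complex) powr (- w)) \<le> 1 / real (index P) ^ (degree_bound + 2)"
proof -
  have q: "1 \<le> real (index P)" "index P > 0" using index_prime_ge_2[OF P] by auto
  have "norm ((of_nat (index P) :: complex) powr (- w)) = real (index P) powr (- Re w)"
    using norm_of_nat_powr[OF q(2)] by simp
  also have "\<dots> \<le> real (index P) powr (- real (degree_bound + 2))"
    using w q by (intro powr_mono) auto
  also have "\<dots> = 1 / real (index P) ^ (degree_bound + 2)"
    using q powr_realpow[of "real (index P)" "degree_bound + 2"] by (simp only: powr_minus_divide of_nat_0_less_iff)
  finally show ?thesis .
qed

lemma dedekind_zeta_euler: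
  assumes w: "Re w \<ge> degree_bound + 2"
  shows "dedekind_zeta_term K w summable_on {I. proper_ideal I}"
    and "has_abs_prod (\<lambda>P. 1 / (1 - of_nat (index P) powr (- w))) {P. is_prime P} (dedekind_zeta K w)"
proof -
  have local: "dedekind_zeta_term K w (prime_pow P k) = (of_nat (index P) powr (- w)) ^ k" if "is_prime P" for P k
    using of_nat_power_powr[OF index_pos[OF primeD(2)[OF that]], of k "- w"] index_prime_pow[OF that, of k]
    by (simp add: dedekind_zeta_term_def ideal_index_eq is_ideal_prime_pow)
  have bound: "norm (dedekind_zeta_term K w (prime_pow P k)) \<le> (1 / real (index P) ^ (degree_bound + 2)) ^ k" if "is_prime P" for P k
    unfolding local[OF that] norm_power by (intro power_mono prime_powr_bound[OF that w]) simp
  note e = euler_product[OF multiplicative_dedekind_zeta_term bound majorant summable_primes]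
  show "dedekind_zeta_term K w summable_on {I. proper_ideal I}" by (rule e(1))
  have "(\<Sum>k. dedekind_zeta_term K w (prime_pow P k)) = 1 / (1 - of_nat (index P) powr (- w))" if P: "is_prime P" for P
  proof -
    have "norm ((of_nat (index P) :: complex) powr (- w)) < 1"
      using prime_powr_bound[OF P w] majorant[OF P] by linarith
    thus ?thesis unfolding local[OF P] by (rule suminf_geometric)
  qed
  hence "has_abs_prod (\<lambda>P. \<Sum>k. dedekind_zeta_term K w (prime_pow P k)) {P. is_prime P} z \<longleftrightarrow>
      has_abs_prod (\<lambda>P. 1 / (1 - of_nat (index P) powr (- w))) {P. is_prime P} z" for z
    by (intro has_abs_prod_cong) blast
  thus "has_abs_prod (\<lambda>P. 1 / (1 - of_nat (index P) powr (- w))) {P. is_prime P} (dedekind_zeta K w)"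
    using e(2) unfolding dedekind_zeta_def nonzero_ideals_eq by blast
qed

end

section \<open>Local factors\<close>

lemma powr_of_nat_plus:
  assumes "n > 0"
  shows "(of_nat n :: complex) powr (of_nat m + z) = of_nat n ^ m * of_nat n powr z"
  using assms by (simp add: powr_add powr_nat')

lemma norm_of_nat_powr_less_1:
  assumes "n \<ge> 2" "Re z < 0"
  shows "norm ((of_nat n :: complex) powr z) < 1"
proof -
  have "norm ((of_nat n :: complex) powr z) = real n powr Re z" using assms by (intro norm_of_nat_powr) simp
  also have "\<dots> < real n powr 0" using assms by (intro powr_less_mono) auto
  finally show ?thesis using assms by simp
qed

context number_field_loc
begin

text \<open>Not the true abscissa. The trivial bound \<open>N^(2 xdim)\<close> for the commuting
  pairs makes a term at most \<open>N\<close> to the power \<open>ydim + xdim - Re s\<close>, and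
  the exponent \<open>degree_bound + 2\<close> is needed for the sum over primes.\<close>

definition class_abscissa :: "lie_lattice \<Rightarrow> real" where
  "class_abscissa L = real (ydim L + xdim L + degree_bound + 2)"

lemma class_zeta_euler:
  assumes L: "two_step L" and s: "Re s \<ge> class_abscissa L"
  shows "class_zeta_term L K s summable_on {I. proper_ideal I}"
    and "has_abs_prod (\<lambda>P. \<Sum>k. class_zeta_term L K s (prime_pow P k)) {P. is_prime P} (class_zeta L K s)"
proof -
  have bound: "norm (class_zeta_term L K s (prime_pow P k)) \<le> (1 / real (index P) ^ (degree_bound + 2)) ^ k"
    if P: "is_prime P" for P k
  proof -
    note I = proper_prime_pow[OF P, of k]
    let ?r = "real (index (prime_pow P k))"
    have r: "?r \<ge> 1" "index (prime_pow P k) > 0" using index_pos[OF I] by auto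
    have "real (comm_count L (prime_pow P k)) \<le> real (index (prime_pow P k) ^ (2 * xdim L))"
      using finite_comm_pairs(2)[OF L I] by (subst of_nat_le_iff)
    hence N: "real (comm_count L (prime_pow P k)) \<le> ?r ^ xdim L * ?r ^ xdim L"
      by (simp add: power_add[symmetric] mult_2)
    have "norm (class_zeta_term L K s (prime_pow P k)) =
        ?r ^ ydim L * (real (comm_count L (prime_pow P k)) / ?r ^ xdim L) * ?r powr (- Re s)"
      unfolding class_zeta_term_eq[OF L I]
      using norm_of_nat_powr[OF r(2), of "- s"] by (simp add: norm_mult norm_divide norm_power)
    also have "\<dots> \<le> ?r ^ ydim L * ?r ^ xdim L * ?r powr (- Re s)"
      using N r by (intro mult_right_mono mult_left_mono) (auto simp: divide_le_eq)
    also have "\<dots> = ?r powr (real (ydim L + xdim L) - Re s)"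
      using r powr_realpow[of ?r "ydim L + xdim L"] powr_add[of ?r "real (ydim L + xdim L)" "- Re s"]
      by (simp add: power_add)
    also have "\<dots> \<le> ?r powr (- real (degree_bound + 2))"
      using r s by (intro powr_mono) (auto simp: class_abscissa_def)
    also have "\<dots> = 1 / ?r ^ (degree_bound + 2)"
      using r powr_realpow[of ?r "degree_bound + 2"] by (simp only: powr_minus_divide of_nat_0_less_iff)
    also have "\<dots> = (1 / real (index P) ^ (degree_bound + 2)) ^ k"
      unfolding index_prime_pow[OF P] power_one_over of_nat_power power_mult[symmetric] by (simp only: mult.commute)
    finally show ?thesis .
  qed
  note e = euler_product[OF multiplicative_class_zeta_term[OF L] bound majorant summable_primes]
  show "class_zeta_term L K s summable_on {I. proper_ideal I}" by (rule e(1))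
  show "has_abs_prod (\<lambda>P. \<Sum>k. class_zeta_term L K s (prime_pow P k)) {P. is_prime P} (class_zeta L K s)"
    using e(2) unfolding class_zeta_def nonzero_ideals_eq .
qed

end

context prime_ideal_loc
begin

abbreviation "Q \<equiv> of_nat q :: complex"

lemma q_ge_2: "q \<ge> 2" using index_prime_ge_2[OF P] .

lemma of_nat_diff_q_powers: "(of_nat (q ^ (Suc k * m) - q ^ (k * m)) :: complex) = Q ^ (Suc k * m) - Q ^ (k * m)"
proof -
  have "q ^ (k * m) \<le> q ^ (Suc k * m)" using q_ge_2 by (intro power_increasing) auto
  thus ?thesis by (simp add: of_nat_diff)
qed

lemma class_zeta_term_prime_pow:
  assumes L: "two_step L"
  shows "class_zeta_term L K s (M k) =
    of_nat (comm_count L (M k)) / Q ^ (k * xdim L) * (Q powr (of_nat (ydim L) - s)) ^ k"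
proof -
  have "Q powr (of_nat (ydim L) - s) = Q ^ ydim L * Q powr (- s)"
    using powr_of_nat_plus[of q "ydim L" "- s"] q_ge_2 by simp
  thus ?thesis
    using of_nat_power_powr[of q k "- s"] q_ge_2
    by (simp add: class_zeta_term_eq[OF L proper_prime_pow[OF P]] index_prime_pow[OF P] power_mult_distrib
      power_mult[symmetric] mult.commute[of k])
qed

text \<open>Dividing by \<open>Q^(ke)\<close> turns the recursion into a summation of increments,
  the form which \<open>partial_sums_gf\<close> handles.\<close>

lemma ann_count_recurrence:
  "of_nat (ann_count m e (Suc k)) / Q ^ (Suc k * e) =
    of_nat (ann_count m e k) / Q ^ (k * e) + (Q ^ (Suc k * m) - Q ^ (k * m)) / Q ^ (Suc k * e)"
proof -
  have "(of_nat (ann_count m e (Suc k)) :: complex) =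
      (Q ^ (Suc k * m) - Q ^ (k * m)) + Q ^ e * of_nat (ann_count m e k)"
    using of_nat_diff_q_powers[of k m] by simp
  thus ?thesis using q_ge_2 by (simp add: add_divide_distrib power_add)
qed

lemma comm_count_recurrence:
  assumes "comm_count L (M (Suc k)) = q ^ d * comm_count L (M k) + (q ^ (Suc k * m) - q ^ (k * m)) * N"
  shows "of_nat (comm_count L (M (Suc k))) / Q ^ (Suc k * d) =
    of_nat (comm_count L (M k)) / Q ^ (k * d) + (Q ^ (Suc k * m) - Q ^ (k * m)) * of_nat N / Q ^ (Suc k * d)"
proof -
  have "(of_nat (comm_count L (M (Suc k))) :: complex) =
      Q ^ d * of_nat (comm_count L (M k)) + (Q ^ (Suc k * m) - Q ^ (k * m)) * of_nat N"
    unfolding assms of_nat_add of_nat_mult of_nat_diff_q_powers by simp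
  thus ?thesis using q_ge_2 by (simp add: add_divide_distrib power_add)
qed

lemma norm_local_variable:
  assumes "Re s \<ge> class_abscissa L"
  shows "norm (Q powr (of_nat (ydim L) - s)) < 1" "norm (Q * Q powr (of_nat (ydim L) - s)) < 1"
proof -
  have "Q powr (of_nat 1 + (of_nat (ydim L) - s)) = Q * Q powr (of_nat (ydim L) - s)"
    using powr_of_nat_plus[of q 1] q_ge_2 by simp
  moreover have "norm (Q powr (of_nat 1 + (of_nat (ydim L) - s))) < 1"
    using assms q_ge_2 by (intro norm_of_nat_powr_less_1) (auto simp: class_abscissa_def)
  ultimately show "norm (Q * Q powr (of_nat (ydim L) - s)) < 1" by simp
  show "norm (Q powr (of_nat (ydim L) - s)) < 1"
    using assms q_ge_2 by (intro norm_of_nat_powr_less_1) (auto simp: class_abscissa_def)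
qed

end

lemma choose_2_Suc: "Suc n choose 2 = (n choose 2) + n"
  by (simp add: numeral_2_eq_2)

lemma choose_2_square: "n ^ 2 = 2 * (n choose 2) + (n :: nat)"
  by (induction n) (simp_all add: numeral_2_eq_2 algebra_simps)

context prime_ideal_loc
begin

lemma Q_nonzero: "Q \<noteq> 0" using q_ge_2 by simp

lemma powr_diff_of_nat: "Q powr (z - of_nat m) = 1 / Q ^ m * Q powr z"
  using Q_nonzero by (simp add: powr_diff powr_nat')

lemma powr_plus_1: "Q powr (z + 1) = Q * Q powr z"
  using Q_nonzero by (simp add: powr_add)

lemma cancel_powers:
  "(Q ^ (Suc k * n) - Q ^ (k * n)) * (Q ^ (Suc k * n) * z) / Q ^ (Suc k * (2 * n)) = (1 - 1 / Q ^ n) * z"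
proof -
  have "Q ^ (Suc k * (2 * n)) = (Q ^ (k * n) * Q ^ n) * (Q ^ (k * n) * Q ^ n)"
    unfolding power_add[symmetric] by (rule arg_cong[of _ _ "\<lambda>m. Q ^ m"]) simp
  moreover have "Q ^ (Suc k * n) = Q ^ (k * n) * Q ^ n" by (simp add: power_add[symmetric] algebra_simps)
  \<comment> \<open>Here \<open>u\<close> and \<open>v\<close> stand for \<open>Q^(kn)\<close> and
    \<open>Q^n\<close>, so that no exponents take part in the cancellation.\<close>
  moreover have "(u * v - u) * (u * v * z) / (u * v * (u * v)) = (1 - 1 / v) * z" if "u \<noteq> 0" "v \<noteq> 0" for u v :: complex
    using that by (simp add: field_simps)
  ultimately show ?thesis using Q_nonzero by simp
qed

lemma class_zeta_local_factor:
  assumes L: "two_step L"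
    and gf: "(\<Sum>k. (of_nat (comm_count L (M k)) / Q ^ (k * xdim L)) * (Q powr (of_nat (ydim L) - s)) ^ k) = z"
  shows "(\<Sum>k. class_zeta_term L K s (M k)) = z"
  unfolding class_zeta_term_prime_pow[OF L] by (rule gf)

text \<open>In \<open>gf_F\<close> the numerator variable is \<open>Q a t\<close>, and the exponents
  match by \<open>(d choose 2) - (d - 1) = (d - 1) choose 2\<close>.\<close>

lemma local_factor_F:
  assumes d: "d = 2 * n + \<delta>" "d \<ge> 1" and s: "Re s \<ge> class_abscissa (F_lat n \<delta>)"
  shows "(\<Sum>k. class_zeta_term (F_lat n \<delta>) K s (M k)) =
    (1 - Q powr (of_nat ((d - 1) choose 2) - s)) /
      ((1 - Q powr (of_nat (d choose 2) - s)) * (1 - Q powr (of_nat (d choose 2) + 1 - s)))"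
proof -
  let ?L = "F_lat n \<delta>"
  let ?t = "Q powr (of_nat (d choose 2) - s)"
  have dims: "xdim ?L = d" "ydim ?L = d choose 2"
    using y_basis_F[of n \<delta>] by (simp_all add: x_basis_F card_image inj_X d)
  note t = norm_local_variable[OF s, unfolded dims]
  have "of_nat (comm_count ?L (M (Suc k))) / Q ^ (Suc k * d) =
      of_nat (comm_count ?L (M k)) / Q ^ (k * d) + (1 - 1 / Q ^ d) * Q ^ Suc k" for k
    unfolding comm_count_recurrence[OF comm_count_F[where n = n and \<delta> = \<delta> and k = k, folded d(1)]]
    using Q_nonzero by (simp add: field_simps power_add)
  hence "(\<Sum>k. of_nat (comm_count ?L (M k)) / Q ^ (k * d) * ?t ^ k) =
      (1 - Q * (1 / Q ^ d) * ?t) / ((1 - ?t) * (1 - Q * ?t))"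
    by (intro gf_F t) (simp_all add: comm_count_0[OF two_step_F, unfolded prime_pow_0] prime_pow_0)
  hence "(\<Sum>k. class_zeta_term ?L K s (M k)) = (1 - Q * (1 / Q ^ d) * ?t) / ((1 - ?t) * (1 - Q * ?t))"
    by (intro class_zeta_local_factor[OF two_step_F]) (simp add: dims)
  moreover obtain e where e: "d = Suc e" using d(2) by (cases d) auto
  have "d choose 2 = ((d - 1) choose 2) + (d - 1)" by (simp add: e choose_2_Suc)
  hence "of_nat ((d - 1) choose 2) - s = (of_nat (d choose 2) - s) - of_nat (d - 1)" by (simp del: of_nat_diff)
  hence "Q powr (of_nat ((d - 1) choose 2) - s) = 1 / Q ^ (d - 1) * ?t" by (simp only: powr_diff_of_nat)
  hence "Q powr (of_nat ((d - 1) choose 2) - s) = Q * (1 / Q ^ d) * ?t" using Q_nonzero by (simp add: e)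
  moreover have "Q powr (of_nat (d choose 2) + 1 - s) = Q * ?t"
    using powr_plus_1[of "of_nat (d choose 2) - s"] by (simp add: algebra_simps)
  ultimately show ?thesis by simp
qed

lemma local_factor_G:
  assumes n: "n \<ge> 1" and s: "Re s \<ge> class_abscissa (G_lat n)"
  shows "(\<Sum>k. class_zeta_term (G_lat n) K s (M k)) =
    ((1 - Q powr (2 * of_nat (n choose 2) - s)) * (1 - Q powr (2 * of_nat (n choose 2) + 1 - s))
      + Q powr (of_nat (n^2) - s) * (1 - Q powr (- of_nat n)) * (1 - Q powr (- of_nat n + 1)))
    / ((1 - Q powr (of_nat (n^2) - s))^2 * (1 - Q powr (of_nat (n^2) + 1 - s)))"
proof -
  let ?L = "G_lat n" and ?a = "1 / Q ^ n"
  let ?t = "Q powr (of_nat (n^2) - s)"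
  obtain e where e: "n = Suc e" using n by (cases n) auto
  hence n1: "n - 1 = e" by simp
  have dims: "xdim ?L = 2 * n" "ydim ?L = n^2"
    using y_basis_G[of n] by (simp_all add: x_basis_G card_image inj_X)
  note t = norm_local_variable[OF s, unfolded dims]
  define \<alpha> where "\<alpha> = (\<lambda>k. of_nat (ann_count n e k) / Q ^ (k * e))"
  have \<alpha>: "\<alpha> (Suc k) = \<alpha> k + (1 - ?a) * Q ^ Suc k" for k
    unfolding \<alpha>_def ann_count_recurrence using Q_nonzero by (simp add: e field_simps power_add)
  have ann: "of_nat (ann_count n e k) = \<alpha> k * Q ^ (k * e)" for k using Q_nonzero by (simp add: \<alpha>_def)
  have "of_nat (comm_count ?L (M (Suc k))) / Q ^ (Suc k * (2 * n)) =
      of_nat (comm_count ?L (M k)) / Q ^ (k * (2 * n)) + (1 - ?a) * (\<alpha> (Suc k) + \<alpha> k)" for k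
  proof -
    have "of_nat (q ^ Suc k * (ann_count n (n - 1) (Suc k) + q ^ (n - 1) * ann_count n (n - 1) k)) =
        Q ^ Suc k * (\<alpha> (Suc k) * Q ^ (Suc k * e) + Q ^ e * (\<alpha> k * Q ^ (k * e)))"
      by (simp only: of_nat_mult of_nat_add of_nat_power ann n1)
    also have "\<dots> = Q ^ (Suc k * n) * (\<alpha> (Suc k) + \<alpha> k)"
      by (simp add: e power_add algebra_simps)
    finally show ?thesis
      by (simp only: comm_count_recurrence[OF comm_count_G[OF n, of k]] cancel_powers)
  qed
  hence "(\<Sum>k. of_nat (comm_count ?L (M k)) / Q ^ (k * (2 * n)) * ?t ^ k) =
      ((1 - ?a * ?t) * (1 - Q * ?a * ?t) + ?t * (1 - ?a) * (1 - Q * ?a)) / ((1 - ?t)^2 * (1 - Q * ?t))"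
    by (intro gf_G[where \<alpha> = \<alpha>] t \<alpha>)
      (simp_all add: \<alpha>_def comm_count_0[OF two_step_G, unfolded prime_pow_0] prime_pow_0)
  hence "(\<Sum>k. class_zeta_term ?L K s (M k)) =
      ((1 - ?a * ?t) * (1 - Q * ?a * ?t) + ?t * (1 - ?a) * (1 - Q * ?a)) / ((1 - ?t)^2 * (1 - Q * ?t))"
    by (intro class_zeta_local_factor[OF two_step_G]) (simp add: dims)
  \<comment> \<open>The exponent of \<open>a t\<close> is \<open>n^2 - n - s\<close>, and
    \<open>n^2 - n\<close> is twice \<open>n choose 2\<close>.\<close>
  moreover have "2 * of_nat (n choose 2) - s = (of_nat (n^2) - s) - of_nat n"
    unfolding choose_2_square[of n] by simp
  hence at: "Q powr (2 * of_nat (n choose 2) - s) = ?a * ?t" by (simp only: powr_diff_of_nat)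
  moreover have "Q powr (2 * of_nat (n choose 2) + 1 - s) = Q * ?a * ?t"
    using powr_plus_1[of "2 * of_nat (n choose 2) - s"] at by (simp add: algebra_simps)
  moreover have "Q powr (of_nat (n^2) + 1 - s) = Q * ?t"
    using powr_plus_1[of "of_nat (n^2) - s"] by (simp add: algebra_simps)
  moreover have a: "Q powr (- of_nat n) = ?a"
    using powr_diff_of_nat[of 0 n] Q_nonzero by simp
  moreover have "Q powr (- of_nat n + 1) = Q * ?a" using powr_plus_1[of "- of_nat n"] a by simp
  ultimately show ?thesis by simp
qed

lemma local_factor_H:
  assumes n: "n \<ge> 1" and s: "Re s \<ge> class_abscissa (H_lat n)"
  shows "(\<Sum>k. class_zeta_term (H_lat n) K s (M k)) =
    ((1 - Q powr (of_nat (n choose 2) - s)) * (1 - Q powr (of_nat (n choose 2) + 2 - s))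
      + Q powr (of_nat ((n+1) choose 2) - s) * (1 - Q powr (- of_nat n + 1))^2)
    / ((1 - Q powr (of_nat ((n+1) choose 2) - s)) * (1 - Q powr (of_nat ((n+1) choose 2) + 1 - s))^2)"
proof -
  let ?L = "H_lat n" and ?a = "1 / Q ^ n"
  let ?t = "Q powr (of_nat ((n+1) choose 2) - s)"
  obtain e where e: "n = Suc e" using n by (cases n) auto
  hence n1: "n - 1 = e" by simp
  have dims: "xdim ?L = 2 * n" "ydim ?L = (n+1) choose 2"
    using y_basis_H[of n] by (simp_all add: x_basis_H card_image inj_X)
  note t = norm_local_variable[OF s, unfolded dims]
  define \<beta> where "\<beta> = (\<lambda>k. of_nat (ann_count e e k) / Q ^ (k * e))"
  have \<beta>: "\<beta> (Suc k) = \<beta> k + (1 - Q * ?a)" for k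
    unfolding \<beta>_def ann_count_recurrence using Q_nonzero by (simp add: e field_simps power_add)
  have ann: "of_nat (ann_count e e k) = \<beta> k * Q ^ (k * e)" for k using Q_nonzero by (simp add: \<beta>_def)
  have "of_nat (comm_count ?L (M (Suc k))) / Q ^ (Suc k * (2 * n)) =
      of_nat (comm_count ?L (M k)) / Q ^ (k * (2 * n)) + (1 - ?a) * (Q ^ Suc k * \<beta> (Suc k) + Q ^ k * \<beta> k)" for k
  proof -
    have "of_nat (q ^ Suc k * (q ^ Suc k * ann_count (n - 1) (n - 1) (Suc k) +
          q ^ k * (q ^ (n - 1) * ann_count (n - 1) (n - 1) k))) =
        Q ^ Suc k * (Q ^ Suc k * (\<beta> (Suc k) * Q ^ (Suc k * e)) + Q ^ k * (Q ^ e * (\<beta> k * Q ^ (k * e))))"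
      by (simp only: of_nat_mult of_nat_add of_nat_power ann n1)
    also have "\<dots> = Q ^ (Suc k * n) * (Q ^ Suc k * \<beta> (Suc k) + Q ^ k * \<beta> k)"
      by (simp add: e power_add algebra_simps)
    finally show ?thesis
      by (simp only: comm_count_recurrence[OF comm_count_H[OF n, of k]] cancel_powers)
  qed
  hence "(\<Sum>k. of_nat (comm_count ?L (M k)) / Q ^ (k * (2 * n)) * ?t ^ k) =
      ((1 - ?a * ?t) * (1 - Q^2 * ?a * ?t) + ?t * (1 - Q * ?a)^2) / ((1 - ?t) * (1 - Q * ?t)^2)"
    by (intro gf_H[where \<beta> = \<beta>] t \<beta>)
      (simp_all add: \<beta>_def comm_count_0[OF two_step_H, unfolded prime_pow_0] prime_pow_0)
  hence "(\<Sum>k. class_zeta_term ?L K s (M k)) =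
      ((1 - ?a * ?t) * (1 - Q^2 * ?a * ?t) + ?t * (1 - Q * ?a)^2) / ((1 - ?t) * (1 - Q * ?t)^2)"
    by (intro class_zeta_local_factor[OF two_step_H]) (simp add: dims)
  moreover have "(n + 1) choose 2 = (n choose 2) + n" by (simp add: numeral_2_eq_2)
  hence "of_nat (n choose 2) - s = (of_nat ((n + 1) choose 2) - s) - of_nat n" by simp
  hence at: "Q powr (of_nat (n choose 2) - s) = ?a * ?t" by (simp only: powr_diff_of_nat)
  moreover have "Q powr (of_nat (n choose 2) + 2 - s) = Q^2 * ?a * ?t"
    using powr_of_nat_plus[of q 2 "of_nat (n choose 2) - s"] at q_ge_2 by (simp add: algebra_simps)
  moreover have "Q powr (of_nat ((n+1) choose 2) + 1 - s) = Q * ?t"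
    using powr_plus_1[of "of_nat ((n+1) choose 2) - s"] by (simp only: add_diff_eq add.commute diff_add_eq)
  moreover have a: "Q powr (- of_nat n) = ?a"
    using powr_diff_of_nat[of 0 n] Q_nonzero by simp
  moreover have "Q powr (- of_nat n + 1) = Q * ?a" using powr_plus_1[of "- of_nat n"] a by simp
  ultimately show ?thesis by simp
qed

end

section \<open>Global zeta functions\<close>

context number_field_loc
begin

text \<open>Needed for the quotient in the formula for \<open>F_lat\<close>. For large real part the
  terms with \<open>I \<noteq> \<O>\<close> add up to less than 1 in norm and cannot cancel the term
  1 of \<open>\<O>\<close>.\<close>

lemma dedekind_zeta_nonzero: "\<exists>\<sigma>. \<forall>w. Re w \<ge> \<sigma> \<longrightarrow> dedekind_zeta K w \<noteq> 0"
proof -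
  define N :: "'a set set" where "N = {I. proper_ideal I} - {\<O>}"
  let ?f = "\<lambda>I. norm (dedekind_zeta_term K (of_nat (degree_bound + 2)) I)"
  have N: "proper_ideal I" "I \<noteq> \<O>" if "I \<in> N" for I using that by (auto simp: N_def)
  have split: "{I. proper_ideal I} = insert \<O> N" using proper_ideal_ints by (auto simp: N_def)
  have nterm: "norm (dedekind_zeta_term K w I) = real (index I) powr (- Re w)" if "proper_ideal I" for w I
    using norm_of_nat_powr[OF index_pos[OF that], of "- w"] that by (simp add: dedekind_zeta_term_def ideal_index_eq)
  have index_2: "real (index I) \<ge> 2" if "I \<in> N" for I
  proof -
    have "I \<subset> \<O>" using N[OF that] idealD(1) by blast
    from index_strict_mono[OF N(1)[OF that] is_ideal_ints this] show ?thesis by (simp add: index_ints)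
  qed
  have sf: "?f summable_on N"
    by (rule summable_on_subset_banach[of _ "{I. proper_ideal I}"])
      (use dedekind_zeta_euler(1)[of "of_nat (degree_bound + 2)"] split in
        \<open>auto simp: summable_on_iff_abs_summable_on_complex[symmetric] simp del: of_nat_add\<close>)
  \<comment> \<open>Every ideal other than \<open>\<O>\<close> has index at least 2, so raising the
    real part by \<open>j\<close> divides the tail at \<open>degree_bound + 2\<close> by at least
    \<open>2^j\<close>.\<close>
  obtain j where j: "infsum ?f N < 2 ^ j" using real_arch_pow[of 2 "infsum ?f N"] by auto
  have "dedekind_zeta K w \<noteq> 0" if w: "Re w \<ge> real (degree_bound + 2 + j)" for w
  proof
    assume zero: "dedekind_zeta K w = 0"
    have bound: "norm (dedekind_zeta_term K w I) \<le> 1 / 2 ^ j * ?f I" if I: "I \<in> N" for I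
    proof -
      have "norm (dedekind_zeta_term K w I) \<le> real (index I) powr (- real j + - real (degree_bound + 2))"
        using index_2[OF I] w unfolding nterm[OF N(1)[OF I]] by (intro powr_mono) auto
      also have "\<dots> = real (index I) powr (- real j) * ?f I"
        unfolding nterm[OF N(1)[OF I]] powr_add by simp
      also have "real (index I) powr (- real j) \<le> 2 powr (- real j)"
        using index_2[OF I] by (intro powr_mono2') auto
      also have "2 powr (- real j) = 1 / 2 ^ j" by (simp add: powr_minus_divide powr_realpow)
      finally show ?thesis by (simp add: mult_right_mono)
    qed
    have "dedekind_zeta_term K w summable_on {I. proper_ideal I}" using w by (intro dedekind_zeta_euler(1)) simp
    hence sw: "dedekind_zeta_term K w summable_on N" by (rule summable_on_subset_banach) (auto simp: N_def)
    have "dedekind_zeta K w = dedekind_zeta_term K w \<O> + infsum (dedekind_zeta_term K w) N"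
      unfolding dedekind_zeta_def nonzero_ideals_eq split by (rule infsum_insert[OF sw]) (simp add: N_def)
    hence "infsum (dedekind_zeta_term K w) N = - 1"
      using zero by (simp add: dedekind_zeta_term_def ideal_index_eq is_ideal_ints index_ints add_eq_0_iff)
    hence "1 \<le> infsum (\<lambda>I. norm (dedekind_zeta_term K w I)) N"
      using norm_infsum_bound[of "dedekind_zeta_term K w" N] sw
      by (simp add: summable_on_iff_abs_summable_on_complex[symmetric])
    also have "\<dots> \<le> infsum (\<lambda>I. 1 / 2 ^ j * ?f I) N"
      using sw bound by (intro infsum_mono summable_on_cmult_right sf)
        (simp_all add: summable_on_iff_abs_summable_on_complex[symmetric])
    also have "\<dots> = 1 / 2 ^ j * infsum ?f N" by (rule infsum_cmult_right')
    also have "\<dots> < 1" using j by simp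
    finally show False by simp
  qed
  thus ?thesis by blast
qed

text \<open>The formula is multiplied out, so that the finite Euler products on both sides agree
  factor by factor and the claim follows by uniqueness of limits. The second bound on
  \<open>s\<close> puts all three Dedekind arguments into the half-plane of
  \<open>dedekind_zeta_euler\<close>.\<close>

lemma class_zeta_F:
  assumes d: "d = 2 * n + \<delta>" "d \<ge> 1"
    and s: "Re s \<ge> class_abscissa (F_lat n \<delta>)" "Re s \<ge> real (d choose 2) + real ((d - 1) choose 2) + degree_bound + 3"
  shows "class_zeta (F_lat n \<delta>) K s * dedekind_zeta K (s - of_nat ((d - 1) choose 2)) =
    dedekind_zeta K (s - of_nat (d choose 2) - 1) * dedekind_zeta K (s - of_nat (d choose 2))"
proof -
  define f where "f = (\<lambda>P. \<Sum>k. class_zeta_term (F_lat n \<delta>) K s (prime_pow P k))"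
  define g where "g = (\<lambda>w P. 1 / (1 - (of_nat (index P) :: complex) powr (- w)))"
  have lim_g: "(prod (g w) \<longlongrightarrow> dedekind_zeta K w) (finite_subsets_at_top {P. is_prime P})"
    if "Re w \<ge> degree_bound + 2" for w
    using dedekind_zeta_euler(2)[OF that] unfolding has_abs_prod_def g_def by blast
  have lim_f: "(prod f \<longlongrightarrow> class_zeta (F_lat n \<delta>) K s) (finite_subsets_at_top {P. is_prime P})"
    using class_zeta_euler(2)[OF two_step_F s(1)] unfolding has_abs_prod_def f_def by blast
  have loc: "f P * g (s - of_nat ((d - 1) choose 2)) P = g (s - of_nat (d choose 2) - 1) P * g (s - of_nat (d choose 2)) P"
    if P: "is_prime P" for P
  proof -
    interpret prime_ideal_loc K P by unfold_locales (rule P)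
    have "norm (Q powr (of_nat ((d - 1) choose 2) - s)) < 1"
      using s(2) q_ge_2 by (intro norm_of_nat_powr_less_1) auto
    \<comment> \<open>This denominator of \<open>g\<close> cancels against the numerator of the
      local factor, so it has to be nonzero.\<close>
    hence "1 - Q powr (of_nat ((d - 1) choose 2) - s) \<noteq> 0" by auto
    thus ?thesis
      unfolding f_def g_def local_factor_F[OF d s(1)]
      by (simp add: algebra_simps)
  qed
  have L1: "((\<lambda>F. prod f F * prod (g (s - of_nat ((d - 1) choose 2))) F) \<longlongrightarrow>
      class_zeta (F_lat n \<delta>) K s * dedekind_zeta K (s - of_nat ((d - 1) choose 2))) (finite_subsets_at_top {P. is_prime P})"
    using s(2) by (intro tendsto_mult lim_f lim_g) simp
  have L2: "((\<lambda>F. prod (g (s - of_nat (d choose 2) - 1)) F * prod (g (s - of_nat (d choose 2))) F) \<longlongrightarrow>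
      dedekind_zeta K (s - of_nat (d choose 2) - 1) * dedekind_zeta K (s - of_nat (d choose 2)))
      (finite_subsets_at_top {P. is_prime P})"
    using s(2) by (intro tendsto_mult lim_g) simp_all
  have "\<forall>\<^sub>F F in finite_subsets_at_top {P. is_prime P}.
      prod f F * prod (g (s - of_nat ((d - 1) choose 2))) F =
      prod (g (s - of_nat (d choose 2) - 1)) F * prod (g (s - of_nat (d choose 2))) F"
  proof (rule eventually_finite_subsets_at_top_weakI)
    fix F :: "'a set set" assume F: "finite F" "F \<subseteq> {P. is_prime P}"
    have "f P * g (s - of_nat ((d - 1) choose 2)) P = g (s - of_nat (d choose 2) - 1) P * g (s - of_nat (d choose 2)) P"
      if "P \<in> F" for P
      by (rule loc) (use F(2) that in blast)
    thus "prod f F * prod (g (s - of_nat ((d - 1) choose 2))) F =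
        prod (g (s - of_nat (d choose 2) - 1)) F * prod (g (s - of_nat (d choose 2))) F"
      unfolding prod.distrib[symmetric] by (rule prod.cong[OF refl])
  qed
  from tendsto_cong[THEN iffD2, OF this L2] show ?thesis
    by (rule tendsto_unique[OF finite_subsets_at_top_neq_bot L1])
qed

end

theorem corollary1p5:
  fixes K :: "'a::field_char_0 set"
  assumes "number_field K"
  shows
    "(\<forall>n \<delta> :: nat. n \<ge> 1 \<and> \<delta> \<in> {0, 1} \<longrightarrow>
        (\<exists>\<sigma>::real. \<forall>s::complex. Re s > \<sigma> \<longrightarrow>
          class_zeta_term (F_lat n \<delta>) K s summable_on nonzero_ideals K \<and>
          dedekind_zeta_term K (s - of_nat ((2*n+\<delta>) choose 2) - 1) summable_on nonzero_ideals K \<and>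
          dedekind_zeta_term K (s - of_nat ((2*n+\<delta>) choose 2)) summable_on nonzero_ideals K \<and>
          dedekind_zeta_term K (s - of_nat ((2*n+\<delta>-1) choose 2)) summable_on nonzero_ideals K \<and>
          dedekind_zeta K (s - of_nat ((2*n+\<delta>-1) choose 2)) \<noteq> 0 \<and>
          class_zeta (F_lat n \<delta>) K s =
            dedekind_zeta K (s - of_nat ((2*n+\<delta>) choose 2) - 1)
              * dedekind_zeta K (s - of_nat ((2*n+\<delta>) choose 2))
              / dedekind_zeta K (s - of_nat ((2*n+\<delta>-1) choose 2))))
     \<and>
     (\<forall>n::nat. n \<ge> 2 \<longrightarrow>
        (\<exists>\<sigma>::real. \<forall>s::complex. Re s > \<sigma> \<longrightarrow>
          class_zeta_term (G_lat n) K s summable_on nonzero_ideals K \<and>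
          has_abs_prod
            (\<lambda>P. let q = of_nat (ideal_index K P) :: complex in
              ((1 - q powr (2 * of_nat (n choose 2) - s))
                 * (1 - q powr (2 * of_nat (n choose 2) + 1 - s))
               + q powr (of_nat (n^2) - s)
                 * (1 - q powr (- of_nat n)) * (1 - q powr (- of_nat n + 1)))
              / ((1 - q powr (of_nat (n^2) - s))^2 * (1 - q powr (of_nat (n^2) + 1 - s))))
            (nonzero_primes K)
            (class_zeta (G_lat n) K s)))
     \<and>
     (\<forall>n::nat. n \<ge> 2 \<longrightarrow>
        (\<exists>\<sigma>::real. \<forall>s::complex. Re s > \<sigma> \<longrightarrow>
          class_zeta_term (H_lat n) K s summable_on nonzero_ideals K \<and>
          has_abs_prod
            (\<lambda>P. let q = of_nat (ideal_index K P) :: complex in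
              ((1 - q powr (of_nat (n choose 2) - s))
                 * (1 - q powr (of_nat (n choose 2) + 2 - s))
               + q powr (of_nat ((n+1) choose 2) - s) * (1 - q powr (- of_nat n + 1))^2)
              / ((1 - q powr (of_nat ((n+1) choose 2) - s))
                 * (1 - q powr (of_nat ((n+1) choose 2) + 1 - s))^2))
            (nonzero_primes K)
            (class_zeta (H_lat n) K s)))"
proof -
  interpret number_field_loc K by unfold_locales (rule assms)
  have index_prime: "ideal_index K P = index P" if "P \<in> {P. is_prime P}" for P
    using that primeD(2) by (intro ideal_index_eq) blast
  have F: "\<exists>\<sigma>::real. \<forall>s::complex. Re s > \<sigma> \<longrightarrow>
      class_zeta_term (F_lat n \<delta>) K s summable_on nonzero_ideals K \<and>
      dedekind_zeta_term K (s - of_nat ((2*n+\<delta>) choose 2) - 1) summable_on nonzero_ideals K \<and>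
      dedekind_zeta_term K (s - of_nat ((2*n+\<delta>) choose 2)) summable_on nonzero_ideals K \<and>
      dedekind_zeta_term K (s - of_nat ((2*n+\<delta>-1) choose 2)) summable_on nonzero_ideals K \<and>
      dedekind_zeta K (s - of_nat ((2*n+\<delta>-1) choose 2)) \<noteq> 0 \<and>
      class_zeta (F_lat n \<delta>) K s =
        dedekind_zeta K (s - of_nat ((2*n+\<delta>) choose 2) - 1)
          * dedekind_zeta K (s - of_nat ((2*n+\<delta>) choose 2))
          / dedekind_zeta K (s - of_nat ((2*n+\<delta>-1) choose 2))" if n: "n \<ge> 1" for n \<delta> :: nat
  proof -
    define m where "m = (2*n+\<delta>) choose 2"
    define l where "l = (2*n+\<delta>-1) choose 2"
    obtain \<sigma> where \<sigma>: "dedekind_zeta K w \<noteq> 0" if "Re w \<ge> \<sigma>" for w using dedekind_zeta_nonzero by blast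
    show ?thesis unfolding m_def[symmetric] l_def[symmetric]
    \<comment> \<open>The three bounds serve the convergence of the class number zeta function, the
      nonvanishing of the denominator, and the convergence of the Dedekind series.\<close>
    proof (intro exI[of _ "max (class_abscissa (F_lat n \<delta>)) (max (\<sigma> + real l) (real m + real l + degree_bound + 3))"] allI impI)
      fix s :: complex
      assume "Re s > max (class_abscissa (F_lat n \<delta>)) (max (\<sigma> + real l) (real m + real l + degree_bound + 3))"
      hence s: "Re s \<ge> class_abscissa (F_lat n \<delta>)" "Re s \<ge> \<sigma> + real l" "Re s \<ge> real m + real l + degree_bound + 3"
        by simp_all
      have nz: "dedekind_zeta K (s - of_nat l) \<noteq> 0" using s(2) by (intro \<sigma>) simp
      have "class_zeta (F_lat n \<delta>) K s * dedekind_zeta K (s - of_nat l) =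
          dedekind_zeta K (s - of_nat m - 1) * dedekind_zeta K (s - of_nat m)"
        unfolding m_def l_def by (rule class_zeta_F[OF refl]) (use n s m_def l_def in simp_all)
      hence "class_zeta (F_lat n \<delta>) K s =
          dedekind_zeta K (s - of_nat m - 1) * dedekind_zeta K (s - of_nat m) / dedekind_zeta K (s - of_nat l)"
        using nz by (simp add: eq_divide_eq)
      moreover have "dedekind_zeta_term K (s - of_nat m - 1) summable_on nonzero_ideals K"
        unfolding nonzero_ideals_eq using s(3) by (intro dedekind_zeta_euler(1)) simp
      moreover have "dedekind_zeta_term K (s - of_nat m) summable_on nonzero_ideals K"
        unfolding nonzero_ideals_eq using s(3) by (intro dedekind_zeta_euler(1)) simp
      moreover have "dedekind_zeta_term K (s - of_nat l) summable_on nonzero_ideals K"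
        unfolding nonzero_ideals_eq using s(3) by (intro dedekind_zeta_euler(1)) simp
      moreover have "class_zeta_term (F_lat n \<delta>) K s summable_on nonzero_ideals K"
        unfolding nonzero_ideals_eq by (rule class_zeta_euler(1)[OF two_step_F s(1)])
      ultimately show "class_zeta_term (F_lat n \<delta>) K s summable_on nonzero_ideals K \<and>
          dedekind_zeta_term K (s - of_nat m - 1) summable_on nonzero_ideals K \<and>
          dedekind_zeta_term K (s - of_nat m) summable_on nonzero_ideals K \<and>
          dedekind_zeta_term K (s - of_nat l) summable_on nonzero_ideals K \<and>
          dedekind_zeta K (s - of_nat l) \<noteq> 0 \<and>
          class_zeta (F_lat n \<delta>) K s =
            dedekind_zeta K (s - of_nat m - 1) * dedekind_zeta K (s - of_nat m) / dedekind_zeta K (s - of_nat l)"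
        using nz by (intro conjI)
    qed
  qed
  \<comment> \<open>The local factor is a function of the index alone, so one argument covers
    \<open>G_lat\<close> and \<open>H_lat\<close>.\<close>
  have euler: "class_zeta_term L K s summable_on nonzero_ideals K \<and>
      has_abs_prod (\<lambda>P. local (of_nat (ideal_index K P))) (nonzero_primes K) (class_zeta L K s)"
    if L: "two_step L" and s: "Re s > class_abscissa L"
      and local: "\<And>P. is_prime P \<Longrightarrow> (\<Sum>k. class_zeta_term L K s (prime_pow P k)) = local (of_nat (index P))"
    for L s and local :: "complex \<Rightarrow> complex"
  proof -
    have s': "Re s \<ge> class_abscissa L" using s by simp
    have eq: "(\<Sum>k. class_zeta_term L K s (prime_pow P k)) = local (of_nat (ideal_index K P))" if "P \<in> {P. is_prime P}" for P
      unfolding index_prime[OF that] by (rule local) (use that in blast)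
    have "has_abs_prod (\<lambda>P. local (of_nat (ideal_index K P))) {P. is_prime P} (class_zeta L K s)"
      by (rule has_abs_prod_cong[THEN iffD1, OF eq class_zeta_euler(2)[OF L s']])
    thus ?thesis unfolding nonzero_ideals_eq nonzero_primes_eq using class_zeta_euler(1)[OF L s'] by blast
  qed
  have G: "(\<Sum>k. class_zeta_term (G_lat n) K s (prime_pow P k)) =
      (let q = of_nat (index P) :: complex in
        ((1 - q powr (2 * of_nat (n choose 2) - s))
           * (1 - q powr (2 * of_nat (n choose 2) + 1 - s))
         + q powr (of_nat (n^2) - s)
           * (1 - q powr (- of_nat n)) * (1 - q powr (- of_nat n + 1)))
        / ((1 - q powr (of_nat (n^2) - s))^2 * (1 - q powr (of_nat (n^2) + 1 - s))))"
    if "n \<ge> 2" "Re s > class_abscissa (G_lat n)" "is_prime P" for n s P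
  proof -
    interpret prime_ideal_loc K P by unfold_locales (rule that(3))
    show ?thesis unfolding Let_def by (rule local_factor_G) (use that in simp_all)
  qed
  have H: "(\<Sum>k. class_zeta_term (H_lat n) K s (prime_pow P k)) =
      (let q = of_nat (index P) :: complex in
        ((1 - q powr (of_nat (n choose 2) - s))
           * (1 - q powr (of_nat (n choose 2) + 2 - s))
         + q powr (of_nat ((n+1) choose 2) - s) * (1 - q powr (- of_nat n + 1))^2)
        / ((1 - q powr (of_nat ((n+1) choose 2) - s))
           * (1 - q powr (of_nat ((n+1) choose 2) + 1 - s))^2))"
    if "n \<ge> 2" "Re s > class_abscissa (H_lat n)" "is_prime P" for n s P
  proof -
    interpret prime_ideal_loc K P by unfold_locales (rule that(3))
    show ?thesis unfolding Let_def by (rule local_factor_H) (use that in simp_all)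
  qed
  show ?thesis
  proof (intro conjI allI impI)
    fix n \<delta> :: nat assume "n \<ge> 1 \<and> \<delta> \<in> {0, 1}"
    thus "\<exists>\<sigma>::real. \<forall>s::complex. Re s > \<sigma> \<longrightarrow>
      class_zeta_term (F_lat n \<delta>) K s summable_on nonzero_ideals K \<and>
      dedekind_zeta_term K (s - of_nat ((2*n+\<delta>) choose 2) - 1) summable_on nonzero_ideals K \<and>
      dedekind_zeta_term K (s - of_nat ((2*n+\<delta>) choose 2)) summable_on nonzero_ideals K \<and>
      dedekind_zeta_term K (s - of_nat ((2*n+\<delta>-1) choose 2)) summable_on nonzero_ideals K \<and>
      dedekind_zeta K (s - of_nat ((2*n+\<delta>-1) choose 2)) \<noteq> 0 \<and>
      class_zeta (F_lat n \<delta>) K s =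
        dedekind_zeta K (s - of_nat ((2*n+\<delta>) choose 2) - 1)
          * dedekind_zeta K (s - of_nat ((2*n+\<delta>) choose 2))
          / dedekind_zeta K (s - of_nat ((2*n+\<delta>-1) choose 2))" by (intro F) (rule conjunct1)
  qed (rule exI, intro allI impI, rule euler, rule two_step_G two_step_H, assumption, erule (2) G H)+
qed

end
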